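(* Let $M\subset\mathbb{C}^N$ be a smooth real hypersurface, $p\in M$, and assume that $M$ is weakly $k$-nondegenerate at $p$. Then any locally integrable infinitesimal CR diffeomorphism (with distributional coefficients) of $M$ which extends microlocally to a wedge with edge $M$ near $p$ is smooth near $p$.
   Context: Here $N=n+1$ and $M$ carries the CR structure $\mathcal{V}=\mathbb{C}TM\cap T^{0,1}\mathbb{C}^N$, a complex bundle of rank $n$. $\Gamma(\cdot,\cdot)$ denotes smooth sections; sections of $\mathcal{V}$ are CR vector fields. Weak nondegeneracy: $M$ is weakly nondegenerate at $p$ if there exist coordinates $(z,w)\in\mathbb{C}^n\times\mathbb{C}$, and $m,k\in\mathbb{N}$ (positive integers), such that $p=0$ in these coordinates and near $0$ the hypersurface $M$ is given by $$\operatorname{Im}w=(\operatorname{Re}w)^m\varphi(z,\bar z,\operatorname{Re}w),$$ with $\varphi$ a smooth real-valued function defined near $0$ satisfying $$\frac{\partial^{|\alpha|}\varphi}{\partial z^\alpha}(0,0,0)=\frac{\partial^{|\alpha|}\varphi}{\partial\bar z^\alpha}(0,0,0)=0,\qquad|\alpha|\le k,$$ and $$\operatorname{span}_{\mathbb{C}}\{\varphi_{z\bar z^\alpha}(0,0,0):|\alpha|\le k\}=\mathbb{C}^n,$$ where $\varphi_{z\bar z^\alpha}=(\varphi_{z_1\bar z^\alpha},\dots,\varphi_{z_n\bar z^\alpha})$. If $k_0$ is the smallest $k$ for which the preceding condition holds, $M$ is called weakly $k_0$-nondegenerate at $p$. $T'M=\mathcal{V}^\perp\subset\mathbb{C}T^*M$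 (complex rank $N$) is the holomorphic cotangent bundle; its sections are holomorphic forms. $T^0M\subset T'M$ is the real subbundle of real covectors annihilating $\mathcal{V}+\overline{\mathcal{V}}$; its sections are characteristic forms. For a CR vector field $L$ and a holomorphic form $\alpha$, the Lie derivative $\mathcal{L}_L\alpha=d\alpha(L,\cdot)$ is again a holomorphic form. Distributional sections: $\mathcal{D}'(M,(T'M)^* )$ is the space of distributions on $M$ with values in $(T'M)^*$ (the dual of the space of compactly supported smooth sections of $T'M$ tensored with the density bundle). If $\omega^1,\dots,\omega^N$ is a local basis of $T'M$ on an open set $U$ with dual basis $\omega_1,\dots,\omega_N$ of $(T'M)^*$, then $X\in\mathcal{D}'(M,(T'M)^* )$ is given on $U$ by $X=\sum_j c_j\omega_j$ with scalar distributions $c_j\in\mathcal{D}'(U)$. $X$ is locally integrable if in every such local representation the $c_j$ are locally integrable functions. For a holomorphic form $\omega=\sum_j f_j\omega^j$ on $U$ ($f_j$ smooth) one sets $\omega(X)=X(\omega)=\sum_j f_jc_j\in\mathcal{D}'(U)$; this defines $\omega(X)\in\mathcal{D}'(M)$ globally. $X\in\mathcal{D}'(M,(T'M)^* )$ is an infinitesimal CR diffeomorphism with distributional coefficients if $\tau(X)=\overline{\tau(X)}$ for all $\tau\in\Gamma(M,T^0M)$ and $L(\alpha(X))=(\mathcal{L}_L\alpha)(X)$ for all $L\in\Gamma(M,\mathcal{V})$ and all $\alpha\in\Gamma(M,T'M)$. $X$ extends microlocally to a wedge with edge $M$ if there is a set $\Gamma\subset T^0M$ such that for each $q\in M$ the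 fiber $\Gamma_q\subset T^0_qM\setminus\{0\}$ is a closed, convex cone, and $\mathrm{WF}(\omega(X))\subset\Gamma$ for every holomorphic form $\omega\in\Gamma(M,T'M)$, where $\mathrm{WF}$ is the ($C^\infty$) wavefront set. It does so near $p$ if this holds with $M$ replaced by some open neighbourhood of $p$ in $M$. *)

theory Defs
  imports "HOL-Analysis.Analysis"
begin

section \<open>Smooth maps\<close>

text \<open>\<open>Ck_on\<close> and \<open>smooth_on\<close> are meant for open sets in finite-dimensional spaces.\<close>

primrec Ck_on :: "nat \<Rightarrow> 'a set \<Rightarrow> ('a::real_normed_vector \<Rightarrow> 'b::real_normed_vector) \<Rightarrow> bool"
  where
    "Ck_on 0 S f \<longleftrightarrow> continuous_on S f"
  | "Ck_on (Suc k) S f \<longleftrightarrow> (\<forall>x\<in>S. f differentiable (at x)) \<and>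
       (\<forall>v. Ck_on k S (\<lambda>x. frechet_derivative f (at x) v))"

definition smooth_on :: "'a set \<Rightarrow> ('a::real_normed_vector \<Rightarrow> 'b::real_normed_vector) \<Rightarrow> bool"
  where "smooth_on S f \<longleftrightarrow> (\<forall>k. Ck_on k S f)"

text \<open>Smooth maps on an embedded submanifold: those that extend smoothly to the ambient space,
  locally around each point.\<close>

definition smooth_on_submanifold ::
    "'a set \<Rightarrow> ('a::real_normed_vector \<Rightarrow> 'b::real_normed_vector) \<Rightarrow> bool"
  where "smooth_on_submanifold S f \<longleftrightarrow>
    (\<forall>q\<in>S. \<exists>U g. open U \<and> q \<in> U \<and> smooth_on U g \<and> (\<forall>x\<in>S \<inter> U. f x = g x))"


section \<open>Real hypersurfaces and their CR structure\<close>

definition real_hypersurface :: "(complex^'N) set \<Rightarrow> bool"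
  where "real_hypersurface M \<longleftrightarrow>
    (\<forall>q\<in>M. \<exists>U (\<rho> :: complex^'N \<Rightarrow> real). open U \<and> q \<in> U \<and> smooth_on U \<rho> \<and>
       (\<forall>x\<in>U. frechet_derivative \<rho> (at x) \<noteq> (\<lambda>_. 0)) \<and> M \<inter> U = {x\<in>U. \<rho> x = 0})"

definition tangent_space :: "(complex^'N) set \<Rightarrow> complex^'N \<Rightarrow> (complex^'N) set"
  where "tangent_space S q =
    {v. \<exists>\<epsilon>>0. \<exists>\<gamma> :: real \<Rightarrow> complex^'N. smooth_on {-\<epsilon><..<\<epsilon>} \<gamma> \<and> \<gamma> ` {-\<epsilon><..<\<epsilon>} \<subseteq> S \<and>
          \<gamma> 0 = q \<and> (\<gamma> has_vector_derivative v) (at 0)}"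

text \<open>A complexified tangent vector \<open>u + \<i> v\<close> is the pair \<open>(u, v)\<close>.  The complex structure \<open>J\<close> of
  the ambient space is \<open>u \<mapsto> \<i> *s u\<close>, and \<open>J (u + \<i> v) = - \<i> (u + \<i> v)\<close> amounts to \<open>v = J u\<close>.\<close>

definition antiholomorphic_vectors :: "((complex^'N) \<times> (complex^'N)) set"
  where "antiholomorphic_vectors = {(u, v). v = \<i> *s u}"

definition CR_bundle :: "(complex^'N) set \<Rightarrow> complex^'N \<Rightarrow> ((complex^'N) \<times> (complex^'N)) set"
  where "CR_bundle S q = (tangent_space S q \<times> tangent_space S q) \<inter> antiholomorphic_vectors"

definition CR_bundle_conj :: "(complex^'N) set \<Rightarrow> complex^'N \<Rightarrow> ((complex^'N) \<times> (complex^'N)) set"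
  where "CR_bundle_conj S q = (\<lambda>(u, v). (u, - v)) ` CR_bundle S q"

definition CR_vector_fields ::
    "(complex^'N) set \<Rightarrow> (complex^'N \<Rightarrow> (complex^'N) \<times> (complex^'N)) set"
  where "CR_vector_fields S =
    {L. smooth_on_submanifold S L \<and> (\<forall>q\<in>S. L q \<in> CR_bundle S q)}"

text \<open>A complex covector at \<open>q\<close> is a real-linear map from the tangent space to \<open>\<complex>\<close>, made total
  by the value 0 off the tangent space; it acts on complexified vectors by \<open>covector_apply\<close>.\<close>

definition complex_cotangent :: "(complex^'N) set \<Rightarrow> complex^'N \<Rightarrow> (complex^'N \<Rightarrow> complex) set"
  where "complex_cotangent S q =
    {\<xi>. (\<forall>v. v \<notin> tangent_space S q \<longrightarrow> \<xi> v = 0) \<and>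
        (\<forall>u\<in>tangent_space S q. \<forall>v\<in>tangent_space S q. \<forall>a b.
           \<xi> (a *\<^sub>R u + b *\<^sub>R v) = of_real a * \<xi> u + of_real b * \<xi> v)}"

definition real_cotangent :: "(complex^'N) set \<Rightarrow> complex^'N \<Rightarrow> (complex^'N \<Rightarrow> complex) set"
  where "real_cotangent S q = {\<xi> \<in> complex_cotangent S q. \<forall>v. \<xi> v \<in> \<real>}"

definition covector_apply :: "(complex^'N \<Rightarrow> complex) \<Rightarrow> (complex^'N) \<times> (complex^'N) \<Rightarrow> complex"
  where "covector_apply \<xi> L = \<xi> (fst L) + \<i> * \<xi> (snd L)"

definition holomorphic_cotangent :: "(complex^'N) set \<Rightarrow> complex^'N \<Rightarrow> (complex^'N \<Rightarrow> complex) set"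
  where "holomorphic_cotangent S q =
    {\<xi> \<in> complex_cotangent S q. \<forall>L\<in>CR_bundle S q. covector_apply \<xi> L = 0}"

definition characteristic_cotangent ::
    "(complex^'N) set \<Rightarrow> complex^'N \<Rightarrow> (complex^'N \<Rightarrow> complex) set"
  where "characteristic_cotangent S q =
    {\<xi> \<in> real_cotangent S q. \<forall>L\<in>CR_bundle S q \<union> CR_bundle_conj S q. covector_apply \<xi> L = 0}"


section \<open>Differential forms\<close>

type_synonym 'N cform = "complex^'N \<Rightarrow> complex^'N \<Rightarrow> complex"

definition extends_form :: "(complex^'N) set \<Rightarrow> 'N cform \<Rightarrow> complex^'N \<Rightarrow> 'N cform \<Rightarrow> bool"
  where "extends_form S \<alpha> q a \<longleftrightarrow>
    (\<exists>U. open U \<and> q \<in> U \<and> (\<forall>x\<in>U. linear (a x)) \<and> (\<forall>v. smooth_on U (\<lambda>x. a x v)) \<and>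
       (\<forall>x\<in>S \<inter> U. \<forall>v\<in>tangent_space S x. \<alpha> x v = a x v))"

definition smooth_form :: "(complex^'N) set \<Rightarrow> 'N cform \<Rightarrow> bool"
  where "smooth_form S \<alpha> \<longleftrightarrow> (\<forall>q\<in>S. \<exists>a. extends_form S \<alpha> q a)"

definition holomorphic_forms :: "(complex^'N) set \<Rightarrow> 'N cform set"
  where "holomorphic_forms S =
    {\<alpha>. smooth_form S \<alpha> \<and> (\<forall>q\<in>S. \<alpha> q \<in> holomorphic_cotangent S q)}"

definition characteristic_forms :: "(complex^'N) set \<Rightarrow> 'N cform set"
  where "characteristic_forms S =
    {\<tau>. smooth_form S \<tau> \<and> (\<forall>q\<in>S. \<tau> q \<in> characteristic_cotangent S q)}"

text \<open>Exterior derivative, computed from a local ambient extension and constant vector fields;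
  on tangent vectors it does not depend on the extension, since \<open>d\<close> commutes with pullback.\<close>

definition exterior_derivative ::
    "(complex^'N) set \<Rightarrow> 'N cform \<Rightarrow> complex^'N \<Rightarrow> complex^'N \<Rightarrow> complex^'N \<Rightarrow> complex"
  where "exterior_derivative S \<alpha> q u v =
    (let a = (SOME a. extends_form S \<alpha> q a)
     in frechet_derivative (\<lambda>x. a x v) (at q) u - frechet_derivative (\<lambda>x. a x u) (at q) v)"

text \<open>The Lie derivative of a holomorphic form \<open>\<alpha>\<close> along a CR vector field \<open>L\<close>:
  the term \<open>d (\<alpha> L)\<close> of Cartan's formula vanishes.\<close>

definition Lie_derivative ::
    "(complex^'N) set \<Rightarrow> (complex^'N \<Rightarrow> (complex^'N) \<times> (complex^'N)) \<Rightarrow> 'N cform \<Rightarrow> 'N cform"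
  where "Lie_derivative S L \<alpha> q v =
    (if q \<in> S \<and> v \<in> tangent_space S q
     then exterior_derivative S \<alpha> q (fst (L q)) v + \<i> * exterior_derivative S \<alpha> q (snd (L q)) v
     else 0)"


section \<open>Weak nondegeneracy\<close>

definition holomorphic_function :: "(complex^'N) set \<Rightarrow> (complex^'N \<Rightarrow> complex) \<Rightarrow> bool"
  where "holomorphic_function W f \<longleftrightarrow>
    (\<forall>x\<in>W. \<exists>f'. (f has_derivative f') (at x) \<and> (\<forall>v. f' (\<i> *s v) = \<i> * f' v))"

definition holomorphic_coordinates ::
    "(complex^'N) set \<Rightarrow> (complex^'N \<Rightarrow> complex^'n) \<Rightarrow> (complex^'N \<Rightarrow> complex) \<Rightarrow> bool"
  where "holomorphic_coordinates W z w \<longleftrightarrow>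
    open W \<and> (\<forall>j. holomorphic_function W (\<lambda>x. z x $ j)) \<and> holomorphic_function W w \<and>
    inj_on (\<lambda>x. (z x, w x)) W \<and>
    (\<forall>x\<in>W. bij (frechet_derivative (\<lambda>x. (z x, w x)) (at x)))"

text \<open>Wirtinger derivatives in the complex variables \<open>z\<close> of a function of \<open>(z, s)\<close>, \<open>s\<close> real.\<close>

definition dz :: "'n \<Rightarrow> ((complex^'n) \<times> real \<Rightarrow> complex) \<Rightarrow> ((complex^'n) \<times> real \<Rightarrow> complex)"
  where "dz j f x =
    (frechet_derivative f (at x) (axis j 1, 0) - \<i> * frechet_derivative f (at x) (axis j \<i>, 0)) / 2"

definition dzbar :: "'n \<Rightarrow> ((complex^'n) \<times> real \<Rightarrow> complex) \<Rightarrow> ((complex^'n) \<times> real \<Rightarrow> complex)"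
  where "dzbar j f x =
    (frechet_derivative f (at x) (axis j 1, 0) + \<i> * frechet_derivative f (at x) (axis j \<i>, 0)) / 2"

text \<open>A multi-index \<open>\<alpha>\<close> is given by a list of variable indices of length \<open>|\<alpha>|\<close>; the order of the
  list is immaterial because it is only used to differentiate smooth functions.\<close>

definition weak_nondegeneracy_condition ::
    "'n::finite itself \<Rightarrow> (complex^'N) set \<Rightarrow> complex^'N \<Rightarrow> nat \<Rightarrow> nat \<Rightarrow> bool"
  where "weak_nondegeneracy_condition _ M p m k \<longleftrightarrow>
    (\<exists>W (z :: complex^'N \<Rightarrow> complex^'n) w D (\<phi> :: (complex^'n) \<times> real \<Rightarrow> real).
       holomorphic_coordinates W z w \<and> p \<in> W \<and> z p = 0 \<and> w p = 0 \<and>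
       open D \<and> smooth_on D \<phi> \<and> (\<forall>x\<in>W. (z x, Re (w x)) \<in> D) \<and>
       M \<inter> W = {x\<in>W. Im (w x) = Re (w x) ^ m * \<phi> (z x, Re (w x))} \<and>
       (\<forall>\<alpha>. length \<alpha> \<le> k \<longrightarrow>
          foldr dz \<alpha> (\<lambda>x. of_real (\<phi> x)) (0, 0) = 0 \<and>
          foldr dzbar \<alpha> (\<lambda>x. of_real (\<phi> x)) (0, 0) = 0) \<and>
       vec.span {(\<chi> j. dz j (foldr dzbar \<alpha> (\<lambda>x. of_real (\<phi> x))) (0, 0)) | \<alpha>. length \<alpha> \<le> k} = UNIV)"

definition weakly_k_nondegenerate ::
    "'n::finite itself \<Rightarrow> (complex^'N) set \<Rightarrow> complex^'N \<Rightarrow> nat \<Rightarrow> bool"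
  where "weakly_k_nondegenerate n M p k \<longleftrightarrow>
    k > 0 \<and> (\<exists>m>0. weak_nondegeneracy_condition n M p m k) \<and>
    (\<forall>j. 0 < j \<and> j < k \<longrightarrow> \<not> (\<exists>m>0. weak_nondegeneracy_condition n M p m j))"


section \<open>Distributions on open subsets of Euclidean space\<close>

definition test_functions :: "(real^'d) set \<Rightarrow> (real^'d \<Rightarrow> complex) set"
  where "test_functions \<Omega> =
    {\<phi>. smooth_on UNIV \<phi> \<and> (\<exists>K. compact K \<and> K \<subseteq> \<Omega> \<and> (\<forall>x. x \<notin> K \<longrightarrow> \<phi> x = 0))}"

definition partial_deriv :: "'d \<Rightarrow> (real^'d \<Rightarrow> complex) \<Rightarrow> (real^'d \<Rightarrow> complex)"
  where "partial_deriv j f x = frechet_derivative f (at x) (axis j 1)"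

definition distribution :: "(real^'d) set \<Rightarrow> ((real^'d \<Rightarrow> complex) \<Rightarrow> complex) \<Rightarrow> bool"
  where "distribution \<Omega> u \<longleftrightarrow>
    (\<forall>\<phi>\<in>test_functions \<Omega>. \<forall>\<psi>\<in>test_functions \<Omega>. \<forall>a b.
       u (\<lambda>x. a * \<phi> x + b * \<psi> x) = a * u \<phi> + b * u \<psi>) \<and>
    (\<forall>K. compact K \<and> K \<subseteq> \<Omega> \<longrightarrow>
       (\<exists>C k. \<forall>\<phi>\<in>test_functions \<Omega>. \<forall>B.
          (\<forall>x. x \<notin> K \<longrightarrow> \<phi> x = 0) \<and>
          (\<forall>\<alpha>. length \<alpha> \<le> k \<longrightarrow> (\<forall>x. norm (foldr partial_deriv \<alpha> \<phi> x) \<le> B))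
          \<longrightarrow> norm (u \<phi>) \<le> C * B))"

text \<open>The action of a vector field with complex coefficients \<open>Y\<close> on a distribution.\<close>

definition vector_field_apply ::
    "(real^'d \<Rightarrow> complex^'d) \<Rightarrow> ((real^'d \<Rightarrow> complex) \<Rightarrow> complex) \<Rightarrow> ((real^'d \<Rightarrow> complex) \<Rightarrow> complex)"
  where "vector_field_apply Y u \<phi> = - u (\<lambda>x. \<Sum>j\<in>UNIV. partial_deriv j (\<lambda>y. Y y $ j * \<phi> y) x)"

text \<open>The value of \<open>u\<close> at \<open>\<phi>(y) exp(- \<i> y \<bullet> \<eta>)\<close> below is the Fourier transform of \<open>\<phi> u\<close> at \<open>\<eta>\<close>.\<close>

definition wavefront_set_on ::
    "(real^'d) set \<Rightarrow> ((real^'d \<Rightarrow> complex) \<Rightarrow> complex) \<Rightarrow> ((real^'d) \<times> (real^'d)) set"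
  where "wavefront_set_on \<Omega> u =
    {(x, \<xi>). x \<in> \<Omega> \<and> \<xi> \<noteq> 0 \<and>
       \<not> (\<exists>\<phi>\<in>test_functions \<Omega>. \<phi> x \<noteq> 0 \<and>
            (\<exists>V. open V \<and> \<xi> \<in> V \<and> (\<forall>\<eta>\<in>V. \<forall>t>0. t *\<^sub>R \<eta> \<in> V) \<and>
               (\<forall>r::nat. \<exists>C. \<forall>\<eta>\<in>V.
                  norm (u (\<lambda>y. \<phi> y * cis (- (y \<bullet> \<eta>)))) \<le> C / (1 + norm \<eta>) ^ r)))}"


section \<open>Densities and distributions on a hypersurface\<close>

text \<open>Inverses of charts.  For \<open>CARD('d)\<close> equal to the dimension of \<open>S\<close>, the derivative of \<open>\<kappa>\<close> at
  \<open>x\<close> is then an isomorphism onto the tangent space at \<open>\<kappa> x\<close>.\<close>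

definition parametrization ::
    "(complex^'N) set \<Rightarrow> (real^'d) set \<Rightarrow> (real^'d \<Rightarrow> complex^'N) \<Rightarrow> bool"
  where "parametrization S \<Omega> \<kappa> \<longleftrightarrow>
    open \<Omega> \<and> smooth_on \<Omega> \<kappa> \<and> openin (top_of_set S) (\<kappa> ` \<Omega>) \<and>
    (\<exists>g. homeomorphism \<Omega> (\<kappa> ` \<Omega>) \<kappa> g) \<and> (\<forall>x\<in>\<Omega>. inj (frechet_derivative \<kappa> (at x)))"

text \<open>A density at \<open>q\<close> is a function \<open>\<delta>\<close> of the frames \<open>A\<close> (linear isomorphisms onto the tangent
  space at \<open>q\<close>) with \<open>\<delta> (A \<circ> B) = |det B| \<delta> A\<close>, made total by the value 0 off frames.\<close>

definition frames :: "(complex^'N) set \<Rightarrow> complex^'N \<Rightarrow> (real^'d \<Rightarrow> complex^'N) set"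
  where "frames S q = {A. linear A \<and> inj A \<and> range A = tangent_space S q}"

type_synonym ('N, 'd) density = "complex^'N \<Rightarrow> (real^'d \<Rightarrow> complex^'N) \<Rightarrow> complex"

type_synonym ('N, 'd) form_density =
  "complex^'N \<Rightarrow> (real^'d \<Rightarrow> complex^'N) \<Rightarrow> complex^'N \<Rightarrow> complex"

definition test_densities :: "(complex^'N) set \<Rightarrow> ('N::finite, 'd::finite) density set"
  where "test_densities S =
    {\<mu>. (\<forall>q\<in>S. (\<forall>A. A \<notin> frames S q \<longrightarrow> \<mu> q A = 0) \<and>
           (\<forall>A\<in>frames S q. \<forall>B. linear B \<longrightarrow> \<mu> q (A \<circ> B) = of_real \<bar>det (matrix B)\<bar> * \<mu> q A)) \<and>
        (\<forall>\<Omega> \<kappa>. parametrization S \<Omega> \<kappa> \<longrightarrow>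
           smooth_on \<Omega> (\<lambda>x. \<mu> (\<kappa> x) (frechet_derivative \<kappa> (at x)))) \<and>
        (\<exists>K. compact K \<and> K \<subseteq> S \<and> (\<forall>q. q \<notin> K \<longrightarrow> (\<forall>A. \<mu> q A = 0)))}"

text \<open>Compactly supported smooth sections of the holomorphic cotangent bundle tensored with the
  density bundle; smoothness is smoothness of the coefficients of the pulled back form.\<close>

definition test_sections :: "(complex^'N) set \<Rightarrow> ('N::finite, 'd::finite) form_density set"
  where "test_sections S =
    {\<sigma>. (\<forall>q\<in>S. (\<forall>A. A \<notin> frames S q \<longrightarrow> (\<forall>v. \<sigma> q A v = 0)) \<and>
           (\<forall>A\<in>frames S q. \<sigma> q A \<in> holomorphic_cotangent S q \<and>
             (\<forall>B v. linear B \<longrightarrow> \<sigma> q (A \<circ> B) v = of_real \<bar>det (matrix B)\<bar> * \<sigma> q A v))) \<and>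
        (\<forall>\<Omega> \<kappa>. parametrization S \<Omega> \<kappa> \<longrightarrow>
           (\<forall>h. smooth_on \<Omega>
              (\<lambda>x. \<sigma> (\<kappa> x) (frechet_derivative \<kappa> (at x)) (frechet_derivative \<kappa> (at x) h)))) \<and>
        (\<exists>K. compact K \<and> K \<subseteq> S \<and> (\<forall>q. q \<notin> K \<longrightarrow> (\<forall>A v. \<sigma> q A v = 0)))}"

definition form_times_density :: "'N cform \<Rightarrow> ('N::finite, 'd::finite) density \<Rightarrow> ('N::finite, 'd::finite) form_density"
  where "form_times_density \<omega> \<mu> q A v = \<mu> q A * \<omega> q v"

text \<open>The density \<open>\<phi> |dx|\<close> in the coordinates \<open>x\<close> given by \<open>\<kappa>\<close>, extended by 0.\<close>

definition chart_density ::
    "(real^'d) set \<Rightarrow> (real^'d \<Rightarrow> complex^'N) \<Rightarrow> (real^'d \<Rightarrow> complex) \<Rightarrow> ('N::finite, 'd::finite) density"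
  where "chart_density \<Omega> \<kappa> \<phi> q A =
    (if q \<in> \<kappa> ` \<Omega> \<and> A \<in> frames (\<kappa> ` \<Omega>) q
     then let x = inv_into \<Omega> \<kappa> q
          in \<phi> x * of_real \<bar>det (matrix (inv (frechet_derivative \<kappa> (at x)) \<circ> A))\<bar>
     else 0)"

definition local_distribution ::
    "(real^'d) set \<Rightarrow> (real^'d \<Rightarrow> complex^'N) \<Rightarrow> (('N::finite, 'd::finite) density \<Rightarrow> complex) \<Rightarrow>
     ((real^'d \<Rightarrow> complex) \<Rightarrow> complex)"
  where "local_distribution \<Omega> \<kappa> T \<phi> = T (chart_density \<Omega> \<kappa> \<phi>)"

text \<open>Functionals are only looked at on test objects, and a test object of an open subset of \<open>S\<close>
  is literally a test object of \<open>S\<close>; so a functional also denotes its restrictions to open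
  subsets.\<close>

definition scalar_distribution :: "(complex^'N) set \<Rightarrow> (('N::finite, 'd::finite) density \<Rightarrow> complex) \<Rightarrow> bool"
  where "scalar_distribution S T \<longleftrightarrow>
    (\<forall>\<mu>\<in>test_densities S. \<forall>\<nu>\<in>test_densities S. \<forall>a b.
       T (\<lambda>q A. a * \<mu> q A + b * \<nu> q A) = a * T \<mu> + b * T \<nu>) \<and>
    (\<forall>\<Omega> \<kappa>. parametrization S \<Omega> \<kappa> \<longrightarrow> distribution \<Omega> (local_distribution \<Omega> \<kappa> T))"

text \<open>The scalar distribution \<open>\<omega>(X)\<close>.\<close>

definition pairing ::
    "'N cform \<Rightarrow> (('N::finite, 'd::finite) form_density \<Rightarrow> complex) \<Rightarrow> (('N::finite, 'd::finite) density \<Rightarrow> complex)"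
  where "pairing \<omega> X \<mu> = X (form_times_density \<omega> \<mu>)"

text \<open>Distributions with values in the dual of the holomorphic cotangent bundle.  Continuity is
  expressed in charts, for arbitrary local sections (in particular those of local bases).\<close>

definition distributional_section ::
    "(complex^'N) set \<Rightarrow> (('N::finite, 'd::finite) form_density \<Rightarrow> complex) \<Rightarrow> bool"
  where "distributional_section S X \<longleftrightarrow>
    (\<forall>\<sigma>\<in>test_sections S. \<forall>\<tau>\<in>test_sections S. \<forall>a b.
       X (\<lambda>q A v. a * \<sigma> q A v + b * \<tau> q A v) = a * X \<sigma> + b * X \<tau>) \<and>
    (\<forall>\<Omega> \<kappa>. parametrization S \<Omega> \<kappa> \<longrightarrow>
       (\<forall>\<omega>\<in>holomorphic_forms (\<kappa> ` \<Omega>). distribution \<Omega> (local_distribution \<Omega> \<kappa> (pairing \<omega> X))))"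


section \<open>Local representations\<close>

definition local_basis :: "(complex^'N) set \<Rightarrow> ('N \<Rightarrow> 'N cform) \<Rightarrow> bool"
  where "local_basis S \<omega> \<longleftrightarrow>
    (\<forall>j. \<omega> j \<in> holomorphic_forms S) \<and>
    (\<forall>q\<in>S. (\<forall>a. (\<forall>v. (\<Sum>j\<in>UNIV. a j * \<omega> j q v) = 0) \<longrightarrow> (\<forall>j. a j = 0)) \<and>
           (\<forall>\<xi>\<in>holomorphic_cotangent S q. \<exists>a. \<forall>v. \<xi> v = (\<Sum>j\<in>UNIV. a j * \<omega> j q v)))"

text \<open>\<open>X = \<Sum>\<^sub>j c\<^sub>j \<omega>\<^sub>j\<close> for the dual basis \<open>\<omega>\<^sub>j\<close>: a test section \<open>\<Sum>\<^sub>j \<mu>\<^sub>j \<omega>\<^sup>j\<close> is sent to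
  \<open>\<Sum>\<^sub>j c\<^sub>j(\<mu>\<^sub>j)\<close>.\<close>

definition local_representation ::
    "(complex^'N) set \<Rightarrow> ('N \<Rightarrow> 'N cform) \<Rightarrow> (('N::finite, 'd::finite) form_density \<Rightarrow> complex) \<Rightarrow>
     ('N \<Rightarrow> ('N::finite, 'd::finite) density \<Rightarrow> complex) \<Rightarrow> bool"
  where "local_representation S \<omega> X c \<longleftrightarrow>
    local_basis S \<omega> \<and> (\<forall>j. scalar_distribution S (c j)) \<and>
    (\<forall>\<mu>. (\<forall>j. \<mu> j \<in> test_densities S) \<longrightarrow>
       X (\<lambda>q A v. \<Sum>j\<in>UNIV. form_times_density (\<omega> j) (\<mu> j) q A v) = (\<Sum>j\<in>UNIV. c j (\<mu> j)))"

definition given_by_function ::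
    "(complex^'N) set \<Rightarrow> (('N::finite, 'd::finite) density \<Rightarrow> complex) \<Rightarrow> (complex^'N \<Rightarrow> complex) \<Rightarrow> bool"
  where "given_by_function S T f \<longleftrightarrow>
    (\<forall>\<Omega> \<kappa>. parametrization S \<Omega> \<kappa> \<longrightarrow>
       (\<forall>K. compact K \<and> K \<subseteq> \<Omega> \<longrightarrow> set_integrable lebesgue K (\<lambda>x. f (\<kappa> x))) \<and>
       (\<forall>\<phi>\<in>test_functions \<Omega>. local_distribution \<Omega> \<kappa> T \<phi> = (LINT x:\<Omega>|lebesgue. f (\<kappa> x) * \<phi> x)))"

definition locally_integrable_section ::
    "(complex^'N) set \<Rightarrow> (('N::finite, 'd::finite) form_density \<Rightarrow> complex) \<Rightarrow> bool"
  where "locally_integrable_section S X \<longleftrightarrow>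
    (\<forall>U \<omega> c. open U \<and> local_representation (S \<inter> U) \<omega> X c \<longrightarrow>
       (\<forall>j. \<exists>f. given_by_function (S \<inter> U) (c j) f))"

definition smooth_section :: "(complex^'N) set \<Rightarrow> (('N::finite, 'd::finite) form_density \<Rightarrow> complex) \<Rightarrow> bool"
  where "smooth_section S X \<longleftrightarrow>
    (\<forall>U \<omega> c. open U \<and> local_representation (S \<inter> U) \<omega> X c \<longrightarrow>
       (\<forall>j. \<exists>f. smooth_on_submanifold (S \<inter> U) f \<and> given_by_function (S \<inter> U) (c j) f))"

definition smooth_near ::
    "(complex^'N) set \<Rightarrow> complex^'N \<Rightarrow> (('N::finite, 'd::finite) form_density \<Rightarrow> complex) \<Rightarrow> bool"
  where "smooth_near M p X \<longleftrightarrow> (\<exists>U. open U \<and> p \<in> U \<and> smooth_section (M \<inter> U) X)"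


section \<open>Infinitesimal CR diffeomorphisms\<close>

definition conj_distribution :: "(('N::finite, 'd::finite) density \<Rightarrow> complex) \<Rightarrow> (('N::finite, 'd::finite) density \<Rightarrow> complex)"
  where "conj_distribution T \<mu> = cnj (T (\<lambda>q A. cnj (\<mu> q A)))"

definition chart_vector_field ::
    "(real^'d \<Rightarrow> complex^'N) \<Rightarrow> (complex^'N \<Rightarrow> (complex^'N) \<times> (complex^'N)) \<Rightarrow> (real^'d \<Rightarrow> complex^'d)"
  where "chart_vector_field \<kappa> L x =
    (let D = frechet_derivative \<kappa> (at x)
     in \<chi> j. Complex (inv D (fst (L (\<kappa> x))) $ j) (inv D (snd (L (\<kappa> x))) $ j))"

text \<open>The identity \<open>L(\<alpha>(X)) = (\<L>\<^sub>L \<alpha>)(X)\<close> of scalar distributions is stated in every chart.\<close>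

definition infinitesimal_CR_diffeomorphism ::
    "(complex^'N) set \<Rightarrow> (('N::finite, 'd::finite) form_density \<Rightarrow> complex) \<Rightarrow> bool"
  where "infinitesimal_CR_diffeomorphism M X \<longleftrightarrow>
    distributional_section M X \<and>
    (\<forall>\<tau>\<in>characteristic_forms M. \<forall>\<mu>\<in>test_densities M.
       pairing \<tau> X \<mu> = conj_distribution (pairing \<tau> X) \<mu>) \<and>
    (\<forall>L\<in>CR_vector_fields M. \<forall>\<alpha>\<in>holomorphic_forms M.
       \<forall>\<Omega> \<kappa>. parametrization M \<Omega> \<kappa> \<longrightarrow> (\<forall>\<phi>\<in>test_functions \<Omega>.
         vector_field_apply (chart_vector_field \<kappa> L) (local_distribution \<Omega> \<kappa> (pairing \<alpha> X)) \<phi> =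
         local_distribution \<Omega> \<kappa> (pairing (Lie_derivative M L \<alpha>) X) \<phi>))"


section \<open>Microlocal extension\<close>

definition wavefront_set ::
    "(complex^'N) set \<Rightarrow> (('N::finite, 'd::finite) density \<Rightarrow> complex) \<Rightarrow>
     ((complex^'N) \<times> (complex^'N \<Rightarrow> complex)) set"
  where "wavefront_set S T =
    {(q, \<xi>). \<xi> \<in> real_cotangent S q \<and>
       (\<exists>\<Omega> \<kappa> x. parametrization S \<Omega> \<kappa> \<and> x \<in> \<Omega> \<and> \<kappa> x = q \<and>
          (x, \<chi> j. Re (\<xi> (frechet_derivative \<kappa> (at x) (axis j 1))))
            \<in> wavefront_set_on \<Omega> (local_distribution \<Omega> \<kappa> T))}"

text \<open>The fibres of \<open>\<Gamma>\<close> omit 0, so cones are only closed under positive multiples; closedness is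
  relative to the punctured fibre (in the topology of pointwise convergence).\<close>

definition extends_microlocally ::
    "(complex^'N) set \<Rightarrow> (('N::finite, 'd::finite) form_density \<Rightarrow> complex) \<Rightarrow> bool"
  where "extends_microlocally S X \<longleftrightarrow>
    (\<exists>\<Gamma> :: complex^'N \<Rightarrow> (complex^'N \<Rightarrow> complex) set.
       (\<forall>q\<in>S.
          closedin (top_of_set (characteristic_cotangent S q - {\<lambda>_. 0})) (\<Gamma> q) \<and>
          (\<forall>\<xi>\<in>\<Gamma> q. \<forall>t::real. t > 0 \<longrightarrow> (\<lambda>v. of_real t * \<xi> v) \<in> \<Gamma> q) \<and>
          (\<forall>\<xi>\<in>\<Gamma> q. \<forall>\<eta>\<in>\<Gamma> q. \<forall>s t :: real. s \<ge> 0 \<and> t \<ge> 0 \<and> s + t = 1 \<longrightarrow>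
             (\<lambda>v. of_real s * \<xi> v + of_real t * \<eta> v) \<in> \<Gamma> q)) \<and>
       (\<forall>\<omega>\<in>holomorphic_forms S. wavefront_set S (pairing \<omega> X) \<subseteq> Sigma S \<Gamma>))"

definition extends_microlocally_near ::
    "(complex^'N) set \<Rightarrow> complex^'N \<Rightarrow> (('N::finite, 'd::finite) form_density \<Rightarrow> complex) \<Rightarrow> bool"
  where "extends_microlocally_near M p X \<longleftrightarrow>
    (\<exists>U. open U \<and> p \<in> U \<and> extends_microlocally (M \<inter> U) X)"

end

theory Submission
  imports Defs "HOL-Complex_Analysis.Complex_Analysis" "HOL-Probability.Probability"
begin

text \<open>Let \<open>Z\<close> run over the ambient holomorphic coordinates \<open>z\<^sub>1, ..., z\<^sub>n, w\<close> in which the hypersurface is the graph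
\<open>Im w = h\<close> with \<open>h = s^m \<phi>(z, s)\<close> and \<open>s = Re w\<close>.  The forms \<open>dZ\<close> are closed and span the holomorphic
forms, so an infinitesimal CR diffeomorphism \<open>X\<close> is given near \<open>p\<close> by the functions \<open>f = dZ(X)\<close>, one for each
coordinate, and \<open>L(dZ(X)) = (\<L>\<^sub>L dZ)(X) = 0\<close> says that these are weak solutions of the tangential
Cauchy-Riemann equations (\<open>weak_CR\<close>).  It suffices to show that all of them are smooth.

The characteristic form \<open>\<theta> = (1 - \<i> h\<^sub>s) dw - 2 \<i> \<Sum> h\<^sub>z dz\<close> pairs with \<open>X\<close> to a real distribution, whose wavefront set is
symmetric under \<open>\<xi> \<mapsto> -\<xi>\<close>.  On the other hand it lies in convex cones that omit \<open>0\<close>, and a convex cone which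
contains \<open>\<xi>\<close> and \<open>-\<xi>\<close> contains \<open>0\<close>.  So the wavefront set is empty (\<open>wavefront_\<theta>_empty\<close>), and by Fourier
inversion \<open>\<theta>(X)\<close> is smooth near \<open>p\<close> (\<open>smooth_of_empty_wavefront\<close>).  This is a first linear relation
\<open>f\<^sub>w + s^m \<Sum> \<psi>\<^sub>l f\<^sub>l = smooth\<close> between the unknown functions, with \<open>\<psi>\<^sub>l = - 2 \<i> \<phi>\<^sub>z / (1 - \<i> h\<^sub>s)\<close>.

The CR vector fields may be applied to the coefficients of a relation between weak solutions
(\<open>derivative_of_weak_relation\<close>).  They have the form \<open>\<partial>/\<partial>z\<^sub>j-bar + s^m b\<^sub>j \<partial>/\<partial>s\<close>, hence they kill the coefficient \<open>1\<close> of
\<open>f\<^sub>w\<close> and preserve the factor \<open>s^m\<close>: for each nonempty multi-index \<open>\<alpha>\<close>, a combination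
\<open>s^m \<Sum> P\<^sub>l f\<^sub>l\<close> is smooth, where \<open>P\<^sub>l\<close> depends on \<open>\<alpha>\<close> and, up to terms whose \<open>z\<close>-bar derivatives vanish to
sufficiently high order, equals \<open>- 2 \<i>\<close> times the derivative of \<open>\<phi>\<close> by \<open>z\<^sub>l\<close> and \<open>z\<^sup>\<alpha>\<close>-bar (\<open>relation_coefficient_leading_part\<close>).
Nondegeneracy says that the vectors of these derivatives at the origin span, so the linear system can be solved
for the \<open>s^m f\<^sub>l\<close> (\<open>smooth_multiples\<close>).

Finally one divides by \<open>s^m\<close>, one factor at a time.  If \<open>s f\<close> agrees almost everywhere with a smooth function \<open>g\<close> and
\<open>f\<close> is locally integrable, then \<open>g\<close> vanishes for \<open>s = 0\<close>, because \<open>1/s\<close> is not integrable; so \<open>g/s\<close> is smooth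
by Hadamard's lemma (\<open>smooth_after_division\<close>).  Local integrability is thus what excludes solutions such
as \<open>\<delta>(s)\<close>.

The translation between the hypersurface and Euclidean space rests on one chart: the graph parametrization has a smooth left
inverse on the ambient space, forms and vector fields are made global by a cutoff function that is \<open>1\<close> near
\<open>p\<close>, and every holomorphic form is a smooth combination of the \<open>dZ\<close> (\<open>holomorphic_covector_expansion\<close>).\<close>

section \<open>Calculus of smooth maps\<close>

\<comment> \<open>Formal power series share the infix of vector components.\<close>
no_notation fps_nth (infixl "$" 75)

named_theorems smooth_intros

abbreviation fderiv :: "('a::real_normed_vector => 'b::real_normed_vector) => 'a => 'a => 'b"
 where "fderiv f x \<equiv> frechet_derivative f (at x)"

lemma frechet_derivative_eqI: "(f has_derivative f') (at x) ==> fderiv f x = f'"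
 by (rule frechet_derivative_at[symmetric])

lemma Ck_on_subset: "Ck_on k S f ==> T \<subseteq> S ==> Ck_on k T f"
 by (induction k arbitrary: f) (auto intro: continuous_on_subset)

lemma Ck_on_SucE:
 assumes "Ck_on (Suc k) S f" "x \<in> S"
 shows "(f has_derivative fderiv f x) (at x)"
 using assms frechet_derivative_works by auto

lemma Ck_on_continuous_on: "Ck_on k S f ==> continuous_on S f"
 by (cases k) (auto intro!: differentiable_imp_continuous_on differentiable_at_imp_differentiable_on)

lemma Ck_on_decSuc: "Ck_on (Suc k) S f ==> Ck_on k S f"
proof (induction k arbitrary: f)
 case 0
 then show ?case using Ck_on_continuous_on by fastforce
next
 case (Suc k)
 then show ?case by (metis Ck_on.simps(2))
qed

lemma Ck_on_cong:
 assumes "open S" "\<And>x. x \<in> S ==> f x = g x" "Ck_on k S f"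
 shows "Ck_on k S g"
 using assms(2,3)
proof (induction k arbitrary: f g)
 case 0
 then show ?case by (auto cong: continuous_on_cong)
next
 case (Suc k)
 have g: "(g has_derivative fderiv f x) (at x)" if "x \<in> S" for x
  using has_derivative_transform_within_open[OF Ck_on_SucE[OF Suc.prems(2) that] assms(1) that] Suc.prems(1)
  by auto
 have "Ck_on k S (\<lambda>x. fderiv g x v)" for v
 proof (rule Suc.IH)
  show "Ck_on k S (\<lambda>x. fderiv f x v)" using Suc.prems by auto
  show "fderiv f x v = fderiv g x v" if "x \<in> S" for x
   using frechet_derivative_eqI[OF g[OF that]] by simp
 qed
 then show ?case using g by (auto simp: differentiable_def)
qed

lemma Ck_on_SucI:
 assumes "open S" "\<And>x. x \<in> S ==> (f has_derivative f' x) (at x)"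
  and "\<And>v. Ck_on k S (\<lambda>x. f' x v)"
 shows "Ck_on (Suc k) S f"
proof -
 have "Ck_on k S (\<lambda>x. fderiv f x v)" for v
  by (rule Ck_on_cong[OF assms(1) _ assms(3)[of v]])
    (simp add: frechet_derivative_eqI[OF assms(2)])
 then show ?thesis using assms(2) by (auto simp: differentiable_def)
qed

lemma Ck_on_local:
 assumes "\<And>x. x \<in> S ==> \<exists>U. open U \<and> x \<in> U \<and> Ck_on k U f"
 shows "Ck_on k S f"
 using assms
proof (induction k arbitrary: f)
 case 0
 have "isCont f x" if "x \<in> S" for x
  using 0[OF that] by (auto simp: continuous_on_eq_continuous_at)
 then show ?case by (simp add: continuous_at_imp_continuous_on)
next
 case (Suc k)
 show ?case
  unfolding Ck_on.simps
 proof (intro conjI ballI allI)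
  show "f differentiable at x" if "x \<in> S" for x using Suc.prems[OF that] by auto
  show "Ck_on k S (\<lambda>x. fderiv f x v)" for v
   by (rule Suc.IH) (use Suc.prems in fastforce)
 qed
qed

lemma Ck_on_const: "Ck_on k S (\<lambda>x. c)"
 by (induction k arbitrary: c) auto

lemma Ck_on_linear_compose:
 assumes g: "bounded_linear g" and S: "open S" and f: "Ck_on k S f"
 shows "Ck_on k S (\<lambda>x. g (f x))"
 using f
proof (induction k arbitrary: f)
 case 0
 then show ?case by (auto intro: bounded_linear.continuous_on[OF g])
next
 case (Suc k)
 show ?case
 proof (rule Ck_on_SucI[OF S])
  show "((\<lambda>x. g (f x)) has_derivative (\<lambda>v. g (fderiv f x v))) (at x)" if "x \<in> S" for x
   by (rule bounded_linear.has_derivative[OF g Ck_on_SucE[OF Suc.prems that]])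
  show "Ck_on k S (\<lambda>x. g (fderiv f x v))" for v
   by (rule Suc.IH) (use Suc.prems in auto)
 qed
qed

lemma Ck_on_ident: "open S ==> Ck_on k S (\<lambda>x. x)"
 by (cases k) (auto intro!: Ck_on_const continuous_on_id)

lemma Ck_on_linear: "bounded_linear g ==> open S ==> Ck_on k S g"
 using Ck_on_linear_compose[OF _ _ Ck_on_ident] by blast

lemma Ck_on_add:
 assumes S: "open S" and "Ck_on k S f" "Ck_on k S g"
 shows "Ck_on k S (\<lambda>x. f x + g x)"
 using assms(2,3)
proof (induction k arbitrary: f g)
 case 0
 then show ?case by (auto intro: continuous_on_add)
next
 case (Suc k)
 show ?case
 proof (rule Ck_on_SucI[OF S])
  show "((\<lambda>x. f x + g x) has_derivative (\<lambda>v. fderiv f x v + fderiv g x v)) (at x)"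
   if "x \<in> S" for x
   using Ck_on_SucE[OF Suc.prems(1) that] Ck_on_SucE[OF Suc.prems(2) that]
   by (auto intro!: has_derivative_add)
  show "Ck_on k S (\<lambda>x. fderiv f x v + fderiv g x v)" for v
   by (rule Suc.IH) (use Suc.prems in auto)
 qed
qed

lemma Ck_on_bilinear:
 assumes p: "bounded_bilinear p" and S: "open S" and "Ck_on k S f" "Ck_on k S g"
 shows "Ck_on k S (\<lambda>x. p (f x) (g x))"
 using assms(3,4)
proof (induction k arbitrary: f g)
 case 0
 then show ?case by (auto intro: bounded_bilinear.continuous_on[OF p])
next
 case (Suc k)
 show ?case
 proof (rule Ck_on_SucI[OF S])
  show "((\<lambda>x. p (f x) (g x)) has_derivative
    (\<lambda>v. p (f x) (fderiv g x v) + p (fderiv f x v) (g x))) (at x)"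
   if "x \<in> S" for x
   by (rule bounded_bilinear.FDERIV[OF p Ck_on_SucE[OF Suc.prems(1) that] Ck_on_SucE[OF Suc.prems(2) that]])
  show "Ck_on k S (\<lambda>x. p (f x) (fderiv g x v) + p (fderiv f x v) (g x))" for v
   by (intro Ck_on_add[OF S] Suc.IH) (use Suc.prems Ck_on_decSuc in auto)
 qed
qed

lemma Ck_on_sum:
 assumes "open S" "\<And>i. i \<in> I ==> Ck_on k S (f i)"
 shows "Ck_on k S (\<lambda>x. \<Sum>i\<in>I. f i x)"
 using assms(2)
 by (induction I rule: infinite_finite_induct) (auto intro!: Ck_on_const Ck_on_add assms(1))

lemma Ck_on_compose:
 fixes f :: "'a::real_normed_vector => 'b::euclidean_space"
 assumes S: "open S" and T: "open T" and "Ck_on k S f" "Ck_on k T g" "f ` S \<subseteq> T"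
 shows "Ck_on k S (\<lambda>x. g (f x))"
 using assms(3,4)
proof (induction k arbitrary: g)
 case 0
 then show ?case using assms(5) by (auto intro: continuous_on_compose2)
next
 case (Suc k)
 let ?D = "\<lambda>x v. \<Sum>b\<in>Basis. (fderiv f x v \<bullet> b) *\<^sub>R fderiv g (f x) b"
 show ?case
 proof (rule Ck_on_SucI[OF S])
  fix x assume x: "x \<in> S"
  have g: "(g has_derivative fderiv g (f x)) (at (f x))"
   using Suc.prems(2) x assms(5) by (intro Ck_on_SucE) auto
  have "(\<lambda>v. fderiv g (f x) (fderiv f x v)) = ?D x"
  proof
   fix v
   have "fderiv g (f x) (\<Sum>b\<in>Basis. (fderiv f x v \<bullet> b) *\<^sub>R b) = ?D x v"
    using has_derivative_linear[OF g] by (simp add: linear_sum linear_cmul)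
   then show "fderiv g (f x) (fderiv f x v) = ?D x v"
    by (simp add: euclidean_representation)
  qed
  then show "((\<lambda>x. g (f x)) has_derivative ?D x) (at x)"
   using diff_chain_at[OF Ck_on_SucE[OF Suc.prems(1) x] g] by (simp add: o_def)
 next
  fix v
  show "Ck_on k S (\<lambda>x. ?D x v)"
  proof (intro Ck_on_sum[OF S] Ck_on_bilinear[OF bounded_bilinear_scaleR S])
   fix b :: 'b
   show "Ck_on k S (\<lambda>x. fderiv f x v \<bullet> b)"
    by (rule Ck_on_linear_compose[OF bounded_linear_inner_left S]) (use Suc.prems in auto)
   show "Ck_on k S (\<lambda>x. fderiv g (f x) b)"
    by (rule Suc.IH) (use Suc.prems Ck_on_decSuc in auto)
  qed
 qed
qed

lemma Ck_on_inverse: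
 fixes f :: "'a::real_normed_vector => 'b::real_normed_field"
 assumes S: "open S" and "Ck_on k S f" and nz: "\<And>x. x \<in> S ==> f x \<noteq> 0"
 shows "Ck_on k S (\<lambda>x. inverse (f x))"
 using assms(2)
proof (induction k)
 case 0
 then show ?case using nz by (auto intro!: continuous_intros)
next
 case (Suc k)
 have *: "Ck_on k S (\<lambda>x. inverse (f x))"
  using Suc Ck_on_decSuc by auto
 show ?case
 proof (rule Ck_on_SucI[OF S])
  show "((\<lambda>x. inverse (f x)) has_derivative
    (\<lambda>v. - 1 * (inverse (f x) * fderiv f x v * inverse (f x)))) (at x)" if "x \<in> S" for x
   using Deriv.has_derivative_inverse[OF nz[OF that] Ck_on_SucE[OF Suc.prems that]] by simp
  show "Ck_on k S (\<lambda>x. - 1 * (inverse (f x) * fderiv f x v * inverse (f x)))" for v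
   by (intro Ck_on_bilinear[OF bounded_bilinear_mult S] Ck_on_const *) (use Suc.prems in auto)
 qed
qed

text \<open>The derivatives in \<open>smooth_on\<close> are those of the ambient space, so the rules below are meant for open sets.\<close>

lemma smooth_on_continuous: "smooth_on S f ==> continuous_on S f"
 unfolding smooth_on_def using Ck_on_continuous_on by blast

lemma smooth_on_subset: "smooth_on S f ==> T \<subseteq> S ==> smooth_on T f"
 unfolding smooth_on_def using Ck_on_subset by blast

lemma smooth_on_cong: "open S ==> smooth_on S f ==> (\<And>x. x \<in> S ==> f x = g x) ==> smooth_on S g"
 using Ck_on_cong smooth_on_def by metis

lemma smooth_on_local:
 assumes "\<And>x. x \<in> S ==> \<exists>U. open U \<and> x \<in> U \<and> smooth_on U f"
 shows "smooth_on S f"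
 unfolding smooth_on_def
proof
 show "Ck_on k S f" for k
  by (rule Ck_on_local) (use assms smooth_on_def in metis)
qed

lemma smooth_on_has_derivative:
 "smooth_on S f ==> x \<in> S ==> (f has_derivative fderiv f x) (at x)"
 unfolding smooth_on_def using Ck_on_SucE by blast

lemma smooth_on_derivative: "smooth_on S f ==> smooth_on S (\<lambda>x. fderiv f x v)"
 unfolding smooth_on_def by (metis Ck_on.simps(2))

lemma smooth_on_const [smooth_intros]: "smooth_on S (\<lambda>x. c)"
 by (simp add: Ck_on_const smooth_on_def)

lemma smooth_on_ident [smooth_intros]: "open S ==> smooth_on S (\<lambda>x. x)"
 by (simp add: Ck_on_ident smooth_on_def)

lemma smooth_on_linear_compose: "bounded_linear g ==> open S ==> smooth_on S f ==> smooth_on S (\<lambda>x. g (f x))"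
 by (simp add: Ck_on_linear_compose smooth_on_def)

lemma smooth_on_linear: "bounded_linear g ==> open S ==> smooth_on S g"
 by (simp add: Ck_on_linear smooth_on_def)

lemma smooth_on_bilinear:
 "bounded_bilinear p ==> open S ==> smooth_on S f ==> smooth_on S g ==> smooth_on S (\<lambda>x. p (f x) (g x))"
 by (simp add: Ck_on_bilinear smooth_on_def)

lemma smooth_on_add [smooth_intros]:
 "open S ==> smooth_on S f ==> smooth_on S g ==> smooth_on S (\<lambda>x. f x + g x)"
 by (simp add: Ck_on_add smooth_on_def)

lemma smooth_on_mult [smooth_intros]:
 fixes f :: "_ => 'b::real_normed_algebra"
 shows "open S ==> smooth_on S f ==> smooth_on S g ==> smooth_on S (\<lambda>x. f x * g x)"
 by (rule smooth_on_bilinear[OF bounded_bilinear_mult])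

lemma smooth_on_scaleR [smooth_intros]:
 "open S ==> smooth_on S f ==> smooth_on S g ==> smooth_on S (\<lambda>x. f x *\<^sub>R g x)"
 by (rule smooth_on_bilinear[OF bounded_bilinear_scaleR])

lemma smooth_on_inner [smooth_intros]:
 "open S ==> smooth_on S f ==> smooth_on S g ==> smooth_on S (\<lambda>x. f x \<bullet> g x)"
 by (rule smooth_on_bilinear[OF bounded_bilinear_inner])

lemma smooth_on_minus [smooth_intros]: "open S ==> smooth_on S f ==> smooth_on S (\<lambda>x. - f x)"
 by (rule smooth_on_linear_compose[OF bounded_linear_minus[OF bounded_linear_ident]])

lemma smooth_on_diff [smooth_intros]:
 "open S ==> smooth_on S f ==> smooth_on S g ==> smooth_on S (\<lambda>x. f x - g x)"
 using smooth_on_add[OF _ _ smooth_on_minus, of S f g] by simp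

lemma smooth_on_sum [smooth_intros]:
 "open S ==> (\<And>i. i \<in> I ==> smooth_on S (f i)) ==> smooth_on S (\<lambda>x. \<Sum>i\<in>I. f i x)"
 by (simp add: Ck_on_sum smooth_on_def)

lemma smooth_on_prod [smooth_intros]:
 fixes f :: "'i => 'a::real_normed_vector => 'b::real_normed_field"
 assumes "open S" "\<And>i. i \<in> I ==> smooth_on S (f i)"
 shows "smooth_on S (\<lambda>x. \<Prod>i\<in>I. f i x)"
 using assms(2)
 by (induction I rule: infinite_finite_induct) (auto intro!: smooth_intros assms(1))

lemma smooth_on_power [smooth_intros]:
 fixes f :: "'a::real_normed_vector => 'b::real_normed_field"
 assumes "open S" "smooth_on S f"
 shows "smooth_on S (\<lambda>x. f x ^ n)"
 by (induction n) (auto intro!: smooth_intros assms)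

lemma smooth_on_inverse:
 fixes f :: "'a::real_normed_vector => 'b::real_normed_field"
 shows "open S ==> smooth_on S f ==> (\<And>x. x \<in> S ==> f x \<noteq> 0) ==> smooth_on S (\<lambda>x. inverse (f x))"
 by (simp add: Ck_on_inverse smooth_on_def)

lemma smooth_on_divide:
 fixes f g :: "'a::real_normed_vector => 'b::real_normed_field"
 shows "open S ==> smooth_on S f ==> smooth_on S g ==> (\<And>x. x \<in> S ==> g x \<noteq> 0) ==> smooth_on S (\<lambda>x. f x / g x)"
 unfolding divide_inverse by (intro smooth_intros smooth_on_inverse)

lemma smooth_on_of_real [smooth_intros]: "open S ==> smooth_on S f ==> smooth_on S (\<lambda>x. complex_of_real (f x))"
 by (rule smooth_on_linear_compose[OF bounded_linear_of_real])

lemma smooth_on_cnj [smooth_intros]: "open S ==> smooth_on S f ==> smooth_on S (\<lambda>x. cnj (f x))"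
 by (rule smooth_on_linear_compose[OF bounded_linear_cnj])

lemma smooth_on_Re [smooth_intros]: "open S ==> smooth_on S f ==> smooth_on S (\<lambda>x. Re (f x))"
 by (rule smooth_on_linear_compose[OF bounded_linear_Re])

lemma smooth_on_Im [smooth_intros]: "open S ==> smooth_on S f ==> smooth_on S (\<lambda>x. Im (f x))"
 by (rule smooth_on_linear_compose[OF bounded_linear_Im])

lemma smooth_on_nth: "open S ==> smooth_on S f ==> smooth_on S (\<lambda>x. f x $ i)"
 by (rule smooth_on_linear_compose[OF bounded_linear_vec_nth])

lemma smooth_on_compose:
 fixes f :: "'a::real_normed_vector => 'b::euclidean_space"
 shows "open S ==> open T ==> smooth_on S f ==> smooth_on T g ==> f ` S \<subseteq> T ==> smooth_on S (\<lambda>x. g (f x))"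
 unfolding smooth_on_def using Ck_on_compose by blast

lemma smooth_on_coordinates:
 fixes f :: "'a::real_normed_vector => 'b::euclidean_space"
 assumes S: "open S" and "\<And>b. b \<in> Basis ==> smooth_on S (\<lambda>x. f x \<bullet> b)"
 shows "smooth_on S f"
 by (rule smooth_on_cong[OF S, of "\<lambda>x. \<Sum>b\<in>Basis. (f x \<bullet> b) *\<^sub>R b"])
   (intro smooth_intros assms, simp_all add: euclidean_representation)

lemma smooth_on_vec_lambda:
 fixes f :: "'i::finite => 'a::real_normed_vector => 'b::euclidean_space"
 assumes S: "open S" and f: "\<And>i. smooth_on S (f i)"
 shows "smooth_on S (\<lambda>x. \<chi> i. f i x)"
proof (rule smooth_on_coordinates[OF S])
 fix b :: "'b^'i" assume "b \<in> Basis"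
 then obtain i c where b: "b = axis i c" by (auto simp: Basis_vec_def)
 show "smooth_on S (\<lambda>x. (\<chi> i. f i x) \<bullet> b)"
  unfolding b by (auto simp: inner_axis intro!: smooth_intros S f)
qed

lemma smooth_on_Pair [smooth_intros]:
 fixes f :: "'a::real_normed_vector => 'b::euclidean_space" and g :: "'a => 'c::euclidean_space"
 assumes S: "open S" and fg: "smooth_on S f" "smooth_on S g"
 shows "smooth_on S (\<lambda>x. (f x, g x))"
proof (rule smooth_on_coordinates[OF S])
 fix b :: "'b \<times> 'c"
 have "smooth_on S (\<lambda>x. f x \<bullet> fst b + g x \<bullet> snd b)"
  by (intro smooth_intros S fg)
 then show "smooth_on S (\<lambda>x. (f x, g x) \<bullet> b)"
  by (simp add: inner_prod_def)
qed

lemma smooth_on_derivative_apply: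
 fixes f :: "'a::euclidean_space => 'b::real_normed_vector"
 assumes S: "open S" and T: "open T" and f: "smooth_on T f" and g: "smooth_on S g" "g ` S \<subseteq> T"
  and v: "smooth_on S v"
 shows "smooth_on S (\<lambda>x. fderiv f (g x) (v x))"
proof (rule smooth_on_cong[OF S])
 show "smooth_on S (\<lambda>x. \<Sum>b\<in>Basis. (v x \<bullet> b) *\<^sub>R fderiv f (g x) b)"
  by (intro smooth_intros S v smooth_on_compose[OF S T g(1) smooth_on_derivative[OF f] g(2)])
 fix x assume x: "x \<in> S"
 then have "linear (fderiv f (g x))"
  using smooth_on_has_derivative[OF f] g(2) has_derivative_linear by blast
 then have "fderiv f (g x) (\<Sum>b\<in>Basis. (v x \<bullet> b) *\<^sub>R b)
   = (\<Sum>b\<in>Basis. (v x \<bullet> b) *\<^sub>R fderiv f (g x) b)"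
  by (simp add: linear_sum linear_cmul)
 then show "(\<Sum>b\<in>Basis. (v x \<bullet> b) *\<^sub>R fderiv f (g x) b) = fderiv f (g x) (v x)"
  by (simp add: euclidean_representation)
qed

text \<open>The mean value theorem is used twice: for the first difference in direction \<open>v\<close>, as a function on the segment in direction
\<open>u\<close>, and then for the derivative in direction \<open>u\<close> on a segment in direction \<open>v\<close>.\<close>

lemma second_difference_mean_value:
 fixes f :: "'a::euclidean_space => real"
 assumes f: "Ck_on 2 (ball x e) f" and h: "h > 0" "h * (norm u + norm v) < e"
 shows "\<exists>y. norm (y - x) \<le> h * (norm u + norm v) \<and>
  f (x + h *\<^sub>R u + h *\<^sub>R v) - f (x + h *\<^sub>R u) - f (x + h *\<^sub>R v) + f x
   = h * h * fderiv (\<lambda>z. fderiv f z u) y v"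
proof -
 have f1: "Ck_on (Suc 0) (ball x e) (\<lambda>z. fderiv f z u)" and f0: "Ck_on (Suc 0) (ball x e) f"
  using f Ck_on_decSuc[of "Suc 0" "ball x e" f] by (auto simp: numeral_2_eq_2)
 have near: "norm (s *\<^sub>R u + t *\<^sub>R v) \<le> h * (norm u + norm v)" if "0 \<le> s" "s \<le> h" "0 \<le> t" "t \<le> h" for s t
 proof -
  have "norm (s *\<^sub>R u + t *\<^sub>R v) \<le> s * norm u + t * norm v"
   using norm_triangle_ineq[of "s *\<^sub>R u" "t *\<^sub>R v"] that by simp
  also have "\<dots> \<le> h * norm u + h * norm v"
   using that by (intro add_mono mult_right_mono) auto
  finally show ?thesis by (simp add: algebra_simps)
 qed
 have mem: "x + s *\<^sub>R u + t *\<^sub>R v \<in> ball x e" if "0 \<le> s" "s \<le> h" "0 \<le> t" "t \<le> h" for s t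
 proof -
  have "dist x (x + s *\<^sub>R u + t *\<^sub>R v) = norm (s *\<^sub>R u + t *\<^sub>R v)"
   by (simp add: dist_norm norm_minus_commute algebra_simps)
  then show ?thesis using near[OF that] h by simp
 qed
 let ?p = "\<lambda>s. f (x + s *\<^sub>R u + h *\<^sub>R v) - f (x + s *\<^sub>R u + 0 *\<^sub>R v)"
 have d: "((\<lambda>s. f (x + s *\<^sub>R u + t *\<^sub>R v)) has_derivative
   (\<lambda>r. r * fderiv f (x + s *\<^sub>R u + t *\<^sub>R v) u)) (at s)"
  if "0 \<le> s" "s \<le> h" "0 \<le> t" "t \<le> h" for s t
 proof -
  have D: "(f has_derivative fderiv f (x + s *\<^sub>R u + t *\<^sub>R v)) (at (x + s *\<^sub>R u + t *\<^sub>R v))"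
   by (rule Ck_on_SucE[OF f0 mem[OF that]])
  have "((\<lambda>s. x + s *\<^sub>R u + t *\<^sub>R v) has_derivative (\<lambda>r. r *\<^sub>R u)) (at s)"
   by (auto intro!: derivative_eq_intros)
  from diff_chain_at[OF this D] show ?thesis
   using has_derivative_linear[OF D] by (simp add: o_def linear_cmul)
 qed
 have "\<exists>s>0. s < h \<and> ?p h - ?p 0 = (h - 0) * (fderiv f (x + s *\<^sub>R u + h *\<^sub>R v) u
   - fderiv f (x + s *\<^sub>R u + 0 *\<^sub>R v) u)"
 proof (rule MVT2[OF h(1)])
  fix s assume s: "0 \<le> s" "s \<le> h"
  show "DERIV ?p s :> fderiv f (x + s *\<^sub>R u + h *\<^sub>R v) u
    - fderiv f (x + s *\<^sub>R u + 0 *\<^sub>R v) u"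
   unfolding has_field_derivative_def
   by (rule has_derivative_eq_rhs[OF has_derivative_diff[OF d[OF s, of h] d[OF s, of 0]]])
     (use h(1) in \<open>auto simp: fun_eq_iff algebra_simps\<close>)
 qed
 then obtain s where s: "0 < s" "s < h"
  and ps: "?p h - ?p 0 = h * (fderiv f (x + s *\<^sub>R u + h *\<^sub>R v) u
   - fderiv f (x + s *\<^sub>R u + 0 *\<^sub>R v) u)" by auto
 let ?q = "\<lambda>t. fderiv f (x + s *\<^sub>R u + t *\<^sub>R v) u"
 let ?D = "\<lambda>y. fderiv (\<lambda>z. fderiv f z u) y"
 have "\<exists>t>0. t < h \<and> ?q h - ?q 0 = (h - 0) * ?D (x + s *\<^sub>R u + t *\<^sub>R v) v"
 proof (rule MVT2[OF h(1)])
  fix t assume t: "0 \<le> t" "t \<le> h"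
  have D: "((\<lambda>z. fderiv f z u) has_derivative ?D (x + s *\<^sub>R u + t *\<^sub>R v)) (at (x + s *\<^sub>R u + t *\<^sub>R v))"
   by (rule Ck_on_SucE[OF f1 mem]) (use s t in auto)
  have "((\<lambda>t. x + s *\<^sub>R u + t *\<^sub>R v) has_derivative (\<lambda>r. r *\<^sub>R v)) (at t)"
   by (auto intro!: derivative_eq_intros)
  from diff_chain_at[OF this D] show "DERIV ?q t :> ?D (x + s *\<^sub>R u + t *\<^sub>R v) v"
   unfolding has_field_derivative_def o_def
   by (rule has_derivative_eq_rhs) (use has_derivative_linear[OF D] in \<open>auto simp: linear_cmul\<close>)
 qed
 then obtain t where t: "0 < t" "t < h" and qt: "?q h - ?q 0 = h * ?D (x + s *\<^sub>R u + t *\<^sub>R v) v" by auto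
 show ?thesis
 proof (intro exI[of _ "x + s *\<^sub>R u + t *\<^sub>R v"] conjI)
  show "norm (x + s *\<^sub>R u + t *\<^sub>R v - x) \<le> h * (norm u + norm v)"
   using near[of s t] s t by (simp add: algebra_simps)
  show "f (x + h *\<^sub>R u + h *\<^sub>R v) - f (x + h *\<^sub>R u) - f (x + h *\<^sub>R v) + f x
   = h * h * ?D (x + s *\<^sub>R u + t *\<^sub>R v) v"
   using ps qt by simp
 qed
qed

text \<open>Both orders of differentiation are limits of the same symmetric second difference.\<close>

lemma second_derivative_symmetric_real:
 fixes f :: "'a::euclidean_space => real"
 assumes S: "open S" "x \<in> S" and f: "smooth_on S f"
 shows "fderiv (\<lambda>z. fderiv f z u) x v
    = fderiv (\<lambda>z. fderiv f z v) x u"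
proof (rule ccontr)
 let ?D = "\<lambda>u v y. fderiv (\<lambda>z. fderiv f z u) y v"
 assume ne: "?D u v x \<noteq> ?D v u x"
 define r where "r = \<bar>?D u v x - ?D v u x\<bar> / 2"
 have r: "r > 0" using ne by (simp add: r_def)
 obtain e where e: "e > 0" "ball x e \<subseteq> S" using S openE by blast
 have cont: "isCont (?D u v) x" for u v
  using smooth_on_continuous[OF smooth_on_derivative[OF smooth_on_derivative[OF f]]] S
  by (simp add: continuous_on_eq_continuous_at)
 obtain d1 where d1: "d1 > 0" "\<And>y. dist y x < d1 ==> \<bar>?D u v y - ?D u v x\<bar> < r"
  using cont[of u v] r unfolding continuous_at_eps_delta dist_real_def by blast
 obtain d2 where d2: "d2 > 0" "\<And>y. dist y x < d2 ==> \<bar>?D v u y - ?D v u x\<bar> < r"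
  using cont[of v u] r unfolding continuous_at_eps_delta dist_real_def by blast
 define m where "m = min e (min d1 d2)"
 define h where "h = m / (norm u + norm v + 1)"
 have m: "m > 0" using e d1 d2 by (simp add: m_def)
 have h: "h > 0" using m by (simp add: h_def add_nonneg_pos)
 have hm: "h * (norm u + norm v) < m"
 proof -
  have "h * (norm u + norm v) < h * (norm u + norm v + 1)" using h by simp
  also have "\<dots> = m" by (simp add: h_def add_nonneg_eq_0_iff)
  finally show ?thesis .
 qed
 have C2: "Ck_on 2 (ball x e) f" using smooth_on_subset[OF f e(2)] by (simp add: smooth_on_def)
 obtain y1 where y1: "norm (y1 - x) \<le> h * (norm u + norm v)"
  "f (x + h *\<^sub>R u + h *\<^sub>R v) - f (x + h *\<^sub>R u) - f (x + h *\<^sub>R v) + f x = h * h * ?D u v y1"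
  using second_difference_mean_value[OF C2 h, of u v] hm by (auto simp: m_def)
 obtain y2 where y2: "norm (y2 - x) \<le> h * (norm v + norm u)"
  "f (x + h *\<^sub>R v + h *\<^sub>R u) - f (x + h *\<^sub>R v) - f (x + h *\<^sub>R u) + f x = h * h * ?D v u y2"
  using second_difference_mean_value[OF C2 h, of v u] hm by (auto simp: m_def add.commute)
 have "h * h * ?D u v y1 = h * h * ?D v u y2" using y1(2) y2(2) by (simp add: algebra_simps)
 then have eq: "?D u v y1 = ?D v u y2" using h by simp
 have "\<bar>?D u v y1 - ?D u v x\<bar> < r" "\<bar>?D v u y2 - ?D v u x\<bar> < r"
  using y1(1) y2(1) hm by (auto intro!: d1 d2 simp: dist_norm m_def add.commute)
 then show False using eq by (simp add: r_def abs_if split: if_splits)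
qed

lemma frechet_derivative_inner:
 assumes "smooth_on S f" "z \<in> S"
 shows "fderiv (\<lambda>z. f z \<bullet> b) z u = fderiv f z u \<bullet> b"
 using frechet_derivative_eqI[OF bounded_linear.has_derivative[OF bounded_linear_inner_left smooth_on_has_derivative[OF assms]]]
 by simp

lemma frechet_derivative_cong_open:
 assumes "open S" "x \<in> S" "\<And>y. y \<in> S ==> f y = g y"
 shows "fderiv f x = fderiv g x"
proof -
 have "(f has_derivative D) (at x) \<longleftrightarrow> (g has_derivative D) (at x)" for D
  using has_derivative_transform_within_open[OF _ assms(1,2)] assms(3) by metis
 then show ?thesis by (simp add: frechet_derivative_def)
qed

lemma second_derivative_symmetric:
 fixes f :: "'a::euclidean_space => 'b::euclidean_space"
 assumes S: "open S" "x \<in> S" and f: "smooth_on S f"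
 shows "fderiv (\<lambda>z. fderiv f z u) x v
    = fderiv (\<lambda>z. fderiv f z v) x u"
proof (rule euclidean_eqI)
 fix b :: 'b
 have sm: "smooth_on S (\<lambda>z. f z \<bullet> b)" by (intro smooth_intros S f)
 have e: "fderiv (\<lambda>z. fderiv (\<lambda>z. f z \<bullet> b) z u) x
   = fderiv (\<lambda>z. fderiv f z u \<bullet> b) x" for u
  by (rule frechet_derivative_cong_open[OF S]) (rule frechet_derivative_inner[OF f])
 show "fderiv (\<lambda>z. fderiv f z u) x v \<bullet> b
    = fderiv (\<lambda>z. fderiv f z v) x u \<bullet> b"
  using second_derivative_symmetric_real[OF S sm, of u v]
  unfolding e frechet_derivative_inner[OF smooth_on_derivative[OF f] S(2)] .
qed

subsection \<open>Implicitly defined smooth maps\<close>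

text \<open>At a zero of \<open>g\<close> the product rule needs only continuity of the other factor.\<close>

lemma has_derivative_scaleR_vanishing:
 fixes f :: "'a::real_normed_vector => real"
 assumes f: "isCont f x" and g: "(g has_derivative g') (at x)" and g0: "g x = 0"
 shows "((\<lambda>y. f y *\<^sub>R g y) has_derivative (\<lambda>v. f x *\<^sub>R g' v)) (at x)"
proof -
 have bl: "bounded_linear g'" and lim: "((\<lambda>y. (g y - g x - g' (y - x)) /\<^sub>R norm (y - x)) \<longlongrightarrow> 0) (at x)"
  using g unfolding has_derivative_at_within by auto
 obtain K where K: "\<And>v. norm (g' v) \<le> norm v * K" using bounded_linear.bounded[OF bl] by auto
 have f0: "((\<lambda>y. f y - f x) \<longlongrightarrow> 0) (at x)" using f by (simp add: isCont_def LIM_zero_iff)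
 let ?e = "\<lambda>y. (g y - g x - g' (y - x)) /\<^sub>R norm (y - x)"
 let ?q = "\<lambda>y. (f y - f x) *\<^sub>R (g' (y - x) /\<^sub>R norm (y - x))"
 have q: "(?q \<longlongrightarrow> 0) (at x)"
 proof (rule Lim_null_comparison)
  show "\<forall>\<^sub>F y in at x. norm (?q y) \<le> \<bar>f y - f x\<bar> * \<bar>K\<bar>"
  proof (rule eventually_mono[OF eventually_at_filter[THEN iffD2]])
   show "\<forall>\<^sub>F y in nhds x. y \<noteq> x \<longrightarrow> y \<in> UNIV \<longrightarrow> y \<noteq> x" by simp
   fix y assume "y \<noteq> x"
   then have "norm (g' (y - x) /\<^sub>R norm (y - x)) \<le> K"
    using K[of "y - x"] by (simp add: divide_simps mult.commute)
   then show "norm (?q y) \<le> \<bar>f y - f x\<bar> * \<bar>K\<bar>"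
    unfolding norm_scaleR[of "f y - f x"] by (intro mult_left_mono) auto
  qed
  show "((\<lambda>y. \<bar>f y - f x\<bar> * \<bar>K\<bar>) \<longlongrightarrow> 0) (at x)"
   using tendsto_mult[OF tendsto_rabs_zero[OF f0] tendsto_const] by simp
 qed
 have "((\<lambda>y. f y *\<^sub>R ?e y + ?q y) \<longlongrightarrow> f x *\<^sub>R 0 + 0) (at x)"
  using f by (intro tendsto_add tendsto_scaleR lim q) (simp add: isCont_def)
 moreover have "f y *\<^sub>R ?e y + ?q y = (f y *\<^sub>R g y - f x *\<^sub>R g x - f x *\<^sub>R g' (y - x)) /\<^sub>R norm (y - x)" for y
 proof -
  have "f y *\<^sub>R ?e y + ?q y = (f y *\<^sub>R (g y - g x - g' (y - x)) + (f y - f x) *\<^sub>R g' (y - x)) /\<^sub>R norm (y - x)"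
   by (simp only: scaleR_add_right scaleR_left_commute)
  also have "f y *\<^sub>R (g y - g x - g' (y - x)) + (f y - f x) *\<^sub>R g' (y - x) = f y *\<^sub>R g y - f x *\<^sub>R g x - f x *\<^sub>R g' (y - x)"
   by (simp add: algebra_simps g0)
  finally show ?thesis .
 qed
 ultimately show ?thesis
  unfolding has_derivative_at_within
  using bounded_linear_compose[OF bounded_linear_scaleR_right bl] by simp
qed

text \<open>A linear left inverse \<open>P\<close> of \<open>A x0\<close> turns the system into \<open>w x = w x0 + P (b x - b x0 - (A x - A x0) (w x))\<close>.
Near \<open>x0\<close> the coefficient \<open>A x - A x0\<close> is small, which bounds \<open>w\<close> and makes it continuous; since it vanishes at
\<open>x0\<close>, continuity of \<open>w\<close> is enough to differentiate the product.\<close>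

lemma linear_solve_derivative:
 fixes A :: "'x::real_normed_vector => 'a::euclidean_space => 'b::euclidean_space"
 assumes S: "open S" and A: "\<And>x. x \<in> S ==> linear (A x)" "\<And>x. x \<in> S ==> inj (A x)"
  and sol: "\<And>x. x \<in> S ==> A x (w x) = b x"
 shows linear_solve_continuous: "(\<And>a. continuous_on S (\<lambda>x. A x a)) ==> continuous_on S b ==> continuous_on S w"
  and linear_solve_differentiable: "(\<And>a. Ck_on (Suc 0) S (\<lambda>x. A x a)) ==> Ck_on (Suc 0) S b ==> x \<in> S ==>
   w differentiable (at x)"
proof -
 have expand: "A x a = (\<Sum>i\<in>Basis. (a \<bullet> i) *\<^sub>R A x i)" if "x \<in> S" for x a
 proof -
  have "A x (\<Sum>i\<in>Basis. (a \<bullet> i) *\<^sub>R i) = (\<Sum>i\<in>Basis. (a \<bullet> i) *\<^sub>R A x i)"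
   using A(1)[OF that] by (simp add: linear_sum linear_cmul)
  then show ?thesis by (simp add: euclidean_representation)
 qed
 have rep: "\<exists>P. bounded_linear P \<and> (\<forall>x\<in>S. w x = w x0 + P (b x - b x0 - (\<Sum>i\<in>Basis. (w x \<bullet> i) *\<^sub>R (A x i - A x0 i))))"
  if x0: "x0 \<in> S" for x0
 proof -
  obtain P where P: "linear P" "P \<circ> A x0 = id"
   using linear_injective_left_inverse[OF A(1,2)[OF x0]] by auto
  have "w x = w x0 + P (b x - b x0 - (\<Sum>i\<in>Basis. (w x \<bullet> i) *\<^sub>R (A x i - A x0 i)))" if x: "x \<in> S" for x
  proof -
   have "b x - b x0 - (\<Sum>i\<in>Basis. (w x \<bullet> i) *\<^sub>R (A x i - A x0 i)) = A x0 (w x) - A x0 (w x0)"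
    using sol[OF x] sol[OF x0] expand[OF x, of "w x"] expand[OF x0, of "w x"]
    by (simp add: sum_subtractf scaleR_diff_right)
   also have "\<dots> = A x0 (w x - w x0)" using A(1)[OF x0] by (simp add: linear_diff)
   finally show ?thesis using P(2) by (simp add: fun_eq_iff)
  qed
  then show ?thesis using P(1) linear_conv_bounded_linear by blast
 qed
 have cont: "isCont w x0" if cA: "\<And>a. continuous_on S (\<lambda>x. A x a)" and cb: "continuous_on S b" and x0: "x0 \<in> S" for x0
 proof -
  obtain P where P: "bounded_linear P"
   and wP: "\<And>x. x \<in> S ==> w x = w x0 + P (b x - b x0 - (\<Sum>i\<in>Basis. (w x \<bullet> i) *\<^sub>R (A x i - A x0 i)))"
   using rep[OF x0] by blast
  obtain K where K: "K > 0" "\<And>v. norm (P v) \<le> norm v * K" using bounded_linear.pos_bounded[OF P] by blast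
  define N where "N x = (\<Sum>i\<in>Basis. norm (A x i - A x0 i))" for x
  have N0: "(N \<longlongrightarrow> 0) (at x0)"
  proof -
   have "((\<lambda>x. norm (A x i - A x0 i)) \<longlongrightarrow> 0) (at x0)" for i
    using cA[of i] S x0 by (simp add: tendsto_norm_zero_iff LIM_zero_iff continuous_on_eq_continuous_at isCont_def)
   then have "(N \<longlongrightarrow> (\<Sum>i\<in>(Basis::'a set). 0)) (at x0)" unfolding N_def by (intro tendsto_sum) auto
   then show ?thesis by simp
  qed
  have b0: "((\<lambda>x. norm (b x - b x0)) \<longlongrightarrow> 0) (at x0)"
   using cb S x0 by (simp add: tendsto_norm_zero_iff LIM_zero_iff continuous_on_eq_continuous_at isCont_def)
  have "((\<lambda>x. w x - w x0) \<longlongrightarrow> 0) (at x0)"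
  proof (rule Lim_null_comparison)
   show "((\<lambda>x. 2 * K * (norm (b x - b x0) + N x * norm (w x0))) \<longlongrightarrow> 0) (at x0)"
    using tendsto_mult[OF tendsto_const[of "2 * K"] tendsto_add[OF b0 tendsto_mult[OF N0 tendsto_const[of "norm (w x0)"]]]]
    by simp
   have e1: "\<forall>\<^sub>F x in at x0. N x < 1 / (2 * K)" using order_tendstoD(2)[OF N0] K(1) by simp
   have e2: "\<forall>\<^sub>F x in at x0. x \<in> S" using S x0 by (simp add: eventually_at_in_open')
   show "\<forall>\<^sub>F x in at x0. norm (w x - w x0) \<le> 2 * K * (norm (b x - b x0) + N x * norm (w x0))"
    using e1 e2
   proof eventually_elim
    case (elim x)
    let ?d = "norm (w x - w x0)"
    have "norm (\<Sum>i\<in>Basis. (w x \<bullet> i) *\<^sub>R (A x i - A x0 i)) \<le> (\<Sum>i\<in>Basis. norm (w x) * norm (A x i - A x0 i))"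
     by (rule sum_norm_le) (auto intro!: mult_right_mono simp: Basis_le_norm)
    also have "\<dots> = norm (w x) * N x" by (simp add: N_def sum_distrib_left)
    finally have s: "norm (\<Sum>i\<in>Basis. (w x \<bullet> i) *\<^sub>R (A x i - A x0 i)) \<le> norm (w x) * N x" .
    have N: "N x \<ge> 0" by (simp add: N_def sum_nonneg)
    have "norm (w x) \<le> ?d + norm (w x0)" by norm
    then have "norm (w x) * N x \<le> ?d * N x + norm (w x0) * N x"
     using mult_right_mono[OF _ N] by (metis distrib_right)
    then have "norm (b x - b x0 - (\<Sum>i\<in>Basis. (w x \<bullet> i) *\<^sub>R (A x i - A x0 i)))
      \<le> norm (b x - b x0) + (?d * N x + norm (w x0) * N x)"
     using s norm_triangle_ineq4[of "b x - b x0" "\<Sum>i\<in>Basis. (w x \<bullet> i) *\<^sub>R (A x i - A x0 i)"] by linarith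
    moreover have "?d \<le> norm (b x - b x0 - (\<Sum>i\<in>Basis. (w x \<bullet> i) *\<^sub>R (A x i - A x0 i))) * K"
    proof -
     have "w x - w x0 = P (b x - b x0 - (\<Sum>i\<in>Basis. (w x \<bullet> i) *\<^sub>R (A x i - A x0 i)))"
      by (subst wP[OF elim(2)]) simp
     then show ?thesis using K(2) by presburger
    qed
    ultimately have "?d \<le> (norm (b x - b x0) + (?d * N x + norm (w x0) * N x)) * K"
     using K(1) by (meson mult_right_mono less_imp_le order_trans)
    moreover have "?d * N x * K \<le> ?d * (1 / (2 * K)) * K"
     using elim(1) K(1) by (intro mult_right_mono mult_left_mono) auto
    ultimately show ?case using K(1) by (simp add: algebra_simps)
   qed
  qed
  then show ?thesis by (simp add: isCont_def LIM_zero_iff)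
 qed
 then show "continuous_on S w" if "\<And>a. continuous_on S (\<lambda>x. A x a)" "continuous_on S b"
  using that by (simp add: continuous_at_imp_continuous_on)
 show "w differentiable (at x)" if CA: "\<And>a. Ck_on (Suc 0) S (\<lambda>x. A x a)" and Cb: "Ck_on (Suc 0) S b" and x: "x \<in> S"
 proof -
  obtain P where P: "bounded_linear P"
   and wP: "\<And>y. y \<in> S ==> w y = w x + P (b y - b x - (\<Sum>i\<in>Basis. (w y \<bullet> i) *\<^sub>R (A y i - A x i)))"
   using rep[OF x] by blast
  have wc: "isCont w x" using cont[OF _ _ x] Ck_on_continuous_on[OF CA] Ck_on_continuous_on[OF Cb] by blast
  have t: "((\<lambda>y. (w y \<bullet> i) *\<^sub>R (A y i - A x i)) has_derivative (\<lambda>v. (w x \<bullet> i) *\<^sub>R fderiv (\<lambda>y. A y i) x v)) (at x)" for i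
  proof (rule has_derivative_scaleR_vanishing)
   show "isCont (\<lambda>y. w y \<bullet> i) x" using wc by (intro continuous_intros)
   show "((\<lambda>y. A y i - A x i) has_derivative fderiv (\<lambda>y. A y i) x) (at x)"
    using has_derivative_diff[OF Ck_on_SucE[OF CA x] has_derivative_const] by simp
  qed simp
  have "((\<lambda>y. w x + P (b y - b x - (\<Sum>i\<in>Basis. (w y \<bullet> i) *\<^sub>R (A y i - A x i)))) has_derivative
   (\<lambda>v. 0 + P (fderiv b x v - 0 - (\<Sum>i\<in>Basis. (w x \<bullet> i) *\<^sub>R fderiv (\<lambda>y. A y i) x v)))) (at x)"
   by (intro has_derivative_add has_derivative_const bounded_linear.has_derivative[OF P] has_derivative_diff
     Ck_on_SucE[OF Cb x] has_derivative_sum t)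
  then have "(w has_derivative
   (\<lambda>v. 0 + P (fderiv b x v - 0 - (\<Sum>i\<in>Basis. (w x \<bullet> i) *\<^sub>R fderiv (\<lambda>y. A y i) x v)))) (at x)"
   by (rule has_derivative_transform_within_open[OF _ S x]) (use wP in auto)
  then show ?thesis by (auto simp: differentiable_def)
 qed
qed

text \<open>The solution of a linear system depends smoothly on its coefficients.  This replaces Cramer's
 rule; the derivative of the solution solves a system with the same matrix.\<close>

lemma Ck_on_linear_solve:
 fixes A :: "'x::real_normed_vector => 'a::euclidean_space => 'b::euclidean_space"
 assumes S: "open S" and A: "\<And>x. x \<in> S ==> linear (A x)" "\<And>x. x \<in> S ==> inj (A x)"
  and "\<And>x. x \<in> S ==> A x (w x) = b x"
  and "\<And>a. Ck_on k S (\<lambda>x. A x a)" "Ck_on k S b"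
 shows "Ck_on k S w"
 using assms(4-6)
proof (induction k arbitrary: b w)
 case 0
 then show ?case using linear_solve_continuous[OF S A] by simp
next
 case (Suc k)
 have CA: "Ck_on k S (\<lambda>x. A x a)" for a using Suc.prems(2) Ck_on_decSuc by blast
 have wk: "Ck_on k S w" by (rule Suc.IH[OF Suc.prems(1) CA Ck_on_decSuc[OF Suc.prems(3)]])
 have lo: "Ck_on (Suc 0) S f" if "Ck_on (Suc k) S f" for f :: "'x => 'b"
  using that Ck_on_continuous_on by fastforce
 have wd: "w differentiable (at x)" if "x \<in> S" for x
  by (rule linear_solve_differentiable[OF S A Suc.prems(1) lo[OF Suc.prems(2)] lo[OF Suc.prems(3)] that])
 let ?R = "\<lambda>v x. fderiv b x v - (\<Sum>i\<in>Basis. (w x \<bullet> i) *\<^sub>R fderiv (\<lambda>y. A y i) x v)"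
 have "Ck_on k S (\<lambda>x. fderiv w x v)" for v
 proof (rule Suc.IH)
  fix x assume x: "x \<in> S"
  have expand: "A y a = (\<Sum>i\<in>Basis. (a \<bullet> i) *\<^sub>R A y i)" if "y \<in> S" for y a
  proof -
   have "A y (\<Sum>i\<in>Basis. (a \<bullet> i) *\<^sub>R i) = (\<Sum>i\<in>Basis. (a \<bullet> i) *\<^sub>R A y i)"
    using A(1)[OF that] by (simp add: linear_sum linear_cmul)
   then show ?thesis by (simp add: euclidean_representation)
  qed
  have w: "(w has_derivative fderiv w x) (at x)" using wd[OF x] frechet_derivative_works by blast
  have "((\<lambda>y. \<Sum>i\<in>Basis. (w y \<bullet> i) *\<^sub>R A y i) has_derivative
    (\<lambda>v. \<Sum>i\<in>Basis. (w x \<bullet> i) *\<^sub>R fderiv (\<lambda>y. A y i) x v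
     + (fderiv w x v \<bullet> i) *\<^sub>R A x i)) (at x)"
   by (intro has_derivative_sum bounded_bilinear.FDERIV[OF bounded_bilinear_scaleR]
     bounded_linear.has_derivative[OF bounded_linear_inner_left w] Ck_on_SucE[OF Suc.prems(2) x])
  then have "(b has_derivative
    (\<lambda>v. \<Sum>i\<in>Basis. (w x \<bullet> i) *\<^sub>R fderiv (\<lambda>y. A y i) x v
     + (fderiv w x v \<bullet> i) *\<^sub>R A x i)) (at x)"
   by (rule has_derivative_transform_within_open[OF _ S x]) (use expand Suc.prems(1) in auto)
  then have "fderiv b x v = (\<Sum>i\<in>Basis. (w x \<bullet> i) *\<^sub>R fderiv (\<lambda>y. A y i) x v
     + (fderiv w x v \<bullet> i) *\<^sub>R A x i)"
   by (simp add: frechet_derivative_eqI)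
  then show "A x (fderiv w x v) = ?R v x"
   using expand[OF x, of "fderiv w x v"] by (simp add: sum.distrib)
 next
  have "Ck_on k S (\<lambda>x. - 1 *\<^sub>R (\<Sum>i\<in>Basis. (w x \<bullet> i) *\<^sub>R fderiv (\<lambda>y. A y i) x v))"
   by (intro Ck_on_bilinear[OF bounded_bilinear_scaleR S] Ck_on_sum[OF S] Ck_on_const
     Ck_on_linear_compose[OF bounded_linear_inner_left S wk]) (use Suc.prems in auto)
  moreover have "Ck_on k S (\<lambda>x. fderiv b x v)" using Suc.prems by auto
  ultimately have "Ck_on k S (\<lambda>x. fderiv b x v
    + - 1 *\<^sub>R (\<Sum>i\<in>Basis. (w x \<bullet> i) *\<^sub>R fderiv (\<lambda>y. A y i) x v))"
   using Ck_on_add[OF S] by blast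
  then show "Ck_on k S (?R v)" by simp
 qed (use CA in blast)
 then show ?case using wd by simp
qed

lemma smooth_on_linear_solve:
 fixes A :: "'x::real_normed_vector => 'a::euclidean_space => 'b::euclidean_space"
 assumes "open S" "\<And>x. x \<in> S ==> linear (A x)" "\<And>x. x \<in> S ==> inj (A x)"
  "\<And>x. x \<in> S ==> A x (w x) = b x" "\<And>a. smooth_on S (\<lambda>x. A x a)" "smooth_on S b"
 shows "smooth_on S w"
 unfolding smooth_on_def
proof
 show "Ck_on k S w" for k
  by (rule Ck_on_linear_solve[where A = A and b = b, OF assms(1)])
    (use assms(2-6) in \<open>auto simp: smooth_on_def\<close>)
qed

text \<open>A linear left inverse \<open>P\<close> of \<open>F'\<close> straightens the equation to \<open>P (F (\<tau> y)) = P (G y)\<close>, whose left side has derivative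
the identity at \<open>\<tau> x\<close>.  Continuity of \<open>\<tau>\<close> then bounds \<open>\<tau> y - \<tau> x\<close> by a multiple of \<open>y - x\<close>, and with this
bound the expansions of \<open>F\<close> and \<open>G\<close> to first order give the derivative of \<open>\<tau>\<close>.\<close>

lemma implicit_derivative:
 fixes F :: "'a::euclidean_space => 'b::euclidean_space"
 assumes F: "(F has_derivative F') (at (\<tau> x))" "inj F'" and S: "open S" "x \<in> S"
  and eq: "\<And>y. y \<in> S ==> F (\<tau> y) = G y" and G: "(G has_derivative G') (at x)" and c: "isCont \<tau> x"
 shows "\<exists>T. (\<tau> has_derivative T) (at x) \<and> F' \<circ> T = G'"
proof -
 have linF: "linear F'" using F(1) by (rule has_derivative_linear)
 obtain P where P: "linear P" "P \<circ> F' = id" using linear_injective_left_inverse[OF linF F(2)] by auto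
 have bP: "bounded_linear P" using P(1) linear_conv_bounded_linear by blast
 have PF: "((\<lambda>y. P (F y)) has_derivative (\<lambda>v. v)) (at (\<tau> x))"
  using bounded_linear.has_derivative[OF bP F(1)] P(2) by (simp add: fun_eq_iff o_def)
 have PG: "((\<lambda>y. P (G y)) has_derivative (\<lambda>v. P (G' v))) (at x)"
  by (rule bounded_linear.has_derivative[OF bP G])
 then have bPG: "bounded_linear (\<lambda>v. P (G' v))" by (rule has_derivative_bounded_linear)
 then obtain K where K: "K > 0" "\<And>v. norm (P (G' v)) \<le> norm v * K" using bounded_linear.pos_bounded by blast
 have "(\<tau> has_derivative (\<lambda>v. P (G' v))) (at x)"
  unfolding has_derivative_at_alt
 proof (intro conjI allI impI bPG)
  fix e :: real assume e: "e > 0"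
  define r where "r = min (1/2) (e / (4 * (K + 1)))"
  have r: "r > 0" "r \<le> 1/2" "r * (2 * (K + 1)) \<le> e / 2"
  proof -
   show "r > 0" using e K by (simp add: r_def)
   show "r \<le> 1/2" unfolding r_def by (rule min.cobounded1)
   have "r * (2 * (K + 1)) \<le> e / (4 * (K + 1)) * (2 * (K + 1))"
    using K unfolding r_def by (intro mult_right_mono min.cobounded2) auto
   also have "\<dots> = e / 2"
    using nonzero_divide_eq_eq[of "4 * (K + 1)" e] K by (simp add: divide_simps add_nonneg_eq_0_iff)
   finally show "r * (2 * (K + 1)) \<le> e / 2" .
  qed
  obtain d1 where d1: "d1 > 0" "\<And>y. norm (y - \<tau> x) < d1 ==> norm (P (F y) - P (F (\<tau> x)) - (y - \<tau> x)) \<le> r * norm (y - \<tau> x)"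
   using PF r(1) unfolding has_derivative_at_alt by blast
  obtain d2 where d2: "d2 > 0" "\<And>y. norm (y - x) < d2 ==> norm (\<tau> y - \<tau> x) < d1"
   using c d1(1) unfolding continuous_at_eps_delta dist_norm by blast
  have "min 1 (e/2) > 0" using e by simp
  then obtain d3 where d3: "d3 > 0" "\<And>y. norm (y - x) < d3 ==> norm (P (G y) - P (G x) - P (G' (y - x))) \<le> min 1 (e/2) * norm (y - x)"
   using PG unfolding has_derivative_at_alt by blast
  obtain d4 where d4: "d4 > 0" "ball x d4 \<subseteq> S" using S openE by blast
  show "\<exists>d>0. \<forall>y. norm (y - x) < d \<longrightarrow> norm (\<tau> y - \<tau> x - P (G' (y - x))) \<le> e * norm (y - x)"
  proof (intro exI[of _ "min d2 (min d3 d4)"] conjI allI impI)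
   show "min d2 (min d3 d4) > 0" using d2 d3 d4 by simp
   fix y assume y: "norm (y - x) < min d2 (min d3 d4)"
   have yS: "y \<in> S" using d4 y by (auto simp: dist_norm norm_minus_commute)
   let ?t = "\<tau> y - \<tau> x" and ?g = "P (G y) - P (G x)"
   have a: "norm (?g - ?t) \<le> r * norm ?t"
    using d1(2)[OF d2(2), of y] y eq[OF yS] eq[OF S(2)] by auto
   have b: "norm (?g - P (G' (y - x))) \<le> min 1 (e/2) * norm (y - x)" using d3(2) y by auto
   have b1: "min 1 (e/2) * norm (y - x) \<le> 1 * norm (y - x)" "min 1 (e/2) * norm (y - x) \<le> e/2 * norm (y - x)"
    by (intro mult_right_mono; simp)+
   have gK: "norm ?g \<le> (K + 1) * norm (y - x)"
    using b b1 K(2)[of "y - x"] norm_triangle_ineq2[of ?g "P (G' (y - x))"] by (simp add: algebra_simps)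
   have "r * norm ?t \<le> 1/2 * norm ?t" using r by (intro mult_right_mono) auto
   then have "norm ?t \<le> 2 * norm ?g"
    using a norm_triangle_ineq2[of ?t ?g] by (simp add: norm_minus_commute)
   then have "r * norm ?t \<le> r * (2 * ((K + 1) * norm (y - x)))"
    using gK r(1) by (intro mult_left_mono) auto
   also have "\<dots> \<le> e/2 * norm (y - x)"
    using mult_right_mono[OF r(3) norm_ge_zero[of "y - x"]] by (simp add: algebra_simps)
   finally have "norm (?g - ?t) \<le> e/2 * norm (y - x)" using a by simp
   then have "norm (?t - P (G' (y - x))) \<le> e/2 * norm (y - x) + e/2 * norm (y - x)"
    using b b1 norm_triangle_ineq[of "?t - ?g" "?g - P (G' (y - x))"] by (simp add: norm_minus_commute)
   then show "norm (?t - P (G' (y - x))) \<le> e * norm (y - x)" by simp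
  qed
 qed
 moreover
 have "((\<lambda>y. F (\<tau> y)) has_derivative F' \<circ> (\<lambda>v. P (G' v))) (at x)"
  using diff_chain_at[OF calculation F(1)] by (simp add: o_def)
 then have "(G has_derivative F' \<circ> (\<lambda>v. P (G' v))) (at x)"
  by (rule has_derivative_transform_within_open[OF _ S]) (use eq in auto)
 then have "F' \<circ> (\<lambda>v. P (G' v)) = G'" using G has_derivative_unique by blast
 ultimately show ?thesis by blast
qed

text \<open>The smooth inverse function theorem in the form needed for charts: a continuous map into the
 source of an immersion is smooth as soon as its composition with the immersion is.\<close>

lemma smooth_on_implicit:
 fixes F :: "'a::euclidean_space => 'b::euclidean_space" and \<tau> :: "'x::euclidean_space => 'a"
 assumes S: "open S" and T: "open T" and F: "smooth_on T F" and G: "smooth_on S G"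
  and \<tau>: "continuous_on S \<tau>" "\<tau> ` S \<subseteq> T" and eq: "\<And>x. x \<in> S ==> F (\<tau> x) = G x"
  and inj: "\<And>x. x \<in> S ==> inj (fderiv F (\<tau> x))"
 shows "smooth_on S \<tau>"
proof -
 have D: "\<exists>D. (\<tau> has_derivative D) (at x) \<and> fderiv F (\<tau> x) \<circ> D = fderiv G x" if x: "x \<in> S" for x
  by (rule implicit_derivative[OF _ inj[OF x] S x eq smooth_on_has_derivative[OF G x]])
    (use \<tau> S x in \<open>auto simp: continuous_on_eq_continuous_at intro!: smooth_on_has_derivative[OF F]\<close>)
 have d: "(\<tau> has_derivative fderiv \<tau> x) (at x)"
  and De: "fderiv F (\<tau> x) (fderiv \<tau> x v) = fderiv G x v" if x: "x \<in> S" for x v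
 proof -
  obtain E where E: "(\<tau> has_derivative E) (at x)" "fderiv F (\<tau> x) \<circ> E = fderiv G x"
   using D[OF x] by blast
  show "(\<tau> has_derivative fderiv \<tau> x) (at x)"
   using E(1) frechet_derivative_works differentiableI by blast
  show "fderiv F (\<tau> x) (fderiv \<tau> x v) = fderiv G x v"
   unfolding frechet_derivative_eqI[OF E(1)] using fun_cong[OF E(2), of v] by simp
 qed
 have "Ck_on k S \<tau>" for k
 proof (induction k)
  case 0
  then show ?case using \<tau> by simp
 next
  case (Suc k)
  show ?case
  proof (rule Ck_on_SucI[OF S d])
   fix v
   show "Ck_on k S (\<lambda>x. fderiv \<tau> x v)"
   proof (rule Ck_on_linear_solve[OF S _ inj De])
    show "linear (fderiv F (\<tau> x))" if "x \<in> S" for x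
     using smooth_on_has_derivative[OF F] \<tau>(2) that has_derivative_linear by blast
    show "Ck_on k S (\<lambda>x. fderiv F (\<tau> x) a)" for a
     by (rule Ck_on_compose[OF S T Suc.IH _ \<tau>(2)]) (use smooth_on_derivative[OF F] smooth_on_def in blast)
    show "Ck_on k S (\<lambda>x. fderiv G x v)"
     using smooth_on_derivative[OF G] by (simp add: smooth_on_def)
   qed
  qed
 qed
 then show ?thesis by (simp add: smooth_on_def)
qed

subsection \<open>Integrals depending on a parameter\<close>

lemma norm_integral_le:
 fixes f :: "'t => 'b::{banach, second_countable_topology}"
 assumes "integrable M g" "\<And>t. t \<in> space M ==> norm (f t) \<le> g t"
 shows "norm (\<integral>t. f t \<partial>M) \<le> (\<integral>t. g t \<partial>M)"
proof (cases "integrable M f")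
 case True
 then show ?thesis using assms by (intro order_trans[OF integral_norm_bound] integral_mono) auto
next
 case False
 have "0 \<le> (\<integral>t. g t \<partial>M)"
  using assms(2) by (intro integral_nonneg_AE AE_I2) (meson norm_ge_zero order_trans)
 then show ?thesis using False by (simp add: not_integrable_integral_eq)
qed

text \<open>Differentiation under the integral sign.  The derivative is measurable in \<open>t\<close> as a limit of difference quotients, and
the bound \<open>B\<close> dominates the remainder.\<close>

lemma has_derivative_parametric_integral:
 fixes H :: "'x::euclidean_space => 't => 'b::{banach, second_countable_topology}"
 assumes e: "e > 0"
  and D: "\<And>y t. y \<in> ball x e ==> t \<in> space M ==> ((\<lambda>y. H y t) has_derivative H' y t) (at y)"
  and B: "\<And>y t v. y \<in> ball x e ==> t \<in> space M ==> norm (H' y t v) \<le> B t * norm v" "integrable M B"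
  and I: "\<And>y. y \<in> ball x e ==> integrable M (H y)"
 shows "integrable M (\<lambda>t. H' x t v)"
  and "((\<lambda>y. \<integral>t. H y t \<partial>M) has_derivative (\<lambda>v. \<integral>t. H' x t v \<partial>M)) (at x)"
proof -
 have x: "x \<in> ball x e" using e by simp
 have meas: "(\<lambda>t. H' x t v) \<in> borel_measurable M" for v
 proof -
  define c where "c n = e / ((norm v + 1) * (real n + 2))" for n
  have c0: "c n > 0" for n using e by (simp add: c_def add_nonneg_pos)
  have cb: "x + c n *\<^sub>R v \<in> ball x e" for n
  proof -
   have "norm v < (norm v + 1) * (real n + 2)"
    using mult_mono[of "norm v + 1" "norm v + 1" 1 "real n + 2"] by simp
   then have "e * norm v < e * ((norm v + 1) * (real n + 2))" using e by simp
   moreover have "(norm v + 1) * (real n + 2) > 0" by (simp add: add_nonneg_pos)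
   ultimately have "c n * norm v < e" by (simp add: c_def divide_simps)
   then show ?thesis using c0[of n] by (simp add: dist_norm)
  qed
  have clim: "c \<longlonglongrightarrow> 0"
  proof -
   have "(\<lambda>n. (e / (norm v + 1)) * inverse (real (Suc (Suc n)))) \<longlonglongrightarrow> (e / (norm v + 1)) * 0"
    by (intro tendsto_intros LIMSEQ_Suc[OF LIMSEQ_inverse_real_of_nat])
   then show ?thesis by (simp add: c_def[abs_def] field_simps)
  qed
  show ?thesis
  proof (rule borel_measurable_LIMSEQ_metric)
   show "(\<lambda>t. (H (x + c n *\<^sub>R v) t - H x t) /\<^sub>R c n) \<in> borel_measurable M" for n
    using I[OF cb] I[OF x] by (auto intro!: borel_measurable_scaleR borel_measurable_diff dest: borel_measurable_integrable)
   fix t assume t: "t \<in> space M"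
   have "((\<lambda>s. x + s *\<^sub>R v) has_derivative (\<lambda>r. r *\<^sub>R v)) (at 0)" by (auto intro!: derivative_eq_intros)
   from diff_chain_at[OF this, of "\<lambda>y. H y t" "H' x t"] D[OF x t]
   have "((\<lambda>s. H (x + s *\<^sub>R v) t) has_derivative (\<lambda>r. r *\<^sub>R H' x t v)) (at 0)"
    unfolding o_def using has_derivative_linear[OF D[OF x t]] by (simp add: linear_cmul)
   then have "((\<lambda>s. (H (x + s *\<^sub>R v) t - H x t - s *\<^sub>R H' x t v) /\<^sub>R norm s) \<longlongrightarrow> 0) (at 0)"
    unfolding has_derivative_at_within by simp
   moreover have "filterlim c (at 0) sequentially"
    using clim c0 by (auto simp: filterlim_at less_imp_neq[THEN not_sym])
   ultimately have "(\<lambda>n. (H (x + c n *\<^sub>R v) t - H x t - c n *\<^sub>R H' x t v) /\<^sub>R norm (c n)) \<longlonglongrightarrow> 0"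
    by (rule filterlim_compose)
   moreover have "(H (x + c n *\<^sub>R v) t - H x t - c n *\<^sub>R H' x t v) /\<^sub>R norm (c n)
     = (H (x + c n *\<^sub>R v) t - H x t) /\<^sub>R c n - H' x t v" for n
    using c0[of n] by (simp add: scaleR_diff_right)
   ultimately show "(\<lambda>n. (H (x + c n *\<^sub>R v) t - H x t) /\<^sub>R c n) \<longlonglongrightarrow> H' x t v"
    by (simp add: LIM_zero_iff)
  qed
 qed
 show int: "integrable M (\<lambda>t. H' x t v)" for v
 proof (rule Bochner_Integration.integrable_bound)
  show "integrable M (\<lambda>t. B t * norm v)" using B(2) by simp
  show "AE t in M. norm (H' x t v) \<le> norm (B t * norm v)"
   using B(1)[OF x] by (auto intro!: AE_I2 order_trans[OF B(1)[OF x]])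
 qed (rule meas)
 have lin: "bounded_linear (\<lambda>v. \<integral>t. H' x t v \<partial>M)"
 proof (rule bounded_linear_intro[where K = "\<integral>t. B t \<partial>M"])
  have l: "linear (H' x t)" if "t \<in> space M" for t using D[OF x that] has_derivative_linear by blast
  show "(\<integral>t. H' x t (u + v) \<partial>M) = (\<integral>t. H' x t u \<partial>M) + (\<integral>t. H' x t v \<partial>M)" for u v
   by (subst Bochner_Integration.integral_add[symmetric, OF int int])
     (auto intro!: Bochner_Integration.integral_cong simp: linear_add[OF l])
  show "(\<integral>t. H' x t (r *\<^sub>R v) \<partial>M) = r *\<^sub>R (\<integral>t. H' x t v \<partial>M)" for r v
   unfolding integral_scaleR_right[symmetric]
   by (intro Bochner_Integration.integral_cong) (auto simp: linear_cmul[OF l])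
  show "norm (\<integral>t. H' x t v \<partial>M) \<le> norm v * (\<integral>t. B t \<partial>M)" for v
  proof -
   have "norm (\<integral>t. H' x t v \<partial>M) \<le> (\<integral>t. B t * norm v \<partial>M)"
    by (rule norm_integral_le) (use B x in auto)
   then show ?thesis by (simp add: mult.commute)
  qed
 qed
 show "((\<lambda>y. \<integral>t. H y t \<partial>M) has_derivative (\<lambda>v. \<integral>t. H' x t v \<partial>M)) (at x)"
  unfolding has_derivative_at_within
 proof (intro conjI lin)
  let ?Q = "\<lambda>y t. (H y t - H x t - H' x t (y - x)) /\<^sub>R norm (y - x)"
  let ?I = "\<lambda>y. ((\<integral>t. H y t \<partial>M) - (\<integral>t. H x t \<partial>M) - (\<integral>t. H' x t (y - x) \<partial>M)) /\<^sub>R norm (y - x)"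
  have QI: "?I y = (\<integral>t. ?Q y t \<partial>M)" "integrable M (?Q y)" if "y \<in> ball x e" for y
   using I[OF that] I[OF x] int by auto
  have B0: "B t \<ge> 0" if t: "t \<in> space M" for t
  proof -
   obtain b :: 'x where "b \<in> Basis" using nonempty_Basis by blast
   then show ?thesis using B(1)[OF x t, of b] order_trans[OF norm_ge_zero] by fastforce
  qed
  have bound: "norm (?Q y t) \<le> 2 * B t" if y: "y \<in> ball x e" and t: "t \<in> space M" for y t
  proof -
   have "norm (H y t - H x t) \<le> B t * norm (y - x)"
   proof (rule differentiable_bound[of "ball x e" "\<lambda>y. H y t" "\<lambda>y. H' y t"])
    show "((\<lambda>y. H y t) has_derivative H' z t) (at z within ball x e)" if "z \<in> ball x e" for z
     using D[OF that t] by (rule has_derivative_at_withinI)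
    show "onorm (H' z t) \<le> B t" if "z \<in> ball x e" for z
     by (rule onorm_bound) (use B(1)[OF that t] B0[OF t] in auto)
   qed (use y x in auto)
   moreover have "norm (H' x t (y - x)) \<le> B t * norm (y - x)" by (rule B(1)[OF x t])
   ultimately have "norm (H y t - H x t - H' x t (y - x)) \<le> 2 * B t * norm (y - x)"
    using norm_triangle_ineq4[of "H y t - H x t" "H' x t (y - x)"] by linarith
   then show ?thesis using B0[OF t] by (cases "y = x") (auto simp: divide_simps mult.commute)
  qed
  show "(?I \<longlongrightarrow> 0) (at x)"
   unfolding tendsto_at_iff_sequentially
  proof (intro allI impI)
   fix X assume X: "\<forall>i. X i \<in> UNIV - {x}" "X \<longlonglongrightarrow> x"
   obtain N where N: "\<And>n. n \<ge> N ==> X n \<in> ball x e"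
    using X(2) e unfolding lim_sequentially by (auto simp: dist_commute)
   have "(\<lambda>n. \<integral>t. ?Q (X (n + N)) t \<partial>M) \<longlonglongrightarrow> (\<integral>t. 0 \<partial>M)"
   proof (rule integral_dominated_convergence[where w = "\<lambda>t. 2 * B t"])
    show "AE t in M. (\<lambda>n. ?Q (X (n + N)) t) \<longlonglongrightarrow> 0"
    proof (rule AE_I2)
     fix t assume t: "t \<in> space M"
     have "((\<lambda>y. ?Q y t) \<longlongrightarrow> 0) (at x)"
      using D[OF x t] unfolding has_derivative_at_within by auto
     then have "((\<lambda>y. ?Q y t) \<circ> X) \<longlonglongrightarrow> 0" using X unfolding tendsto_at_iff_sequentially by blast
     then show "(\<lambda>n. ?Q (X (n + N)) t) \<longlonglongrightarrow> 0" by (auto simp: o_def intro: LIMSEQ_ignore_initial_segment)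
    qed
    show "AE t in M. norm (?Q (X (n + N)) t) \<le> 2 * B t" for n using bound N by auto
    show "?Q (X (n + N)) \<in> borel_measurable M" for n using QI(2)[OF N] by auto
   qed (use B(2) in auto)
   moreover have "?I (X (n + N)) = (\<integral>t. ?Q (X (n + N)) t \<partial>M)" for n using QI(1)[OF N] by simp
   ultimately have "(\<lambda>n. ?I (X (n + N))) \<longlonglongrightarrow> 0" by (simp only: integral_zero)
   then show "(?I \<circ> X) \<longlonglongrightarrow> 0" unfolding o_def by (rule LIMSEQ_offset)
  qed
 qed
qed

abbreviation unit_interval :: "real measure" where "unit_interval \<equiv> restrict_space lborel {0..1}"

lemma unit_interval_simps:
 "space unit_interval = {0..1}" "finite_measure unit_interval"
proof -
 show "space unit_interval = {0..1}" by (simp add: space_restrict_space)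
 show "finite_measure unit_interval"
  by (rule finite_measureI) (simp add: space_restrict_space emeasure_restrict_space)
qed

lemma integrable_unit_interval:
 fixes f :: "real => 'b::euclidean_space"
 assumes "continuous_on {0..1} f"
 shows "integrable unit_interval f"
proof -
 have "compact (f ` {0..1})" using assms compact_continuous_image by blast
 then obtain K where K: "\<And>t. t \<in> {0..1} ==> norm (f t) \<le> K"
  by (meson compact_imp_bounded bounded_iff imageI)
 have "f \<in> borel_measurable unit_interval"
  using borel_measurable_continuous_on_restrict[OF assms] by (simp cong: measurable_cong_sets add: sets_restrict_space)
 then show ?thesis
  by (intro finite_measure.integrable_const_bound[OF unit_interval_simps(2), of _ K])
    (use K in \<open>auto intro!: AE_I2 simp: space_restrict_space\<close>)
qed

lemma integral_unit_interval_FTC: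
 fixes f :: "real => 'b::euclidean_space"
 assumes "\<And>t. 0 \<le> t ==> t \<le> 1 ==> (F has_vector_derivative f t) (at t within {0..1})" "continuous_on {0..1} f"
 shows "(\<integral>t. f t \<partial>unit_interval) = F 1 - F 0"
 using integral_FTC_atLeastAtMost[of 0 1 F f] assms by (simp add: integral_restrict_space)

lemma integral_unit_interval_eq_integral:
 fixes f :: "real => 'b::euclidean_space"
 assumes "continuous_on {0..1} f"
 shows "(\<integral>t. f t \<partial>unit_interval) = integral {0..1} f"
proof -
 have "set_integrable lborel {0..1} f"
  using integrable_unit_interval[OF assms] by (simp add: integrable_restrict_space set_integrable_def)
 from set_borel_integral_eq_integral(2)[OF this] show ?thesis
  by (simp add: integral_restrict_space set_lebesgue_integral_def)
qed

subsection \<open>Division of a smooth function by a coordinate\<close>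

text \<open>\<open>coordinate_shrink e t\<close> multiplies the coordinate in the direction of the unit vector \<open>e\<close> by \<open>t\<close>.\<close>

definition coordinate_shrink :: "'a::euclidean_space => real => 'a => 'a"
 where "coordinate_shrink e t y = y - ((1 - t) * (y \<bullet> e)) *\<^sub>R e"

lemma coordinate_shrink_simps:
 "coordinate_shrink e 1 y = y" "norm e = 1 ==> coordinate_shrink e 0 y \<bullet> e = 0"
 "linear (coordinate_shrink e t)" "coordinate_shrink e t v = v - (1 - t) *\<^sub>R ((v \<bullet> e) *\<^sub>R e)"
proof -
 show "norm e = 1 ==> coordinate_shrink e 0 y \<bullet> e = 0"
  by (simp add: coordinate_shrink_def inner_diff_left dot_square_norm)
 show "linear (coordinate_shrink e t)"
  unfolding coordinate_shrink_def by (rule linearI) (simp_all add: algebra_simps)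
qed (auto simp: coordinate_shrink_def)

lemma continuous_on_coordinate_shrink: "continuous_on A (\<lambda>(t, y). coordinate_shrink e t y)"
 unfolding coordinate_shrink_def case_prod_unfold by (intro continuous_intros)

text \<open>Averages of a smooth function over the segments that shrink one coordinate are smooth, by
 differentiation under the integral sign: a derivative of such an average is a combination of two
 averages with other weights.\<close>

lemma Ck_on_integral_shrink:
 fixes G :: "'a::euclidean_space => 'b::euclidean_space"
 assumes S: "open S" and star: "\<And>t y. y \<in> S ==> t \<in> {0..1} ==> coordinate_shrink e t y \<in> S"
  and "smooth_on S G" "continuous_on {0..1} q"
 shows "Ck_on k S (\<lambda>y. \<integral>t. q t *\<^sub>R G (coordinate_shrink e t y) \<partial>unit_interval)"
 using assms(3,4)
proof (induction k arbitrary: G q)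
 have D: "((\<lambda>y. \<integral>t. q t *\<^sub>R G (coordinate_shrink e t y) \<partial>unit_interval) has_derivative
   (\<lambda>v. \<integral>t. q t *\<^sub>R fderiv G (coordinate_shrink e t x) (coordinate_shrink e t v) \<partial>unit_interval)) (at x)"
  if G: "smooth_on S G" and q: "continuous_on {0..1} q" and x: "x \<in> S" for G :: "'a => 'b" and q x
 proof -
  obtain r where r: "r > 0" "cball x r \<subseteq> S" using S x open_contains_cball by blast
  let ?K = "(\<lambda>(t, y). coordinate_shrink e t y) ` ({0..1} \<times> cball x r)"
  have K: "compact ?K" "?K \<subseteq> S"
   using star r by (auto intro!: compact_continuous_image continuous_on_coordinate_shrink compact_Times)
  have cG: "continuous_on ({0..1} \<times> cball x r) (\<lambda>(t, y). F (coordinate_shrink e t y))" if "continuous_on S F" for F :: "'a => 'b"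
  proof -
   have "continuous_on ({0..1} \<times> cball x r) (F \<circ> (\<lambda>(t, y). coordinate_shrink e t y))"
    by (intro continuous_on_compose continuous_on_coordinate_shrink continuous_on_subset[OF that] K)
   then show ?thesis by (simp add: o_def case_prod_unfold)
  qed
  have cG1: "continuous_on {0..1} (\<lambda>t. F (coordinate_shrink e t y))" if "continuous_on S F" "y \<in> cball x r" for F :: "'a => 'b" and y
  proof -
   have "continuous_on {0..1} ((\<lambda>(t, y). F (coordinate_shrink e t y)) \<circ> (\<lambda>t. (t, y)))"
    by (intro continuous_on_compose continuous_intros continuous_on_subset[OF cG[OF that(1)]]) (use that(2) in auto)
   then show ?thesis by (simp add: o_def)
  qed
  have sub: "ball x r \<subseteq> cball x r" by (rule ball_subset_cball)
  have "\<exists>C. \<forall>y\<in>?K. norm (fderiv G y b) \<le> C" for b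
   using compact_continuous_image[OF continuous_on_subset[OF smooth_on_continuous[OF smooth_on_derivative[OF G]] K(2)] K(1), of b]
   by (meson compact_imp_bounded bounded_iff imageI)
  then obtain C where C: "\<And>b y. y \<in> ?K ==> norm (fderiv G y b) \<le> C b" by metis
  have nD: "norm (fderiv G y w) \<le> (\<Sum>b\<in>Basis. C b) * norm w" if y: "y \<in> ?K" for y w
  proof -
   have l: "linear (fderiv G y)"
    using smooth_on_has_derivative[OF G] K(2) y has_derivative_linear by blast
   have "fderiv G y (\<Sum>b\<in>Basis. (w \<bullet> b) *\<^sub>R b) = (\<Sum>b\<in>Basis. (w \<bullet> b) *\<^sub>R fderiv G y b)"
    using l by (simp add: linear_sum linear_cmul)
   then have "norm (fderiv G y w) \<le> (\<Sum>b\<in>Basis. norm ((w \<bullet> b) *\<^sub>R fderiv G y b))"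
    using norm_sum[of "\<lambda>b. (w \<bullet> b) *\<^sub>R fderiv G y b"] by (simp only: euclidean_representation)
   also have "\<dots> \<le> (\<Sum>b\<in>Basis. C b * norm w)"
    unfolding norm_scaleR
    by (subst mult.commute, intro sum_mono mult_mono C[OF y])
      (auto intro: Basis_le_norm order_trans[OF norm_ge_zero C[OF y]])
   finally show ?thesis by (simp add: sum_distrib_right)
  qed
  have shr: "norm (coordinate_shrink e t v) \<le> (1 + norm e * norm e) * norm v" if "t \<in> {0..1}" for t v
  proof -
   have "norm ((1 - t) *\<^sub>R ((v \<bullet> e) *\<^sub>R e)) \<le> 1 * ((norm v * norm e) * norm e)"
    using that Cauchy_Schwarz_ineq2[of v e] unfolding norm_scaleR by (intro mult_mono) auto
   then show ?thesis
    using norm_triangle_ineq4[of v "(1 - t) *\<^sub>R ((v \<bullet> e) *\<^sub>R e)"]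
    unfolding coordinate_shrink_simps(4) by (simp add: algebra_simps)
  qed
  let ?C = "(\<Sum>b\<in>Basis. C b) * (1 + norm e * norm e)"
  show ?thesis
  proof (rule has_derivative_parametric_integral(2)[OF r(1), where B = "\<lambda>t. \<bar>q t\<bar> * ?C"])
   fix y t assume y: "y \<in> ball x r" and t: "t \<in> space unit_interval"
   then have t: "t \<in> {0..1}" by (simp add: unit_interval_simps)
   have m: "coordinate_shrink e t y \<in> ?K" using y t sub by force
   have "((\<lambda>y. coordinate_shrink e t y) has_derivative coordinate_shrink e t) (at y)"
    using coordinate_shrink_simps(3) linear_imp_has_derivative by blast
   from diff_chain_at[OF this smooth_on_has_derivative[OF G]] m K(2)
   show "((\<lambda>y. q t *\<^sub>R G (coordinate_shrink e t y)) has_derivative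
     (\<lambda>v. q t *\<^sub>R fderiv G (coordinate_shrink e t y) (coordinate_shrink e t v))) (at y)"
    by (auto simp: o_def intro!: derivative_intros)
   show "norm (q t *\<^sub>R fderiv G (coordinate_shrink e t y) (coordinate_shrink e t v)) \<le> \<bar>q t\<bar> * ?C * norm v" for v
   proof -
    have "0 \<le> norm (fderiv G (coordinate_shrink e t y) b)" for b by simp
    then have "0 \<le> (\<Sum>b\<in>Basis. C b)" using C[OF m] by (intro sum_nonneg) (meson order_trans)
    then have "(\<Sum>b\<in>Basis. C b) * norm (coordinate_shrink e t v) \<le> (\<Sum>b\<in>Basis. C b) * ((1 + norm e * norm e) * norm v)"
     by (intro mult_left_mono shr t)
    then have "norm (fderiv G (coordinate_shrink e t y) (coordinate_shrink e t v)) \<le> ?C * norm v"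
     using nD[OF m, of "coordinate_shrink e t v"] by (simp add: mult.assoc)
    then show ?thesis by (simp add: mult.assoc mult_left_mono)
   qed
  next
   show "integrable unit_interval (\<lambda>t. \<bar>q t\<bar> * ?C)"
    by (intro integrable_unit_interval continuous_intros q)
   show "integrable unit_interval (\<lambda>t. q t *\<^sub>R G (coordinate_shrink e t y))" if "y \<in> ball x r" for y
    using that sub by (intro integrable_unit_interval continuous_intros q cG1[OF smooth_on_continuous[OF G]]) auto
  qed
 qed
 {
  case (0 G q)
  show ?case
   unfolding Ck_on.simps
   by (rule differentiable_imp_continuous_on)
     (auto simp: differentiable_on_def differentiable_def intro!: has_derivative_at_withinI[OF D[OF 0]])
 next
  case (Suc k G q)
  show ?case
  proof (rule Ck_on_SucI[OF S D[OF Suc.prems]])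
   fix v
   have int: "integrable unit_interval (\<lambda>t. p t *\<^sub>R fderiv G (coordinate_shrink e t y) w)"
    if "y \<in> S" "continuous_on {0..1} p" for y w p
   proof (intro integrable_unit_interval continuous_intros that)
    have "continuous_on {0..1} ((\<lambda>y. fderiv G y w) \<circ> ((\<lambda>(t, y). coordinate_shrink e t y) \<circ> (\<lambda>t. (t, y))))"
     by (intro continuous_on_compose continuous_on_coordinate_shrink continuous_intros
       continuous_on_subset[OF smooth_on_continuous[OF smooth_on_derivative[OF Suc.prems(1)]]])
       (use star that in auto)
    then show "continuous_on {0..1} (\<lambda>t. fderiv G (coordinate_shrink e t y) w)"
     by (simp add: o_def)
   qed
   let ?q' = "\<lambda>t. - ((1 - t) * (v \<bullet> e) * q t)"
   have q': "continuous_on {0..1} ?q'" using Suc.prems(2) by (intro continuous_intros)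
   show "Ck_on k S (\<lambda>y. \<integral>t. q t *\<^sub>R fderiv G (coordinate_shrink e t y) (coordinate_shrink e t v) \<partial>unit_interval)"
   proof (rule Ck_on_cong[OF S _ Ck_on_add[OF S Suc.IH[OF smooth_on_derivative[OF Suc.prems(1), of v] Suc.prems(2)]
      Suc.IH[OF smooth_on_derivative[OF Suc.prems(1), of e] q']]])
    fix y assume y: "y \<in> S"
    have l: "linear (fderiv G (coordinate_shrink e t y))" if "t \<in> {0..1}" for t
     using smooth_on_has_derivative[OF Suc.prems(1) star[OF y that]] has_derivative_linear by blast
    show "(\<integral>t. q t *\<^sub>R fderiv G (coordinate_shrink e t y) v \<partial>unit_interval)
      + (\<integral>t. ?q' t *\<^sub>R fderiv G (coordinate_shrink e t y) e \<partial>unit_interval)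
      = (\<integral>t. q t *\<^sub>R fderiv G (coordinate_shrink e t y) (coordinate_shrink e t v) \<partial>unit_interval)"
     unfolding Bochner_Integration.integral_add[OF int[OF y Suc.prems(2)] int[OF y q'], symmetric]
    proof (rule Bochner_Integration.integral_cong[OF refl])
     fix t assume "t \<in> space unit_interval"
     then have t: "t \<in> {0..1}" by (simp add: unit_interval_simps)
     show "q t *\<^sub>R fderiv G (coordinate_shrink e t y) v + ?q' t *\<^sub>R fderiv G (coordinate_shrink e t y) e
       = q t *\<^sub>R fderiv G (coordinate_shrink e t y) (coordinate_shrink e t v)"
      using l[OF t] unfolding coordinate_shrink_simps(4)[of e t v]
      by (simp only: linear_diff linear_cmul) (simp add: algebra_simps)
    qed
   qed
  qed
 }
qed

text \<open>Hadamard's lemma: the quotient is the average of the derivative in direction \<open>e\<close> over the segment to the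
hyperplane.\<close>

lemma smooth_on_divide_coordinate:
 fixes g :: "'a::euclidean_space => 'b::euclidean_space"
 assumes S: "open S" and star: "\<And>t y. y \<in> S ==> t \<in> {0..1} ==> coordinate_shrink e t y \<in> S" and e: "norm e = 1"
  and g: "smooth_on S g" and g0: "\<And>y. y \<in> S ==> y \<bullet> e = 0 ==> g y = 0"
 shows "\<exists>g1. smooth_on S g1 \<and> (\<forall>y\<in>S. g y = (y \<bullet> e) *\<^sub>R g1 y)"
proof (intro exI conjI ballI)
 let ?D = "\<lambda>y. fderiv g y e"
 let ?g1 = "\<lambda>y. \<integral>t. 1 *\<^sub>R ?D (coordinate_shrink e t y) \<partial>unit_interval"
 show "smooth_on S ?g1"
  unfolding smooth_on_def using Ck_on_integral_shrink[OF S star smooth_on_derivative[OF g], of "\<lambda>_. 1" _ e] by auto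
 fix y assume y: "y \<in> S"
 have d: "((\<lambda>t. coordinate_shrink e t y) has_derivative (\<lambda>r. r *\<^sub>R ((y \<bullet> e) *\<^sub>R e))) (at t)" for t
  unfolding coordinate_shrink_def by (auto intro!: derivative_eq_intros simp: algebra_simps)
 have dg: "((\<lambda>t. g (coordinate_shrink e t y)) has_vector_derivative (y \<bullet> e) *\<^sub>R ?D (coordinate_shrink e t y)) (at t within {0..1})"
  if "0 \<le> t" "t \<le> 1" for t
 proof -
  have D: "(g has_derivative fderiv g (coordinate_shrink e t y)) (at (coordinate_shrink e t y))"
   using star[OF y, of t] that by (intro smooth_on_has_derivative[OF g]) auto
  from diff_chain_at[OF d D] show ?thesis
   unfolding has_vector_derivative_def using has_derivative_linear[OF D]
   by (auto simp: o_def linear_cmul intro: has_derivative_at_withinI)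
 qed
 have "continuous_on {0..1} ((\<lambda>y. ?D y) \<circ> ((\<lambda>(t, y). coordinate_shrink e t y) \<circ> (\<lambda>t. (t, y))))"
  by (intro continuous_on_compose continuous_on_coordinate_shrink continuous_intros
    continuous_on_subset[OF smooth_on_continuous[OF smooth_on_derivative[OF g]]])
    (use star y in auto)
 then have c: "continuous_on {0..1} (\<lambda>t. ?D (coordinate_shrink e t y))" by (simp add: o_def)
 have "g (coordinate_shrink e 1 y) - g (coordinate_shrink e 0 y) = (\<integral>t. (y \<bullet> e) *\<^sub>R ?D (coordinate_shrink e t y) \<partial>unit_interval)"
  by (rule integral_unit_interval_FTC[symmetric]) (use dg c in \<open>auto intro!: continuous_intros\<close>)
 moreover have "g (coordinate_shrink e 0 y) = 0"
  using star[OF y, of 0] by (intro g0 coordinate_shrink_simps(2) e) auto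
 ultimately show "g y = (y \<bullet> e) *\<^sub>R ?g1 y" by (simp add: coordinate_shrink_simps(1))
qed

subsection \<open>Holomorphic functions of several variables are smooth\<close>

text \<open>Cauchy's integral formula for the derivative of the one-variable function \<open>\<zeta> \<mapsto> f (x + \<zeta> v)\<close>, on a circle
of radius \<open>r\<close>.\<close>

lemma holomorphic_function_slice:
 fixes f :: "complex^'N => complex"
 assumes W: "open W" and f: "holomorphic_function W f" and r: "r > 0"
  and sub: "\<And>\<zeta>. norm \<zeta> \<le> r ==> x + \<zeta> *s v \<in> W"
 shows "fderiv f x v = (\<integral>t. f (x + (r * cis (2 * pi * t)) *s v) / (r * cis (2 * pi * t)) \<partial>unit_interval)"
  and "continuous_on {0..1} (\<lambda>t. f (x + (r * cis (2 * pi * t)) *s v) / (r * cis (2 * pi * t)))"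
proof -
 let ?g = "\<lambda>\<zeta>. f (x + \<zeta> *s v)"
 have f': "(f has_derivative fderiv f y) (at y)"
  and cl: "fderiv f y (\<i> *s v) = \<i> * fderiv f y v" if "y \<in> W" for y v
  using f that unfolding holomorphic_function_def by (metis frechet_derivative_eqI)+
 have lin: "fderiv f y (c *s v) = c * fderiv f y v" if "y \<in> W" for y c v
 proof -
  have l: "linear (fderiv f y)" using f'[OF that] has_derivative_linear by blast
  have "c *s v = Re c *\<^sub>R v + Im c *\<^sub>R (\<i> *s v)"
   by (simp add: vec_eq_iff complex_eq_iff)
  then have "fderiv f y (c *s v) = Re c *\<^sub>R fderiv f y v + Im c *\<^sub>R (\<i> * fderiv f y v)"
   using l cl[OF that] by (simp add: linear_add linear_cmul)
  also have "\<dots> = c * fderiv f y v" by (simp add: complex_eq_iff)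
  finally show ?thesis .
 qed
 have g': "(?g has_field_derivative fderiv f (x + \<zeta> *s v) v) (at \<zeta>)" if "norm \<zeta> \<le> r" for \<zeta>
 proof -
  have "linear (\<lambda>\<zeta>. \<zeta> *s v)" by (rule linearI) (simp_all add: vec_eq_iff algebra_simps)
  then have "((\<lambda>\<zeta>. x + \<zeta> *s v) has_derivative (\<lambda>\<zeta>. 0 + \<zeta> *s v)) (at \<zeta>)"
   by (intro derivative_intros linear_imp_has_derivative)
  from diff_chain_at[OF this f'[OF sub[OF that]]] show ?thesis
   unfolding has_field_derivative_def o_def
   by (rule has_derivative_eq_rhs) (simp add: fun_eq_iff lin[OF sub[OF that]])
 qed
 have cg: "continuous_on (cball 0 r) ?g"
  by (rule continuous_at_imp_continuous_on) (auto intro!: DERIV_isCont[OF g'])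
 have hol: "?g holomorphic_on ball 0 r"
  unfolding holomorphic_on_def field_differentiable_def
 proof
  show "\<exists>f'. (?g has_field_derivative f') (at \<zeta> within ball 0 r)" if "\<zeta> \<in> ball 0 r" for \<zeta>
   using has_field_derivative_at_within[OF g'[of \<zeta>]] that by auto
 qed
 have cis: "cis (2 * pi * t) = exp (2 * of_real pi * \<i> * of_real t)" for t
  by (simp add: cis_conv_exp mult_ac)
 show c: "continuous_on {0..1} (\<lambda>t. f (x + (r * cis (2 * pi * t)) *s v) / (r * cis (2 * pi * t)))"
 proof (intro continuous_intros)
  show "continuous_on {0..1} (\<lambda>t. f (x + (r * cis (2 * pi * t)) *s v))"
   by (rule continuous_on_compose2[OF cg]) (use r in \<open>auto intro!: continuous_intros simp: norm_mult\<close>)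
 qed (use r in auto)
 have z0: "0 \<in> ball (0::complex) r" using r by simp
 note CD = Cauchy_derivative_integral_circlepath[OF cg hol z0]
 have "fderiv f x v = 1 / (2 * of_real pi * \<i>) * contour_integral (circlepath 0 r) (\<lambda>u. ?g u / (u - 0)^2)"
  using DERIV_unique[OF g'[of 0] CD(2)] r by simp
 also have "contour_integral (circlepath 0 r) (\<lambda>u. ?g u / (u - 0)^2)
   = integral {0..1} (\<lambda>t. ?g (circlepath 0 r t) / (circlepath 0 r t)^2 * vector_derivative (circlepath 0 r) (at t))"
  using has_contour_integral_integral[OF CD(1)] unfolding has_contour_integral by (simp add: integral_unique)
 also have "\<dots> = integral {0..1} (\<lambda>t. (2 * of_real pi * \<i>) * (f (x + (r * cis (2 * pi * t)) *s v) / (r * cis (2 * pi * t))))"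
  unfolding vector_derivative_circlepath unfolding circlepath cis using r by (simp add: power2_eq_square field_simps)
 also have "\<dots> = (2 * of_real pi * \<i>) * (\<integral>t. f (x + (r * cis (2 * pi * t)) *s v) / (r * cis (2 * pi * t)) \<partial>unit_interval)"
  by (subst integral_unit_interval_eq_integral[OF c]) (rule integral_mult_right)
 finally show "fderiv f x v = (\<integral>t. f (x + (r * cis (2 * pi * t)) *s v) / (r * cis (2 * pi * t)) \<partial>unit_interval)"
  by simp
qed

lemma norm_vector_scalar_mult_complex: "norm (c *s (v::complex^'n)) = norm c * norm v"
 by (simp add: norm_vec_def L2_set_def norm_mult power_mult_distrib flip: sum_distrib_left)
   (simp add: real_sqrt_mult)

text \<open>Cauchy's formula represents the derivative near a point by values of \<open>f\<close>; differentiation under the integral sign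
preserves complex linearity.\<close>

lemma holomorphic_function_derivative:
 fixes f :: "complex^'N => complex"
 assumes W: "open W" and f: "holomorphic_function W f"
 shows "holomorphic_function W (\<lambda>x. fderiv f x v)"
 unfolding holomorphic_function_def
proof
 have f': "(f has_derivative fderiv f y) (at y)"
  and cl: "fderiv f y (\<i> *s v) = \<i> * fderiv f y v" if "y \<in> W" for y v
  using f that unfolding holomorphic_function_def by (metis frechet_derivative_eqI)+
 fix x assume x: "x \<in> W"
 obtain d where d: "d > 0" "cball x d \<subseteq> W" using W x open_contains_cball by blast
 define \<delta> where "\<delta> = d / 3"
 have \<delta>: "\<delta> > 0" "cball x (3 * \<delta>) \<subseteq> W" using d by (auto simp: \<delta>_def)
 have "continuous_on (cball x (3 * \<delta>)) f"
  using f' \<delta>(2) by (auto intro!: continuous_at_imp_continuous_on has_derivative_continuous)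
 then have "compact (f ` cball x (3 * \<delta>))" by (intro compact_continuous_image) auto
 then obtain C where C: "\<And>y. y \<in> cball x (3 * \<delta>) ==> norm (f y) \<le> C"
  by (meson compact_imp_bounded bounded_iff imageI)
 have in3: "y + w \<in> cball x (3 * \<delta>)" if "y \<in> cball x (2 * \<delta>)" "norm w \<le> \<delta>" for y w
  using that norm_triangle_ineq4[of "x - y" w] by (auto simp: dist_norm algebra_simps)
 have bound: "norm (fderiv f y u) \<le> C / \<delta> * norm u" if y: "y \<in> cball x (2 * \<delta>)" for y u
 proof (cases "u = 0")
  case True
  have "y \<in> W" using in3[OF y, of 0] \<delta> by auto
  then have "fderiv f y 0 = 0" using linear_0[OF has_derivative_linear[OF f']] by blast
  then show ?thesis using True by simp
 next
  case False
  let ?r = "\<delta> / norm u"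
  have r: "?r > 0" using False \<delta> by simp
  have n: "norm (?r * cis s) = ?r" for s
   unfolding norm_mult norm_of_real norm_cis using r by linarith
  have m: "y + \<zeta> *s u \<in> cball x (3 * \<delta>)" if "norm \<zeta> \<le> ?r" for \<zeta>
   using that False by (intro in3[OF y]) (simp add: norm_vector_scalar_mult_complex field_simps)
  have "y + \<zeta> *s u \<in> W" if "norm \<zeta> \<le> ?r" for \<zeta> using m[OF that] \<delta>(2) by blast
  then have sl: "fderiv f y u = (\<integral>t. f (y + (?r * cis (2 * pi * t)) *s u) / (?r * cis (2 * pi * t)) \<partial>unit_interval)"
   by (rule holomorphic_function_slice(1)[OF W f r])
  have "norm (fderiv f y u) \<le> (\<integral>t. C / ?r \<partial>unit_interval)"
   unfolding sl
  proof (rule norm_integral_le)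
   fix t
   have "norm (f (y + (?r * cis (2 * pi * t)) *s u)) \<le> C" by (intro C m) (simp only: n order_refl)
   then show "norm (f (y + (?r * cis (2 * pi * t)) *s u) / (?r * cis (2 * pi * t))) \<le> C / ?r"
    unfolding norm_divide[of "f _"] n using r by (intro divide_right_mono) auto
  qed (auto intro!: integrable_unit_interval continuous_intros)
  also have "\<dots> = C / ?r" by (simp add: measure_restrict_space space_restrict_space)
  finally show ?thesis by simp
 qed
 define r where "r = \<delta> / (norm v + 1)"
 have r: "r > 0" using \<delta> by (simp add: r_def add_nonneg_pos)
 have rv: "norm (\<zeta> *s v) \<le> \<delta>" if "norm \<zeta> \<le> r" for \<zeta>
 proof -
  have "norm \<zeta> * norm v \<le> r * (norm v + 1)" using that r by (intro mult_mono) auto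
  also have "\<dots> = \<delta>" by (simp add: r_def add_nonneg_eq_0_iff)
  finally show ?thesis by (simp add: norm_vector_scalar_mult_complex)
 qed
 let ?c = "\<lambda>t. r * cis (2 * pi * t)"
 have nc: "norm (?c t) = r" for t using r by (simp add: norm_mult)
 have in2: "y + ?c t *s v \<in> cball x (2 * \<delta>)" if "y \<in> ball x \<delta>" for y t
  using that rv[of "?c t"] nc[of t] norm_triangle_ineq4[of "x - y" "?c t *s v"] by (auto simp: dist_norm algebra_simps)
 have in23: "cball x (2 * \<delta>) \<subseteq> W" using \<delta> subset_cball[of "2 * \<delta>" "3 * \<delta>" x] by fastforce
 have sl: "fderiv f y v = (\<integral>t. f (y + ?c t *s v) / ?c t \<partial>unit_interval)"
  "continuous_on {0..1} (\<lambda>t. f (y + ?c t *s v) / ?c t)" if y: "y \<in> ball x \<delta>" for y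
 proof -
  have "y + \<zeta> *s v \<in> W" if "norm \<zeta> \<le> r" for \<zeta>
  proof -
   have "y + \<zeta> *s v \<in> cball x (3 * \<delta>)" using y \<delta>(1) by (intro in3 rv that) auto
   then show ?thesis using \<delta>(2) by blast
  qed
  from holomorphic_function_slice[OF W f r this]
  show "fderiv f y v = (\<integral>t. f (y + ?c t *s v) / ?c t \<partial>unit_interval)"
   "continuous_on {0..1} (\<lambda>t. f (y + ?c t *s v) / ?c t)" by auto
 qed
 let ?D = "\<lambda>u. \<integral>t. fderiv f (x + ?c t *s v) u / ?c t \<partial>unit_interval"
 have "((\<lambda>y. \<integral>t. f (y + ?c t *s v) / ?c t \<partial>unit_interval) has_derivative ?D) (at x)"
 proof (rule has_derivative_parametric_integral(2)[OF \<delta>(1), where B = "\<lambda>t. C / \<delta> / r"])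
  fix y t assume y: "y \<in> ball x \<delta>"
  have "y + ?c t *s v \<in> W" using in2[OF y] in23 by blast
  moreover have "((\<lambda>y. y + ?c t *s v) has_derivative (\<lambda>u. u)) (at y)" by (auto intro!: derivative_eq_intros)
  ultimately have "((\<lambda>y. f (y + ?c t *s v)) has_derivative fderiv f (y + ?c t *s v)) (at y)"
   using diff_chain_at[of "\<lambda>y. y + ?c t *s v" "\<lambda>u. u" y f] f' by (simp add: o_def)
  then show "((\<lambda>y. f (y + ?c t *s v) / ?c t) has_derivative (\<lambda>u. fderiv f (y + ?c t *s v) u / ?c t)) (at y)"
   using bounded_linear.has_derivative[OF bounded_linear_divide] by blast
  show "norm (fderiv f (y + ?c t *s v) u / ?c t) \<le> C / \<delta> / r * norm u" for u
   using divide_right_mono[OF bound[OF in2[OF y], of t u], of r] r unfolding norm_divide nc by simp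
 next
  show "integrable unit_interval (\<lambda>t. f (y + ?c t *s v) / ?c t)" if "y \<in> ball x \<delta>" for y
   using integrable_unit_interval[OF sl(2)[OF that]] .
 qed (auto intro!: integrable_unit_interval continuous_intros)
 then have "((\<lambda>y. fderiv f y v) has_derivative ?D) (at x)"
  by (rule has_derivative_transform_within_open[where s = "ball x \<delta>", OF _ open_ball]) (use sl(1) \<delta> in auto)
 moreover have "?D (\<i> *s u) = \<i> * ?D u" for u
 proof -
  have "?D (\<i> *s u) = (\<integral>t. \<i> * (fderiv f (x + ?c t *s v) u / ?c t) \<partial>unit_interval)"
  proof (rule Bochner_Integration.integral_cong[OF refl])
   fix t
   have "x + ?c t *s v \<in> W" using in2[of x] in23 \<delta> by auto
   then show "fderiv f (x + ?c t *s v) (\<i> *s u) / ?c t = \<i> * (fderiv f (x + ?c t *s v) u / ?c t)"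
    by (simp add: cl)
  qed
  then show ?thesis by (simp only: integral_mult_right_zero)
 qed
 ultimately show "\<exists>f'. ((\<lambda>x. fderiv f x v) has_derivative f') (at x) \<and> (\<forall>w. f' (\<i> *s w) = \<i> * f' w)" by blast
qed

text \<open>Induction on the order of differentiability: the derivatives are again holomorphic.\<close>

lemma holomorphic_function_smooth:
 fixes f :: "complex^'N => complex"
 assumes W: "open W" and "holomorphic_function W f"
 shows "smooth_on W f"
proof -
 have "Ck_on k W f" for k
  using assms(2)
 proof (induction k arbitrary: f)
  case 0
  then have "continuous (at x) f" if "x \<in> W" for x
   using that unfolding holomorphic_function_def by (meson has_derivative_continuous)
  then show ?case by (simp add: continuous_at_imp_continuous_on)
 next
  case (Suc k)
  then show ?case
   using holomorphic_function_derivative[OF W Suc.prems]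
   by (auto simp: holomorphic_function_def differentiable_def)
 qed
 then show ?thesis by (simp add: smooth_on_def)
qed

section \<open>Test functions\<close>

text \<open>The functions \<open>t\<^sup>-\<^sup>k exp (-1/t)\<close> for \<open>t > 0\<close>, extended by \<open>0\<close>.  All \<open>k\<close> are treated together since
 differentiation leads from one to the others.\<close>

definition flat_exp :: "nat => real => real"
 where "flat_exp k t = (if t > 0 then inverse t ^ k * exp (- inverse t) else 0)"

lemma flat_exp_bounds: "flat_exp k t \<ge> 0" "flat_exp 0 t \<le> 1" "flat_exp 0 t > 0 \<longleftrightarrow> t > 0"
 by (auto simp: flat_exp_def)

lemma flat_exp_quadratic: "flat_exp k t \<le> fact (k + 2) * t\<^sup>2"
proof (cases "t > 0")
 case True
 define x where "x = inverse t"
 define F :: real where "F = fact (k + 2)"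
 have x: "x > 0" using True by (simp add: x_def)
 have F: "F > 0" unfolding F_def by (rule fact_gt_zero)
 have "(\<Sum>n\<in>{k + 2}. x ^ n /\<^sub>R fact n) \<le> exp x"
  unfolding exp_def using x by (intro sum_le_suminf summable_exp_generic) auto
 then have "x ^ (k + 2) / F \<le> exp x" by (simp add: F_def divide_inverse mult.commute del: power_Suc fact_Suc)
 then have "x ^ (k + 2) \<le> F * exp x" using F by (simp add: pos_divide_le_eq mult.commute)
 then have "x ^ k / exp x \<le> F / x\<^sup>2"
  using x by (simp add: divide_simps power_add mult_ac power2_eq_square)
 moreover have "t\<^sup>2 = 1 / x\<^sup>2" using True by (simp add: x_def power_inverse field_simps)
 ultimately show ?thesis
  unfolding F_def[symmetric] using True by (simp add: flat_exp_def x_def[symmetric] exp_minus divide_inverse)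
qed (simp add: flat_exp_def)

lemma flat_exp_derivative:
 "(flat_exp k has_real_derivative flat_exp (k + 2) t - k * flat_exp (k + 1) t) (at t)"
proof -
 consider "t > 0" | "t < 0" | "t = 0" by linarith
 then show ?thesis
 proof cases
  case 1
  have "((\<lambda>t. inverse t ^ k * exp (- inverse t)) has_real_derivative
    flat_exp (k + 2) t - k * flat_exp (k + 1) t) (at t)"
  proof -
   define x where "x = inverse t"
   have "((\<lambda>t. inverse t ^ k * exp (- inverse t)) has_real_derivative
     k * (x ^ (k - 1) * - (x * x)) * exp (- x) + exp (- x) * (x * x) * x ^ k) (at t)"
    using 1 by (auto intro!: derivative_eq_intros simp: x_def)
   moreover have "k * (x ^ (k - 1) * - (x * x)) * exp (- x) + exp (- x) * (x * x) * x ^ k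
     = x ^ (k + 2) * exp (- x) - k * (x ^ (k + 1) * exp (- x))"
    by (cases k) (auto simp: algebra_simps)
   ultimately show ?thesis using 1 by (simp add: flat_exp_def x_def[symmetric] del: power_Suc)
  qed
  then show ?thesis
   by (rule has_field_derivative_transform_within_open[where S = "{0<..}"]) (use 1 in \<open>auto simp: flat_exp_def\<close>)
 next
  case 2
  have "((\<lambda>t. 0) has_real_derivative flat_exp (k + 2) t - k * flat_exp (k + 1) t) (at t)"
   using 2 by (auto simp: flat_exp_def)
  then show ?thesis
   by (rule has_field_derivative_transform_within_open[where S = "{..<0}"]) (use 2 in \<open>auto simp: flat_exp_def\<close>)
 next
  case 3
  have "(flat_exp k has_real_derivative 0) (at 0)"
   unfolding has_field_derivative_def has_derivative_at
  proof (intro conjI bounded_linear_mult_right)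
   have "((\<lambda>h. fact (k + 2) * \<bar>h\<bar>) \<longlongrightarrow> fact (k + 2) * \<bar>0\<bar>) (at (0::real))"
    by (intro tendsto_intros)
   then have lim: "((\<lambda>h. fact (k + 2) * \<bar>h\<bar>) \<longlongrightarrow> 0) (at (0::real))" by simp
   show "((\<lambda>h. norm (flat_exp k (0 + h) - flat_exp k 0 - 0 * h) / norm h) \<longlongrightarrow> 0) (at 0)"
   proof (rule Lim_null_comparison[OF always_eventually lim], rule allI)
    fix h :: real
    have "flat_exp k h / \<bar>h\<bar> \<le> (fact (k + 2) * \<bar>h\<bar>) * \<bar>h\<bar> / \<bar>h\<bar>"
     using flat_exp_quadratic[of k h] by (intro divide_right_mono) (auto simp: power2_eq_square abs_mult_self_eq mult.assoc)
    also have "\<dots> \<le> fact (k + 2) * \<bar>h\<bar>" by simp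
    finally show "norm (norm (flat_exp k (0 + h) - flat_exp k 0 - 0 * h) / norm h) \<le> fact (k + 2) * \<bar>h\<bar>"
     using flat_exp_bounds(1)[of k h] by (simp add: flat_exp_def[of k 0] del: fact_Suc)
   qed
  qed
  then show ?thesis using 3 by (simp add: flat_exp_def)
 qed
qed

lemma smooth_flat_exp: "smooth_on UNIV (flat_exp k)"
proof -
 have "Ck_on j UNIV (flat_exp k)" for j k
 proof (induction j arbitrary: k)
  case 0
  then show ?case using DERIV_isCont[OF flat_exp_derivative] by (simp add: continuous_at_imp_continuous_on)
 next
  case (Suc j)
  show ?case
  proof (rule Ck_on_SucI)
   show "(flat_exp k has_derivative (*) (flat_exp (k + 2) t - k * flat_exp (k + 1) t)) (at t)" for t
    using flat_exp_derivative unfolding has_field_derivative_def .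
   fix v :: real
   have "Ck_on j UNIV (\<lambda>t. (flat_exp (k + 2) t + - real k * flat_exp (k + 1) t) * v)"
    by (intro Ck_on_bilinear[OF bounded_bilinear_mult] Ck_on_add Ck_on_const Suc.IH open_UNIV)
   then show "Ck_on j UNIV (\<lambda>t. (flat_exp (k + 2) t - k * flat_exp (k + 1) t) * v)" by simp
  qed simp
 qed
 then show ?thesis by (simp add: smooth_on_def)
qed

lemma smooth_on_flat_exp [smooth_intros]:
 "open S ==> smooth_on S f ==> smooth_on S (\<lambda>x. flat_exp k (f x))"
 using smooth_on_compose[OF _ open_UNIV _ smooth_flat_exp] by blast

lemma flat_exp_LIMSEQ: "t > 0 ==> (\<lambda>n. flat_exp 0 (real (Suc n) * t)) \<longlonglongrightarrow> 1"
proof -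
 assume t: "t > 0"
 have "(\<lambda>n. exp (- (inverse (real (Suc n)) * inverse t))) \<longlonglongrightarrow> exp (- (0 * inverse t))"
  by (intro tendsto_intros LIMSEQ_inverse_real_of_nat)
 then show ?thesis using t by (simp add: flat_exp_def inverse_mult_distrib add_pos_nonneg)
qed

text \<open>The quotient \<open>a/(a + b)\<close>, where \<open>a\<close> and \<open>b\<close> are flat functions of the distance that vanish outside the
large ball and inside the small ball respectively.\<close>

lemma exists_cutoff:
 fixes p :: "'a::euclidean_space"
 assumes r: "0 < r" "r < R"
 shows "\<exists>c :: 'a => real. smooth_on UNIV c \<and> (\<forall>x\<in>ball p r. c x = 1) \<and> (\<forall>x. x \<notin> ball p R \<longrightarrow> c x = 0)"
proof (intro exI conjI ballI allI impI)
 let ?q = "\<lambda>x. (x - p) \<bullet> (x - p)"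
 let ?a = "\<lambda>x. flat_exp 0 (R\<^sup>2 - ?q x)" and ?b = "\<lambda>x. flat_exp 0 (?q x - r\<^sup>2)"
 have q: "?q x = (dist p x)\<^sup>2" for x unfolding dist_norm power2_norm_eq_inner by (simp add: inner_diff_left inner_diff_right algebra_simps)
 have rR: "r\<^sup>2 < R\<^sup>2" using r by (simp add: power_strict_mono)
 have pos: "?a x + ?b x \<noteq> 0" for x
 proof -
  have "R\<^sup>2 - ?q x > 0 \<or> ?q x - r\<^sup>2 > 0" using rR by linarith
  then show ?thesis
   using flat_exp_bounds(3)[of "R\<^sup>2 - ?q x"] flat_exp_bounds(3)[of "?q x - r\<^sup>2"]
    flat_exp_bounds(1)[of 0 "R\<^sup>2 - ?q x"] flat_exp_bounds(1)[of 0 "?q x - r\<^sup>2"] by linarith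
 qed
 show "smooth_on UNIV (\<lambda>x. ?a x / (?a x + ?b x))"
  by (intro smooth_on_divide smooth_intros open_UNIV pos)
 fix x
 show "x \<in> ball p r ==> ?a x / (?a x + ?b x) = 1"
 proof -
  assume "x \<in> ball p r"
  then have "(dist p x)\<^sup>2 < r\<^sup>2" using r by (simp add: power_strict_mono)
  then have "?b x = 0" by (simp only: q flat_exp_def) simp
  then show ?thesis using pos[of x] by simp
 qed
 show "x \<notin> ball p R ==> ?a x / (?a x + ?b x) = 0"
 proof -
  assume "x \<notin> ball p R"
  then have "(dist p x)\<^sup>2 \<ge> R\<^sup>2" using r by (intro power_mono) auto
  then show ?thesis by (simp only: q flat_exp_def) simp
 qed
qed

text \<open>As \<open>n\<close> grows, these test functions converge, boundedly, to the indicator function of the open box.\<close>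

definition box_bump :: "real^'d => real^'d => nat => real^'d => complex"
 where "box_bump a b n y = of_real
  (\<Prod>i\<in>UNIV. flat_exp 0 (real (Suc n) * (y $ i - a $ i)) * flat_exp 0 (real (Suc n) * (b $ i - y $ i)))"

lemma box_bump_eq_0_iff: "box_bump a b n y = 0 \<longleftrightarrow> y \<notin> box a b"
proof -
 have *: "flat_exp 0 (real (Suc n) * t) = 0 \<longleftrightarrow> \<not> t > 0" for t
 proof -
  have "real (Suc n) * t > 0 \<longleftrightarrow> t > 0" by (simp add: zero_less_mult_iff)
  then show ?thesis
   using flat_exp_bounds(3)[of "real (Suc n) * t"] flat_exp_bounds(1)[of 0 "real (Suc n) * t"] by linarith
 qed
 show ?thesis
  unfolding box_bump_def of_real_eq_0_iff prod_zero_iff[OF finite] mult_eq_0_iff *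
  by (simp add: mem_box_cart not_less)
qed

lemma norm_box_bump: "norm (box_bump a b n y) \<le> 1"
proof -
 have "norm (box_bump a b n y)
   = (\<Prod>i\<in>UNIV. flat_exp 0 (real (Suc n) * (y $ i - a $ i)) * flat_exp 0 (real (Suc n) * (b $ i - y $ i)))"
  unfolding box_bump_def norm_of_real by (intro abs_of_nonneg prod_nonneg ballI mult_nonneg_nonneg flat_exp_bounds(1))
 also have "\<dots> \<le> 1"
  by (intro prod_le_1) (auto intro!: mult_nonneg_nonneg mult_le_one flat_exp_bounds)
 finally show ?thesis .
qed

lemma box_bump_LIMSEQ: "(\<lambda>n. box_bump a b n y) \<longlonglongrightarrow> indicator (box a b) y"
proof (cases "y \<in> box a b")
 case True
 have "(\<lambda>n. box_bump a b n y) \<longlonglongrightarrow> of_real (\<Prod>i\<in>(UNIV::'a set). 1 * 1)"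
  unfolding box_bump_def by (intro tendsto_intros flat_exp_LIMSEQ) (use True in \<open>auto simp: mem_box_cart\<close>)
 then show ?thesis using True by simp
next
 case False
 then show ?thesis using box_bump_eq_0_iff[of a b _ y] by simp
qed

lemma smooth_box_bump: "smooth_on UNIV (box_bump a b n)"
 unfolding box_bump_def by (intro smooth_intros smooth_on_nth open_UNIV)

lemma test_functionsI:
 "smooth_on UNIV \<phi> ==> compact K ==> K \<subseteq> \<Omega> ==> (\<And>x. x \<notin> K ==> \<phi> x = 0) ==> \<phi> \<in> test_functions \<Omega>"
 unfolding test_functions_def by blast

lemma test_functionsE:
 assumes "\<phi> \<in> test_functions \<Omega>"
 shows "\<exists>K. smooth_on UNIV \<phi> \<and> compact K \<and> K \<subseteq> \<Omega> \<and> (\<forall>x. x \<notin> K \<longrightarrow> \<phi> x = 0)"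
 using assms unfolding test_functions_def by blast

lemma test_functions_smooth: "\<phi> \<in> test_functions \<Omega> ==> smooth_on UNIV \<phi>"
 by (auto simp: test_functions_def)

lemma test_functions_zero: "\<phi> \<in> test_functions \<Omega> ==> x \<notin> \<Omega> ==> \<phi> x = 0"
 by (auto simp: test_functions_def)

lemma test_functions_mono: "\<phi> \<in> test_functions \<Omega> ==> \<Omega> \<subseteq> \<Omega>' ==> \<phi> \<in> test_functions \<Omega>'"
 unfolding test_functions_def by blast

lemma box_bump_test: "cbox a b \<subseteq> \<Omega> ==> box_bump a b n \<in> test_functions \<Omega>"
 by (rule test_functionsI[OF smooth_box_bump compact_cbox])
   (use box_bump_eq_0_iff box_subset_cbox in blast)+

lemma test_functions_mult:
 assumes O: "open \<Omega>" and a: "smooth_on \<Omega> a" and p: "\<phi> \<in> test_functions \<Omega>"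
 shows "(\<lambda>x. a x * \<phi> x) \<in> test_functions \<Omega>"
proof -
 obtain K where K: "smooth_on UNIV \<phi>" "compact K" "K \<subseteq> \<Omega>" "\<And>x. x \<notin> K ==> \<phi> x = 0"
  using test_functionsE[OF p] by blast
 have "smooth_on UNIV (\<lambda>x. a x * \<phi> x)"
 proof (rule smooth_on_local)
  fix x
  show "\<exists>U. open U \<and> x \<in> U \<and> smooth_on U (\<lambda>x. a x * \<phi> x)"
  proof (cases "x \<in> K")
   case True
   then show ?thesis
    using K O a by (intro exI[of _ \<Omega>] conjI smooth_intros smooth_on_subset[OF K(1)]) auto
  next
   case False
   have "open (- K)" using K(2) compact_imp_closed by blast
   moreover have "smooth_on (- K) (\<lambda>x. a x * \<phi> x)"
    by (rule smooth_on_cong[OF \<open>open (- K)\<close> smooth_on_const[of _ 0]]) (use K(4) in auto)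
   ultimately show ?thesis using False by blast
  qed
 qed
 then show ?thesis by (rule test_functionsI[OF _ K(2,3)]) (use K(4) in auto)
qed

lemma test_functions_cnj: "\<phi> \<in> test_functions \<Omega> ==> (\<lambda>x. cnj (\<phi> x)) \<in> test_functions \<Omega>"
 unfolding test_functions_def by (auto intro!: smooth_intros)

lemma test_functions_derivative:
 assumes "\<phi> \<in> test_functions \<Omega>"
 shows "(\<lambda>x. fderiv \<phi> x v) \<in> test_functions \<Omega>"
proof -
 obtain K where K: "smooth_on UNIV \<phi>" "compact K" "K \<subseteq> \<Omega>" "\<And>x. x \<notin> K ==> \<phi> x = 0"
  using test_functionsE[OF assms] by blast
 show ?thesis
 proof (rule test_functionsI[OF smooth_on_derivative[OF K(1)] K(2,3)])
  fix x assume "x \<notin> K"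
  then have "fderiv \<phi> x = fderiv (\<lambda>x. 0) x"
   using K(2,4) by (intro frechet_derivative_cong_open[of "- K"]) (auto intro: compact_imp_closed)
  then show "fderiv \<phi> x v = 0" by simp
 qed
qed

lemma test_functions_sum:
 assumes "finite I" "\<And>i. i \<in> I ==> f i \<in> test_functions \<Omega>"
 shows "(\<lambda>x. \<Sum>i\<in>I. f i x) \<in> test_functions \<Omega>"
proof -
 have "\<exists>K. compact K \<and> K \<subseteq> \<Omega> \<and> (\<forall>x. x \<notin> K \<longrightarrow> f i x = 0)" if "i \<in> I" for i
  using assms(2)[OF that] unfolding test_functions_def by blast
 then obtain K where K: "\<And>i. i \<in> I ==> compact (K i) \<and> K i \<subseteq> \<Omega> \<and> (\<forall>x. x \<notin> K i \<longrightarrow> f i x = 0)" by metis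
 show ?thesis
 proof (rule test_functionsI[where K = "\<Union>(K ` I)"])
  show "smooth_on UNIV (\<lambda>x. \<Sum>i\<in>I. f i x)" using assms(2) by (auto intro!: smooth_intros dest: test_functions_smooth)
  show "compact (\<Union>(K ` I))" using K assms(1) by blast
 qed (use K in \<open>auto intro!: sum.neutral\<close>)
qed

subsection \<open>Integration against test functions\<close>

text \<open>Fubini's theorem is applied to \<open>lborel\<close>, so a function integrable for the completed measure is changed on a null set.\<close>

lemma lebesgue_integrable_borel_version:
 fixes g :: "'a::euclidean_space => complex"
 assumes "integrable lebesgue g"
 shows "\<exists>g'. integrable lborel g' \<and> (AE x in lborel. g x = g' x)"
proof -
 have g: "g \<in> borel_measurable lebesgue" using assms by simp
 have "(\<lambda>x. Re (g x)) \<in> borel_measurable lebesgue" "(\<lambda>x. Im (g x)) \<in> borel_measurable lebesgue"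
  using g by (auto intro: borel_measurable_complex_iff[THEN iffD1, THEN conjunct1] borel_measurable_complex_iff[THEN iffD1, THEN conjunct2])
 then obtain a b where ab: "a \<in> borel_measurable lborel" "b \<in> borel_measurable lborel"
  "AE x in lborel. Re (g x) = a x" "AE x in lborel. Im (g x) = b x"
  using completion_ex_borel_measurable_real by metis
 let ?g = "\<lambda>x. Complex (a x) (b x)"
 have m: "?g \<in> borel_measurable lborel"
  using ab(1,2) by (simp add: borel_measurable_complex_iff)
 have e: "AE x in lborel. g x = ?g x" using ab(3,4) by eventually_elim (simp add: complex_eq_iff)
 have "integrable lebesgue ?g"
  using assms by (rule Bochner_Integration.integrable_cong_AE_imp)
   (use m AE_completion[OF e] in \<open>auto simp: eq_commute intro: measurable_completion\<close>)
 then show ?thesis using e m integrable_completion by blast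
qed

lemma continuous_on_indicator_integrable:
 fixes F :: "real^'d => complex"
 assumes F: "set_integrable lebesgue K F" and K: "compact K" and h: "continuous_on K h"
 shows "set_integrable lebesgue K (\<lambda>y. F y * h y)"
proof -
 have Ks: "K \<in> sets lebesgue" using K by (auto intro: lmeasurable_compact fmeasurableD)
 obtain C where C: "\<And>y. y \<in> K ==> norm (h y) \<le> C"
  using compact_continuous_image[OF h K] by (meson compact_imp_bounded bounded_iff imageI)
 have hm: "(\<lambda>y. indicator K y *\<^sub>R h y) \<in> borel_measurable lebesgue"
  using borel_measurable_continuous_on_indicator[OF borel_closed[OF compact_imp_closed[OF K]] h]
  by (auto intro!: measurable_completion)
 have "set_integrable lebesgue K (\<lambda>y. C *\<^sub>R F y)" using F by simp
 then show ?thesis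
  unfolding set_integrable_def
 proof (rule Bochner_Integration.integrable_bound)
  have "(\<lambda>y. (indicator K y *\<^sub>R F y) * (indicator K y *\<^sub>R h y)) \<in> borel_measurable lebesgue"
   using F hm unfolding set_integrable_def by (intro borel_measurable_times) auto
  then show "(\<lambda>y. indicator K y *\<^sub>R (F y * h y)) \<in> borel_measurable lebesgue"
   by (rule measurable_cong[THEN iffD1, rotated]) (auto simp: indicator_def)
  show "AE y in lebesgue. norm (indicator K y *\<^sub>R (F y * h y)) \<le> norm (indicator K y *\<^sub>R C *\<^sub>R F y)"
   using order_trans[OF C abs_ge_self]
   by (intro AE_I2) (auto simp: indicator_def norm_mult mult.commute[of "\<bar>C\<bar>"] intro!: mult_left_mono)
 qed
qed

definition locally_integrable_on :: "(real^'d) set => (real^'d => complex) => bool"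
 where "locally_integrable_on \<Omega> F \<longleftrightarrow> (\<forall>K. compact K \<and> K \<subseteq> \<Omega> \<longrightarrow> set_integrable lebesgue K F)"

lemma locally_integrable_test:
 assumes F: "locally_integrable_on \<Omega> F" and p: "\<phi> \<in> test_functions \<Omega>"
 shows "integrable lebesgue (\<lambda>y. F y * \<phi> y)"
  and "(LINT y:\<Omega>|lebesgue. F y * \<phi> y) = (LINT y|lebesgue. F y * \<phi> y)"
proof -
 obtain K where K: "smooth_on UNIV \<phi>" "compact K" "K \<subseteq> \<Omega>" "\<And>x. x \<notin> K ==> \<phi> x = 0"
  using test_functionsE[OF p] by blast
 have "set_integrable lebesgue K (\<lambda>y. F y * \<phi> y)"
  using F K by (intro continuous_on_indicator_integrable continuous_on_subset[OF smooth_on_continuous[OF K(1)]])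
   (auto simp: locally_integrable_on_def)
 moreover have "(\<lambda>y. indicator K y *\<^sub>R (F y * \<phi> y)) = (\<lambda>y. F y * \<phi> y)"
  using K(4) by (auto simp: indicator_def fun_eq_iff)
 ultimately show "integrable lebesgue (\<lambda>y. F y * \<phi> y)" by (simp add: set_integrable_def)
 have "(\<lambda>y. indicator \<Omega> y *\<^sub>R (F y * \<phi> y)) = (\<lambda>y. F y * \<phi> y)"
  using K(3,4) by (auto simp: indicator_def fun_eq_iff)
 then show "(LINT y:\<Omega>|lebesgue. F y * \<phi> y) = (LINT y|lebesgue. F y * \<phi> y)"
  by (simp add: set_lebesgue_integral_def)
qed

lemma locally_integrable_on_subset: "locally_integrable_on \<Omega> F ==> \<Omega>' \<subseteq> \<Omega> ==> locally_integrable_on \<Omega>' F"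
 unfolding locally_integrable_on_def by blast

lemma locally_integrable_on_mult:
 "locally_integrable_on \<Omega> F ==> continuous_on \<Omega> h ==> locally_integrable_on \<Omega> (\<lambda>y. F y * h y)"
 unfolding locally_integrable_on_def by (auto intro!: continuous_on_indicator_integrable intro: continuous_on_subset)

lemma locally_integrable_on_continuous:
 assumes "continuous_on \<Omega> h"
 shows "locally_integrable_on \<Omega> h"
 unfolding locally_integrable_on_def set_integrable_def
proof (intro allI impI, elim conjE)
 fix K assume "compact K" "K \<subseteq> \<Omega>"
 then have "integrable lborel (\<lambda>x. indicator K x *\<^sub>R h x)"
  using continuous_on_subset[OF assms] by (intro borel_integrable_compact) auto
 then show "integrable lebesgue (\<lambda>x. indicator K x *\<^sub>R h x)"
  by (subst integrable_completion) auto
qed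

lemma locally_integrable_on_diff:
 "locally_integrable_on \<Omega> F ==> locally_integrable_on \<Omega> G ==> locally_integrable_on \<Omega> (\<lambda>y. F y - G y)"
 unfolding locally_integrable_on_def by (simp add: set_integral_diff)

lemma locally_integrable_on_sum:
 "(\<And>i. i \<in> I ==> locally_integrable_on \<Omega> (F i)) ==> locally_integrable_on \<Omega> (\<lambda>y. \<Sum>i\<in>I. F i y)"
 unfolding locally_integrable_on_def set_integrable_def by (auto simp: scaleR_sum_right)

lemma open_contains_cbox_around:
 fixes x :: "'a::euclidean_space"
 assumes "open \<Omega>" "x \<in> \<Omega>"
 shows "\<exists>a b. x \<in> box a b \<and> cbox a b \<subseteq> \<Omega>"
proof -
 obtain e where e: "e > 0" "cball x e \<subseteq> \<Omega>" using assms open_contains_cball by blast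
 obtain a b where ab: "x \<in> box a b" "box a b \<subseteq> ball x e" using rational_boxes[OF e(1), of x] by blast
 have "cbox a b = closure (box a b)" using ab(1) by (intro closure_box[symmetric]) auto
 also have "\<dots> \<subseteq> cball x e" using ab(2) ball_subset_cball[of x e] by (intro closure_minimal) auto
 finally show ?thesis using ab e by blast
qed

text \<open>Approximation of the indicator function of a box by test functions, with dominated convergence.\<close>

lemma integral_box_eq_0:
 fixes F :: "real^'d => complex"
 assumes F: "locally_integrable_on \<Omega> F" and ab: "cbox a b \<subseteq> \<Omega>"
  and z: "\<And>\<phi>. \<phi> \<in> test_functions \<Omega> ==> (LINT y|lebesgue. F y * \<phi> y) = 0"
  and g: "integrable lborel g" "AE y in lborel. indicator (box a b) y *\<^sub>R F y = g y"
 shows "(LINT y:box c d|lborel. g y) = 0"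
proof -
 have gm [measurable]: "g \<in> borel_measurable borel" using g(1) by auto
 obtain c' d' where I: "box c d \<inter> box a b = box c' d'" unfolding box_Int_box by blast
 have "(LINT y:box c d|lborel. g y) = (LINT y|lborel. indicator (box c' d') y * g y)"
  unfolding set_lebesgue_integral_def
 proof (rule integral_cong_AE)
  show "AE y in lborel. indicator (box c d) y *\<^sub>R g y = indicator (box c' d') y * g y"
   using g(2)
  proof eventually_elim
   case (elim y)
   then show ?case unfolding I[symmetric] by (cases "y \<in> box a b") (auto simp: indicator_def)
  qed
 qed auto
 also have "\<dots> = 0"
 proof (cases "box c' d' = {}")
  case False
  have "cbox c' d' = closure (box c' d')" using False by (rule closure_box[symmetric])
  also have "\<dots> \<subseteq> cbox a b" using I box_subset_cbox[of a b] by (intro closure_minimal) auto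
  finally have sub: "cbox c' d' \<subseteq> \<Omega>" using ab by blast
  have m: "(\<lambda>y. g y * box_bump c' d' n y) \<in> borel_measurable lborel" for n
   using borel_measurable_continuous_onI[OF smooth_on_continuous[OF smooth_box_bump[of c' d' n]]]
   by (intro borel_measurable_times) auto
  have "(LINT y|lborel. g y * box_bump c' d' n y) = 0" for n
  proof -
   have "AE y in lborel. g y * box_bump c' d' n y = F y * box_bump c' d' n y"
    using g(2)
   proof eventually_elim
    case (elim y)
    then show ?case
     using box_bump_eq_0_iff[of c' d' n y] unfolding I[symmetric]
     by (cases "y \<in> box a b") (auto simp: indicator_def)
   qed
   then have "(LINT y|lebesgue. g y * box_bump c' d' n y) = (LINT y|lebesgue. F y * box_bump c' d' n y)"
    using m[of n] locally_integrable_test(1)[OF F box_bump_test[OF sub]]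
    by (intro integral_cong_AE AE_completion) (auto intro: measurable_completion)
   then show ?thesis using z[OF box_bump_test[OF sub, of n]] integral_completion[OF m] by simp
  qed
  moreover have "(\<lambda>n. LINT y|lborel. g y * box_bump c' d' n y) \<longlonglongrightarrow> (LINT y|lborel. indicator (box c' d') y * g y)"
  proof (rule integral_dominated_convergence[where w = "\<lambda>y. norm (g y)"])
   show "AE y in lborel. (\<lambda>n. g y * box_bump c' d' n y) \<longlonglongrightarrow> indicator (box c' d') y * g y"
   proof (rule AE_I2)
    fix y
    have "(\<lambda>n. g y * box_bump c' d' n y) \<longlonglongrightarrow> g y * indicator (box c' d') y"
     by (intro tendsto_mult tendsto_const box_bump_LIMSEQ)
    then show "(\<lambda>n. g y * box_bump c' d' n y) \<longlonglongrightarrow> indicator (box c' d') y * g y"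
     by (simp add: mult.commute)
   qed
   show "AE y in lborel. norm (g y * box_bump c' d' n y) \<le> norm (g y)" for n
    using mult_left_mono[OF norm_box_bump norm_ge_zero] by (intro AE_I2) (simp add: norm_mult)
  qed (use g m in auto)
  ultimately show ?thesis by (simp add: LIMSEQ_const_iff)
 qed simp
 finally show ?thesis .
qed

lemma locally_integrable_eq_0_box:
 fixes F :: "real^'d => complex"
 assumes F: "locally_integrable_on \<Omega> F" and ab: "cbox a b \<subseteq> \<Omega>"
  and z: "\<And>\<phi>. \<phi> \<in> test_functions \<Omega> ==> (LINT y|lebesgue. F y * \<phi> y) = 0"
 shows "AE y in lborel. y \<in> box a b \<longrightarrow> F y = 0"
proof -
 let ?g = "\<lambda>y. indicator (box a b) y *\<^sub>R F y"
 have "set_integrable lebesgue (cbox a b) F" using F ab by (auto simp: locally_integrable_on_def)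
 then have "set_integrable lebesgue (box a b) F" by (rule set_integrable_subset) (auto simp: box_subset_cbox)
 then have "integrable lebesgue ?g" by (simp add: set_integrable_def)
 then obtain g where g: "integrable lborel g" "AE y in lborel. ?g y = g y"
  using lebesgue_integrable_borel_version by blast
 note box0 = integral_box_eq_0[OF F ab z g]
 have sint: "set_integrable lborel A g" if "A \<in> sets borel" for A
  using that g(1) by (simp add: set_integrable_def integrable_mult_indicator)
 have tot: "(LINT y|lborel. g y) = 0"
 proof -
  have "(LINT y:box a b|lborel. g y) = (LINT y|lborel. g y)"
   unfolding set_lebesgue_integral_def
  proof (rule integral_cong_AE)
   show "AE y in lborel. indicator (box a b) y *\<^sub>R g y = g y"
    using g(2) by eventually_elim (auto simp: indicator_def split: if_splits)
  qed (use g(1) in auto)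
  then show ?thesis using box0 by simp
 qed
 have "(LINT y:A|lborel. g y) = 0" if "A \<in> sets borel" for A
 proof -
  have borel: "sets (borel :: (real^'d) measure) = sigma_sets UNIV (range (\<lambda>(a, b). box a b))"
   unfolding borel_eq_box by (rule sets_measure_of) auto
  have I: "Int_stable (range (\<lambda>(a, b). box a (b :: real^'d)))"
   unfolding Int_stable_def by (auto simp: box_Int_box)
  have P: "range (\<lambda>(a, b). box a (b :: real^'d)) \<subseteq> Pow UNIV" by simp
  show ?thesis
   using I P that[unfolded borel]
  proof (induction A rule: sigma_sets_induct_disjoint)
   case (basic A)
   then show ?case using box0 by auto
  next
   case empty
   then show ?case by (simp add: set_lebesgue_integral_def)
  next
   case (compl A)
   then have A: "A \<in> sets borel" by (simp add: borel)
   have "(LINT y:A \<union> (UNIV - A)|lborel. g y) = (LINT y:A|lborel. g y) + (LINT y:UNIV - A|lborel. g y)"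
    using A by (intro set_integral_Un sint) auto
   moreover have "A \<union> (UNIV - A) = UNIV" by auto
   ultimately show ?case using compl(2) tot by (simp add: set_lebesgue_integral_def)
  next
   case (union A)
   then have A: "A i \<in> sets borel" for i by (auto simp: borel)
   have "(LINT y:(\<Union>i. A i)|lborel. g y) = (\<Sum>i. LINT y:A i|lborel. g y)"
    using A union(1) by (intro lebesgue_integral_countable_add sint) (auto simp: disjoint_family_on_def)
   then show ?case using union(3) by simp
  qed
 qed
 then have "AE y in lborel. g y = 0" using sigma_finite_measure.density_zero[OF lborel.sigma_finite_measure_axioms g(1)] by simp
 then show ?thesis using g(2) by eventually_elim (auto simp: indicator_def)
qed

text \<open>The fundamental lemma of the calculus of variations: the bump functions of boxes show that the
 function has integral zero over every box in the domain, hence over every Borel set.\<close>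

lemma locally_integrable_eq_0:
 fixes F :: "real^'d => complex"
 assumes O: "open \<Omega>" and F: "locally_integrable_on \<Omega> F"
  and z: "\<And>\<phi>. \<phi> \<in> test_functions \<Omega> ==> (LINT y|lebesgue. F y * \<phi> y) = 0"
 shows "AE y in lebesgue. y \<in> \<Omega> \<longrightarrow> F y = 0"
proof -
 define B where "B = {X. \<exists>a b. X = box a b \<and> cbox a b \<subseteq> \<Omega>}"
 have "\<Union>B = \<Omega>"
 proof
  show "\<Omega> \<subseteq> \<Union>B" unfolding B_def using open_contains_cbox_around[OF O] by blast
  show "\<Union>B \<subseteq> \<Omega>" unfolding B_def using box_subset_cbox by blast
 qed
 moreover have "\<exists>D\<subseteq>B. countable D \<and> \<Union>D = \<Union>B"
 proof -
  have "open X" if "X \<in> B" for X using that by (auto simp: B_def)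
  then obtain D where "D \<subseteq> B" "countable D" "\<Union>D = \<Union>B" by (rule Lindelof)
  then show ?thesis by blast
 qed
 ultimately obtain D where D: "countable D" "D \<subseteq> B" "\<Union>D = \<Omega>" by blast
 have "AE y in lborel. y \<in> X \<longrightarrow> F y = 0" if "X \<in> D" for X
  using D(2) that locally_integrable_eq_0_box[OF F _ z] unfolding B_def by blast
 then have "AE y in lborel. \<forall>X\<in>D. y \<in> X \<longrightarrow> F y = 0"
  by (subst AE_ball_countable[OF D(1)]) blast
 then have "AE y in lborel. y \<in> \<Omega> \<longrightarrow> F y = 0" by eventually_elim (use D(3) in blast)
 then show ?thesis by (rule AE_completion)
qed

section \<open>Fourier analysis\<close>

subsection \<open>Integrals of products and Gaussians\<close>

lemma lborel_integral_prod:
 fixes f :: "'a::euclidean_space => real => complex"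
 assumes "\<And>b. b \<in> Basis ==> integrable lborel (f b)"
 shows "integrable lborel (\<lambda>x::'a. \<Prod>b\<in>Basis. f b (x \<bullet> b))"
  and "(\<integral>x. (\<Prod>b\<in>Basis. f b (x \<bullet> b)) \<partial>(lborel :: 'a measure)) = (\<Prod>b\<in>Basis. \<integral>t. f b t \<partial>lborel)"
proof -
 interpret product_sigma_finite "\<lambda>b::'a. lborel :: real measure" by standard
 let ?T = "\<lambda>f. \<Sum>b\<in>Basis. f b *\<^sub>R (b :: 'a)"
 have T [measurable]: "?T \<in> measurable (\<Pi>\<^sub>M b\<in>Basis. lborel) borel" by measurable
 have m [measurable]: "f b \<in> borel_measurable borel" if "b \<in> Basis" for b using assms[OF that] by auto
 have F: "(\<lambda>x::'a. \<Prod>b\<in>Basis. f b (x \<bullet> b)) \<in> borel_measurable borel"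
  by (intro borel_measurable_prod measurable_compose[OF _ m]) auto
 have e: "(\<Prod>b\<in>Basis. f b (?T x \<bullet> b)) = (\<Prod>b\<in>Basis. f b (x b))" for x
  by (intro prod.cong) (auto simp: inner_sum_left_Basis)
 show "integrable lborel (\<lambda>x::'a. \<Prod>b\<in>Basis. f b (x \<bullet> b))"
  unfolding lborel_eq[where 'a = 'a] integrable_distr_eq[OF T F] e
  by (rule product_integrable_prod) (use assms in auto)
 show "(\<integral>x. (\<Prod>b\<in>Basis. f b (x \<bullet> b)) \<partial>(lborel :: 'a measure)) = (\<Prod>b\<in>Basis. \<integral>t. f b t \<partial>lborel)"
  unfolding lborel_eq[where 'a = 'a] integral_distr[OF T F] e
  by (rule product_integral_prod) (use assms in auto)
qed

lemma gaussian_fourier_real: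
 fixes a \<epsilon> :: real
 assumes e: "\<epsilon> > 0"
 shows "integrable lborel (\<lambda>t. complex_of_real (exp (- ((\<epsilon> * t)\<^sup>2 / 2))) * cis (a * t))"
  and "(\<integral>t. complex_of_real (exp (- ((\<epsilon> * t)\<^sup>2 / 2))) * cis (a * t) \<partial>lborel)
   = of_real (sqrt (2 * pi) / \<epsilon> * exp (- ((a / \<epsilon>)\<^sup>2 / 2)))"
proof -
 let ?f = "\<lambda>t. complex_of_real (exp (- (t\<^sup>2 / 2))) * cis (a / \<epsilon> * t)"
 have m: "(\<lambda>t. cis (c * t)) \<in> borel_measurable borel" for c :: real
  by (intro borel_measurable_continuous_onI continuous_intros)
 have nd: "std_normal_density t *\<^sub>R iexp (c * t) = of_real (1 / sqrt (2 * pi)) * (of_real (exp (- (t\<^sup>2 / 2))) * cis (c * t))" for c t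
  by (simp add: std_normal_density_def cis_conv_exp scaleR_conv_of_real)
 have "integrable lborel (\<lambda>t. std_normal_density t *\<^sub>R iexp (c * t))" for c
  by (rule Bochner_Integration.integrable_bound[OF integrable_normal_density[of 1 0]])
    (use m[of c] in \<open>auto simp: cis_conv_exp\<close>)
 then have "integrable lborel (\<lambda>t. of_real (sqrt (2 * pi)) * (std_normal_density t *\<^sub>R iexp (a / \<epsilon> * t)))"
  by (intro integrable_mult_right)
 moreover have "of_real (sqrt (2 * pi)) * (std_normal_density t *\<^sub>R iexp (a / \<epsilon> * t)) = ?f t" for t
  unfolding nd mult.assoc[symmetric] of_real_mult[symmetric] by simp
 ultimately have i: "integrable lborel ?f" by simp
 have "(\<integral>t. std_normal_density t *\<^sub>R iexp (a / \<epsilon> * t) \<partial>lborel) = of_real (exp (- ((a / \<epsilon>)\<^sup>2) / 2))"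
  using fun_cong[OF char_std_normal_distribution, of "a / \<epsilon>"] unfolding char_def
  by (subst (asm) integral_density) (use m[of "a / \<epsilon>"] in \<open>auto simp: cis_conv_exp\<close>)
 then have v: "(\<integral>t. ?f t \<partial>lborel) = of_real (sqrt (2 * pi) * exp (- ((a / \<epsilon>)\<^sup>2 / 2)))"
  unfolding nd by (simp add: field_simps)
 have s: "?f (0 + \<epsilon> * t) = complex_of_real (exp (- ((\<epsilon> * t)\<^sup>2 / 2))) * cis (a * t)" for t
  using e by simp
 show "integrable lborel (\<lambda>t. complex_of_real (exp (- ((\<epsilon> * t)\<^sup>2 / 2))) * cis (a * t))"
  using lborel_integrable_real_affine[OF i, of \<epsilon> 0] e unfolding s by simp
 show "(\<integral>t. complex_of_real (exp (- ((\<epsilon> * t)\<^sup>2 / 2))) * cis (a * t) \<partial>lborel)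
   = of_real (sqrt (2 * pi) / \<epsilon> * exp (- ((a / \<epsilon>)\<^sup>2 / 2)))"
  using lborel_integral_real_affine[of \<epsilon> ?f 0] e v unfolding s
  by (simp add: scaleR_conv_of_real field_simps)
qed

definition gaussian :: "'a::euclidean_space => complex"
 where "gaussian x = of_real (exp (- ((norm x)\<^sup>2 / 2)))"

lemma gaussian_simps: "norm (gaussian x) = exp (- ((norm x)\<^sup>2 / 2))" "norm (gaussian x) \<le> 1" "gaussian 0 = 1"
 by (auto simp: gaussian_def)

lemma gaussian_measurable [measurable]: "gaussian \<in> borel_measurable borel"
 unfolding gaussian_def by (intro borel_measurable_continuous_onI continuous_intros) auto

text \<open>The Gaussian is its own Fourier transform up to a constant; coordinatewise this is the characteristic function of the
normal distribution.\<close>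

lemma gaussian_fourier:
 fixes u :: "'a::euclidean_space"
 assumes e: "\<epsilon> > 0"
 shows "integrable lborel (\<lambda>x::'a. gaussian (\<epsilon> *\<^sub>R x) * cis (u \<bullet> x))"
  and "(\<integral>x. gaussian (\<epsilon> *\<^sub>R x) * cis (u \<bullet> x) \<partial>lborel) = of_real ((sqrt (2 * pi) / \<epsilon>) ^ DIM('a)) * gaussian (u /\<^sub>R \<epsilon>)"
proof -
 have g: "gaussian y = (\<Prod>b\<in>Basis. of_real (exp (- ((y \<bullet> b)\<^sup>2 / 2))))" for y :: 'a
 proof -
  have "- ((norm y)\<^sup>2 / 2) = (\<Sum>b\<in>Basis. - ((y \<bullet> b)\<^sup>2 / 2))"
   by (simp add: norm_eq_sqrt_inner euclidean_inner[of y y] power2_eq_square sum_nonneg sum_divide_distrib sum_negf)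
  then show ?thesis by (simp add: gaussian_def exp_sum)
 qed
 have c: "cis (u \<bullet> x) = (\<Prod>b\<in>Basis. cis ((u \<bullet> b) * (x \<bullet> b)))" for x
 proof -
  have "cis (\<Sum>b\<in>B. f b) = (\<Prod>b\<in>B. cis (f b))" for B and f :: "'a => real"
   by (induction B rule: infinite_finite_induct) (auto simp flip: cis_mult)
  then show ?thesis by (simp add: euclidean_inner[of u x])
 qed
 have p: "gaussian (\<epsilon> *\<^sub>R x) * cis (u \<bullet> x)
   = (\<Prod>b\<in>Basis. complex_of_real (exp (- ((\<epsilon> * (x \<bullet> b))\<^sup>2 / 2))) * cis ((u \<bullet> b) * (x \<bullet> b)))" for x
  unfolding g c by (simp add: prod.distrib)
 note L = lborel_integral_prod[of "\<lambda>b t. complex_of_real (exp (- ((\<epsilon> * t)\<^sup>2 / 2))) * cis ((u \<bullet> b) * t)"]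
 show "integrable lborel (\<lambda>x::'a. gaussian (\<epsilon> *\<^sub>R x) * cis (u \<bullet> x))"
  unfolding p by (rule L(1)) (rule gaussian_fourier_real(1)[OF e])
 have "(\<integral>x. gaussian (\<epsilon> *\<^sub>R x) * cis (u \<bullet> x) \<partial>lborel)
   = (\<Prod>b\<in>(Basis::'a set). of_real (sqrt (2 * pi) / \<epsilon> * exp (- (((u \<bullet> b) / \<epsilon>)\<^sup>2 / 2))))"
  unfolding p by (subst L(2)) (simp_all only: gaussian_fourier_real[OF e])
 also have "\<dots> = of_real ((sqrt (2 * pi) / \<epsilon>) ^ DIM('a)) * gaussian (u /\<^sub>R \<epsilon>)"
 proof -
  have t: "(u /\<^sub>R \<epsilon>) \<bullet> b = (u \<bullet> b) / \<epsilon>" for b by (simp add: divide_inverse mult.commute)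
  show ?thesis unfolding g t of_real_mult prod.distrib by (simp only: prod_constant of_real_power)
 qed
 finally show "(\<integral>x. gaussian (\<epsilon> *\<^sub>R x) * cis (u \<bullet> x) \<partial>lborel) = of_real ((sqrt (2 * pi) / \<epsilon>) ^ DIM('a)) * gaussian (u /\<^sub>R \<epsilon>)" .
qed

lemma gaussian_integral:
 shows "\<epsilon> > 0 ==> integrable lborel (\<lambda>x::'a::euclidean_space. gaussian (\<epsilon> *\<^sub>R x))"
  and "integrable lborel (gaussian :: 'a => complex)"
  and "(\<integral>x. gaussian x \<partial>(lborel :: 'a measure)) = of_real (sqrt (2 * pi) ^ DIM('a))"
 using gaussian_fourier[of \<epsilon> "0::'a"] gaussian_fourier[of 1 "0::'a"] by (auto simp: gaussian_simps)

lemma Fubini_bounded_kernel: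
 fixes a :: "'a::euclidean_space => complex" and b :: "'b::euclidean_space => complex"
 assumes a: "integrable lborel a" and b: "integrable lborel b"
  and k: "(\<lambda>(x, y). k x y) \<in> borel_measurable borel" "\<And>x y. norm (k x y) \<le> 1"
 shows "(\<integral>x. a x * (\<integral>y. b y * k x y \<partial>lborel) \<partial>lborel) = (\<integral>y. b y * (\<integral>x. a x * k x y \<partial>lborel) \<partial>lborel)"
proof -
 have am [measurable]: "a \<in> borel_measurable borel" and bm [measurable]: "b \<in> borel_measurable borel"
  using a b by auto
 have km [measurable]: "(\<lambda>p. k (fst p) (snd p)) \<in> borel_measurable (lborel \<Otimes>\<^sub>M lborel)"
  using k(1) by (simp add: case_prod_unfold lborel_prod)
 have kx [measurable]: "k x \<in> borel_measurable borel" for x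
  using measurable_Pair2[OF km, of x] by simp
 have bk: "integrable lborel (\<lambda>y. b y * k x y)" for x
  by (rule Bochner_Integration.integrable_bound[OF b])
    (use k(2) in \<open>auto simp: norm_mult intro!: mult_left_le AE_I2\<close>)
 have I: "integrable (lborel \<Otimes>\<^sub>M lborel) (\<lambda>p. a (fst p) * (b (snd p) * k (fst p) (snd p)))"
 proof (rule Bochner_Integration.integrable_bound)
  show "integrable (lborel \<Otimes>\<^sub>M lborel) (\<lambda>p. a (fst p) * b (snd p))"
  proof (rule lborel_pair.Fubini_integrable)
   have "(\<lambda>x. \<integral>y. norm (a (fst (x, y)) * b (snd (x, y))) \<partial>lborel) = (\<lambda>x. norm (a x) * (\<integral>y. norm (b y) \<partial>lborel))"
    by (simp add: norm_mult)
   then show "integrable lborel (\<lambda>x. \<integral>y. norm (a (fst (x, y)) * b (snd (x, y))) \<partial>lborel)" using a by simp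
  qed (use b in auto)
  show "AE p in lborel \<Otimes>\<^sub>M lborel. norm (a (fst p) * (b (snd p) * k (fst p) (snd p))) \<le> norm (a (fst p) * b (snd p))"
   using k(2) by (auto simp: norm_mult intro!: AE_I2 mult_left_mono mult_left_le)
 qed measurable
 have "(\<integral>x. a x * (\<integral>y. b y * k x y \<partial>lborel) \<partial>lborel) = (\<integral>x. (\<integral>y. a x * (b y * k x y) \<partial>lborel) \<partial>lborel)"
  by simp
 also have "\<dots> = (\<integral>y. (\<integral>x. a x * (b y * k x y) \<partial>lborel) \<partial>lborel)"
  using lborel_pair.Fubini_integral[of "\<lambda>x y. a x * (b y * k x y)"] I by (simp add: case_prod_unfold)
 also have "\<dots> = (\<integral>y. b y * (\<integral>x. a x * k x y \<partial>lborel) \<partial>lborel)"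
  unfolding mult.left_commute[of "a _"] integral_mult_right_zero ..
 finally show ?thesis .
qed

definition fourier :: "('a::euclidean_space => complex) => 'a => complex"
 where "fourier g \<eta> = (\<integral>y. g y * cis (- (y \<bullet> \<eta>)) \<partial>lborel)"

lemma cis_inner_measurable: "(\<lambda>(x, y :: 'a::euclidean_space). cis (x \<bullet> y)) \<in> borel_measurable borel"
 "(\<lambda>(x, y :: 'a). cis (- (x \<bullet> y))) \<in> borel_measurable borel"
 "(\<lambda>x :: 'a. cis (x \<bullet> y)) \<in> borel_measurable borel" "(\<lambda>x :: 'a. cis (- (x \<bullet> y))) \<in> borel_measurable borel"
 unfolding case_prod_unfold by (intro borel_measurable_continuous_onI continuous_intros)+

lemma fourier_measurable:
 fixes g :: "'a::euclidean_space => complex"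
 assumes "integrable lborel g"
 shows "fourier g \<in> borel_measurable borel"
proof -
 have [measurable]: "g \<in> borel_measurable borel" using assms by auto
 have [measurable]: "(\<lambda>p. cis (- (snd p \<bullet> fst p))) \<in> borel_measurable (borel \<Otimes>\<^sub>M (borel :: 'a measure))"
  unfolding borel_prod by (intro borel_measurable_continuous_onI continuous_intros)
 have "(\<lambda>(\<eta>, y). g y * cis (- (y \<bullet> \<eta>))) \<in> borel_measurable (borel \<Otimes>\<^sub>M lborel)"
  unfolding case_prod_unfold by measurable
 then show ?thesis
  unfolding fourier_def[abs_def] by (rule lborel.borel_measurable_lebesgue_integral)
qed

lemma norm_fourier_le: "integrable lborel g ==> norm (fourier g \<eta>) \<le> (\<integral>y. norm (g y) \<partial>lborel)"
 unfolding fourier_def by (rule norm_integral_le) (auto simp: norm_mult)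

lemma integrable_mult_cis:
 assumes "integrable lborel g"
 shows "integrable lborel (\<lambda>y. g y * cis (- (y \<bullet> \<eta>)))"
proof (rule Bochner_Integration.integrable_bound[OF assms])
 show "(\<lambda>y. g y * cis (- (y \<bullet> \<eta>))) \<in> borel_measurable lborel"
  using assms cis_inner_measurable(4)[of \<eta>] by (intro borel_measurable_times) auto
qed (auto simp: norm_mult)

text \<open>Parseval's identity against bounded continuous functions, with a Gaussian factor that makes the left side converge; it takes the
place of Fourier inversion.\<close>

lemma parseval_regularized:
 fixes g \<psi> :: "'a::euclidean_space => complex"
 assumes g: "integrable lborel g" and p: "integrable lborel \<psi>" and c: "continuous_on UNIV \<psi>"
  and C: "\<And>x. norm (\<psi> x) \<le> C"
 shows "(\<lambda>n. \<integral>\<zeta>. gaussian (inverse (real (Suc n)) *\<^sub>R \<zeta>) * (fourier g \<zeta> * fourier \<psi> (- \<zeta>)) \<partial>lborel)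
  \<longlonglongrightarrow> of_real ((2 * pi) ^ DIM('a)) * (\<integral>y. g y * \<psi> y \<partial>lborel)"
proof -
 define s where "s = complex_of_real (sqrt (2 * pi) ^ DIM('a))"
 have ss: "s * s = of_real ((2 * pi) ^ DIM('a))"
  unfolding s_def of_real_mult[symmetric] power_mult_distrib[symmetric] by simp
 define \<Psi> where "\<Psi> n y = s * (\<integral>t. \<psi> (y + inverse (real (Suc n)) *\<^sub>R t) * gaussian t \<partial>lborel)" for n y
 have pm [measurable]: "\<psi> \<in> borel_measurable borel" using p by auto
 have step: "(\<integral>\<zeta>. gaussian (\<epsilon> *\<^sub>R \<zeta>) * (fourier g \<zeta> * fourier \<psi> (- \<zeta>)) \<partial>lborel) = (\<integral>y. g y * \<Psi> n y \<partial>lborel)"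
  if e: "\<epsilon> = inverse (real (Suc n))" for \<epsilon> n
 proof -
  have e0: "\<epsilon> > 0" using e by simp
  note wI = gaussian_integral(1)[OF e0]
  have fm: "(\<lambda>\<zeta>. fourier \<psi> (- \<zeta>)) \<in> borel_measurable borel"
   using measurable_compose[OF borel_measurable_uminus[OF measurable_ident] fourier_measurable[OF p]] by simp
  have wfI: "integrable lborel (\<lambda>\<zeta>. gaussian (\<epsilon> *\<^sub>R \<zeta>) * fourier \<psi> (- \<zeta>))"
  proof (rule Bochner_Integration.integrable_bound)
   show "integrable lborel (\<lambda>\<zeta>::'a. of_real (\<integral>y. norm (\<psi> y) \<partial>lborel) * gaussian (\<epsilon> *\<^sub>R \<zeta>))"
    by (intro integrable_mult_right wI)
   show "(\<lambda>\<zeta>. gaussian (\<epsilon> *\<^sub>R \<zeta>) * fourier \<psi> (- \<zeta>)) \<in> borel_measurable lborel"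
    using fm wI by (intro borel_measurable_times) auto
   show "AE \<zeta> in lborel. norm (gaussian (\<epsilon> *\<^sub>R \<zeta>) * fourier \<psi> (- \<zeta>)) \<le> norm (of_real (\<integral>y. norm (\<psi> y) \<partial>lborel) * gaussian (\<epsilon> *\<^sub>R \<zeta>))"
    using mult_right_mono[OF norm_fourier_le[OF p] norm_ge_zero]
    by (intro AE_I2) (simp add: norm_mult mult.commute[of "norm (gaussian _)"])
  qed
  have "(\<integral>\<zeta>. gaussian (\<epsilon> *\<^sub>R \<zeta>) * (fourier g \<zeta> * fourier \<psi> (- \<zeta>)) \<partial>lborel)
    = (\<integral>\<zeta>. (gaussian (\<epsilon> *\<^sub>R \<zeta>) * fourier \<psi> (- \<zeta>)) * (\<integral>y. g y * cis (- (\<zeta> \<bullet> y)) \<partial>lborel) \<partial>lborel)"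
   by (simp add: fourier_def[of g] mult_ac inner_commute)
  also have "\<dots> = (\<integral>y. g y * (\<integral>\<zeta>. (gaussian (\<epsilon> *\<^sub>R \<zeta>) * fourier \<psi> (- \<zeta>)) * cis (- (\<zeta> \<bullet> y)) \<partial>lborel) \<partial>lborel)"
   by (rule Fubini_bounded_kernel[OF wfI g cis_inner_measurable(2)]) simp
  also have "\<dots> = (\<integral>y. g y * \<Psi> n y \<partial>lborel)"
  proof (rule Bochner_Integration.integral_cong[OF refl])
   fix y
   have "(\<integral>\<zeta>. (gaussian (\<epsilon> *\<^sub>R \<zeta>) * fourier \<psi> (- \<zeta>)) * cis (- (\<zeta> \<bullet> y)) \<partial>lborel)
     = (\<integral>\<zeta>. gaussian (\<epsilon> *\<^sub>R \<zeta>) * (\<integral>x. \<psi> x * cis ((x - y) \<bullet> \<zeta>) \<partial>lborel) \<partial>lborel)"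
   proof (rule Bochner_Integration.integral_cong[OF refl])
    fix \<zeta>
    have "fourier \<psi> (- \<zeta>) * cis (- (\<zeta> \<bullet> y)) = (\<integral>x. \<psi> x * cis (x \<bullet> \<zeta>) * cis (- (\<zeta> \<bullet> y)) \<partial>lborel)"
     by (simp add: fourier_def)
    also have "\<dots> = (\<integral>x. \<psi> x * cis ((x - y) \<bullet> \<zeta>) \<partial>lborel)"
     by (simp add: mult.assoc cis_mult inner_diff_left inner_commute[of \<zeta> y])
    finally show "gaussian (\<epsilon> *\<^sub>R \<zeta>) * fourier \<psi> (- \<zeta>) * cis (- (\<zeta> \<bullet> y))
     = gaussian (\<epsilon> *\<^sub>R \<zeta>) * (\<integral>x. \<psi> x * cis ((x - y) \<bullet> \<zeta>) \<partial>lborel)" by (simp add: mult.assoc)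
   qed
   also have "\<dots> = (\<integral>x. \<psi> x * (\<integral>\<zeta>. gaussian (\<epsilon> *\<^sub>R \<zeta>) * cis ((x - y) \<bullet> \<zeta>) \<partial>lborel) \<partial>lborel)"
   proof (rule Fubini_bounded_kernel[OF wI p])
    show "(\<lambda>(\<zeta>, x). cis ((x - y) \<bullet> \<zeta>)) \<in> borel_measurable borel"
     unfolding case_prod_unfold by (intro borel_measurable_continuous_onI continuous_intros)
   qed simp
   also have "\<dots> = (\<integral>x. \<psi> x * (of_real ((sqrt (2 * pi) / \<epsilon>) ^ DIM('a)) * gaussian ((x - y) /\<^sub>R \<epsilon>)) \<partial>lborel)"
    by (simp only: gaussian_fourier(2)[OF e0])
   also have "\<dots> = \<epsilon> ^ DIM('a) *\<^sub>R (\<integral>t. \<psi> (y + \<epsilon> *\<^sub>R t) * (of_real ((sqrt (2 * pi) / \<epsilon>) ^ DIM('a)) * gaussian ((y + \<epsilon> *\<^sub>R t - y) /\<^sub>R \<epsilon>)) \<partial>lborel)"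
   proof -
    let ?f = "\<lambda>x. \<psi> x * (of_real ((sqrt (2 * pi) / \<epsilon>) ^ DIM('a)) * gaussian ((x - y) /\<^sub>R \<epsilon>))"
    have fm [measurable]: "?f \<in> borel_measurable borel" by measurable
    have "integral\<^sup>L lborel ?f = integral\<^sup>L (density (distr lborel borel (\<lambda>x. y + \<epsilon> *\<^sub>R x)) (\<lambda>_. ennreal (\<bar>\<epsilon>\<bar> ^ DIM('a)))) ?f"
     using lborel_affine[of \<epsilon> y] e0 by simp
    also have "\<dots> = (\<integral>x. \<bar>\<epsilon>\<bar> ^ DIM('a) *\<^sub>R ?f x \<partial>distr lborel borel (\<lambda>x. y + \<epsilon> *\<^sub>R x))"
     by (rule integral_density) auto
    also have "\<dots> = (\<integral>t. \<bar>\<epsilon>\<bar> ^ DIM('a) *\<^sub>R ?f (y + \<epsilon> *\<^sub>R t) \<partial>lborel)"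
     by (rule integral_distr) auto
    finally show ?thesis using e0 by simp
   qed
   also have "\<dots> = \<Psi> n y"
   proof -
    have e1: "\<psi> (y + \<epsilon> *\<^sub>R t) * (of_real ((sqrt (2 * pi) / \<epsilon>) ^ DIM('a)) * gaussian ((y + \<epsilon> *\<^sub>R t - y) /\<^sub>R \<epsilon>))
      = of_real ((sqrt (2 * pi) / \<epsilon>) ^ DIM('a)) * (\<psi> (y + \<epsilon> *\<^sub>R t) * gaussian t)" for t
     using e0 by simp
    have e2: "complex_of_real (\<epsilon> ^ DIM('a)) * of_real ((sqrt (2 * pi) / \<epsilon>) ^ DIM('a)) = s"
     unfolding s_def of_real_mult[symmetric] using e0 by (simp add: power_divide)
    show ?thesis
     unfolding \<Psi>_def e[symmetric] scaleR_conv_of_real[of "\<epsilon> ^ DIM('a)"] e1 integral_mult_right_zero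
     unfolding mult.assoc[symmetric] e2 ..
   qed
   finally show "g y * (\<integral>\<zeta>. (gaussian (\<epsilon> *\<^sub>R \<zeta>) * fourier \<psi> (- \<zeta>)) * cis (- (\<zeta> \<bullet> y)) \<partial>lborel) = g y * \<Psi> n y" by simp
  qed
  finally show ?thesis .
 qed
 have gI: "integrable lborel (\<lambda>t. C * norm (gaussian (t::'a)))"
  by (intro integrable_mult_right integrable_norm gaussian_integral(2))
 have \<Psi>lim: "(\<lambda>n. \<Psi> n y) \<longlonglongrightarrow> s * (\<psi> y * s)" for y
 proof -
  have "(\<lambda>n. \<integral>t. \<psi> (y + inverse (real (Suc n)) *\<^sub>R t) * gaussian t \<partial>lborel) \<longlonglongrightarrow> (\<integral>t. \<psi> y * gaussian (t::'a) \<partial>lborel)"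
  proof (rule integral_dominated_convergence[where w = "\<lambda>t. C * norm (gaussian (t::'a))"])
   show "AE t in lborel. (\<lambda>n. \<psi> (y + inverse (real (Suc n)) *\<^sub>R t) * gaussian t) \<longlonglongrightarrow> \<psi> y * gaussian t"
   proof (rule AE_I2)
    fix t
    have "(\<lambda>n. y + inverse (real (Suc n)) *\<^sub>R t) \<longlonglongrightarrow> y + 0 *\<^sub>R t"
     by (intro tendsto_intros LIMSEQ_inverse_real_of_nat)
    then have "(\<lambda>n. y + inverse (real (Suc n)) *\<^sub>R t) \<longlonglongrightarrow> y" by simp
    then show "(\<lambda>n. \<psi> (y + inverse (real (Suc n)) *\<^sub>R t) * gaussian t) \<longlonglongrightarrow> \<psi> y * gaussian t"
     using c by (intro tendsto_mult tendsto_const isCont_tendsto_compose[of _ \<psi>]) (simp_all add: continuous_on_eq_continuous_at)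
   qed
   show "AE t in lborel. norm (\<psi> (y + inverse (real (Suc n)) *\<^sub>R t) * gaussian t) \<le> C * norm (gaussian t)" for n
    using C by (intro AE_I2) (auto simp: norm_mult intro!: mult_right_mono)
   show "integrable lborel (\<lambda>t::'a. C * norm (gaussian t))" by (rule gI)
  qed measurable
  then show ?thesis unfolding \<Psi>_def
   using gaussian_integral(3)[where 'a = 'a] by (intro tendsto_mult tendsto_const) (simp add: s_def)
 qed
 have \<Psi>b: "norm (\<Psi> n y) \<le> norm s * (\<integral>t. C * norm (gaussian (t::'a)) \<partial>lborel)" for n y
  unfolding \<Psi>_def norm_mult
  by (intro mult_left_mono norm_integral_le gI) (use C in \<open>auto simp: norm_mult intro!: mult_right_mono\<close>)
 have "(\<lambda>n. \<integral>y. g y * \<Psi> n y \<partial>lborel) \<longlonglongrightarrow> (\<integral>y. g y * (s * (\<psi> y * s)) \<partial>lborel)"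
 proof (rule integral_dominated_convergence)
  have gm [measurable]: "g \<in> borel_measurable borel" using g by auto
  show "AE y in lborel. (\<lambda>n. g y * \<Psi> n y) \<longlonglongrightarrow> g y * (s * (\<psi> y * s))"
   by (intro AE_I2 tendsto_mult tendsto_const \<Psi>lim)
  show "AE y in lborel. norm (g y * \<Psi> n y) \<le> norm (g y) * (norm s * (\<integral>t. C * norm (gaussian (t::'a)) \<partial>lborel))" for n
   using \<Psi>b by (intro AE_I2) (auto simp: norm_mult[of "g _"] intro!: mult_left_mono)
  show "integrable lborel (\<lambda>y. norm (g y) * (norm s * (\<integral>t. C * norm (gaussian (t::'a)) \<partial>lborel)))" using g by simp
  show "(\<lambda>y. g y * (s * (\<psi> y * s))) \<in> borel_measurable lborel" by measurable
  show "(\<lambda>y. g y * \<Psi> n y) \<in> borel_measurable lborel" for n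
  proof -
   have "(\<lambda>p. \<psi> (fst p + inverse (real (Suc n)) *\<^sub>R snd p) * gaussian (snd p :: 'a)) \<in> borel_measurable (borel \<Otimes>\<^sub>M lborel)"
    by measurable
   then have "(\<lambda>y. \<integral>t. \<psi> (y + inverse (real (Suc n)) *\<^sub>R t) * gaussian t \<partial>lborel) \<in> borel_measurable borel"
    by (intro lborel.borel_measurable_lebesgue_integral) (simp add: case_prod_unfold)
   then show ?thesis unfolding \<Psi>_def by measurable
  qed
 qed
 moreover have "(\<integral>y. g y * (s * (\<psi> y * s)) \<partial>lborel) = (s * s) * (\<integral>y. g y * \<psi> y \<partial>lborel)"
  by (simp add: mult_ac flip: integral_mult_right_zero)
 ultimately show ?thesis using step unfolding ss by simp
qed

subsection \<open>Rapid decrease\<close>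

definition rapidly_decreasing_on :: "'a::real_normed_vector set => ('a => complex) => bool"
 where "rapidly_decreasing_on V f \<longleftrightarrow> (\<forall>r::nat. \<exists>C. \<forall>\<eta>\<in>V. norm (f \<eta>) \<le> C / (1 + norm \<eta>) ^ r)"

lemma rapidly_decreasing_onE:
 assumes "rapidly_decreasing_on V f"
 shows "\<exists>C\<ge>0. \<forall>\<eta>\<in>V. norm (f \<eta>) \<le> C / (1 + norm \<eta>) ^ r"
proof -
 obtain C where C: "\<And>\<eta>. \<eta> \<in> V ==> norm (f \<eta>) \<le> C / (1 + norm \<eta>) ^ r"
  using assms unfolding rapidly_decreasing_on_def by blast
 have "C / (1 + norm \<eta>) ^ r \<le> \<bar>C\<bar> / (1 + norm \<eta>) ^ r" for \<eta> :: 'a by (intro divide_right_mono) auto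
 then show ?thesis using C by (intro exI[of _ "\<bar>C\<bar>"]) (auto intro: order_trans)
qed

lemma integrable_power_decay:
 "integrable lborel (\<lambda>x::'a::euclidean_space. 1 / (1 + norm x) ^ (2 * DIM('a)))"
proof -
 have "integrable lborel (\<lambda>t::real. inverse (1 + t\<^sup>2))"
  using integrable_inverse_1_plus_square by (simp add: set_integrable_def einterval_eq)
 then have "integrable lborel (\<lambda>t::real. complex_of_real (inverse (1 + t\<^sup>2)))" by (rule integrable_of_real)
 then have I: "integrable lborel (\<lambda>x::'a. \<Prod>b\<in>Basis. complex_of_real (inverse (1 + (x \<bullet> b)\<^sup>2)))"
  by (rule lborel_integral_prod(1))
 show ?thesis
 proof (rule Bochner_Integration.integrable_bound[OF I])
  show "(\<lambda>x::'a. 1 / (1 + norm x) ^ (2 * DIM('a))) \<in> borel_measurable lborel" by measurable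
  show "AE x::'a in lborel. norm (1 / (1 + norm x) ^ (2 * DIM('a)))
    \<le> norm (\<Prod>b\<in>Basis. complex_of_real (inverse (1 + (x \<bullet> b)\<^sup>2)))"
  proof (rule AE_I2)
   fix x :: 'a
   have le: "1 + (x \<bullet> b)\<^sup>2 \<le> (1 + norm x)\<^sup>2" if "b \<in> Basis" for b
   proof -
    have "(x \<bullet> b)\<^sup>2 \<le> (norm x)\<^sup>2" using Basis_le_norm[OF that, of x] abs_le_square_iff[of "x \<bullet> b" "norm x"] by simp
    then show ?thesis by (simp add: power2_sum add_increasing2)
   qed
   have "norm (1 / (1 + norm x) ^ (2 * DIM('a))) = (\<Prod>b\<in>(Basis::'a set). inverse ((1 + norm x)\<^sup>2))"
    by (simp add: power_mult divide_inverse power_inverse)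
   also have "\<dots> \<le> (\<Prod>b\<in>(Basis::'a set). inverse (1 + (x \<bullet> b)\<^sup>2))"
    by (intro prod_mono conjI le_imp_inverse_le le) (auto simp: add_pos_nonneg)
   also have "\<dots> = norm (\<Prod>b\<in>(Basis::'a set). complex_of_real (inverse (1 + (x \<bullet> b)\<^sup>2)))"
    unfolding prod_norm[symmetric] norm_of_real by (intro prod.cong) (auto simp: add_nonneg_nonneg)
   finally show "norm (1 / (1 + norm x) ^ (2 * DIM('a))) \<le> norm (\<Prod>b\<in>Basis. complex_of_real (inverse (1 + (x \<bullet> b)\<^sup>2)))" .
  qed
 qed
qed

lemma rapidly_decreasing_integrable:
 fixes f :: "'a::euclidean_space => complex"
 assumes "rapidly_decreasing_on UNIV f" "f \<in> borel_measurable borel"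
 shows "integrable lborel f"
proof -
 obtain C where C: "\<And>\<eta>. norm (f \<eta>) \<le> C / (1 + norm \<eta>) ^ (2 * DIM('a))"
  using rapidly_decreasing_onE[OF assms(1)] by blast
 show ?thesis
 proof (rule Bochner_Integration.integrable_bound)
  show "integrable lborel (\<lambda>x::'a. C * (1 / (1 + norm x) ^ (2 * DIM('a))))"
   by (intro integrable_mult_right integrable_power_decay)
  show "AE x in lborel. norm (f x) \<le> norm (C * (1 / (1 + norm x) ^ (2 * DIM('a))))"
   using C by (intro AE_I2) (auto intro: order_trans[OF C] simp: divide_right_mono)
 qed (use assms(2) in simp)
qed

lemma rapidly_decreasing_mult_norm:
 fixes f g :: "'a::real_normed_vector => complex"
 assumes f: "rapidly_decreasing_on V f" and g: "\<And>\<eta>. norm (g \<eta>) \<le> K * norm \<eta> * norm (f \<eta>)"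
 shows "rapidly_decreasing_on V g"
 unfolding rapidly_decreasing_on_def
proof
 fix r :: nat
 obtain C where C: "C \<ge> 0" "\<And>\<eta>. \<eta> \<in> V ==> norm (f \<eta>) \<le> C / (1 + norm \<eta>) ^ (Suc r)"
  using rapidly_decreasing_onE[OF f] by blast
 have "norm (g \<eta>) \<le> (\<bar>K\<bar> * C) / (1 + norm \<eta>) ^ r" if "\<eta> \<in> V" for \<eta>
 proof -
  let ?t = "1 + norm \<eta>"
  have t: "?t > 0" by (simp add: add_pos_nonneg)
  have "norm (g \<eta>) \<le> \<bar>K\<bar> * ?t * (C / ?t ^ Suc r)"
   by (rule order_trans[OF g]) (intro mult_mono C(2) that; auto)
  also have "\<dots> = (\<bar>K\<bar> * C) / ?t ^ r" using t by (simp add: divide_simps)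
  finally show ?thesis .
 qed
 then show "\<exists>C. \<forall>\<eta>\<in>V. norm (g \<eta>) \<le> C / (1 + norm \<eta>) ^ r" by blast
qed

lemma has_derivative_cis: "(cis has_derivative (\<lambda>r. r *\<^sub>R (\<i> * cis t))) (at t)"
 using has_vector_derivative_iexp[of t UNIV] unfolding has_vector_derivative_def cis_conv_exp by simp

lemma has_derivative_cis_inner:
 fixes \<zeta> :: "'a::euclidean_space"
 shows "((\<lambda>y. cis (y \<bullet> \<zeta>)) has_derivative (\<lambda>v. (v \<bullet> \<zeta>) *\<^sub>R (\<i> * cis (y \<bullet> \<zeta>)))) (at y)"
 using diff_chain_at[OF bounded_linear_imp_has_derivative[OF bounded_linear_inner_left] has_derivative_cis]
 by (simp add: o_def)

lemma smooth_cis_inner: "smooth_on UNIV (\<lambda>y::'a::euclidean_space. cis (y \<bullet> \<zeta>))"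
proof -
 have "Ck_on k UNIV (\<lambda>y::'a. cis (y \<bullet> \<zeta>))" for k
 proof (induction k)
  case 0
  then show ?case by (simp add: continuous_intros)
 next
  case (Suc k)
  show ?case
  proof (rule Ck_on_SucI[OF _ has_derivative_cis_inner])
   show "Ck_on k UNIV (\<lambda>y. (v \<bullet> \<zeta>) *\<^sub>R (\<i> * cis (y \<bullet> \<zeta>)))" for v
    by (intro Ck_on_bilinear[OF bounded_bilinear_scaleR] Ck_on_bilinear[OF bounded_bilinear_mult] Ck_on_const Suc open_UNIV)
  qed simp
 qed
 then show ?thesis by (simp add: smooth_on_def)
qed

text \<open>Each derivative of the integrand costs one factor \<open>norm \<zeta>\<close>, which rapid decrease absorbs.\<close>

lemma Ck_on_fourier_integral:
 fixes a :: "'a::euclidean_space => complex"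
 assumes "rapidly_decreasing_on UNIV a" "a \<in> borel_measurable borel"
 shows "Ck_on k UNIV (\<lambda>y. \<integral>\<zeta>. a \<zeta> * cis (y \<bullet> \<zeta>) \<partial>lborel)"
 using assms
proof (induction k arbitrary: a)
 have D: "((\<lambda>y. \<integral>\<zeta>. a \<zeta> * cis (y \<bullet> \<zeta>) \<partial>lborel) has_derivative
   (\<lambda>v. \<integral>\<zeta>. a \<zeta> * ((v \<bullet> \<zeta>) *\<^sub>R (\<i> * cis (y \<bullet> \<zeta>))) \<partial>lborel)) (at y)"
  if a: "rapidly_decreasing_on UNIV a" and m: "a \<in> borel_measurable borel" for a :: "'a => complex" and y
 proof (rule has_derivative_parametric_integral(2)[where e = 1 and B = "\<lambda>\<zeta>. norm (a \<zeta>) * norm \<zeta>"])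
  have "rapidly_decreasing_on UNIV (\<lambda>\<zeta>. a \<zeta> * of_real (norm \<zeta>))"
   by (rule rapidly_decreasing_mult_norm[OF a, of _ 1]) (simp add: norm_mult mult.commute)
  then have "integrable lborel (\<lambda>\<zeta>. norm (a \<zeta> * of_real (norm \<zeta>)))"
   using m by (intro integrable_norm rapidly_decreasing_integrable) auto
  then show "integrable lborel (\<lambda>\<zeta>. norm (a \<zeta>) * norm \<zeta>)" by (simp add: norm_mult)
  show "integrable lborel (\<lambda>\<zeta>. a \<zeta> * cis (y \<bullet> \<zeta>))" for y
   using integrable_mult_cis[OF rapidly_decreasing_integrable[OF a m], of "- y"] by (simp add: inner_commute)
  fix y \<zeta>
  show "((\<lambda>y. a \<zeta> * cis (y \<bullet> \<zeta>)) has_derivative (\<lambda>v. a \<zeta> * ((v \<bullet> \<zeta>) *\<^sub>R (\<i> * cis (y \<bullet> \<zeta>))))) (at y)"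
   by (rule bounded_linear.has_derivative[OF bounded_linear_mult_right has_derivative_cis_inner])
  show "norm (a \<zeta> * ((v \<bullet> \<zeta>) *\<^sub>R (\<i> * cis (y \<bullet> \<zeta>)))) \<le> norm (a \<zeta>) * norm \<zeta> * norm v" for v
   using mult_left_mono[OF Cauchy_Schwarz_ineq2[of v \<zeta>] norm_ge_zero[of "a \<zeta>"]] by (simp add: norm_mult mult_ac)
 qed simp
 {
  case (0 a)
  show ?case
   unfolding Ck_on.simps
   by (intro continuous_at_imp_continuous_on ballI has_derivative_continuous[OF D[OF 0]])
 next
  case (Suc k a)
  show ?case
  proof (rule Ck_on_SucI[OF open_UNIV D[OF Suc.prems]])
   fix v
   have "rapidly_decreasing_on UNIV (\<lambda>\<zeta>. a \<zeta> * ((v \<bullet> \<zeta>) *\<^sub>R \<i>))"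
   proof (rule rapidly_decreasing_mult_norm[OF Suc.prems(1), of _ "norm v"])
    show "norm (a \<zeta> * ((v \<bullet> \<zeta>) *\<^sub>R \<i>)) \<le> norm v * norm \<zeta> * norm (a \<zeta>)" for \<zeta>
     using mult_right_mono[OF Cauchy_Schwarz_ineq2[of v \<zeta>] norm_ge_zero[of "a \<zeta>"]] by (simp add: norm_mult mult_ac)
   qed
   moreover have "(\<lambda>\<zeta>. a \<zeta> * ((v \<bullet> \<zeta>) *\<^sub>R \<i>)) \<in> borel_measurable borel" using Suc.prems(2) by measurable
   ultimately have "Ck_on k UNIV (\<lambda>y. \<integral>\<zeta>. a \<zeta> * ((v \<bullet> \<zeta>) *\<^sub>R \<i>) * cis (y \<bullet> \<zeta>) \<partial>lborel)" by (rule Suc.IH)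
   then show "Ck_on k UNIV (\<lambda>y. \<integral>\<zeta>. a \<zeta> * ((v \<bullet> \<zeta>) *\<^sub>R (\<i> * cis (y \<bullet> \<zeta>))) \<partial>lborel)"
    by (simp add: mult.assoc)
  qed
 }
qed

subsection \<open>Fourier transforms of test functions\<close>

lemma integrable_compact_support:
 fixes h :: "'a::euclidean_space => complex"
 assumes "continuous_on UNIV h" "compact K" "\<And>x. x \<notin> K ==> h x = 0"
 shows "integrable lborel h"
proof -
 have "integrable lborel (\<lambda>x. indicator K x *\<^sub>R h x)"
  using assms(1,2) by (intro borel_integrable_compact continuous_on_subset[OF assms(1)]) auto
 moreover have "(\<lambda>x. indicator K x *\<^sub>R h x) = h" using assms(3) by (auto simp: indicator_def fun_eq_iff)
 ultimately show ?thesis by simp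
qed

lemma integrable_test_function: "\<phi> \<in> test_functions \<Omega> ==> integrable lborel \<phi>"
 using test_functionsE[of \<phi> \<Omega>] integrable_compact_support smooth_on_continuous by metis

lemma test_function_bounded: 
 assumes "\<phi> \<in> test_functions \<Omega>" shows "\<exists>C\<ge>0. \<forall>x. norm (\<phi> x) \<le> C"
proof -
 obtain K where K: "smooth_on UNIV \<phi>" "compact K" "K \<subseteq> \<Omega>" "\<And>x. x \<notin> K ==> \<phi> x = 0"
  using test_functionsE[OF assms] by blast
 have "compact (\<phi> ` K)" using compact_continuous_image continuous_on_subset[OF smooth_on_continuous[OF K(1)]] K(2) by blast
 then obtain C where C: "\<And>x. x \<in> K ==> norm (\<phi> x) \<le> C" by (meson compact_imp_bounded bounded_iff imageI)
 have "norm (\<phi> x) \<le> \<bar>C\<bar>" for x using C[of x] K(4)[of x] by (cases "x \<in> K") auto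
 then show ?thesis by (intro exI[of _ "\<bar>C\<bar>"]) auto
qed

text \<open>Translation invariance of Lebesgue measure, differentiated.\<close>

lemma integral_derivative_test_function:
 assumes p: "\<phi> \<in> test_functions \<Omega>"
 shows "(\<integral>y. fderiv \<phi> y v \<partial>lborel) = 0"
proof -
 obtain K where K: "smooth_on UNIV \<phi>" "compact K" "K \<subseteq> \<Omega>" "\<And>x. x \<notin> K ==> \<phi> x = 0"
  using test_functionsE[OF p] by blast
 obtain R where R: "\<And>x. x \<in> K ==> norm x \<le> R"
  using compact_imp_bounded[OF K(2)] unfolding bounded_iff by blast
 obtain C where C: "C \<ge> 0" "\<And>x. norm (fderiv \<phi> x v) \<le> C"
  using test_function_bounded[OF test_functions_derivative[OF p]] by blast
 let ?H = "\<lambda>(h::real) y. \<phi> (y + h *\<^sub>R v)"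
 have D: "(\<phi> has_derivative fderiv \<phi> x) (at x)" for x
  using smooth_on_has_derivative[OF K(1)] by simp
 have far: "y + h *\<^sub>R v \<notin> K" if "y \<notin> cball 0 (R + norm v)" "h \<in> ball 0 1" for y h
 proof
  assume "y + h *\<^sub>R v \<in> K"
  then have "norm (y + h *\<^sub>R v) \<le> R" using R by auto
  moreover have "norm (h *\<^sub>R v) \<le> norm v" using that(2) mult_right_mono[of "\<bar>h\<bar>" 1 "norm v"] by simp
  ultimately have "norm y \<le> R + norm v" using norm_triangle_ineq4[of "y + h *\<^sub>R v" "h *\<^sub>R v"] by simp
  then show False using that(1) by simp
 qed
 have Hi: "integrable lborel (?H h)" "(\<integral>y. ?H h y \<partial>lborel) = (\<integral>y. \<phi> y \<partial>lborel)" for h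
 proof -
  have pm: "\<phi> \<in> borel_measurable borel" using integrable_test_function[OF p] by auto
  have d: "distr lborel borel (\<lambda>y. y + h *\<^sub>R v) = lborel"
  proof -
   have "(\<lambda>y. y + h *\<^sub>R v) = (+) (h *\<^sub>R v)" by (simp add: fun_eq_iff add.commute)
   then show ?thesis using lborel_distr_plus[of "h *\<^sub>R v"] by (simp only:)
  qed
  have m: "(\<lambda>y. y + h *\<^sub>R v) \<in> measurable lborel borel" by simp
  show "integrable lborel (?H h)"
   using integrable_distr_eq[OF m pm] integrable_test_function[OF p] unfolding d by simp
  show "(\<integral>y. ?H h y \<partial>lborel) = (\<integral>y. \<phi> y \<partial>lborel)"
   using integral_distr[OF m pm] unfolding d by simp
 qed
 have "((\<lambda>h. \<integral>y. ?H h y \<partial>lborel) has_derivative (\<lambda>r. \<integral>y. r *\<^sub>R fderiv \<phi> (y + 0 *\<^sub>R v) v \<partial>lborel)) (at (0::real))"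
 proof (rule has_derivative_parametric_integral(2)[where e = 1 and B = "\<lambda>y. C * indicator (cball 0 (R + norm v)) y"])
  fix h :: real and y assume h: "h \<in> ball 0 1"
  have "((\<lambda>h. y + h *\<^sub>R v) has_derivative (\<lambda>r. r *\<^sub>R v)) (at h)" by (auto intro!: derivative_eq_intros)
  from diff_chain_at[OF this D] show "((\<lambda>h. ?H h y) has_derivative (\<lambda>r. r *\<^sub>R fderiv \<phi> (y + h *\<^sub>R v) v)) (at h)"
   using has_derivative_linear[OF D] by (simp add: o_def linear_cmul)
  show "norm (r *\<^sub>R fderiv \<phi> (y + h *\<^sub>R v) v) \<le> C * indicator (cball 0 (R + norm v)) y * norm r" for r
  proof (cases "y \<in> cball 0 (R + norm v)")
   case True
   then show ?thesis using mult_right_mono[OF C(2), of "\<bar>r\<bar>"] by (simp add: mult.commute)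
  next
   case False
   have "fderiv \<phi> (y + h *\<^sub>R v) = fderiv (\<lambda>_. 0) (y + h *\<^sub>R v)"
    using far[OF False h] K(2,4) by (intro frechet_derivative_cong_open[of "- K"]) (auto intro: compact_imp_closed)
   then show ?thesis using C(1) by simp
  qed
 next
  show "integrable lborel (\<lambda>y. C * indicator (cball 0 (R + norm v)) (y :: real^'a))"
   by (intro integrable_mult_right integrable_real_indicator) (simp_all add: emeasure_bounded_finite[unfolded infinity_ennreal_def])
 qed (use Hi in auto)
 then have "((\<lambda>h::real. \<integral>y. \<phi> y \<partial>lborel) has_derivative (\<lambda>r. \<integral>y. r *\<^sub>R fderiv \<phi> y v \<partial>lborel)) (at 0)"
  unfolding Hi(2) by simp
 from has_derivative_unique[OF this has_derivative_const]
 have "(\<integral>y. 1 *\<^sub>R fderiv \<phi> y v \<partial>lborel) = 0" by meson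
 then show ?thesis by simp
qed

lemma test_functions_mult_cis:
 assumes "\<phi> \<in> test_functions \<Omega>"
 shows "(\<lambda>y. \<phi> y * cis (- (y \<bullet> \<eta>))) \<in> test_functions \<Omega>"
proof -
 obtain K where K: "smooth_on UNIV \<phi>" "compact K" "K \<subseteq> \<Omega>" "\<And>x. x \<notin> K ==> \<phi> x = 0"
  using test_functionsE[OF assms] by blast
 show ?thesis
  by (rule test_functionsI[OF _ K(2,3)])
    (use K smooth_cis_inner[of "- \<eta>"] in \<open>auto intro!: smooth_intros\<close>)
qed

lemma fourier_derivative:
 assumes p: "\<phi> \<in> test_functions \<Omega>"
 shows "fourier (\<lambda>y. fderiv \<phi> y v) \<eta> = of_real (v \<bullet> \<eta>) * \<i> * fourier \<phi> \<eta>"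
proof -
 have "fderiv (\<lambda>y. \<phi> y * cis (- (y \<bullet> \<eta>))) y v
   = fderiv \<phi> y v * cis (- (y \<bullet> \<eta>)) - of_real (v \<bullet> \<eta>) * \<i> * (\<phi> y * cis (- (y \<bullet> \<eta>)))" for y
 proof -
  have "((\<lambda>y. \<phi> y * cis (y \<bullet> (- \<eta>))) has_derivative
    (\<lambda>v. \<phi> y * ((v \<bullet> (- \<eta>)) *\<^sub>R (\<i> * cis (y \<bullet> (- \<eta>)))) + fderiv \<phi> y v * cis (y \<bullet> (- \<eta>)))) (at y)"
   by (intro has_derivative_mult has_derivative_cis_inner smooth_on_has_derivative[OF test_functions_smooth[OF p]]) simp
  from frechet_derivative_eqI[OF this] show ?thesis by (simp add: scaleR_conv_of_real mult_ac)
 qed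
 then have "0 = (\<integral>y. fderiv \<phi> y v * cis (- (y \<bullet> \<eta>)) - of_real (v \<bullet> \<eta>) * \<i> * (\<phi> y * cis (- (y \<bullet> \<eta>))) \<partial>lborel)"
  using integral_derivative_test_function[OF test_functions_mult_cis[OF p, of \<eta>], of v] by simp
 also have "\<dots> = fourier (\<lambda>y. fderiv \<phi> y v) \<eta> - of_real (v \<bullet> \<eta>) * \<i> * fourier \<phi> \<eta>"
  unfolding fourier_def
  by (subst Bochner_Integration.integral_diff)
    (auto intro!: integrable_mult_cis integrable_mult_right integrable_test_function[OF test_functions_derivative[OF p]] integrable_test_function[OF p])
 finally show ?thesis by simp
qed

lemma power_one_plus_norm_le:
 fixes \<eta> :: "'a::euclidean_space"
 shows "(1 + norm \<eta>) ^ r \<le> (real DIM('a) + 1) ^ r * (1 + (\<Sum>b\<in>Basis. \<bar>\<eta> \<bullet> b\<bar> ^ r))"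
proof -
 define M where "M = Max (insert 1 ((\<lambda>b. \<bar>\<eta> \<bullet> b\<bar>) ` Basis))"
 have M: "1 \<le> M" "\<And>b. b \<in> Basis ==> \<bar>\<eta> \<bullet> b\<bar> \<le> M" unfolding M_def by (auto intro: Max_ge simp del: Max_insert)
 have "norm \<eta> \<le> (\<Sum>b\<in>Basis. \<bar>\<eta> \<bullet> b\<bar>)" by (rule norm_le_l1)
 also have "\<dots> \<le> real DIM('a) * M" using sum_mono[of Basis "\<lambda>b. \<bar>\<eta> \<bullet> b\<bar>" "\<lambda>_. M"] M by simp
 finally have "1 + norm \<eta> \<le> (real DIM('a) + 1) * M" using M(1) by (simp add: algebra_simps)
 then have "(1 + norm \<eta>) ^ r \<le> ((real DIM('a) + 1) * M) ^ r" by (intro power_mono) auto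
 moreover have "M ^ r \<le> 1 + (\<Sum>b\<in>Basis. \<bar>\<eta> \<bullet> b\<bar> ^ r)"
 proof -
  have "M \<in> insert 1 ((\<lambda>b. \<bar>\<eta> \<bullet> b\<bar>) ` Basis)" unfolding M_def by (intro Max_in) auto
  then consider "M = 1" | b where "b \<in> Basis" "M = \<bar>\<eta> \<bullet> b\<bar>" by blast
  then show ?thesis
  proof cases
   case 1
   then show ?thesis by (simp add: sum_nonneg)
  next
   case (2 b)
   then show ?thesis using member_le_sum[of b Basis "\<lambda>b. \<bar>\<eta> \<bullet> b\<bar> ^ r"] by simp
  qed
 qed
 ultimately show ?thesis
  by (simp add: power_mult_distrib) (meson mult_left_mono order_trans zero_le_power add_nonneg_nonneg of_nat_0_le_iff zero_le_one)
qed

text \<open>Integration by parts in the direction of each basis vector.\<close>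

lemma fourier_test_rapidly_decreasing:
 fixes \<phi> :: "real^'d => complex"
 assumes p: "\<phi> \<in> test_functions \<Omega>"
 shows "rapidly_decreasing_on UNIV (fourier \<phi>)"
 unfolding rapidly_decreasing_on_def
proof
 fix r :: nat
 have "\<exists>C. \<forall>\<eta>. \<bar>\<eta> \<bullet> b\<bar> ^ r * norm (fourier \<phi> \<eta>) \<le> C" for b
  using p
 proof (induction r arbitrary: \<phi>)
  case 0
  then show ?case using norm_fourier_le[OF integrable_test_function] by auto
 next
  case (Suc r)
  obtain C where "\<And>\<eta>. \<bar>\<eta> \<bullet> b\<bar> ^ r * norm (fourier (\<lambda>y. fderiv \<phi> y b) \<eta>) \<le> C"
   using Suc.IH[OF test_functions_derivative[OF Suc.prems]] by blast
  then show ?case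
   unfolding fourier_derivative[OF Suc.prems] by (intro exI[of _ C]) (simp add: norm_mult inner_commute mult_ac)
 qed
 then obtain C where C: "\<And>b \<eta>. \<bar>\<eta> \<bullet> b\<bar> ^ r * norm (fourier \<phi> \<eta>) \<le> C b" by metis
 let ?K = "(real DIM(real^'d) + 1) ^ r * ((\<integral>y. norm (\<phi> y) \<partial>lborel) + (\<Sum>b\<in>Basis. C b))"
 have "norm (fourier \<phi> \<eta>) \<le> ?K / (1 + norm \<eta>) ^ r" for \<eta>
 proof -
  have "(1 + norm \<eta>) ^ r * norm (fourier \<phi> \<eta>) \<le> (real DIM(real^'d) + 1) ^ r * (1 + (\<Sum>b\<in>Basis. \<bar>\<eta> \<bullet> b\<bar> ^ r)) * norm (fourier \<phi> \<eta>)"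
   by (intro mult_right_mono power_one_plus_norm_le) auto
  also have "\<dots> = (real DIM(real^'d) + 1) ^ r * (norm (fourier \<phi> \<eta>) + (\<Sum>b\<in>Basis. \<bar>\<eta> \<bullet> b\<bar> ^ r * norm (fourier \<phi> \<eta>)))"
   by (simp add: distrib_right sum_distrib_right mult.assoc)
  also have "\<dots> \<le> ?K"
   by (intro mult_left_mono add_mono sum_mono C norm_fourier_le integrable_test_function[OF p]) auto
  finally show ?thesis by (simp add: pos_le_divide_eq add_pos_nonneg mult.commute)
 qed
 then show "\<exists>C. \<forall>\<eta>\<in>UNIV. norm (fourier \<phi> \<eta>) \<le> C / (1 + norm \<eta>) ^ r" by blast
qed

subsection \<open>Localization of the wavefront set\<close>

text \<open>Multiplication by a test function preserves rapid decrease in a smaller cone: the Fourier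
 transform of the product is a convolution with a rapidly decreasing function, whose mass near the
 origin only moves points within the cone.\<close>

lemma rapidly_decreasing_localization:
 fixes g :: "real^'d => complex"
 assumes g: "integrable lborel g" and V: "open V" "\<xi> \<in> V" "\<And>\<eta> t. \<eta> \<in> V ==> t > 0 ==> t *\<^sub>R \<eta> \<in> V"
  and \<xi>: "norm \<xi> = 1" and dec: "rapidly_decreasing_on V (fourier g)"
 shows "\<exists>V'. open V' \<and> \<xi> \<in> V' \<and> (\<forall>\<eta>\<in>V'. \<forall>t>0. t *\<^sub>R \<eta> \<in> V') \<and>
  (\<forall>\<psi> \<Omega>. \<psi> \<in> test_functions \<Omega> \<longrightarrow> rapidly_decreasing_on V' (fourier (\<lambda>y. \<psi> y * g y)))"
proof -
 obtain e where e: "e > 0" "ball \<xi> e \<subseteq> V" using V(1,2) openE by blast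
 define c where "c = min (e / 2) (1 / 2)"
 have c: "c > 0" "c \<le> 1/2" "2 * c \<le> e" using e by (auto simp: c_def)
 define V' where "V' = {\<eta>. norm (\<eta> - norm \<eta> *\<^sub>R \<xi>) < c * norm \<eta>}"
 have "open V'" unfolding V'_def by (intro open_Collect_less continuous_intros)
 moreover have "\<xi> \<in> V'" using \<xi> c by (simp add: V'_def)
 moreover have "t *\<^sub>R \<eta> \<in> V'" if "\<eta> \<in> V'" "t > 0" for \<eta> t
 proof -
  have "norm (t *\<^sub>R \<eta> - norm (t *\<^sub>R \<eta>) *\<^sub>R \<xi>) = t * norm (\<eta> - norm \<eta> *\<^sub>R \<xi>)"
   using that(2) norm_scaleR[of t "\<eta> - norm \<eta> *\<^sub>R \<xi>"] by (simp add: scaleR_diff_right)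
  then show ?thesis using that by (simp add: V'_def)
 qed
 moreover have "rapidly_decreasing_on V' (fourier (\<lambda>y. \<psi> y * g y))" if p: "\<psi> \<in> test_functions \<Omega>" for \<psi> \<Omega>
  unfolding rapidly_decreasing_on_def
 proof
  fix r :: nat
  let ?D = "2 * DIM(real^'d)"
  have pI: "integrable lborel \<psi>" by (rule integrable_test_function[OF p])
  obtain C1 where C1: "C1 \<ge> 0" "\<And>\<eta>. \<eta> \<in> V ==> norm (fourier g \<eta>) \<le> C1 / (1 + norm \<eta>) ^ r"
   using rapidly_decreasing_onE[OF dec] by blast
  obtain C2 where C2: "C2 \<ge> 0" "\<And>\<eta>. norm (fourier \<psi> \<eta>) \<le> C2 / (1 + norm \<eta>) ^ ?D"
   using rapidly_decreasing_onE[OF fourier_test_rapidly_decreasing[OF p]] by blast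
  obtain C3 where C3: "C3 \<ge> 0" "\<And>\<eta>. norm (fourier \<psi> \<eta>) \<le> C3 / (1 + norm \<eta>) ^ (r + ?D)"
   using rapidly_decreasing_onE[OF fourier_test_rapidly_decreasing[OF p]] by blast
  define G where "G = (\<integral>y. norm (g y) \<partial>lborel)"
  have G: "G \<ge> 0" unfolding G_def by (intro integral_nonneg_AE) auto
  define K where "K = 2 ^ r * (C1 * C2) + (G * C3) / c ^ r"
  have K: "2 ^ r * (C1 * C2) \<le> K" "(G * C3) / c ^ r \<le> K" "K \<ge> 0"
   using C1 C2 C3 G c by (auto simp: K_def)
  define I where "I = (\<integral>x. 1 / (1 + norm (x::real^'d)) ^ ?D \<partial>lborel)"
  have "norm (fourier (\<lambda>y. \<psi> y * g y) \<eta>) \<le> (K * I / (2 * pi) ^ DIM(real^'d)) / (1 + norm \<eta>) ^ r" if \<eta>: "\<eta> \<in> V'" for \<eta>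
  proof -
   \<comment> \<open>For small \<open>\<zeta>\<close> the point \<open>\<eta> + \<zeta>\<close> stays in the cone \<open>V\<close>; for large \<open>\<zeta>\<close> the second factor is small.\<close>
  have pt: "norm (fourier g (\<eta> + \<zeta>)) * norm (fourier \<psi> (- \<zeta>)) \<le> K / (1 + norm \<eta>) ^ r * (1 / (1 + norm \<zeta>) ^ ?D)" for \<zeta>
   proof (cases "norm \<zeta> < c * norm \<eta>")
    case True
    have n0: "norm \<eta> > 0" using True c by (metis mult_zero_right norm_ge_zero norm_zero not_le zero_less_norm_iff)
    have "norm ((\<eta> + \<zeta>) - norm \<eta> *\<^sub>R \<xi>) \<le> norm (\<eta> - norm \<eta> *\<^sub>R \<xi>) + norm \<zeta>"
     using norm_triangle_ineq[of "\<eta> - norm \<eta> *\<^sub>R \<xi>" \<zeta>] by (simp add: algebra_simps)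
    also have "\<dots> < norm \<eta> * e"
    proof -
     have "norm (\<eta> - norm \<eta> *\<^sub>R \<xi>) + norm \<zeta> < c * norm \<eta> + c * norm \<eta>" using \<eta> True by (simp add: V'_def)
     also have "\<dots> \<le> norm \<eta> * e" using mult_left_mono[OF c(3) norm_ge_zero[of \<eta>]] by (simp add: algebra_simps)
     finally show ?thesis .
    qed
    finally have "norm ((\<eta> + \<zeta>) - norm \<eta> *\<^sub>R \<xi>) < norm \<eta> * e" .
    moreover have "norm \<eta> * norm ((\<eta> + \<zeta>) /\<^sub>R norm \<eta> - \<xi>) = norm ((\<eta> + \<zeta>) - norm \<eta> *\<^sub>R \<xi>)"
     using n0 norm_scaleR[of "norm \<eta>" "(\<eta> + \<zeta>) /\<^sub>R norm \<eta> - \<xi>"] by (simp add: scaleR_diff_right)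
    ultimately have "norm \<eta> * norm ((\<eta> + \<zeta>) /\<^sub>R norm \<eta> - \<xi>) < norm \<eta> * e" by (simp only:)
    then have "norm ((\<eta> + \<zeta>) /\<^sub>R norm \<eta> - \<xi>) < e" using n0 mult_less_cancel_left_pos by blast
    then have "(\<eta> + \<zeta>) /\<^sub>R norm \<eta> \<in> V" using e(2) by (auto simp: dist_norm norm_minus_commute)
    then have mV: "\<eta> + \<zeta> \<in> V" using V(3)[of "(\<eta> + \<zeta>) /\<^sub>R norm \<eta>" "norm \<eta>"] n0 by simp
    have "norm \<zeta> \<le> norm \<eta> / 2" using True mult_right_mono[OF c(2) norm_ge_zero[of \<eta>]] by simp
    then have "(1 + norm \<eta>) / 2 \<le> 1 + norm (\<eta> + \<zeta>)"
     using norm_triangle_ineq4[of "\<eta> + \<zeta>" \<zeta>] by simp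
    then have "((1 + norm \<eta>) / 2) ^ r \<le> (1 + norm (\<eta> + \<zeta>)) ^ r" by (intro power_mono) auto
    then have "C1 / (1 + norm (\<eta> + \<zeta>)) ^ r \<le> C1 / ((1 + norm \<eta>) / 2) ^ r"
     using C1(1) by (intro divide_left_mono) (auto simp: add_pos_nonneg)
    also have "\<dots> = 2 ^ r * C1 / (1 + norm \<eta>) ^ r" by (simp add: power_divide)
    finally have "norm (fourier g (\<eta> + \<zeta>)) \<le> 2 ^ r * C1 / (1 + norm \<eta>) ^ r"
     using C1(2)[OF mV] by linarith
    then have "norm (fourier g (\<eta> + \<zeta>)) * norm (fourier \<psi> (- \<zeta>))
      \<le> (2 ^ r * C1 / (1 + norm \<eta>) ^ r) * (C2 / (1 + norm \<zeta>) ^ ?D)"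
     using C2(2)[of "- \<zeta>"] C1(1) by (intro mult_mono) auto
    also have "\<dots> = (2 ^ r * (C1 * C2)) / (1 + norm \<eta>) ^ r * (1 / (1 + norm \<zeta>) ^ ?D)" by simp
    also have "\<dots> \<le> K / (1 + norm \<eta>) ^ r * (1 / (1 + norm \<zeta>) ^ ?D)"
     using K(1) by (intro mult_right_mono divide_right_mono) auto
    finally show ?thesis .
   next
    case False
    have "c * (1 + norm \<eta>) \<le> 1 + norm \<zeta>" using False c(1,2) by (simp add: algebra_simps)
    then have "(c * (1 + norm \<eta>)) ^ r \<le> (1 + norm \<zeta>) ^ r" using c(1) by (intro power_mono) auto
    then have "(c * (1 + norm \<eta>)) ^ r * (1 + norm \<zeta>) ^ ?D \<le> (1 + norm \<zeta>) ^ (r + ?D)"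
     unfolding power_add by (intro mult_right_mono) auto
    then have "C3 / (1 + norm \<zeta>) ^ (r + ?D) \<le> C3 / ((c * (1 + norm \<eta>)) ^ r * (1 + norm \<zeta>) ^ ?D)"
     using C3(1) c(1) by (intro divide_left_mono mult_pos_pos) (auto simp: add_pos_nonneg)
    then have "norm (fourier \<psi> (- \<zeta>)) \<le> C3 / ((c * (1 + norm \<eta>)) ^ r * (1 + norm \<zeta>) ^ ?D)"
     using C3(2)[of "- \<zeta>"] by simp
    then have "norm (fourier g (\<eta> + \<zeta>)) * norm (fourier \<psi> (- \<zeta>)) \<le> G * (C3 / ((c * (1 + norm \<eta>)) ^ r * (1 + norm \<zeta>) ^ ?D))"
     using norm_fourier_le[OF g, of "\<eta> + \<zeta>"] G by (intro mult_mono) (auto simp: G_def)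
    also have "\<dots> = ((G * C3) / c ^ r) / (1 + norm \<eta>) ^ r * (1 / (1 + norm \<zeta>) ^ ?D)"
     by (simp add: power_mult_distrib)
    also have "\<dots> \<le> K / (1 + norm \<eta>) ^ r * (1 / (1 + norm \<zeta>) ^ ?D)"
     using K(2) by (intro mult_right_mono divide_right_mono) auto
    finally show ?thesis .
   qed
   let ?g = "\<lambda>y. g y * cis (- (y \<bullet> \<eta>))"
   have fg: "fourier ?g \<zeta> = fourier g (\<eta> + \<zeta>)" for \<zeta>
    unfolding fourier_def by (simp add: mult.assoc cis_mult inner_add_right algebra_simps)
   obtain C where C: "\<And>x. norm (\<psi> x) \<le> C" using test_function_bounded[OF p] by blast
   have lim: "(\<lambda>n. \<integral>\<zeta>. gaussian (inverse (real (Suc n)) *\<^sub>R \<zeta>) * (fourier ?g \<zeta> * fourier \<psi> (- \<zeta>)) \<partial>lborel)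
     \<longlonglongrightarrow> of_real ((2 * pi) ^ DIM(real^'d)) * (\<integral>y. ?g y * \<psi> y \<partial>lborel)"
    by (rule parseval_regularized[OF integrable_mult_cis[OF g] pI _ C])
      (rule smooth_on_continuous[OF test_functions_smooth[OF p]])
   have bd: "norm (\<integral>\<zeta>. gaussian (inverse (real (Suc n)) *\<^sub>R \<zeta>) * (fourier ?g \<zeta> * fourier \<psi> (- \<zeta>)) \<partial>lborel) \<le> K / (1 + norm \<eta>) ^ r * I" for n
   proof -
    have "norm (\<integral>\<zeta>. gaussian (inverse (real (Suc n)) *\<^sub>R \<zeta>) * (fourier ?g \<zeta> * fourier \<psi> (- \<zeta>)) \<partial>lborel)
      \<le> (\<integral>\<zeta>. K / (1 + norm \<eta>) ^ r * (1 / (1 + norm (\<zeta>::real^'d)) ^ ?D) \<partial>lborel)"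
    proof (rule norm_integral_le)
     show "integrable lborel (\<lambda>\<zeta>. K / (1 + norm \<eta>) ^ r * (1 / (1 + norm (\<zeta>::real^'d)) ^ ?D))"
      by (intro integrable_mult_right integrable_power_decay)
     fix \<zeta> :: "real^'d"
     have "norm (gaussian (inverse (real (Suc n)) *\<^sub>R \<zeta>)) * (norm (fourier g (\<eta> + \<zeta>)) * norm (fourier \<psi> (- \<zeta>)))
       \<le> 1 * (norm (fourier g (\<eta> + \<zeta>)) * norm (fourier \<psi> (- \<zeta>)))"
      by (intro mult_right_mono gaussian_simps) auto
     then show "norm (gaussian (inverse (real (Suc n)) *\<^sub>R \<zeta>) * (fourier ?g \<zeta> * fourier \<psi> (- \<zeta>)))
       \<le> K / (1 + norm \<eta>) ^ r * (1 / (1 + norm \<zeta>) ^ ?D)"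
      using pt[of \<zeta>] unfolding fg norm_mult by linarith
    qed
    then show ?thesis unfolding I_def by (simp only: integral_mult_right_zero)
   qed
   have "norm (of_real ((2 * pi) ^ DIM(real^'d)) * (\<integral>y. ?g y * \<psi> y \<partial>lborel)) \<le> K / (1 + norm \<eta>) ^ r * I"
    by (rule LIMSEQ_le_const2[OF tendsto_norm[OF lim]]) (use bd in auto)
   moreover have "(\<integral>y. ?g y * \<psi> y \<partial>lborel) = fourier (\<lambda>y. \<psi> y * g y) \<eta>"
    unfolding fourier_def by (simp add: mult_ac)
   ultimately have "(2 * pi) ^ DIM(real^'d) * norm (fourier (\<lambda>y. \<psi> y * g y) \<eta>) \<le> K / (1 + norm \<eta>) ^ r * I"
    by (simp add: norm_mult norm_power)
   then have "norm (fourier (\<lambda>y. \<psi> y * g y) \<eta>) \<le> (K / (1 + norm \<eta>) ^ r * I) / (2 * pi) ^ DIM(real^'d)"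
    by (subst pos_le_divide_eq) (simp, simp only: mult.commute)
   then show ?thesis by (simp add: mult_ac)
  qed
  then show "\<exists>C. \<forall>\<eta>\<in>V'. norm (fourier (\<lambda>y. \<psi> y * g y) \<eta>) \<le> C / (1 + norm \<eta>) ^ r" by blast
 qed
 ultimately show ?thesis by blast
qed

text \<open>An integrable function with rapidly decreasing Fourier transform is smooth: it agrees with its
 inverse Fourier integral when tested against test functions.\<close>

lemma smooth_of_rapidly_decreasing_fourier:
 fixes g :: "real^'d => complex"
 assumes g: "integrable lborel g" and dec: "rapidly_decreasing_on UNIV (fourier g)"
 shows "\<exists>h. smooth_on UNIV h \<and> (AE y in lebesgue. g y = h y)"
proof -
 let ?c = "complex_of_real ((2 * pi) ^ DIM(real^'d))"
 have c0: "?c \<noteq> 0" by simp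
 define h where "h y = inverse ?c * (\<integral>\<zeta>. fourier g \<zeta> * cis (y \<bullet> \<zeta>) \<partial>lborel)" for y
 have "smooth_on UNIV (\<lambda>y. \<integral>\<zeta>. fourier g \<zeta> * cis (y \<bullet> \<zeta>) \<partial>lborel)"
  unfolding smooth_on_def using Ck_on_fourier_integral[OF dec fourier_measurable[OF g]] by blast
 then have h: "smooth_on UNIV h" unfolding h_def[abs_def] by (intro smooth_intros open_UNIV)
 have fI: "integrable lborel (fourier g)" by (rule rapidly_decreasing_integrable[OF dec fourier_measurable[OF g]])
 have weak: "(\<integral>y. g y * \<psi> y \<partial>lborel) = (\<integral>y. h y * \<psi> y \<partial>lborel)" if p: "\<psi> \<in> test_functions UNIV" for \<psi>
 proof -
  obtain C where C: "\<And>x. norm (\<psi> x) \<le> C" using test_function_bounded[OF p] by blast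
  have pI: "integrable lborel \<psi>" by (rule integrable_test_function[OF p])
  have fm: "(\<lambda>\<zeta>. fourier \<psi> (- \<zeta>)) \<in> borel_measurable borel"
   using measurable_compose[OF borel_measurable_uminus[OF measurable_ident] fourier_measurable[OF pI]] by simp
  have fgm [measurable]: "fourier g \<in> borel_measurable borel" by (rule fourier_measurable[OF g])
  define M where "M = (\<integral>y. norm (\<psi> y) \<partial>lborel)"
  have lim: "(\<lambda>n. \<integral>\<zeta>. gaussian (inverse (real (Suc n)) *\<^sub>R \<zeta>) * (fourier g \<zeta> * fourier \<psi> (- \<zeta>)) \<partial>lborel)
    \<longlonglongrightarrow> ?c * (\<integral>y. g y * \<psi> y \<partial>lborel)"
   by (rule parseval_regularized[OF g pI _ C]) (rule smooth_on_continuous[OF test_functions_smooth[OF p]])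
  have "(\<lambda>n. \<integral>\<zeta>. gaussian (inverse (real (Suc n)) *\<^sub>R \<zeta>) * (fourier g \<zeta> * fourier \<psi> (- \<zeta>)) \<partial>lborel)
    \<longlonglongrightarrow> (\<integral>\<zeta>. fourier g \<zeta> * fourier \<psi> (- \<zeta>) \<partial>lborel)"
  proof (rule integral_dominated_convergence[where w = "\<lambda>\<zeta>. norm (fourier g \<zeta>) * M"])
   show "integrable lborel (\<lambda>\<zeta>. norm (fourier g \<zeta>) * M)" using fI by (intro integrable_mult_left integrable_norm)
   show "AE \<zeta> in lborel. (\<lambda>n. gaussian (inverse (real (Suc n)) *\<^sub>R \<zeta>) * (fourier g \<zeta> * fourier \<psi> (- \<zeta>)))
     \<longlonglongrightarrow> fourier g \<zeta> * fourier \<psi> (- \<zeta>)"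
   proof (rule AE_I2)
    fix \<zeta> :: "real^'d"
    have "(\<lambda>n. gaussian (inverse (real (Suc n)) *\<^sub>R \<zeta>)) \<longlonglongrightarrow> complex_of_real (exp (- ((norm (0 *\<^sub>R \<zeta>))\<^sup>2 / 2)))"
     unfolding gaussian_def by (intro tendsto_intros LIMSEQ_inverse_real_of_nat) auto
    then have "(\<lambda>n. gaussian (inverse (real (Suc n)) *\<^sub>R \<zeta>)) \<longlonglongrightarrow> 1" by simp
    from tendsto_mult[OF this tendsto_const[of "fourier g \<zeta> * fourier \<psi> (- \<zeta>)"]]
    show "(\<lambda>n. gaussian (inverse (real (Suc n)) *\<^sub>R \<zeta>) * (fourier g \<zeta> * fourier \<psi> (- \<zeta>)))
     \<longlonglongrightarrow> fourier g \<zeta> * fourier \<psi> (- \<zeta>)" by simp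
   qed
   show "AE \<zeta> in lborel. norm (gaussian (inverse (real (Suc n)) *\<^sub>R \<zeta>) * (fourier g \<zeta> * fourier \<psi> (- \<zeta>))) \<le> norm (fourier g \<zeta>) * M" for n
   proof (rule AE_I2)
    fix \<zeta> :: "real^'d"
    have "norm (gaussian (inverse (real (Suc n)) *\<^sub>R \<zeta>)) * (norm (fourier g \<zeta>) * norm (fourier \<psi> (- \<zeta>)))
      \<le> 1 * (norm (fourier g \<zeta>) * M)"
     using norm_fourier_le[OF pI, of "- \<zeta>"] by (intro mult_mono gaussian_simps) (auto simp: M_def)
    then show "norm (gaussian (inverse (real (Suc n)) *\<^sub>R \<zeta>) * (fourier g \<zeta> * fourier \<psi> (- \<zeta>))) \<le> norm (fourier g \<zeta>) * M"
     by (simp add: norm_mult)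
   qed
  qed (use fm in measurable)
  with lim have "?c * (\<integral>y. g y * \<psi> y \<partial>lborel) = (\<integral>\<zeta>. fourier g \<zeta> * fourier \<psi> (- \<zeta>) \<partial>lborel)"
   using LIMSEQ_unique by blast
  also have "\<dots> = (\<integral>\<zeta>. fourier g \<zeta> * (\<integral>x. \<psi> x * cis (\<zeta> \<bullet> x) \<partial>lborel) \<partial>lborel)"
   by (simp add: fourier_def[of \<psi>] inner_commute)
  also have "\<dots> = (\<integral>x. \<psi> x * (\<integral>\<zeta>. fourier g \<zeta> * cis (\<zeta> \<bullet> x) \<partial>lborel) \<partial>lborel)"
   by (rule Fubini_bounded_kernel[OF fI pI cis_inner_measurable(1)]) simp
  also have "\<dots> = (\<integral>x. ?c * (h x * \<psi> x) \<partial>lborel)"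
  proof -
   have "?c * h x = (\<integral>\<zeta>. fourier g \<zeta> * cis (\<zeta> \<bullet> x) \<partial>lborel)" for x
    unfolding h_def mult.assoc[symmetric] right_inverse[OF c0] by (simp add: inner_commute)
   from this[symmetric] show ?thesis by (simp only: mult_ac)
  qed
  also have "\<dots> = ?c * (\<integral>x. h x * \<psi> x \<partial>lborel)" by (rule integral_mult_right_zero)
  finally show ?thesis using c0 by simp
 qed
 have gl: "locally_integrable_on UNIV g"
  unfolding locally_integrable_on_def set_integrable_def
 proof (intro allI impI, elim conjE)
  fix K :: "(real^'d) set" assume "compact K"
  then have "integrable lborel (\<lambda>x. indicator K x *\<^sub>R g x)"
   by (intro integrable_mult_indicator g) (auto intro: borel_compact)
  then show "integrable lebesgue (\<lambda>x. indicator K x *\<^sub>R g x)" by (subst integrable_completion) auto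
 qed
 have hl: "locally_integrable_on UNIV h" by (rule locally_integrable_on_continuous[OF smooth_on_continuous[OF h]])
 have "AE y in lebesgue. y \<in> UNIV \<longrightarrow> g y - h y = 0"
 proof (rule locally_integrable_eq_0[OF open_UNIV locally_integrable_on_diff[OF gl hl]])
  fix \<phi> :: "real^'d => complex" assume p: "\<phi> \<in> test_functions UNIV"
  note ip = locally_integrable_test(1)[OF gl p] locally_integrable_test(1)[OF hl p]
  have m: "(\<lambda>y. g y * \<phi> y) \<in> borel_measurable lborel" "(\<lambda>y. h y * \<phi> y) \<in> borel_measurable lborel"
   using g borel_measurable_continuous_onI[OF smooth_on_continuous[OF test_functions_smooth[OF p]]]
    borel_measurable_continuous_onI[OF smooth_on_continuous[OF h]] by (auto intro!: borel_measurable_times)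
  have "(LINT y|lebesgue. (g y - h y) * \<phi> y) = (LINT y|lebesgue. g y * \<phi> y) - (LINT y|lebesgue. h y * \<phi> y)"
   using ip by (simp add: left_diff_distrib)
  then show "(LINT y|lebesgue. (g y - h y) * \<phi> y) = 0"
   using weak[OF p] by (simp add: integral_completion[OF m(1)] integral_completion[OF m(2)])
 qed
 then show ?thesis using h by (intro exI[of _ h]) auto
qed

text \<open>By compactness of the unit sphere, finitely many of the cones in the definition of the wavefront set cover all directions.
A bump function \<open>\<psi>\<close> around \<open>x\<close>, supported where none of the corresponding test functions \<open>\<phi>\<close> has a zero, can be written as
\<open>(\<psi> / \<phi>) \<phi>\<close> for each of them; by localization the Fourier transform of \<open>\<psi> F\<close> decreases rapidly in all these cones.  Near
\<open>x\<close> one divides by \<open>\<psi>\<close>.\<close>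

lemma smooth_of_empty_wavefront:
 fixes F :: "real^'d => complex"
 assumes O: "open \<Omega>" and F: "locally_integrable_on \<Omega> F" and x: "x \<in> \<Omega>"
  and u: "\<And>\<phi>. \<phi> \<in> test_functions \<Omega> ==> u \<phi> = (LINT y|lebesgue. F y * \<phi> y)"
  and wf: "\<And>\<xi>. (x, \<xi>) \<notin> wavefront_set_on \<Omega> u"
 shows "\<exists>\<Omega>' h. open \<Omega>' \<and> x \<in> \<Omega>' \<and> \<Omega>' \<subseteq> \<Omega> \<and> smooth_on \<Omega>' h \<and> (AE y in lebesgue. y \<in> \<Omega>' \<longrightarrow> F y = h y)"
proof -
 define Q where "Q \<xi> \<phi> V' \<longleftrightarrow> \<phi> \<in> test_functions \<Omega> \<and> \<phi> x \<noteq> 0 \<and> open V' \<and> \<xi> \<in> V' \<and> (\<forall>\<eta>\<in>V'. \<forall>t>0. t *\<^sub>R \<eta> \<in> V') \<and>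
   (\<exists>g. integrable lborel g \<and> (AE y in lborel. F y * \<phi> y = g y) \<and>
    (\<forall>\<psi> \<Omega>. \<psi> \<in> test_functions \<Omega> \<longrightarrow> rapidly_decreasing_on V' (fourier (\<lambda>y. \<psi> y * g y))))" for \<xi> \<phi> V'
 have loc: "\<exists>\<phi> V'. Q \<xi> \<phi> V'"
  if \<xi>: "norm \<xi> = 1" for \<xi>
 proof -
  have "\<xi> \<noteq> 0" using \<xi> by auto
   then obtain \<phi> V where p: "\<phi> \<in> test_functions \<Omega>" "\<phi> x \<noteq> 0" and V: "open V" "\<xi> \<in> V" "\<And>\<eta> t. \<eta> \<in> V ==> t > 0 ==> t *\<^sub>R \<eta> \<in> V"
   and dec: "\<And>r::nat. \<exists>C. \<forall>\<eta>\<in>V. norm (u (\<lambda>y. \<phi> y * cis (- (y \<bullet> \<eta>)))) \<le> C / (1 + norm \<eta>) ^ r"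
   using wf[of \<xi>] x unfolding wavefront_set_on_def by blast
  obtain g where g: "integrable lborel g" "AE y in lborel. F y * \<phi> y = g y"
   using lebesgue_integrable_borel_version[OF locally_integrable_test(1)[OF F p(1)]] by blast
  have "u (\<lambda>y. \<phi> y * cis (- (y \<bullet> \<eta>))) = fourier g \<eta>" for \<eta>
  proof -
   have m: "(\<lambda>y. g y * cis (- (y \<bullet> \<eta>))) \<in> borel_measurable lborel"
    by (rule borel_measurable_integrable[OF integrable_mult_cis[OF g(1)]])
   have "u (\<lambda>y. \<phi> y * cis (- (y \<bullet> \<eta>))) = (LINT y|lebesgue. F y * (\<phi> y * cis (- (y \<bullet> \<eta>))))"
    by (rule u[OF test_functions_mult_cis[OF p(1)]])
   also have "\<dots> = (LINT y|lebesgue. g y * cis (- (y \<bullet> \<eta>)))"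
   proof (rule integral_cong_AE)
    show "AE y in lebesgue. F y * (\<phi> y * cis (- (y \<bullet> \<eta>))) = g y * cis (- (y \<bullet> \<eta>))"
     using AE_completion[OF g(2)] by eventually_elim simp
   qed (use locally_integrable_test(1)[OF F test_functions_mult_cis[OF p(1)]] m in \<open>auto intro: measurable_completion\<close>)
   finally show ?thesis using integral_completion[OF m] by (simp add: fourier_def)
  qed
  then have "rapidly_decreasing_on V (fourier g)" using dec by (simp add: rapidly_decreasing_on_def)
  from rapidly_decreasing_localization[OF g(1) V \<xi> this] show ?thesis unfolding Q_def using p g by blast
 qed
 then obtain \<phi> V where "\<And>\<xi>. norm \<xi> = 1 ==> Q \<xi> (\<phi> \<xi>) (V \<xi>)" by metis
 note p = this[unfolded Q_def]
 have "compact (sphere (0 :: real^'d) 1)" by simp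
 moreover have "\<And>\<xi>. \<xi> \<in> sphere 0 1 ==> open (V \<xi>)" using p by simp
 moreover have "sphere 0 1 \<subseteq> (\<Union>\<xi>\<in>sphere 0 1. V \<xi>)" using p by auto
 ultimately obtain D where D: "D \<subseteq> sphere 0 1" "finite D" "sphere 0 1 \<subseteq> (\<Union>\<xi>\<in>D. V \<xi>)"
  by (rule compactE_image)
 have Dn: "norm \<xi> = 1" if "\<xi> \<in> D" for \<xi> using D(1) that by auto
 have cont: "continuous_on UNIV (\<phi> \<xi>)" if "\<xi> \<in> D" for \<xi>
  using p[OF Dn[OF that]] by (intro smooth_on_continuous test_functions_smooth) auto
 define U where "U = \<Omega> \<inter> (\<Inter>\<xi>\<in>D. {y. \<phi> \<xi> y \<noteq> 0})"
 have "open U" unfolding U_def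
  using D(2) cont by (intro open_Int O open_INT ballI open_Collect_neq continuous_on_const) auto
 moreover have "x \<in> U" using x p Dn by (auto simp: U_def)
 ultimately obtain a b where ab: "x \<in> box a b" "cbox a b \<subseteq> U" using open_contains_cbox_around by blast
 define \<psi> where "\<psi> = box_bump a b 0"
 have \<psi>U: "\<psi> \<in> test_functions U" unfolding \<psi>_def by (rule box_bump_test[OF ab(2)])
 have \<psi>O: "\<psi> \<in> test_functions \<Omega>" by (rule test_functions_mono[OF \<psi>U]) (simp add: U_def)
 obtain G where G: "integrable lborel G" "AE y in lborel. F y * \<psi> y = G y"
  using lebesgue_integrable_borel_version[OF locally_integrable_test(1)[OF F \<psi>O]] by blast
 have Gdec: "rapidly_decreasing_on (V \<xi>) (fourier G)" if \<xi>: "\<xi> \<in> D" for \<xi>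
 proof -
  obtain g where g: "integrable lborel g" "AE y in lborel. F y * \<phi> \<xi> y = g y"
   and gd: "\<And>\<psi> \<Omega>. \<psi> \<in> test_functions \<Omega> ==> rapidly_decreasing_on (V \<xi>) (fourier (\<lambda>y. \<psi> y * g y))"
   using p[OF Dn[OF \<xi>]] by blast
  let ?\<psi> = "\<lambda>y. inverse (\<phi> \<xi> y) * \<psi> y"
  have sm: "smooth_on U (\<lambda>y. inverse (\<phi> \<xi> y))"
   using p[OF Dn[OF \<xi>]] \<xi> \<open>open U\<close>
   by (intro smooth_on_inverse smooth_on_subset[OF test_functions_smooth]) (auto simp: U_def)
  have t: "?\<psi> \<in> test_functions U" by (rule test_functions_mult[OF \<open>open U\<close> sm \<psi>U])
  have e: "AE y in lborel. ?\<psi> y * g y = G y"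
   using g(2) G(2)
  proof eventually_elim
   case (elim y)
   show ?case
   proof (cases "y \<in> U")
    case True
    then have "\<phi> \<xi> y \<noteq> 0" using \<xi> by (auto simp: U_def)
    then show ?thesis using elim(1)[symmetric] elim(2)[symmetric] by simp
   next
    case False
    then have "\<psi> y = 0" using test_functions_zero[OF \<psi>U] by blast
    then show ?thesis using elim by auto
   qed
  qed
  have "fourier (\<lambda>y. ?\<psi> y * g y) = fourier G"
  proof
   fix \<eta>
   show "fourier (\<lambda>y. ?\<psi> y * g y) \<eta> = fourier G \<eta>"
    unfolding fourier_def
   proof (rule integral_cong_AE)
    show "AE y in lborel. ?\<psi> y * g y * cis (- (y \<bullet> \<eta>)) = G y * cis (- (y \<bullet> \<eta>))"
     using e by eventually_elim simp
    show "(\<lambda>y. ?\<psi> y * g y * cis (- (y \<bullet> \<eta>))) \<in> borel_measurable lborel"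
     using borel_measurable_continuous_onI[OF smooth_on_continuous[OF test_functions_smooth[OF t]]] g(1) cis_inner_measurable(4)[of \<eta>]
     by (intro borel_measurable_times[of "\<lambda>y. ?\<psi> y * g y"] borel_measurable_times[of ?\<psi>]) auto
    show "(\<lambda>y. G y * cis (- (y \<bullet> \<eta>))) \<in> borel_measurable lborel" by (rule borel_measurable_integrable[OF integrable_mult_cis[OF G(1)]])
   qed
  qed
  then show ?thesis using gd[OF t] by simp
 qed
 have "rapidly_decreasing_on UNIV (fourier G)"
  unfolding rapidly_decreasing_on_def
 proof
  fix r :: nat
  obtain C where C: "\<And>\<xi>. \<xi> \<in> D ==> C \<xi> \<ge> 0 \<and> (\<forall>\<eta>\<in>V \<xi>. norm (fourier G \<eta>) \<le> C \<xi> / (1 + norm \<eta>) ^ r)"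
   using bchoice[of D "\<lambda>\<xi> C. C \<ge> 0 \<and> (\<forall>\<eta>\<in>V \<xi>. norm (fourier G \<eta>) \<le> C / (1 + norm \<eta>) ^ r)"]
    rapidly_decreasing_onE[OF Gdec] by blast
  let ?C = "(\<integral>y. norm (G y) \<partial>lborel) + (\<Sum>\<xi>\<in>D. C \<xi>)"
  have nn: "(\<integral>y. norm (G y) \<partial>lborel) \<ge> 0" by (intro integral_nonneg_AE) auto
  have "norm (fourier G \<eta>) \<le> ?C / (1 + norm \<eta>) ^ r" for \<eta>
  proof (cases "\<eta> = 0")
   case True
   then show ?thesis using norm_fourier_le[OF G(1), of \<eta>] C by (simp add: sum_nonneg add_increasing2)
  next
   case False
   then have "\<eta> /\<^sub>R norm \<eta> \<in> sphere 0 1" by simp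
   then obtain \<xi> where \<xi>: "\<xi> \<in> D" "\<eta> /\<^sub>R norm \<eta> \<in> V \<xi>" using D(3) by blast
   have "norm \<eta> *\<^sub>R (\<eta> /\<^sub>R norm \<eta>) \<in> V \<xi>" using p[OF Dn[OF \<xi>(1)]] \<xi>(2) False by (meson zero_less_norm_iff)
   then have "norm (fourier G \<eta>) \<le> C \<xi> / (1 + norm \<eta>) ^ r" using C[OF \<xi>(1)] False by simp
   also have "\<dots> \<le> ?C / (1 + norm \<eta>) ^ r"
   proof (intro divide_right_mono)
    have "C \<xi> \<le> (\<Sum>\<xi>\<in>D. C \<xi>)" using \<xi>(1) D(2) C by (intro member_le_sum) auto
    then show "C \<xi> \<le> ?C" using nn by linarith
   qed auto
   finally show ?thesis .
  qed
  then show "\<exists>C. \<forall>\<eta>\<in>UNIV. norm (fourier G \<eta>) \<le> C / (1 + norm \<eta>) ^ r" by blast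
 qed
 then obtain h where h: "smooth_on UNIV h" "AE y in lebesgue. G y = h y"
  using smooth_of_rapidly_decreasing_fourier[OF G(1)] by blast
 have nz: "\<psi> y \<noteq> 0" if "y \<in> box a b" for y using that box_bump_eq_0_iff by (auto simp: \<psi>_def)
 show ?thesis
 proof (intro exI conjI)
  show "smooth_on (box a b) (\<lambda>y. h y / \<psi> y)"
   by (intro smooth_on_divide open_box smooth_on_subset[OF h(1)] smooth_on_subset[OF test_functions_smooth[OF \<psi>O]] nz) auto
  show "AE y in lebesgue. y \<in> box a b \<longrightarrow> F y = h y / \<psi> y"
   using AE_completion[OF G(2)] h(2) by eventually_elim (auto simp: nz field_simps)
  show "box a b \<subseteq> \<Omega>" using ab(2) box_subset_cbox[of a b] by (auto simp: U_def)
 qed (use ab in auto)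
qed

section \<open>Weak solutions of first order equations\<close>

lemma frechet_derivative_mult:
 fixes f g :: "'a::real_normed_vector => complex"
 assumes "smooth_on S f" "smooth_on S g" "y \<in> S"
 shows "fderiv (\<lambda>y. f y * g y) y v
  = f y * fderiv g y v + fderiv f y v * g y"
 using frechet_derivative_eqI[OF has_derivative_mult[OF smooth_on_has_derivative[OF assms(1,3)] smooth_on_has_derivative[OF assms(2,3)]]]
 by simp

lemma frechet_derivative_add:
 fixes f g :: "'a::real_normed_vector => 'b::real_normed_vector"
 assumes "smooth_on S f" "smooth_on S g" "y \<in> S"
 shows "fderiv (\<lambda>y. f y + g y) y v = fderiv f y v + fderiv g y v"
 using frechet_derivative_eqI[OF has_derivative_add[OF smooth_on_has_derivative[OF assms(1,3)] smooth_on_has_derivative[OF assms(2,3)]]]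
 by simp

definition vector_field_derivative :: "(real^'d => complex^'d) => (real^'d => complex) => real^'d => complex"
 where "vector_field_derivative Y w y = (\<Sum>j\<in>UNIV. Y y $ j * partial_deriv j w y)"

text \<open>The formal transpose of the vector field is \<open>\<phi> \<mapsto> - divergence_form Y \<phi>\<close>.\<close>

definition divergence_form :: "(real^'d => complex^'d) => (real^'d => complex) => real^'d => complex"
 where "divergence_form Y \<phi> y = (\<Sum>j\<in>UNIV. partial_deriv j (\<lambda>y. Y y $ j * \<phi> y) y)"

lemma smooth_on_partial_deriv [smooth_intros]: "smooth_on S w ==> smooth_on S (partial_deriv j w)"
 unfolding partial_deriv_def[abs_def] by (rule smooth_on_derivative)

lemma smooth_on_vector_field_derivative:
 "open S ==> (\<And>j. smooth_on S (\<lambda>y. Y y $ j)) ==> smooth_on S w ==> smooth_on S (vector_field_derivative Y w)"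
 unfolding vector_field_derivative_def[abs_def] by (intro smooth_intros) auto

lemma divergence_form_test:
 assumes O: "open \<Omega>" and Y: "\<And>j. smooth_on \<Omega> (\<lambda>y. Y y $ j)" and p: "\<phi> \<in> test_functions \<Omega>"
 shows "divergence_form Y \<phi> \<in> test_functions \<Omega>"
  and "(LINT y|lebesgue. divergence_form Y \<phi> y) = 0"
proof -
 have t: "(\<lambda>y. Y y $ j * \<phi> y) \<in> test_functions \<Omega>" for j by (rule test_functions_mult[OF O Y p])
 then have pt: "partial_deriv j (\<lambda>y. Y y $ j * \<phi> y) \<in> test_functions \<Omega>" for j
  unfolding partial_deriv_def[abs_def] by (rule test_functions_derivative)
 show d: "divergence_form Y \<phi> \<in> test_functions \<Omega>"
  unfolding divergence_form_def[abs_def] by (intro test_functions_sum pt) auto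
 have "(LINT y|lebesgue. divergence_form Y \<phi> y) = (\<integral>y. divergence_form Y \<phi> y \<partial>lborel)"
  using integrable_test_function[OF d] by (intro integral_completion) auto
 also have "\<dots> = (\<Sum>j\<in>UNIV. \<integral>y. partial_deriv j (\<lambda>y. Y y $ j * \<phi> y) y \<partial>lborel)"
  unfolding divergence_form_def by (intro Bochner_Integration.integral_sum integrable_test_function[OF pt])
 also have "\<dots> = 0"
  unfolding partial_deriv_def by (intro sum.neutral ballI integral_derivative_test_function[OF t])
 finally show "(LINT y|lebesgue. divergence_form Y \<phi> y) = 0" .
qed

lemma divergence_form_mult:
 assumes O: "open \<Omega>" and Y: "\<And>j. smooth_on \<Omega> (\<lambda>y. Y y $ j)" and w: "smooth_on \<Omega> w" and p: "\<phi> \<in> test_functions \<Omega>"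
 shows "divergence_form Y (\<lambda>y. w y * \<phi> y) y = w y * divergence_form Y \<phi> y + vector_field_derivative Y w y * \<phi> y"
proof -
 obtain K where K: "smooth_on UNIV \<phi>" "compact K" "K \<subseteq> \<Omega>" "\<And>x. x \<notin> K ==> \<phi> x = 0"
  using test_functionsE[OF p] by blast
 show ?thesis
 proof (cases "y \<in> K")
  case True
  then have y: "y \<in> \<Omega>" using K by blast
  have Yp: "smooth_on \<Omega> (\<lambda>y. Y y $ j * \<phi> y)" for j by (intro smooth_intros O Y smooth_on_subset[OF K(1)]) simp
  have "partial_deriv j (\<lambda>y. Y y $ j * (w y * \<phi> y)) y = w y * partial_deriv j (\<lambda>y. Y y $ j * \<phi> y) y + (Y y $ j * partial_deriv j w y) * \<phi> y" for j
   using frechet_derivative_mult[OF w Yp[of j] y, where v = "axis j 1"] unfolding partial_deriv_def by (simp add: mult_ac)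
  then show ?thesis
   unfolding divergence_form_def vector_field_derivative_def by (simp add: sum.distrib sum_distrib_left sum_distrib_right)
 next
  case False
  have "partial_deriv j (\<lambda>y. Y y $ j * (c y * \<phi> y)) y = 0" for j c
  proof -
   have "fderiv (\<lambda>y. Y y $ j * (c y * \<phi> y)) y = fderiv (\<lambda>y. 0) y"
    using False K(2,4) by (intro frechet_derivative_cong_open[of "- K"]) (auto intro: compact_imp_closed)
   then show ?thesis by (simp add: partial_deriv_def)
  qed
  from this[of _ w] this[of _ "\<lambda>_. 1"] show ?thesis using K(4)[OF False] by (simp add: divergence_form_def)
 qed
qed

text \<open>Test the relation with \<open>divergence_form Y \<phi>\<close>.  The product rule turns \<open>w i * divergence_form Y \<phi>\<close> into
\<open>divergence_form Y (w i * \<phi>)\<close>, which \<open>f i\<close> annihilates, minus the derivative of \<open>w i\<close> times \<open>\<phi>\<close>.\<close>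

lemma derivative_of_weak_relation:
 fixes f :: "'i::finite => real^'d => complex"
 assumes O: "open \<Omega>" and Y: "\<And>j. smooth_on \<Omega> (\<lambda>y. Y y $ j)"
  and f: "\<And>i. locally_integrable_on \<Omega> (f i)"
  and ann: "\<And>i \<phi>. \<phi> \<in> test_functions \<Omega> ==> (LINT y|lebesgue. f i y * divergence_form Y \<phi> y) = 0"
  and w: "\<And>i. smooth_on \<Omega> (w i)" and g: "smooth_on \<Omega> g"
  and rel: "AE y in lebesgue. y \<in> \<Omega> \<longrightarrow> (\<Sum>i\<in>UNIV. f i y * w i y) = g y"
 shows "AE y in lebesgue. y \<in> \<Omega> \<longrightarrow> (\<Sum>i\<in>UNIV. f i y * vector_field_derivative Y (w i) y) = vector_field_derivative Y g y"
proof -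
 let ?D = "vector_field_derivative Y"
 have c: "continuous_on \<Omega> (?D w)" if "smooth_on \<Omega> w" for w
  by (rule smooth_on_continuous[OF smooth_on_vector_field_derivative[OF O Y that]])
 have LI: "locally_integrable_on \<Omega> (\<lambda>y. \<Sum>i\<in>UNIV. f i y * ?D (w i) y)"
  by (intro locally_integrable_on_sum locally_integrable_on_mult f c w)
 have LG: "locally_integrable_on \<Omega> (?D g)" by (intro locally_integrable_on_continuous c g)
 have "AE y in lebesgue. y \<in> \<Omega> \<longrightarrow> (\<Sum>i\<in>UNIV. f i y * ?D (w i) y) - ?D g y = 0"
 proof (rule locally_integrable_eq_0[OF O locally_integrable_on_diff[OF LI LG]])
  fix \<phi> :: "real^'d => complex" assume p: "\<phi> \<in> test_functions \<Omega>"
  let ?d = "divergence_form Y \<phi>"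
  have d: "?d \<in> test_functions \<Omega>" by (rule divergence_form_test(1)[OF O Y p])
  have i1: "integrable lebesgue (\<lambda>y. f i y * w i y * ?d y)" for i
   by (rule locally_integrable_test(1)[OF locally_integrable_on_mult[OF f smooth_on_continuous[OF w]] d])
  have i2: "integrable lebesgue (\<lambda>y. f i y * ?D (w i) y * \<phi> y)" for i
   by (rule locally_integrable_test(1)[OF locally_integrable_on_mult[OF f c[OF w]] p])
  have i3: "integrable lebesgue (\<lambda>y. g y * ?d y)" "integrable lebesgue (\<lambda>y. ?D g y * \<phi> y)"
   using locally_integrable_test(1)[OF locally_integrable_on_continuous[OF smooth_on_continuous[OF g]] d]
    locally_integrable_test(1)[OF LG p] by auto
  have "(LINT y|lebesgue. f i y * ?D (w i) y * \<phi> y) = - (LINT y|lebesgue. f i y * w i y * ?d y)" for i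
  proof -
   have "0 = (LINT y|lebesgue. f i y * divergence_form Y (\<lambda>y. w i y * \<phi> y) y)"
    using ann[OF test_functions_mult[OF O w p]] by simp
   also have "\<dots> = (LINT y|lebesgue. f i y * w i y * ?d y + f i y * ?D (w i) y * \<phi> y)"
    unfolding divergence_form_mult[OF O Y w p] by (simp add: algebra_simps)
   also have "\<dots> = (LINT y|lebesgue. f i y * w i y * ?d y) + (LINT y|lebesgue. f i y * ?D (w i) y * \<phi> y)"
    by (rule Bochner_Integration.integral_add[OF i1 i2])
   finally show ?thesis by (simp add: eq_neg_iff_add_eq_0 add.commute)
  qed
  then have "(\<Sum>i\<in>UNIV. LINT y|lebesgue. f i y * ?D (w i) y * \<phi> y) = - (\<Sum>i\<in>UNIV. LINT y|lebesgue. f i y * w i y * ?d y)"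
   by (simp add: sum_negf)
  also have "(\<Sum>i\<in>UNIV. LINT y|lebesgue. f i y * w i y * ?d y) = (LINT y|lebesgue. (\<Sum>i\<in>UNIV. f i y * w i y * ?d y))"
   by (rule Bochner_Integration.integral_sum[symmetric]) (rule i1)
  also have "\<dots> = (LINT y|lebesgue. g y * ?d y)"
  proof (rule integral_cong_AE)
   show "AE y in lebesgue. (\<Sum>i\<in>UNIV. f i y * w i y * ?d y) = g y * ?d y"
    using rel
   proof eventually_elim
    case (elim y)
    then show ?case
     using test_functions_zero[OF d, of y] by (cases "y \<in> \<Omega>") (auto simp flip: sum_distrib_right)
   qed
  qed (use i1 i3 in auto)
  also have "\<dots> = - (LINT y|lebesgue. ?D g y * \<phi> y)"
  proof -
   have "0 = (LINT y|lebesgue. divergence_form Y (\<lambda>y. g y * \<phi> y) y)"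
    using divergence_form_test(2)[OF O Y test_functions_mult[OF O g p]] by simp
   also have "\<dots> = (LINT y|lebesgue. g y * ?d y) + (LINT y|lebesgue. ?D g y * \<phi> y)"
    unfolding divergence_form_mult[OF O Y g p] by (rule Bochner_Integration.integral_add[OF i3])
   finally show ?thesis by (simp add: eq_neg_iff_add_eq_0)
  qed
  finally have "(\<Sum>i\<in>UNIV. LINT y|lebesgue. f i y * ?D (w i) y * \<phi> y) = (LINT y|lebesgue. ?D g y * \<phi> y)" by simp
  moreover have "(LINT y|lebesgue. ((\<Sum>i\<in>UNIV. f i y * ?D (w i) y) - ?D g y) * \<phi> y)
    = (\<Sum>i\<in>UNIV. LINT y|lebesgue. f i y * ?D (w i) y * \<phi> y) - (LINT y|lebesgue. ?D g y * \<phi> y)"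
   unfolding left_diff_distrib sum_distrib_right
   by (subst Bochner_Integration.integral_diff[OF Bochner_Integration.integrable_sum[OF i2] i3(2)])
     (simp add: Bochner_Integration.integral_sum[OF i2])
  ultimately show "(LINT y|lebesgue. ((\<Sum>i\<in>UNIV. f i y * ?D (w i) y) - ?D g y) * \<phi> y) = 0" by simp
 qed
 then show ?thesis by eventually_elim auto
qed

section \<open>Division of locally integrable functions by powers of a coordinate\<close>

text \<open>A locally integrable function that behaves like \<open>1/s\<close> times a continuous function forces the
 latter to vanish for \<open>s = 0\<close>: otherwise all slabs \<open>\<epsilon>/2 < s < \<epsilon>\<close> of a box would carry the same mass.\<close>

lemma numerator_vanishes:
 fixes f g :: "real^'d => complex"
 assumes O: "open \<Omega>" and f: "locally_integrable_on \<Omega> f" and g: "continuous_on \<Omega> g"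
  and rel: "AE y in lebesgue. y \<in> \<Omega> \<longrightarrow> of_real (y $ s) * f y = g y"
  and x: "x \<in> \<Omega>" "x $ s = 0"
 shows "g x = 0"
proof (rule ccontr)
 assume nz: "g x \<noteq> 0"
 define c where "c = norm (g x) / 2"
 have c: "c > 0" using nz by (simp add: c_def)
 have "open (\<Omega> \<inter> {y. norm (g y) > c})"
 proof -
  have "open (\<Omega> \<inter> g -` {z. norm z > c})"
   by (rule continuous_open_preimage[OF g O]) (intro open_Collect_less continuous_intros)
  then show ?thesis by (simp add: vimage_def)
 qed
 moreover have "x \<in> \<Omega> \<inter> {y. norm (g y) > c}" using x nz by (simp add: c_def)
 ultimately obtain a b where ab: "x \<in> box a b" "cbox a b \<subseteq> \<Omega> \<inter> {y. norm (g y) > c}"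
  using open_contains_cbox_around by blast
 define r where "r = b $ s"
 have r: "r > 0" "a $ s < 0" using ab(1) x(2) by (auto simp: r_def mem_box_cart dest: spec[of _ s])
 have axs: "a $ i < b $ i" for i using ab(1) by (auto simp: mem_box_cart intro: less_trans)
 \<comment> \<open>On the slab \<open>A n\<close> the function is at least \<open>c 2^n / r\<close>, and the volume is proportional to \<open>r / 2^n\<close>: all slabs
  carry at least the same mass, although they move out of every point.\<close>
 define A where "A n = {y \<in> box a b. r / 2 ^ Suc n < y $ s \<and> y $ s < r / 2 ^ n}" for n :: nat
 define V where "V = (\<Prod>i\<in>UNIV - {s}. b $ i - a $ i)"
 have V: "V > 0" unfolding V_def by (intro prod_pos) (use axs in auto)
 have Abox: "A n = box (\<chi> i. if i = s then r / 2 ^ Suc n else a $ i) (\<chi> i. if i = s then r / 2 ^ n else b $ i)" for n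
 proof -
  have e: "r / 2 ^ Suc n > 0" "r / 2 ^ n \<le> r" using r by (auto simp: divide_simps)
  show ?thesis
  proof (intro set_eqI iffI)
   fix y assume "y \<in> A n"
   then have "a $ i < y $ i \<and> y $ i < b $ i" "r / 2 ^ Suc n < y $ s" "y $ s < r / 2 ^ n" for i
    by (auto simp: A_def mem_box_cart)
   then show "y \<in> box (\<chi> i. if i = s then r / 2 ^ Suc n else a $ i) (\<chi> i. if i = s then r / 2 ^ n else b $ i)"
    by (auto simp: mem_box_cart)
  next
   fix y assume "y \<in> box (\<chi> i. if i = s then r / 2 ^ Suc n else a $ i) (\<chi> i. if i = s then r / 2 ^ n else b $ i)"
   then have y: "(if i = s then r / 2 ^ Suc n else a $ i) < y $ i \<and> y $ i < (if i = s then r / 2 ^ n else b $ i)" for i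
    by (simp add: mem_box_cart)
   have ys: "r / 2 ^ Suc n < y $ s" "y $ s < r / 2 ^ n" using y[of s] by simp_all
   have "a $ i < y $ i \<and> y $ i < b $ i" for i
    using y[of i] ys e r by (cases "i = s") (simp_all add: r_def[symmetric])
   then show "y \<in> A n" using ys by (simp add: A_def mem_box_cart)
  qed
 qed
 have mA: "measure lebesgue (A n) = V * (r / 2 ^ Suc n)" for n
 proof -
  let ?l = "\<chi> i. if i = s then r / 2 ^ Suc n else a $ i" and ?u = "\<chi> i. if i = s then r / 2 ^ n else b $ i"
  have le: "?l $ i \<le> ?u $ i" for i using r axs[of i] by (auto simp: divide_simps)
  have "measure lebesgue (A n) = measure lborel (box ?l ?u)" unfolding Abox by simp
  also have "\<dots> = (\<Prod>b\<in>Basis. (?u - ?l) \<bullet> b)"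
   using le by (intro measure_lborel_box) (auto simp: Basis_vec_def inner_axis)
  also have "\<dots> = (\<Prod>i\<in>UNIV. ?u $ i - ?l $ i)"
   unfolding Basis_vec_def by (subst prod.UNION_disjoint) (auto simp: axis_eq_axis inner_axis)
  also have "\<dots> = (r / 2 ^ n - r / 2 ^ Suc n) * (\<Prod>i\<in>UNIV - {s}. ?u $ i - ?l $ i)"
   by (subst prod.remove[of _ s]) auto
  also have "(\<Prod>i\<in>UNIV - {s}. ?u $ i - ?l $ i) = V" unfolding V_def by (intro prod.cong) auto
  also have "r / 2 ^ n - r / 2 ^ Suc n = r / 2 ^ Suc n" by (simp add: field_simps)
  finally show ?thesis by simp
 qed
 let ?h = "\<lambda>y. indicator (cbox a b) y *\<^sub>R f y"
 have hI: "integrable lebesgue ?h"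
  using f ab(2) unfolding locally_integrable_on_def set_integrable_def by auto
 have Al: "A n \<in> sets lebesgue" for n unfolding Abox by simp
 have lim: "(\<lambda>n. LINT y|lebesgue. indicator (A n) y *\<^sub>R norm (?h y)) \<longlonglongrightarrow> (LINT y|(lebesgue :: (real^'d) measure). 0)"
 proof (rule integral_dominated_convergence[where w = "\<lambda>y. norm (?h y)"])
  show "AE y in lebesgue. (\<lambda>n. indicator (A n) y *\<^sub>R norm (?h y)) \<longlonglongrightarrow> 0"
  proof (rule AE_I2)
   fix y
   have "\<forall>\<^sub>F n in sequentially. y \<notin> A n"
   proof (cases "y $ s > 0")
    case True
    have "(\<lambda>n. r * inverse (2 ^ n)) \<longlonglongrightarrow> r * 0" by (intro tendsto_intros LIMSEQ_inverse_realpow_zero) simp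
    then have "\<forall>\<^sub>F n in sequentially. r * inverse (2 ^ n) < y $ s" using True by (intro order_tendstoD) auto
    then show ?thesis
    proof eventually_elim
     case (elim n)
     have "r / 2 ^ n = r * inverse (2 ^ n)" by (rule divide_inverse)
     then have "\<not> y $ s < r / 2 ^ n" using elim by linarith
     then show ?case unfolding A_def by blast
    qed
   next
    case False
    have "y \<notin> A n" for n
    proof
     assume "y \<in> A n"
     then have "r / 2 ^ Suc n < y $ s" by (simp add: A_def)
     moreover have "r / 2 ^ Suc n > 0" using r by simp
     ultimately show False using False by linarith
    qed
    then show ?thesis by simp
   qed
   then have "\<forall>\<^sub>F n in sequentially. indicator (A n) y *\<^sub>R norm (?h y) = 0" by eventually_elim simp
   then show "(\<lambda>n. indicator (A n) y *\<^sub>R norm (?h y)) \<longlonglongrightarrow> 0" by (rule tendsto_eventually)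
  qed
  show "(\<lambda>y. indicator (A n) y *\<^sub>R norm (?h y)) \<in> borel_measurable lebesgue" for n
   by (rule borel_measurable_integrable[OF integrable_mult_indicator[OF Al integrable_norm[OF hI]]])
  show "AE y in lebesgue. norm (indicator (A n) y *\<^sub>R norm (?h y)) \<le> norm (?h y)" for n
   by (intro AE_I2) (auto simp: indicator_def)
  show "integrable lebesgue (\<lambda>y. norm (?h y))" by (rule integrable_norm[OF hI])
 qed auto
 have low: "V * c / 2 \<le> (LINT y|lebesgue. indicator (A n) y *\<^sub>R norm (?h y))" for n
 proof -
  have "V * c / 2 = (LINT y|lebesgue. indicator (A n) y *\<^sub>R (c * 2 ^ n / r))"
   using r mA[of n] Al[of n] by (simp add: measure_def)
  also have "\<dots> \<le> (LINT y|lebesgue. indicator (A n) y *\<^sub>R norm (?h y))"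
  proof (rule integral_mono_AE)
   have fin: "emeasure lebesgue (A n) < \<infinity>" unfolding Abox using emeasure_bounded_finite[OF bounded_box] by simp
   show "integrable lebesgue (\<lambda>y. indicator (A n) y *\<^sub>R (c * 2 ^ n / r))"
    using Al[of n] fin by (intro integrable_scaleR_left integrable_real_indicator) auto
   show "integrable lebesgue (\<lambda>y. indicator (A n) y *\<^sub>R norm (?h y))"
    by (rule integrable_mult_indicator[OF Al integrable_norm[OF hI]])
   show "AE y in lebesgue. indicator (A n) y *\<^sub>R (c * 2 ^ n / r) \<le> indicator (A n) y *\<^sub>R norm (?h y)"
    using rel
   proof eventually_elim
    case (elim y)
    show ?case
    proof (cases "y \<in> A n")
     case True
     then have y: "y \<in> cbox a b" "0 < y $ s" "y $ s < r / 2 ^ n"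
     proof -
      have "r / 2 ^ Suc n > 0" using r by simp
      then show "y \<in> cbox a b" "0 < y $ s" "y $ s < r / 2 ^ n"
       using True box_subset_cbox[of a b] unfolding A_def by auto
     qed
     then have yO: "y \<in> \<Omega>" "norm (g y) > c" using ab(2) by auto
     have "g y = of_real (y $ s) * f y" using elim yO(1) by simp
     then have "norm (g y) = y $ s * norm (f y)" using y(2) by (simp add: norm_mult)
     then have "c < y $ s * norm (f y)" using yO(2) by simp
     also have "\<dots> \<le> r / 2 ^ n * norm (f y)" using y by (intro mult_right_mono) auto
     finally have "c * 2 ^ n / r \<le> norm (f y)" using r by (simp add: field_simps)
     then show ?thesis using True y(1) by simp
    qed simp
   qed
  qed
  finally show ?thesis .
 qed
 have "V * c / 2 \<le> (LINT y|(lebesgue :: (real^'d) measure). 0)"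
  by (rule LIMSEQ_le_const[OF lim]) (intro exI allI impI low)
 then have "V * c / 2 \<le> 0" by simp
 then show False using V c by (simp add: mult_le_0_iff)
qed

text \<open>Induction on \<open>m\<close>: one factor of the coordinate is removed by Hadamard's lemma, since \<open>g\<close> vanishes on the hyperplane.\<close>

lemma smooth_after_division:
 fixes f g :: "real^'d => complex"
 assumes B: "a $ s < 0" "0 < b $ s"
  and f: "locally_integrable_on (box a b) f" and g: "smooth_on (box a b) g"
  and rel: "AE y in lebesgue. y \<in> box a b \<longrightarrow> of_real (y $ s) ^ m * f y = g y"
 shows "\<exists>h. smooth_on (box a b) h \<and> (AE y in lebesgue. y \<in> box a b \<longrightarrow> f y = h y)"
 using g rel
proof (induction m arbitrary: g)
 case 0
 then show ?case by auto
next
 case (Suc m)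
 let ?e = "axis s 1 :: real^'d" and ?B = "box a b"
 have ye: "y \<bullet> ?e = y $ s" for y by (simp add: inner_axis)
 have LI: "locally_integrable_on ?B (\<lambda>y. of_real (y $ s) ^ m * f y)"
  using locally_integrable_on_mult[OF f, of "\<lambda>y. of_real (y $ s) ^ m"] by (simp add: continuous_intros mult.commute)
 have rel: "AE y in lebesgue. y \<in> ?B \<longrightarrow> of_real (y $ s) * (of_real (y $ s) ^ m * f y) = g y"
  using Suc.prems(2) by (simp add: mult.assoc)
 have g0: "g y = 0" if "y \<in> ?B" "y \<bullet> ?e = 0" for y
  using numerator_vanishes[OF open_box LI smooth_on_continuous[OF Suc.prems(1)] rel that(1)] that(2) by (simp add: ye)
 have star: "coordinate_shrink ?e t y \<in> ?B" if "y \<in> ?B" "t \<in> {0..1}" for t y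
 proof -
  have c: "coordinate_shrink ?e t y $ i = (if i = s then t * y $ s else y $ i)" for i
   unfolding coordinate_shrink_def ye by (simp add: axis_def algebra_simps)
  have "a $ s < t * y $ s" "t * y $ s < b $ s"
  proof -
   have y: "a $ s < y $ s" "y $ s < b $ s" using that(1) by (auto simp: mem_box_cart)
   have "min 0 (y $ s) \<le> t * y $ s" "t * y $ s \<le> max 0 (y $ s)"
    using that(2) mult_right_mono[of t 1 "y $ s"] mult_right_mono_neg[of t 1 "y $ s"]
    by (auto simp: min_def max_def mult_nonneg_nonpos zero_le_mult_iff not_le)
   then show "a $ s < t * y $ s" "t * y $ s < b $ s" using B y by auto
  qed
  then show ?thesis using that(1) unfolding mem_box_cart c by auto
 qed
 have n: "norm ?e = 1" by (simp add: norm_axis_1)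
 have "\<exists>g1. smooth_on ?B g1 \<and> (\<forall>y\<in>?B. g y = (y \<bullet> ?e) *\<^sub>R g1 y)"
  by (rule smooth_on_divide_coordinate[OF open_box star n Suc.prems(1) g0])
 then obtain g1 where g1: "smooth_on ?B g1" "\<forall>y\<in>?B. g y = (y \<bullet> ?e) *\<^sub>R g1 y" by (elim exE conjE)
 have "AE y :: real^'d in lebesgue. y $ s \<noteq> 0"
 proof -
  have "negligible {y. ?e \<bullet> y = 0}" by (intro negligible_hyperplane) (simp add: axis_eq_0_iff)
  then have "{y :: real^'d. y $ s = 0} \<in> null_sets lebesgue" by (simp add: negligible_iff_null_sets inner_axis' )
  then show ?thesis by (rule AE_I') auto
 qed
 with rel have "AE y in lebesgue. y \<in> ?B \<longrightarrow> of_real (y $ s) ^ m * f y = g1 y"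
 proof eventually_elim
  case (elim y)
  then show ?case using bspec[OF g1(2), of y] by (auto simp: ye scaleR_conv_of_real)
 qed
 then show ?case using Suc.IH[OF g1(1)] by blast
qed

section \<open>Wirtinger derivatives\<close>

definition ds :: "((complex^'n) \<times> real => complex) => (complex^'n) \<times> real => complex"
 where "ds g x = fderiv g x (0, 1)"

lemma smooth_on_Wirtinger [smooth_intros]:
 assumes "open S" "smooth_on S g"
 shows "smooth_on S (dz j g)" "smooth_on S (dzbar j g)" "smooth_on S (ds g)"
proof -
 show "smooth_on S (dz j g)"
  unfolding dz_def[abs_def] by (intro smooth_intros smooth_on_derivative smooth_on_divide assms) auto
 show "smooth_on S (dzbar j g)"
  unfolding dzbar_def[abs_def] by (intro smooth_intros smooth_on_derivative smooth_on_divide assms) auto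
 show "smooth_on S (ds g)"
  unfolding ds_def[abs_def] by (intro smooth_on_derivative assms)
qed

lemma smooth_on_iterated_Wirtinger [smooth_intros]:
 "open S ==> smooth_on S g ==> smooth_on S (foldr dzbar \<alpha> g)"
 by (induction \<alpha>) (auto intro: smooth_on_Wirtinger)

lemma Wirtinger_cong:
 assumes "open S" "x \<in> S" "\<And>y. y \<in> S ==> f y = g y"
 shows "dz j f x = dz j g x" "dzbar j f x = dzbar j g x" "ds f x = ds g x"
 using frechet_derivative_cong_open[OF assms] by (simp_all add: dz_def dzbar_def ds_def)

lemma Wirtinger_mult:
 assumes "smooth_on S f" "smooth_on S g" "x \<in> S"
 shows "dz j (\<lambda>x. f x * g x) x = f x * dz j g x + dz j f x * g x"
  and "dzbar j (\<lambda>x. f x * g x) x = f x * dzbar j g x + dzbar j f x * g x"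
  and "ds (\<lambda>x. f x * g x) x = f x * ds g x + ds f x * g x"
 unfolding dz_def dzbar_def ds_def frechet_derivative_mult[OF assms] by (simp_all add: algebra_simps add_divide_distrib diff_divide_distrib)

lemma Wirtinger_add:
 assumes "smooth_on S f" "smooth_on S g" "x \<in> S"
 shows "dz j (\<lambda>x. f x + g x) x = dz j f x + dz j g x"
  and "dzbar j (\<lambda>x. f x + g x) x = dzbar j f x + dzbar j g x"
  and "ds (\<lambda>x. f x + g x) x = ds f x + ds g x"
 unfolding dz_def dzbar_def ds_def frechet_derivative_add[OF assms] by (simp_all add: algebra_simps add_divide_distrib diff_divide_distrib)

lemma Wirtinger_const:
 "dz j (\<lambda>x. c) x = 0" "dzbar j (\<lambda>x. c) x = 0" "ds (\<lambda>x. c) x = 0"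
 by (simp_all add: dz_def dzbar_def ds_def)

lemma smooth_on_real_coordinate [smooth_intros]: "open S ==> smooth_on S (\<lambda>x. complex_of_real (snd x) ^ m)"
 by (intro smooth_on_power smooth_on_of_real smooth_on_linear bounded_linear_snd)

lemma Wirtinger_real_coordinate:
 fixes x :: "(complex^'n) \<times> real"
 shows "dz j (\<lambda>x. of_real (snd x) ^ m) x = 0" "dzbar j (\<lambda>x. of_real (snd x) ^ m) x = 0"
  "ds (\<lambda>x. of_real (snd x) ^ m) x = of_nat m * of_real (snd x) ^ (m - 1)"
proof -
 have "((\<lambda>x :: (complex^'n) \<times> real. of_real (snd x) ^ m :: complex) has_derivative (\<lambda>v. of_nat m * of_real (snd v) * of_real (snd x) ^ (m - 1))) (at x)"
  by (rule has_derivative_power has_derivative_of_real has_derivative_snd has_derivative_ident)+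
 then have "fderiv (\<lambda>x :: (complex^'n) \<times> real. of_real (snd x) ^ m :: complex) x = (\<lambda>v. of_nat m * of_real (snd v) * of_real (snd x) ^ (m - 1))"
  by (rule frechet_derivative_eqI)
 then show "dz j (\<lambda>x. of_real (snd x) ^ m) x = 0" "dzbar j (\<lambda>x. of_real (snd x) ^ m) x = 0"
  "ds (\<lambda>x. of_real (snd x) ^ m) x = of_nat m * of_real (snd x) ^ (m - 1)"
  by (simp_all add: dz_def dzbar_def ds_def)
qed

lemma dz_dzbar_commute:
 assumes S: "open S" "x \<in> S" and g: "smooth_on S g"
 shows "dz j (dzbar i g) x = dzbar i (dz j g) x"
proof -
 let ?D = "\<lambda>v x. fderiv g x v"
 have sm: "smooth_on S (?D v)" for v by (rule smooth_on_derivative[OF g])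
 have D: "fderiv (\<lambda>y. (?D a y + c * ?D b y) / 2) x v
   = (fderiv (?D a) x v + c * fderiv (?D b) x v) / 2" for a b v c
 proof -
  have "((\<lambda>y. (?D a y + c * ?D b y) / 2) has_derivative
    (\<lambda>v. (fderiv (?D a) x v + c * fderiv (?D b) x v) / 2)) (at x)"
   unfolding divide_inverse
   by (intro has_derivative_mult_left has_derivative_add has_derivative_mult_right smooth_on_has_derivative[OF sm S(2)])
  then show ?thesis by (simp add: frechet_derivative_eqI)
 qed
 have sym: "fderiv (?D a) x b = fderiv (?D b) x a" for a b
  by (rule second_derivative_symmetric[OF S g])
 have 1: "dz j (dzbar i g) x = (fderiv (\<lambda>y. (?D (axis i 1, 0) y + \<i> * ?D (axis i \<i>, 0) y) / 2) x (axis j 1, 0)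
   - \<i> * fderiv (\<lambda>y. (?D (axis i 1, 0) y + \<i> * ?D (axis i \<i>, 0) y) / 2) x (axis j \<i>, 0)) / 2"
  unfolding dz_def dzbar_def[abs_def] ..
 have 2: "dzbar i (dz j g) x = (fderiv (\<lambda>y. (?D (axis j 1, 0) y + (- \<i>) * ?D (axis j \<i>, 0) y) / 2) x (axis i 1, 0)
   + \<i> * fderiv (\<lambda>y. (?D (axis j 1, 0) y + (- \<i>) * ?D (axis j \<i>, 0) y) / 2) x (axis i \<i>, 0)) / 2"
  unfolding dzbar_def dz_def[abs_def] by simp
 show ?thesis
  unfolding 1 2 D sym[of "(axis i 1, 0)" "(axis j 1, 0)"] sym[of "(axis i 1, 0)" "(axis j \<i>, 0)"]
   sym[of "(axis i \<i>, 0)" "(axis j 1, 0)"] sym[of "(axis i \<i>, 0)" "(axis j \<i>, 0)"]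
  by (simp add: add_divide_distrib diff_divide_distrib algebra_simps)
qed

lemma dz_iterated_dzbar_commute:
 assumes S: "open S" and g: "smooth_on S g"
 shows "x \<in> S ==> dz j (foldr dzbar \<alpha> g) x = foldr dzbar \<alpha> (dz j g) x"
proof (induction \<alpha> arbitrary: x)
 case (Cons i \<alpha>)
 have "dz j (foldr dzbar (i # \<alpha>) g) x = dzbar i (dz j (foldr dzbar \<alpha> g)) x"
  using dz_dzbar_commute[OF S Cons.prems smooth_on_iterated_Wirtinger[OF S g]] by simp
 also have "\<dots> = dzbar i (foldr dzbar \<alpha> (dz j g)) x"
  by (rule Wirtinger_cong[OF S Cons.prems Cons.IH])
 finally show ?case by simp
qed simp

section \<open>Functions whose iterated \<open>z\<close>-bar derivatives vanish at the origin\<close>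

text \<open>\<open>vanish r\<close> is the space of functions all of whose \<open>z\<close>-bar derivatives of order less than \<open>r\<close> vanish at the
origin.  On smooth functions it is an ideal, and \<open>\<partial>/\<partial>z\<^sub>j-bar\<close> lowers the order by one.\<close>

primrec vanish :: "nat => ((complex^'n) \<times> real => complex) => bool"
 where "vanish 0 g \<longleftrightarrow> True"
 | "vanish (Suc r) g \<longleftrightarrow> g (0, 0) = 0 \<and> (\<forall>j. vanish r (dzbar j g))"

lemma vanish_cong:
 assumes "open S" "(0, 0) \<in> S"
 shows "(\<And>y. y \<in> S ==> f y = g y) ==> vanish r f ==> vanish r g"
proof (induction r arbitrary: f g)
 case (Suc r)
 have "vanish r (dzbar j g)" for j
  using Suc.IH[of "dzbar j f" "dzbar j g"] Wirtinger_cong(2)[OF assms(1) _ Suc.prems(1)] Suc.prems(2) by simp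
 then show ?case using Suc.prems assms(2) by simp
qed simp

lemma vanish_Suc: "vanish (Suc r) g ==> vanish r g"
 by (induction r arbitrary: g) auto

lemma vanish_mono: "r \<le> r' ==> vanish r' g ==> vanish r g"
 by (induction r' rule: dec_induct) (auto simp del: vanish.simps dest: vanish_Suc)

lemma vanish_add:
 assumes S: "open S" "(0, 0) \<in> S"
 shows "smooth_on S f ==> smooth_on S g ==> vanish r f ==> vanish r g ==> vanish r (\<lambda>x. f x + g x)"
proof (induction r arbitrary: f g)
 case (Suc r)
 have "vanish r (dzbar j (\<lambda>x. f x + g x))" for j
  by (rule vanish_cong[OF S, of "\<lambda>x. dzbar j f x + dzbar j g x"])
    (use Suc Wirtinger_add(2)[OF Suc.prems(1,2)] smooth_on_Wirtinger(2)[OF S(1)] in auto)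
 then show ?case using Suc.prems by simp
qed simp

lemma vanish_mult:
 assumes S: "open S" "(0, 0) \<in> S"
 shows "smooth_on S c ==> smooth_on S g ==> vanish r g ==> vanish r (\<lambda>x. c x * g x)"
proof (induction r arbitrary: c g)
 case (Suc r)
 have "vanish r (dzbar j (\<lambda>x. c x * g x))" for j
 proof (rule vanish_cong[OF S])
  note sm = smooth_on_Wirtinger(2)[OF S(1)] Suc.prems(1,2)
  show "vanish r (\<lambda>x. c x * dzbar j g x + dzbar j c x * g x)"
   using Suc.prems(3) by (intro vanish_add[OF S] Suc.IH smooth_intros S(1) sm vanish_Suc[OF Suc.prems(3)]) auto
  show "c x * dzbar j g x + dzbar j c x * g x = dzbar j (\<lambda>x. c x * g x) x" if "x \<in> S" for x
   using Wirtinger_mult(2)[OF Suc.prems(1,2) that] by simp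
 qed
 then show ?case using Suc.prems by simp
qed simp

text \<open>The \<open>z\<close>-bar derivatives do not see the coordinate \<open>s\<close>, so a factor \<open>s\<close> makes all of them vanish at the origin.\<close>

lemma vanish_real_coordinate:
 assumes S: "open S" "(0, 0) \<in> S" and m: "m > 0"
 shows "smooth_on S g ==> vanish r (\<lambda>x. of_real (snd x) ^ m * g x)"
proof (induction r arbitrary: g)
 case (Suc r)
 have "vanish r (dzbar j (\<lambda>x. of_real (snd x) ^ m * g x))" for j
 proof (rule vanish_cong[OF S])
  show "vanish r (\<lambda>x. of_real (snd x) ^ m * dzbar j g x)"
   by (intro Suc.IH smooth_intros S Suc.prems)
  show "of_real (snd x) ^ m * dzbar j g x = dzbar j (\<lambda>x. of_real (snd x) ^ m * g x) x" if "x \<in> S" for x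
   using Wirtinger_mult(2)[OF smooth_on_real_coordinate[OF S(1)] Suc.prems that] by (simp add: Wirtinger_real_coordinate)
 qed
 then show ?case using m by (simp add: zero_power)
qed simp

lemma vanish_iterated:
 "(\<And>\<alpha>. length \<alpha> < r ==> foldr dzbar \<alpha> g (0, 0) = 0) ==> vanish r g"
proof (induction r arbitrary: g)
 case (Suc r)
 have "vanish r (dzbar j g)" for j
 proof (rule Suc.IH)
  fix \<alpha> :: "'a list" assume "length \<alpha> < r"
  then show "foldr dzbar \<alpha> (dzbar j g) (0, 0) = 0" using Suc.prems[of "\<alpha> @ [j]"] by simp
 qed
 then show ?case using Suc.prems[of "[]"] by simp
qed simp

section \<open>The coefficients of the differentiated relation\<close>

definition graph_ds :: "nat => ((complex^'n) \<times> real => complex) => (complex^'n) \<times> real => complex"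
 where "graph_ds m \<Phi> = ds (\<lambda>x. of_real (snd x) ^ m * \<Phi> x)"

text \<open>With \<open>h = s^m \<Phi>\<close>, the field \<open>\<partial>/\<partial>z\<^sub>j-bar + a \<partial>/\<partial>s\<close> annihilates \<open>w = s + \<i> h\<close> if and only if
\<open>a = - \<i> h\<^bsub>zbar\<^esub> / (1 + \<i> h\<^sub>s)\<close>, which is \<open>s^m\<close> times the coefficient below.\<close>

definition CR_coefficient :: "nat => ((complex^'n) \<times> real => complex) => 'n => (complex^'n) \<times> real => complex"
 where "CR_coefficient m \<Phi> j x = - \<i> * dzbar j \<Phi> x / (1 + \<i> * graph_ds m \<Phi> x)"

text \<open>The coefficients \<open>P\<^sub>l\<close> for which \<open>s^m \<Sum> P\<^sub>l f\<^sub>l\<close> is smooth.  The recursion is obtained by applying the CR vector field to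
\<open>s^m P\<^sub>l\<close> and removing the factor \<open>s^m\<close>; the summand with \<open>of_nat m\<close> comes from the derivative of \<open>s^m\<close>.\<close>

primrec relation_coefficient ::
  "nat => ((complex^'n) \<times> real => complex) => 'n => 'n list => (complex^'n) \<times> real => complex"
 where "relation_coefficient m \<Phi> l [] = (\<lambda>x. - 2 * \<i> * dz l \<Phi> x / (1 - \<i> * graph_ds m \<Phi> x))"
 | "relation_coefficient m \<Phi> l (j # \<alpha>) = (\<lambda>x. dzbar j (relation_coefficient m \<Phi> l \<alpha>) x +
   of_real (snd x) ^ (m - 1) * CR_coefficient m \<Phi> j x *
    (of_real (snd x) * ds (relation_coefficient m \<Phi> l \<alpha>) x + of_nat m * relation_coefficient m \<Phi> l \<alpha> x))"

locale real_valued_graph =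
 fixes m :: nat and \<Phi> :: "(complex^'n) \<times> real => complex" and S
 assumes m: "m > 0" and S: "open S" and \<Phi>: "smooth_on S \<Phi>" and real: "\<And>x. x \<in> S ==> \<Phi> x \<in> \<real>"
begin

lemma smooth_on_graph: "smooth_on S (\<lambda>x. of_real (snd x) ^ m * \<Phi> x)"
 by (intro smooth_intros S \<Phi>)

lemma smooth_on_graph_ds: "smooth_on S (graph_ds m \<Phi>)"
 unfolding graph_ds_def by (intro smooth_intros S \<Phi>)

lemma graph_ds_eq: "x \<in> S ==> graph_ds m \<Phi> x = of_real (snd x) ^ m * ds \<Phi> x + of_nat m * of_real (snd x) ^ (m - 1) * \<Phi> x"
 unfolding graph_ds_def using Wirtinger_mult(3)[OF smooth_on_real_coordinate[OF S] \<Phi>] by (simp add: Wirtinger_real_coordinate)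

lemma real_derivative:
 fixes g :: "(complex^'n) \<times> real => complex"
 assumes g: "smooth_on S g" "\<And>x. x \<in> S ==> g x \<in> \<real>" and x: "x \<in> S"
 shows "fderiv g x v \<in> \<real>"
proof -
 have "((\<lambda>x. Im (g x)) has_derivative (\<lambda>v. Im (fderiv g x v))) (at x)"
  by (intro has_derivative_Im smooth_on_has_derivative[OF g(1) x])
 then have "fderiv (\<lambda>x. Im (g x)) x = (\<lambda>v. Im (fderiv g x v))"
  by (rule frechet_derivative_eqI)
 moreover have "fderiv (\<lambda>x. Im (g x)) x = fderiv (\<lambda>x. 0) x"
  using g(2) by (intro frechet_derivative_cong_open[OF S x]) (simp add: complex_is_Real_iff)
 ultimately have "Im (fderiv g x v) = 0" by (metis frechet_derivative_const)
 then show ?thesis by (simp add: complex_is_Real_iff)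
qed

lemma graph_ds_real: "x \<in> S ==> graph_ds m \<Phi> x \<in> \<real>"
 unfolding graph_ds_def ds_def by (rule real_derivative[OF smooth_on_graph]) (auto intro!: real Reals_mult Reals_power)

text \<open>The derivative of \<open>h\<close> by \<open>s\<close> is real, so it differs from \<open>\<plusminus>\<i>\<close>.\<close>

lemma graph_ds_nonzero: "x \<in> S ==> 1 + \<i> * graph_ds m \<Phi> x \<noteq> 0" "x \<in> S ==> 1 - \<i> * graph_ds m \<Phi> x \<noteq> 0"
 using graph_ds_real[of x] by (auto simp: complex_eq_iff complex_is_Real_iff)

lemma smooth_on_CR_coefficient: "smooth_on S (CR_coefficient m \<Phi> j)"
 unfolding CR_coefficient_def[abs_def] using graph_ds_nonzero(1) by (intro smooth_intros smooth_on_divide S \<Phi> smooth_on_graph_ds)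

lemma smooth_on_relation_coefficient: "smooth_on S (relation_coefficient m \<Phi> l \<alpha>)"
proof (induction \<alpha>)
 case Nil
 show ?case
  unfolding relation_coefficient.simps using graph_ds_nonzero(2) by (intro smooth_intros smooth_on_divide S \<Phi> smooth_on_graph_ds)
next
 case (Cons j \<alpha>)
 have "smooth_on S (\<lambda>x :: (complex^'n) \<times> real. of_real (snd x) :: complex)" using smooth_on_real_coordinate[OF S, of 1] by simp
 then show ?case using Cons by (auto intro!: smooth_intros S \<Phi> smooth_on_CR_coefficient)
qed

lemma CR_derivative_relation_coefficient:
 assumes x: "x \<in> S"
  and P_def: "P = relation_coefficient m \<Phi> l \<alpha>"
 shows "dzbar j (\<lambda>x. of_real (snd x) ^ m * P x) x + of_real (snd x) ^ m * CR_coefficient m \<Phi> j x * ds (\<lambda>x. of_real (snd x) ^ m * P x) x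
  = of_real (snd x) ^ m * relation_coefficient m \<Phi> l (j # \<alpha>) x"
proof -
 note sm = smooth_on_real_coordinate[OF S, of m] smooth_on_relation_coefficient[of l \<alpha>, folded P_def]
 have pw: "complex_of_real (snd x) ^ m = of_real (snd x) * of_real (snd x) ^ (m - 1)"
  using m by (simp add: power_eq_if)
 show ?thesis
  unfolding Wirtinger_mult(2)[OF sm x] Wirtinger_mult(3)[OF sm x] Wirtinger_real_coordinate
  by (simp add: P_def[symmetric] pw algebra_simps)
qed

text \<open>Every correction in the recursion contains a factor \<open>\<Phi>\<^bsub>zbar\<^esub>\<close>, which vanishes to order \<open>k\<close>; the denominator
\<open>1 - \<i> h\<^sub>s\<close> differs from \<open>1\<close> by \<open>h\<^sub>s\<close>, which vanishes to order \<open>k + 1\<close> (for \<open>m = 1\<close> because \<open>\<Phi>\<close> does).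
One order is lost with each differentiation.\<close>

lemma relation_coefficient_leading_part:
 assumes 0: "(0, 0) \<in> S" and v: "vanish (Suc k) \<Phi>"
 shows "length \<alpha> \<le> Suc k ==> vanish (Suc k - length \<alpha>) (\<lambda>x. relation_coefficient m \<Phi> l \<alpha> x + 2 * \<i> * foldr dzbar \<alpha> (dz l \<Phi>) x)"
proof (induction \<alpha>)
 case Nil
 let ?H = "graph_ds m \<Phi>"
 have vh: "vanish (Suc k) ?H"
 proof (rule vanish_cong[OF S 0])
  show "vanish (Suc k) (\<lambda>x. of_real (snd x) ^ m * ds \<Phi> x + of_nat m * of_real (snd x) ^ (m - 1) * \<Phi> x)"
   using v by (intro vanish_add[OF S 0] vanish_real_coordinate[OF S 0 m] vanish_mult[OF S 0] smooth_intros S \<Phi>)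
 qed (simp add: graph_ds_eq)
 show ?case
 proof (rule vanish_cong[OF S 0])
  show "vanish (Suc k - length []) (\<lambda>x. 2 * dz l \<Phi> x / (1 - \<i> * ?H x) * ?H x)"
   using vh graph_ds_nonzero(2)
   by (simp only: list.size diff_zero) (intro vanish_mult[OF S 0] smooth_intros smooth_on_divide S \<Phi> smooth_on_graph_ds)
  show "2 * dz l \<Phi> x / (1 - \<i> * ?H x) * ?H x = relation_coefficient m \<Phi> l [] x + 2 * \<i> * foldr dzbar [] (dz l \<Phi>) x" if "x \<in> S" for x
   using graph_ds_nonzero(2)[OF that] by (simp add: field_simps)
 qed
next
 case (Cons j \<alpha>)
 let ?P = "relation_coefficient m \<Phi> l \<alpha>" and ?Q = "foldr dzbar \<alpha> (dz l \<Phi>)" and ?r = "Suc k - length (j # \<alpha>)"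
 have r: "Suc ?r = Suc k - length \<alpha>" using Cons.prems by simp
 have "vanish (Suc ?r) (\<lambda>x. ?P x + 2 * \<i> * ?Q x)" using Cons unfolding r by simp
 then have 1: "vanish ?r (dzbar j (\<lambda>x. ?P x + 2 * \<i> * ?Q x))" by simp
 have "vanish k (dzbar j \<Phi>)" using v by simp
 then have 2: "vanish ?r (dzbar j \<Phi>)" by (rule vanish_mono[rotated]) simp
 have smQ: "smooth_on S ?Q" by (intro smooth_intros S \<Phi>)
 have s1: "smooth_on S (\<lambda>x :: (complex^'n) \<times> real. of_real (snd x) :: complex)" using smooth_on_real_coordinate[OF S, of 1] by simp
 note sm = smooth_on_relation_coefficient smQ smooth_on_graph_ds s1
 define c where "c x = of_real (snd x) ^ (m - 1) * (- \<i> / (1 + \<i> * graph_ds m \<Phi> x)) * (of_real (snd x) * ds ?P x + of_nat m * ?P x)" for x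
 have c: "smooth_on S c" unfolding c_def[abs_def] using graph_ds_nonzero(1) by (intro smooth_intros smooth_on_divide S \<Phi> sm)
 show ?case
 proof (rule vanish_cong[OF S 0])
  show "vanish ?r (\<lambda>x. dzbar j (\<lambda>x. ?P x + 2 * \<i> * ?Q x) x + c x * dzbar j \<Phi> x)"
   by (intro vanish_add[OF S 0] vanish_mult[OF S 0] smooth_intros S \<Phi> sm c 1 2)
  fix x assume x: "x \<in> S"
  have "dzbar j (\<lambda>x. ?P x + 2 * \<i> * ?Q x) x = dzbar j ?P x + dzbar j (\<lambda>x. 2 * \<i> * ?Q x) x"
   by (rule Wirtinger_add(2)[OF _ _ x]) (intro smooth_intros S sm)+
  also have "dzbar j (\<lambda>x. (2 * \<i>) * ?Q x) x = 2 * \<i> * dzbar j ?Q x"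
   using Wirtinger_mult(2)[OF smooth_on_const smQ x, of j "2 * \<i>"] by (simp add: Wirtinger_const)
  finally show "dzbar j (\<lambda>x. ?P x + 2 * \<i> * ?Q x) x + c x * dzbar j \<Phi> x
   = relation_coefficient m \<Phi> l (j # \<alpha>) x + 2 * \<i> * foldr dzbar (j # \<alpha>) (dz l \<Phi>) x"
   unfolding c_def by (simp add: CR_coefficient_def)
 qed
qed

end

section \<open>Real coordinates on the model space\<close>

text \<open>Distributions live on \<open>real^'d\<close>, whereas the graph is over \<open>(complex^'n) \<times> real\<close>.  The bijection names the real and
imaginary parts of the \<open>z\<^sub>l\<close> (by a Boolean) and the coordinate \<open>s\<close> (by \<open>None\<close>).\<close>

locale chart_index =
 fixes e :: "('n::finite \<times> bool) option => 'd::finite"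
 assumes bij: "bij e"
begin

definition to_model :: "real^'d => (complex^'n) \<times> real"
 where "to_model y = ((\<chi> l. Complex (y $ e (Some (l, False))) (y $ e (Some (l, True)))), y $ e None)"

definition of_model :: "(complex^'n) \<times> real => real^'d"
 where "of_model x = (\<chi> i. case inv e i of None => snd x
  | Some (l, b) => if b then Im (fst x $ l) else Re (fst x $ l))"

lemma inv_e [simp]: "inv e (e t) = t" "e (inv e i) = i"
 using bij by (simp_all add: bij_is_inj bij_is_surj surj_f_inv_f)

lemma e_eq_iff [simp]: "e a = e b \<longleftrightarrow> a = b"
 using bij by (simp add: bij_is_inj inj_eq)

lemma to_model_of_model [simp]: "to_model (of_model x) = x"
 by (cases x) (simp add: to_model_def of_model_def vec_eq_iff)

lemma of_model_to_model [simp]: "of_model (to_model y) = y"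
proof -
 have "of_model (to_model y) $ i = y $ i" for i
 proof -
  show ?thesis
   using inv_e(2)[of i] unfolding of_model_def to_model_def
   by (auto split: option.split prod.split if_split simp del: inv_e)
 qed
 then show ?thesis by (simp add: vec_eq_iff)
qed

lemma snd_to_model: "snd (to_model y) = y $ e None"
 by (simp add: to_model_def)

lemma linear_to_model: "linear to_model"
 by (rule linearI) (simp_all add: to_model_def vec_eq_iff complex_eq_iff)

lemma linear_of_model: "linear of_model"
 by (rule linearI) (simp_all add: of_model_def vec_eq_iff split: option.split prod.split)

lemma bounded_linear_to_model: "bounded_linear to_model" and bounded_linear_of_model: "bounded_linear of_model"
 using linear_to_model linear_of_model linear_conv_bounded_linear by blast+

lemma to_model_0 [simp]: "to_model 0 = (0, 0)"
 using linear_0[OF linear_to_model] by (simp add: zero_prod_def)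

lemma open_to_model: "open S ==> open (to_model -` S)" and open_of_model: "open T ==> open (of_model -` T)"
 by (rule open_vimage; simp add: linear_continuous_on bounded_linear_to_model bounded_linear_of_model)+

lemma to_model_axis:
 "to_model (axis (e None) 1) = (0, 1)"
 "to_model (axis (e (Some (l, b))) 1) = (axis l (if b then \<i> else 1), 0)"
 by (auto simp: to_model_def axis_def vec_eq_iff complex_eq_iff)

lemma smooth_on_to_model:
 assumes "open S" "smooth_on S g"
 shows "smooth_on (to_model -` S) (\<lambda>y. g (to_model y))"
 by (rule smooth_on_compose[OF open_to_model[OF assms(1)] assms(1) smooth_on_linear[OF bounded_linear_to_model open_to_model[OF assms(1)]] assms(2)]) auto

lemma derivative_to_model:
 assumes "smooth_on S g" "to_model y \<in> S"
 shows "fderiv (\<lambda>y. g (to_model y)) y v = fderiv g (to_model y) (to_model v)"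
proof -
 have "((\<lambda>y. g (to_model y)) has_derivative (\<lambda>v. fderiv g (to_model y) (to_model v))) (at y)"
  by (rule has_derivative_compose[OF bounded_linear.has_derivative[OF bounded_linear_to_model has_derivative_ident] smooth_on_has_derivative[OF assms]])
 then show ?thesis by (simp add: frechet_derivative_eqI)
qed

text \<open>The vector field \<open>\<partial>/\<partial>z\<^sub>j-bar + a \<partial>/\<partial>s\<close> in the real coordinates.\<close>

definition CR_field :: "'n => ((complex^'n) \<times> real => complex) => real^'d => complex^'d"
 where "CR_field j a y = (\<chi> i. case inv e i of None => a (to_model y)
  | Some (l, b) => if l = j then (if b then \<i> / 2 else 1 / 2) else 0)"

lemma smooth_on_CR_field:
 assumes "open S" "smooth_on S a"
 shows "smooth_on (to_model -` S) (\<lambda>y. CR_field j a y $ i)"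
 by (cases "inv e i") (auto simp: CR_field_def intro!: smooth_intros smooth_on_to_model assms split: prod.split)

lemma sum_CR_field:
 "(\<Sum>i\<in>UNIV. CR_field j a y $ i * B i)
  = (B (e (Some (j, False))) + \<i> * B (e (Some (j, True)))) / 2 + a (to_model y) * B (e None)"
proof -
 have U: "(UNIV :: ('n \<times> bool) option set) = insert None (Some ` (UNIV \<times> UNIV))"
  by (auto simp: UNIV_option_conv)
 have "(\<Sum>i\<in>UNIV. CR_field j a y $ i * B i) = (\<Sum>t\<in>UNIV. CR_field j a y $ e t * B (e t))"
  by (rule sum.reindex_bij_betw[OF bij, symmetric])
 also have "\<dots> = a (to_model y) * B (e None)
   + (\<Sum>l\<in>UNIV. \<Sum>b\<in>UNIV. (if l = j then (if b then \<i> / 2 else 1 / 2) else 0) * B (e (Some (l, b))))"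
  unfolding U by (subst sum.insert) (auto simp: sum.reindex sum.cartesian_product CR_field_def intro!: sum.cong)
 also have "(\<Sum>l\<in>UNIV. \<Sum>b\<in>UNIV. (if l = j then (if b then \<i> / 2 else 1 / 2) else 0) * B (e (Some (l, b))))
   = (\<Sum>l\<in>UNIV. if l = j then B (e (Some (l, False))) / 2 + \<i> / 2 * B (e (Some (l, True))) else 0)"
  by (intro sum.cong) (auto simp: UNIV_bool)
 finally show ?thesis by (simp add: add_divide_distrib)
qed

lemma vector_field_derivative_CR_field:
 assumes g: "smooth_on S g" "to_model y \<in> S"
 shows "vector_field_derivative (CR_field j a) (\<lambda>y. g (to_model y)) y = dzbar j g (to_model y) + a (to_model y) * ds g (to_model y)"
 unfolding vector_field_derivative_def partial_deriv_def derivative_to_model[OF g] sum_CR_field to_model_axis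
 by (simp add: dzbar_def ds_def)

end

section \<open>Regularity of CR functions on a weakly nondegenerate graph\<close>

lemma spanning_family_matrix:
 fixes v :: "'i => complex^'n"
 assumes "vec.span (v ` I) = UNIV"
 shows "\<exists>A. (\<forall>r. A r \<in> I) \<and> det (\<chi> r l. v (A r) $ l) \<noteq> 0"
proof -
 obtain B where B: "B \<subseteq> v ` I" "vec.independent B" "v ` I \<subseteq> vec.span B"
  using vec.maximal_independent_subset[of "v ` I"] by blast
 have sB: "vec.span B = UNIV"
  using vec.span_minimal[OF B(3) vec.subspace_span] assms by auto
 then have "card B = vec.dim (UNIV :: (complex^'n) set)"
  by (intro vec.basis_card_eq_dim B(2)) auto
 then have c: "card B = CARD('n)" by (simp add: card_cart_basis)
 then have "finite B" using card_ge_0_finite[of B] by simp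
 then obtain q where q: "bij_betw q (UNIV :: 'n set) B" using c finite_same_card_bij by (metis finite_code)
 have "\<exists>\<alpha>\<in>I. q r = v \<alpha>" for r using q B(1) by (auto simp: bij_betw_def)
 then obtain A where A: "\<And>r. A r \<in> I" "\<And>r. q r = v (A r)" by metis
 let ?M = "\<chi> r l. v (A r) $ l"
 have "rows ?M = B"
 proof -
  have "row r ?M = q r" for r by (simp add: row_def A(2) vec_eq_iff)
  then show ?thesis using q by (auto simp: rows_def bij_betw_def)
 qed
 then have "\<exists>C. C ** ?M = mat 1" using sB matrix_left_invertible_span_rows_gen[of ?M] by simp
 then have "det ?M \<noteq> 0" using invertible_left_inverse invertible_det_nz by blast
 then show ?thesis using A(1) by blast
qed

lemma smooth_on_det:
 fixes R :: "'a::real_normed_vector => 'b::real_normed_field^'n^'n"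
 assumes "open S" "\<And>r l. smooth_on S (\<lambda>y. R y $ r $ l)"
 shows "smooth_on S (\<lambda>y. det (R y))"
 unfolding det_def by (intro smooth_intros smooth_on_prod assms)

text \<open>Weak CR functions \<open>f\<close> that satisfy the relation coming from the characteristic form.  Only \<open>None\<close>, the index of
the coordinate \<open>w\<close>, occurs without a factor \<open>s^m\<close>.\<close>

locale weak_CR_functions = chart_index e + real_valued_graph m \<Phi> S
 for e :: "('n::finite \<times> bool) option => 'd::finite" and m \<Phi> S +
 fixes f :: "'n option => real^'d => complex" and u :: "real^'d => complex" and k :: nat
 assumes origin: "(0, 0) \<in> S"
  and f: "\<And>i. locally_integrable_on (to_model -` S) (f i)"
  and CR: "\<And>i j \<phi>. \<phi> \<in> test_functions (to_model -` S) ==>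
   (LINT y|lebesgue. f i y * divergence_form (CR_field j (\<lambda>x. of_real (snd x) ^ m * CR_coefficient m \<Phi> j x)) \<phi> y) = 0"
  and u: "smooth_on (to_model -` S) u"
  and relation: "AE y in lebesgue. y \<in> to_model -` S \<longrightarrow>
   f None y * (1 - \<i> * graph_ds m \<Phi> (to_model y))
    + (\<Sum>l\<in>UNIV. f (Some l) y * (- 2 * \<i> * of_real (snd (to_model y)) ^ m * dz l \<Phi> (to_model y))) = u y"
  and vanishing: "vanish (Suc k) \<Phi>" and vanishing_dz: "\<And>l. dz l \<Phi> (0, 0) = 0"
  and span: "vec.span {(\<chi> j. dz j (foldr dzbar \<alpha> \<Phi>) (0, 0)) | \<alpha>. length \<alpha> \<le> k} = UNIV"
begin

abbreviation "\<Omega> \<equiv> to_model -` S"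

lemma open_\<Omega>: "open \<Omega>" by (rule open_to_model[OF S])

abbreviation "L j \<equiv> CR_field j (\<lambda>x. of_real (snd x) ^ m * CR_coefficient m \<Phi> j x)"

abbreviation "P l \<alpha> y \<equiv> relation_coefficient m \<Phi> l \<alpha> (to_model y)"

abbreviation "sm y \<equiv> complex_of_real (snd (to_model y)) ^ m"

lemma smooth_P: "smooth_on \<Omega> (P l \<alpha>)"
 by (rule smooth_on_to_model[OF S smooth_on_relation_coefficient])

lemma smooth_sm: "smooth_on \<Omega> sm"
 by (rule smooth_on_to_model[OF S smooth_on_real_coordinate[OF S]])

lemma smooth_L: "smooth_on \<Omega> (\<lambda>y. L j y $ i)"
 by (intro smooth_on_CR_field smooth_intros S smooth_on_CR_coefficient)

lemma L_P: "y \<in> \<Omega> ==> vector_field_derivative (L j) (\<lambda>y. sm y * P l \<alpha> y) y = sm y * P l (j # \<alpha>) y"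
 using vector_field_derivative_CR_field[OF smooth_on_mult[OF S smooth_on_real_coordinate[OF S, of m] smooth_on_relation_coefficient[of l \<alpha>]], of y j]
  CR_derivative_relation_coefficient[OF _ refl, of "to_model y" j l \<alpha>] by (simp del: relation_coefficient.simps)

lemma sum_option: "(\<Sum>i\<in>UNIV. g i) = g None + (\<Sum>l\<in>UNIV. g (Some l))" for g :: "'n option => complex"
 by (simp add: UNIV_option_conv sum.reindex)

lemma normalized_relation:
 "\<exists>v. smooth_on \<Omega> v \<and> (AE y in lebesgue. y \<in> \<Omega> \<longrightarrow> f None y + (\<Sum>l\<in>UNIV. f (Some l) y * (sm y * P l [] y)) = v y)"
proof (intro exI conjI)
 let ?c = "\<lambda>y. 1 - \<i> * graph_ds m \<Phi> (to_model y)"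
 have nz: "?c y \<noteq> 0" if "y \<in> \<Omega>" for y using graph_ds_nonzero(2) that by simp
 show "smooth_on \<Omega> (\<lambda>y. u y / ?c y)"
  by (intro smooth_on_divide smooth_intros open_\<Omega> u smooth_on_to_model[OF S] smooth_on_graph_ds nz)
 show "AE y in lebesgue. y \<in> \<Omega> \<longrightarrow> f None y + (\<Sum>l\<in>UNIV. f (Some l) y * (sm y * P l [] y)) = u y / ?c y"
  using relation
 proof eventually_elim
  case (elim y)
  show ?case
  proof
   assume y: "y \<in> \<Omega>"
   have "u y / ?c y = f None y + (\<Sum>l\<in>UNIV. f (Some l) y * (- 2 * \<i> * sm y * dz l \<Phi> (to_model y))) / ?c y"
    using elim y nz[OF y] by (simp add: field_simps)
   then show "f None y + (\<Sum>l\<in>UNIV. f (Some l) y * (sm y * P l [] y)) = u y / ?c y"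
    by (simp add: sum_divide_distrib mult_ac)
  qed
 qed
qed

text \<open>The constant coefficient of \<open>f None\<close> is killed by the first differentiation.\<close>

lemma differentiated_relation:
 "\<alpha> \<noteq> [] ==> \<exists>v. smooth_on \<Omega> v \<and> (AE y in lebesgue. y \<in> \<Omega> \<longrightarrow> (\<Sum>l\<in>UNIV. f (Some l) y * (sm y * P l \<alpha> y)) = v y)"
proof (induction \<alpha>)
 case (Cons j \<alpha>)
 define c :: complex where "c = (if \<alpha> = [] then 1 else 0)"
 have "\<exists>v. smooth_on \<Omega> v \<and> (AE y in lebesgue. y \<in> \<Omega> \<longrightarrow> f None y * c + (\<Sum>l\<in>UNIV. f (Some l) y * (sm y * P l \<alpha> y)) = v y)"
  using normalized_relation Cons.IH by (cases "\<alpha> = []") (simp_all add: c_def)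
 then obtain v where v: "smooth_on \<Omega> v"
  "AE y in lebesgue. y \<in> \<Omega> \<longrightarrow> f None y * c + (\<Sum>l\<in>UNIV. f (Some l) y * (sm y * P l \<alpha> y)) = v y" by blast
 define w where "w i y = (case i of None => c | Some l => sm y * P l \<alpha> y)" for i y
 have w: "smooth_on \<Omega> (w i)" for i
  by (cases i) (simp_all add: w_def[abs_def] smooth_on_const smooth_on_mult[OF open_\<Omega> smooth_sm smooth_P])
 have "AE y in lebesgue. y \<in> \<Omega> \<longrightarrow> (\<Sum>i\<in>UNIV. f i y * vector_field_derivative (L j) (w i) y) = vector_field_derivative (L j) v y"
  by (rule derivative_of_weak_relation[OF open_\<Omega> smooth_L f CR w v(1)]) (use v(2) in \<open>simp_all add: sum_option w_def\<close>)
 then have "AE y in lebesgue. y \<in> \<Omega> \<longrightarrow> (\<Sum>l\<in>UNIV. f (Some l) y * (sm y * P l (j # \<alpha>) y)) = vector_field_derivative (L j) v y"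
 proof eventually_elim
  case (elim y)
  show ?case
  proof
   assume y: "y \<in> \<Omega>"
   have "w None = (\<lambda>y. c)" "w (Some l) = (\<lambda>y. sm y * P l \<alpha> y)" for l by (simp_all add: w_def fun_eq_iff)
   moreover have "vector_field_derivative (L j) (\<lambda>y. c) y = 0" by (simp add: vector_field_derivative_def partial_deriv_def)
   ultimately show "(\<Sum>l\<in>UNIV. f (Some l) y * (sm y * P l (j # \<alpha>) y)) = vector_field_derivative (L j) v y"
    using elim y L_P[OF y, of j] by (simp add: sum_option del: relation_coefficient.simps)
  qed
 qed
 then show ?case using smooth_on_vector_field_derivative[OF open_\<Omega> smooth_L v(1)] by blast
qed simp

lemma coefficient_at_origin:
 assumes "length \<alpha> \<le> k"
 shows "relation_coefficient m \<Phi> l \<alpha> (0, 0) = - 2 * \<i> * dz l (foldr dzbar \<alpha> \<Phi>) (0, 0)"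
proof -
 have "vanish (Suc (k - length \<alpha>)) (\<lambda>x. relation_coefficient m \<Phi> l \<alpha> x + 2 * \<i> * foldr dzbar \<alpha> (dz l \<Phi>) x)"
  using relation_coefficient_leading_part[OF origin vanishing, of \<alpha> l] assms by (simp add: Suc_diff_le)
 then have "relation_coefficient m \<Phi> l \<alpha> (0, 0) + 2 * \<i> * foldr dzbar \<alpha> (dz l \<Phi>) (0, 0) = 0" by simp
 then show ?thesis
  using dz_iterated_dzbar_commute[OF S \<Phi> origin, of l \<alpha>] by (simp add: eq_neg_iff_add_eq_0)
qed

text \<open>The empty multi-index contributes only the zero vector to the spanning family, since \<open>\<phi>\<^sub>z\<close> vanishes at the origin.\<close>

lemma nondegenerate_system: "\<exists>A. (\<forall>r. A r \<noteq> []) \<and> det (\<chi> r l. relation_coefficient m \<Phi> l (A r) (0, 0)) \<noteq> 0"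
proof -
 let ?v = "\<lambda>\<alpha>. \<chi> l. dz l (foldr dzbar \<alpha> \<Phi>) (0, 0)" and ?w = "\<lambda>\<alpha>. \<chi> l. relation_coefficient m \<Phi> l \<alpha> (0, 0)"
 let ?I = "{\<alpha>. \<alpha> \<noteq> [] \<and> length \<alpha> \<le> k}"
 have "?v \<alpha> \<in> vec.span (?w ` ?I)" if "length \<alpha> \<le> k" for \<alpha>
 proof (cases "\<alpha> = []")
  case True
  then have "?v \<alpha> = 0" by (simp add: vec_eq_iff vanishing_dz)
  then show ?thesis using vec.span_zero by simp
 next
  case False
  have "?v \<alpha> = (\<i> / 2) *s ?w \<alpha>" using coefficient_at_origin[OF that] by (simp add: vec_eq_iff)
  moreover have "?w \<alpha> \<in> ?w ` ?I" using False that by blast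
  ultimately show ?thesis by (simp only: vec.span_scale vec.span_base)
 qed
 then have "{?v \<alpha> | \<alpha>. length \<alpha> \<le> k} \<subseteq> vec.span (?w ` ?I)" by blast
 then have "vec.span (?w ` ?I) = UNIV"
  using vec.span_minimal[OF _ vec.subspace_span] span by (metis (no_types, lifting) top.extremum_uniqueI)
 then obtain A where "\<And>r. A r \<in> ?I" "det (\<chi> r l. ?w (A r) $ l) \<noteq> 0" using spanning_family_matrix by blast
 then show ?thesis by auto
qed

text \<open>The system holds only almost everywhere; its smooth solution is therefore defined by the inverse matrix, and agrees with
\<open>s^m f\<^sub>l\<close> almost everywhere.\<close>

lemma smooth_multiples:
 "\<exists>\<Omega>' g. open \<Omega>' \<and> 0 \<in> \<Omega>' \<and> \<Omega>' \<subseteq> \<Omega> \<and> (\<forall>l. smooth_on \<Omega>' (g l) \<and> (AE y in lebesgue. y \<in> \<Omega>' \<longrightarrow> sm y * f (Some l) y = g l y))"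
proof -
 obtain A where A: "\<And>r. A r \<noteq> []" "det (\<chi> r l. relation_coefficient m \<Phi> l (A r) (0, 0)) \<noteq> 0"
  using nondegenerate_system by blast
 have "\<forall>r. \<exists>v. smooth_on \<Omega> v \<and> (AE y in lebesgue. y \<in> \<Omega> \<longrightarrow> (\<Sum>l\<in>UNIV. f (Some l) y * (sm y * P l (A r) y)) = v y)"
  using differentiated_relation[OF A(1)] by blast
 then obtain v where v: "\<And>r. smooth_on \<Omega> (v r)"
  "\<And>r. AE y in lebesgue. y \<in> \<Omega> \<longrightarrow> (\<Sum>l\<in>UNIV. f (Some l) y * (sm y * P l (A r) y)) = v r y"
  by (auto dest!: choice)
 define R :: "real^'d => complex^'n^'n" where "R y = (\<chi> r l. P l (A r) y)" for y
 define \<Omega>' where "\<Omega>' = \<Omega> \<inter> {y. det (R y) \<noteq> 0}"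
 have dR: "smooth_on \<Omega> (\<lambda>y. det (R y))" by (rule smooth_on_det[OF open_\<Omega>]) (simp add: R_def smooth_P)
 have O: "open \<Omega>'"
 proof -
  have "open (\<Omega> \<inter> (\<lambda>y. det (R y)) -` (- {0}))"
   by (rule continuous_open_preimage[OF smooth_on_continuous[OF dR] open_\<Omega>]) auto
  then show ?thesis by (simp add: \<Omega>'_def vimage_def)
 qed
 have 0: "0 \<in> \<Omega>'" using A(2) origin by (simp add: \<Omega>'_def R_def)
 have inv: "invertible (R y)" if "y \<in> \<Omega>'" for y using that by (simp add: \<Omega>'_def invertible_det_nz)
 define w where "w y = matrix_inv (R y) *v (\<chi> r. v r y)" for y
 have Rw: "R y *v w y = (\<chi> r. v r y)" if "y \<in> \<Omega>'" for y
 proof -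
  have "R y ** matrix_inv (R y) = mat 1 \<and> matrix_inv (R y) ** R y = mat 1"
   unfolding matrix_inv_def by (rule someI_ex) (use inv[OF that] in \<open>simp add: invertible_def\<close>)
  then show ?thesis by (simp add: w_def matrix_vector_mul_assoc)
 qed
 have sw: "smooth_on \<Omega>' w"
 proof (rule smooth_on_linear_solve[where A = "\<lambda>y. (*v) (R y)" and b = "\<lambda>y. \<chi> r. v r y", OF O])
  show "linear ((*v) (R y))" for y
   by (rule linearI) (simp_all add: matrix_vector_mult_def vec_eq_iff sum.distrib distrib_left scaleR_sum_right)
  show "inj ((*v) (R y))" if "y \<in> \<Omega>'" for y by (rule inj_matrix_vector_mult[OF inv[OF that]])
  have sub: "smooth_on \<Omega>' g" if "smooth_on \<Omega> g" for g :: "real^'d => complex"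
   using that by (rule smooth_on_subset) (simp add: \<Omega>'_def)
  show "smooth_on \<Omega>' (\<lambda>y. R y *v a)" for a
   unfolding matrix_vector_mult_def R_def by (simp, intro smooth_on_vec_lambda smooth_intros O sub smooth_P)
  show "smooth_on \<Omega>' (\<lambda>y. \<chi> r. v r y)" by (intro smooth_on_vec_lambda O sub v(1))
 qed (rule Rw)
 have "AE y in lebesgue. \<forall>r. y \<in> \<Omega> \<longrightarrow> (\<Sum>l\<in>UNIV. f (Some l) y * (sm y * P l (A r) y)) = v r y"
  using AE_finite_allI[OF finite v(2), of UNIV] by simp
 then have "AE y in lebesgue. y \<in> \<Omega>' \<longrightarrow> sm y * f (Some l) y = w y $ l" for l
 proof eventually_elim
  case (elim y)
  show ?case
  proof
   assume y: "y \<in> \<Omega>'"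
   have "R y *v (\<chi> l. sm y * f (Some l) y) = (\<chi> r. v r y)"
    using elim y by (simp add: \<Omega>'_def matrix_vector_mult_def R_def vec_eq_iff mult_ac)
   then have "R y *v (\<chi> l. sm y * f (Some l) y) = R y *v w y" using Rw[OF y] by simp
   then have "(\<chi> l. sm y * f (Some l) y) = w y" using inj_matrix_vector_mult[OF inv[OF y]] by (simp add: inj_eq)
   then show "sm y * f (Some l) y = w y $ l" by (metis vec_lambda_beta)
  qed
 qed
 then show ?thesis
  using O 0 smooth_on_nth[OF O sw] by (intro exI[of _ \<Omega>'] exI[of _ "\<lambda>l y. w y $ l"]) (auto simp: \<Omega>'_def)
qed

theorem smooth_representatives:
 "\<exists>\<Omega>'. open \<Omega>' \<and> 0 \<in> \<Omega>' \<and> \<Omega>' \<subseteq> \<Omega> \<and> (\<forall>i. \<exists>g. smooth_on \<Omega>' g \<and> (AE y in lebesgue. y \<in> \<Omega>' \<longrightarrow> f i y = g y))"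
proof -
 obtain \<Omega>1 g where O1: "open \<Omega>1" "0 \<in> \<Omega>1" "\<Omega>1 \<subseteq> \<Omega>" and g: "\<And>l. smooth_on \<Omega>1 (g l)"
  "\<And>l. AE y in lebesgue. y \<in> \<Omega>1 \<longrightarrow> sm y * f (Some l) y = g l y"
  using smooth_multiples by blast
 obtain a b where ab: "0 \<in> box a b" "cbox a b \<subseteq> \<Omega>1" using open_contains_cbox_around[OF O1(1,2)] by blast
 let ?B = "box a b"
 have sub: "?B \<subseteq> \<Omega>1" using ab(2) box_subset_cbox by blast
 have "\<exists>h. smooth_on ?B h \<and> (AE y in lebesgue. y \<in> ?B \<longrightarrow> f (Some l) y = h y)" for l
 proof (rule smooth_after_division[where s = "e None" and m = m and g = "g l"])
  show "a $ e None < 0" "0 < b $ e None" using ab(1) by (simp_all add: mem_box_cart)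
  show "locally_integrable_on ?B (f (Some l))" by (rule locally_integrable_on_subset[OF f]) (use sub O1(3) in blast)
  show "smooth_on ?B (g l)" by (rule smooth_on_subset[OF g(1) sub])
  show "AE y in lebesgue. y \<in> ?B \<longrightarrow> complex_of_real (y $ e None) ^ m * f (Some l) y = g l y"
   using g(2)[of l] by eventually_elim (use subsetD[OF sub] in \<open>auto simp: snd_to_model\<close>)
 qed
 then obtain h where h: "\<And>l. smooth_on ?B (h l)" "\<And>l. AE y in lebesgue. y \<in> ?B \<longrightarrow> f (Some l) y = h l y" by metis
 obtain v where v: "smooth_on \<Omega> v" "AE y in lebesgue. y \<in> \<Omega> \<longrightarrow> f None y + (\<Sum>l\<in>UNIV. f (Some l) y * (sm y * P l [] y)) = v y"
  using normalized_relation by blast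
 have sB: "?B \<subseteq> \<Omega>" using sub O1(3) by blast
 let ?h0 = "\<lambda>y. v y - (\<Sum>l\<in>UNIV. h l y * (sm y * P l [] y))"
 have "smooth_on ?B ?h0"
  by (intro smooth_intros open_box smooth_on_subset[OF v(1) sB] smooth_on_subset[OF smooth_sm sB] smooth_on_subset[OF smooth_P sB] h(1))
 moreover have "AE y in lebesgue. y \<in> ?B \<longrightarrow> f None y = ?h0 y"
 proof -
  have "AE y in lebesgue. \<forall>l. y \<in> ?B \<longrightarrow> f (Some l) y = h l y" using AE_finite_allI[OF finite h(2), of UNIV] by simp
  with v(2) show ?thesis
  proof eventually_elim
   case (elim y)
   show ?case
   proof
    assume y: "y \<in> ?B"
    then have "f None y + (\<Sum>l\<in>UNIV. h l y * (sm y * P l [] y)) = v y" using elim sB by auto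
    then show "f None y = ?h0 y" by (simp only: eq_diff_eq)
   qed
  qed
 qed
 ultimately have "\<exists>g. smooth_on ?B g \<and> (AE y in lebesgue. y \<in> ?B \<longrightarrow> f i y = g y)" for i
  using h by (cases i) blast+
 then show ?thesis using ab(1) sB by (intro exI[of _ ?B]) auto
qed

end

section \<open>Tangent spaces, forms and densities in parametrizations\<close>

lemma curve_stays_in_open:
 fixes \<gamma> :: "real => 'b::topological_space"
 assumes "\<epsilon> > 0" "continuous_on {-\<epsilon><..<\<epsilon>} \<gamma>" "open T" "\<gamma> 0 \<in> T"
 shows "\<exists>\<delta>>0. \<delta> \<le> \<epsilon> \<and> \<gamma> ` {-\<delta><..<\<delta>} \<subseteq> T"
proof -
 have "open ({-\<epsilon><..<\<epsilon>} \<inter> \<gamma> -` T)" by (rule continuous_open_preimage[OF assms(2) _ assms(3)]) simp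
 moreover have "0 \<in> {-\<epsilon><..<\<epsilon>} \<inter> \<gamma> -` T" using assms by simp
 ultimately obtain \<delta> where d: "\<delta> > 0" "ball 0 \<delta> \<subseteq> {-\<epsilon><..<\<epsilon>} \<inter> \<gamma> -` T" by (metis openE)
 have "{- min \<delta> \<epsilon><..<min \<delta> \<epsilon>} \<subseteq> ball 0 \<delta>" by (auto simp: dist_real_def)
 then have "\<gamma> ` {- min \<delta> \<epsilon><..<min \<delta> \<epsilon>} \<subseteq> T" using d(2) by blast
 then show ?thesis using d(1) assms(1) by (intro exI[of _ "min \<delta> \<epsilon>"]) auto
qed

lemma tangent_space_Int:
 assumes U: "open U" "q \<in> U"
 shows "tangent_space (S \<inter> U) q = tangent_space S q"
proof
 show "tangent_space (S \<inter> U) q \<subseteq> tangent_space S q" unfolding tangent_space_def by blast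
 show "tangent_space S q \<subseteq> tangent_space (S \<inter> U) q"
 proof
  fix v assume "v \<in> tangent_space S q"
  then obtain \<epsilon> \<gamma> where g: "\<epsilon> > 0" "smooth_on {-\<epsilon><..<\<epsilon>} \<gamma>" "\<gamma> ` {-\<epsilon><..<\<epsilon>} \<subseteq> S" "\<gamma> 0 = q"
   "(\<gamma> has_vector_derivative v) (at 0)" unfolding tangent_space_def by blast
  obtain \<delta> where d: "\<delta> > 0" "\<delta> \<le> \<epsilon>" "\<gamma> ` {-\<delta><..<\<delta>} \<subseteq> U"
   using curve_stays_in_open[OF g(1) smooth_on_continuous[OF g(2)] U(1)] U(2) g(4) by auto
  have sub: "{-\<delta><..<\<delta>} \<subseteq> {-\<epsilon><..<\<epsilon>}" using d by auto
  have "\<gamma> ` {-\<delta><..<\<delta>} \<subseteq> S \<inter> U" using d(3) g(3) sub by blast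
  then show "v \<in> tangent_space (S \<inter> U) q"
   unfolding tangent_space_def using d(1) smooth_on_subset[OF g(2) sub] g(4,5) by blast
 qed
qed

lemma CR_bundle_Int: "open U ==> q \<in> U ==> CR_bundle (S \<inter> U) q = CR_bundle S q"
 by (simp add: CR_bundle_def tangent_space_Int)

lemma complex_cotangent_Int: "open U ==> q \<in> U ==> complex_cotangent (S \<inter> U) q = complex_cotangent S q"
 by (simp add: complex_cotangent_def tangent_space_Int)

lemma holomorphic_cotangent_Int: "open U ==> q \<in> U ==> holomorphic_cotangent (S \<inter> U) q = holomorphic_cotangent S q"
 by (simp add: holomorphic_cotangent_def CR_bundle_Int complex_cotangent_Int)

lemma frames_Int: "open U ==> q \<in> U ==> frames (S \<inter> U) q = frames S q"
 by (simp add: frames_def tangent_space_Int)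

lemma holomorphic_forms_Int:
 assumes U: "open U" and a: "\<alpha> \<in> holomorphic_forms S"
 shows "\<alpha> \<in> holomorphic_forms (S \<inter> U)"
proof -
 have "smooth_form (S \<inter> U) \<alpha>"
  unfolding smooth_form_def
 proof
  fix q assume q: "q \<in> S \<inter> U"
  then obtain a V where V: "open V" "q \<in> V" "\<forall>x\<in>V. linear (a x)" "\<forall>v. smooth_on V (\<lambda>x. a x v)"
   "\<forall>x\<in>S \<inter> V. \<forall>v\<in>tangent_space S x. \<alpha> x v = a x v"
   using a unfolding holomorphic_forms_def smooth_form_def extends_form_def by blast
  have "open (V \<inter> U)" "q \<in> V \<inter> U" using V U q by auto
  moreover have "smooth_on (V \<inter> U) (\<lambda>x. a x v)" for v using V(4) by (rule_tac smooth_on_subset[of V]) auto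
  ultimately have "extends_form (S \<inter> U) \<alpha> q a"
   unfolding extends_form_def using V(3,5) tangent_space_Int[OF U]
   by (intro exI[of _ "V \<inter> U"]) auto
  then show "\<exists>a. extends_form (S \<inter> U) \<alpha> q a" by blast
 qed
 then show ?thesis using a holomorphic_cotangent_Int[OF U] by (auto simp: holomorphic_forms_def)
qed

lemma parametrizationE:
 assumes "parametrization S \<Omega> \<kappa>"
 obtains T g where "open \<Omega>" "smooth_on \<Omega> \<kappa>" "open T" "\<kappa> ` \<Omega> = S \<inter> T" "homeomorphism \<Omega> (\<kappa> ` \<Omega>) \<kappa> g"
  "\<And>x. x \<in> \<Omega> ==> inj (fderiv \<kappa> x)"
proof -
 obtain T where T: "open T" "\<kappa> ` \<Omega> = S \<inter> T" using assms unfolding parametrization_def openin_open by blast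
 obtain g where g: "homeomorphism \<Omega> (\<kappa> ` \<Omega>) \<kappa> g" using assms unfolding parametrization_def by blast
 show thesis
  by (rule that[OF _ _ T g]) (use assms in \<open>simp_all add: parametrization_def\<close>)
qed

lemma parametrization_subset:
 assumes p: "parametrization S \<Omega> \<kappa>" and O: "open \<Omega>'" "\<Omega>' \<subseteq> \<Omega>"
 shows "parametrization S \<Omega>' \<kappa>"
proof -
 obtain T g where T: "open \<Omega>" "smooth_on \<Omega> \<kappa>" "open T" "\<kappa> ` \<Omega> = S \<inter> T" "homeomorphism \<Omega> (\<kappa> ` \<Omega>) \<kappa> g"
  "\<And>x. x \<in> \<Omega> ==> inj (fderiv \<kappa> x)" by (rule parametrizationE[OF p]) (rule that)
 have "openin (top_of_set \<Omega>) \<Omega>'" using O by (simp add: openin_open_eq[OF T(1)])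
 then have "openin (top_of_set (\<kappa> ` \<Omega>)) (\<kappa> ` \<Omega>')" by (rule homeomorphism_imp_open_map[OF T(5)])
 moreover have "openin (top_of_set S) (\<kappa> ` \<Omega>)" using T by (auto simp: openin_open)
 ultimately have "openin (top_of_set S) (\<kappa> ` \<Omega>')" by (rule openin_trans)
 moreover have "homeomorphism \<Omega>' (\<kappa> ` \<Omega>') \<kappa> g"
  by (rule homeomorphism_of_subsets[OF T(5)]) (use O in auto)
 ultimately show ?thesis
  unfolding parametrization_def using O T(6) smooth_on_subset[OF T(2) O(2)] by blast
qed

lemma parametrization_Int_iff:
 assumes U: "open U"
 shows "parametrization (S \<inter> U) \<Omega> \<kappa> \<longleftrightarrow> parametrization S \<Omega> \<kappa> \<and> \<kappa> ` \<Omega> \<subseteq> U"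
proof -
 have "openin (top_of_set (S \<inter> U)) (\<kappa> ` \<Omega>) \<longleftrightarrow> openin (top_of_set S) (\<kappa> ` \<Omega>) \<and> \<kappa> ` \<Omega> \<subseteq> U"
 proof
  assume "openin (top_of_set (S \<inter> U)) (\<kappa> ` \<Omega>)"
  then obtain T where "open T" "\<kappa> ` \<Omega> = (S \<inter> U) \<inter> T" unfolding openin_open by blast
  then have "open (U \<inter> T)" "\<kappa> ` \<Omega> = S \<inter> (U \<inter> T)" using U by blast+
  then show "openin (top_of_set S) (\<kappa> ` \<Omega>) \<and> \<kappa> ` \<Omega> \<subseteq> U"
   using openin_open_Int[of "U \<inter> T" S] by auto
 next
  assume *: "openin (top_of_set S) (\<kappa> ` \<Omega>) \<and> \<kappa> ` \<Omega> \<subseteq> U"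
  then obtain T where T: "open T" "\<kappa> ` \<Omega> = S \<inter> T" unfolding openin_open by blast
  then have "\<kappa> ` \<Omega> = (S \<inter> U) \<inter> T" using * by blast
  then show "openin (top_of_set (S \<inter> U)) (\<kappa> ` \<Omega>)"
   using openin_open_Int[OF T(1), of "S \<inter> U"] by simp
 qed
 then show ?thesis unfolding parametrization_def by satx
qed

lemma parametrization_preimage:
 assumes p: "parametrization S \<Omega> \<kappa>" and U: "open U"
 shows "open (\<Omega> \<inter> \<kappa> -` U)" "parametrization (S \<inter> U) (\<Omega> \<inter> \<kappa> -` U) \<kappa>"
proof -
 have T: "open \<Omega>" "smooth_on \<Omega> \<kappa>" using p by (simp_all add: parametrization_def)
 show o: "open (\<Omega> \<inter> \<kappa> -` U)" by (rule continuous_open_preimage[OF smooth_on_continuous[OF T(2)] T(1) U])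
 show "parametrization (S \<inter> U) (\<Omega> \<inter> \<kappa> -` U) \<kappa>"
  unfolding parametrization_Int_iff[OF U] using parametrization_subset[OF p o] by auto
qed

lemma parametrization_linear:
 assumes "parametrization S \<Omega> \<kappa>" "x \<in> \<Omega>"
 shows "linear (fderiv \<kappa> x)" "inj (fderiv \<kappa> x)"
proof -
 show "linear (fderiv \<kappa> x)"
  using assms smooth_on_has_derivative unfolding parametrization_def by (blast intro: has_derivative_linear)
 show "inj (fderiv \<kappa> x)" using assms unfolding parametrization_def by blast
qed

text \<open>A curve in the image is lifted to the parameter domain; the lift is smooth by \<open>smooth_on_implicit\<close>.\<close>

lemma tangent_space_parametrization:
 assumes p: "parametrization S \<Omega> \<kappa>" and x: "x \<in> \<Omega>"
 shows "tangent_space S (\<kappa> x) = range (fderiv \<kappa> x)"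
proof
 obtain T g where T: "open \<Omega>" "smooth_on \<Omega> \<kappa>" "open T" "\<kappa> ` \<Omega> = S \<inter> T" "homeomorphism \<Omega> (\<kappa> ` \<Omega>) \<kappa> g"
  "\<And>x. x \<in> \<Omega> ==> inj (fderiv \<kappa> x)" by (rule parametrizationE[OF p]) (rule that)
 note D = smooth_on_has_derivative[OF T(2) x]
 show "range (fderiv \<kappa> x) \<subseteq> tangent_space S (\<kappa> x)"
 proof
  fix v assume "v \<in> range (fderiv \<kappa> x)"
  then obtain e where v: "v = fderiv \<kappa> x e" by blast
  have line: "smooth_on A (\<lambda>t. x + t *\<^sub>R e)" if "open A" for A :: "real set"
   using that by (intro smooth_intros)
  obtain \<delta> where d: "\<delta> > 0" "(\<lambda>t. x + t *\<^sub>R e) ` {-\<delta><..<\<delta>} \<subseteq> \<Omega>"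
  proof -
   have "continuous_on {-1<..<1} (\<lambda>t. x + t *\<^sub>R e)" by (intro continuous_intros)
   then show ?thesis using curve_stays_in_open[of 1 "\<lambda>t. x + t *\<^sub>R e" \<Omega>] T(1) x that by auto
  qed
  have "smooth_on {-\<delta><..<\<delta>} (\<lambda>t. \<kappa> (x + t *\<^sub>R e))"
   by (rule smooth_on_compose[OF _ T(1) line T(2) d(2)]) auto
  moreover have "(\<lambda>t. \<kappa> (x + t *\<^sub>R e)) ` {-\<delta><..<\<delta>} \<subseteq> S" using d(2) T(4) by blast
  moreover have "((\<lambda>t. \<kappa> (x + t *\<^sub>R e)) has_vector_derivative v) (at 0)"
  proof -
   have "((\<lambda>t. x + t *\<^sub>R e) has_vector_derivative e) (at 0)"
    by (auto intro!: derivative_eq_intros)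
   then show ?thesis
    using vector_derivative_diff_chain_within[of "\<lambda>t. x + t *\<^sub>R e" e 0 UNIV \<kappa> "fderiv \<kappa> x"]
     has_derivative_at_withinI[OF D] by (simp add: o_def v)
  qed
  ultimately show "v \<in> tangent_space S (\<kappa> x)"
   unfolding tangent_space_def using d(1) by (auto intro!: exI[of _ \<delta>] exI[of _ "\<lambda>t. \<kappa> (x + t *\<^sub>R e)"])
 qed
 show "tangent_space S (\<kappa> x) \<subseteq> range (fderiv \<kappa> x)"
 proof
  fix v assume "v \<in> tangent_space S (\<kappa> x)"
  then obtain \<epsilon> \<gamma> where g: "\<epsilon> > 0" "smooth_on {-\<epsilon><..<\<epsilon>} \<gamma>" "\<gamma> ` {-\<epsilon><..<\<epsilon>} \<subseteq> S" "\<gamma> 0 = \<kappa> x"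
   "(\<gamma> has_vector_derivative v) (at 0)" unfolding tangent_space_def by blast
  have "\<kappa> x \<in> T" using T(4) x by blast
  then obtain \<delta> where d: "\<delta> > 0" "\<delta> \<le> \<epsilon>" "\<gamma> ` {-\<delta><..<\<delta>} \<subseteq> T"
   using curve_stays_in_open[OF g(1) smooth_on_continuous[OF g(2)] T(3)] g(4) by auto
  let ?I = "{-\<delta><..<\<delta>}"
  have sub: "?I \<subseteq> {-\<epsilon><..<\<epsilon>}" using d by auto
  have im: "\<gamma> ` ?I \<subseteq> \<kappa> ` \<Omega>" using d(3) g(3) sub T(4) by blast
  have sg: "smooth_on ?I \<gamma>" by (rule smooth_on_subset[OF g(2) sub])
  define \<tau> where "\<tau> t = g (\<gamma> t)" for t
  have eq: "\<kappa> (\<tau> t) = \<gamma> t" "\<tau> t \<in> \<Omega>" if "t \<in> ?I" for t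
  proof -
   have t: "\<gamma> t \<in> \<kappa> ` \<Omega>" using im that by blast
   show "\<kappa> (\<tau> t) = \<gamma> t" unfolding \<tau>_def by (rule homeomorphism_apply2[OF T(5) t])
   show "\<tau> t \<in> \<Omega>" unfolding \<tau>_def using homeomorphism_image2[OF T(5)] t by blast
  qed
  have c: "continuous_on ?I \<tau>"
   unfolding \<tau>_def by (rule continuous_on_compose2[OF homeomorphism_cont2[OF T(5)] smooth_on_continuous[OF sg] im])
  have st: "smooth_on ?I \<tau>"
  proof (rule smooth_on_implicit[OF _ T(1,2) sg c])
   show "\<tau> ` ?I \<subseteq> \<Omega>" using eq(2) by blast
   show "inj (fderiv \<kappa> (\<tau> t))" if "t \<in> ?I" for t by (rule T(6)[OF eq(2)[OF that]])
  qed (simp_all add: eq(1))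
  have t0: "\<tau> 0 = x" using homeomorphism_apply1[OF T(5) x] by (simp add: \<tau>_def g(4))
  have "(\<tau> has_vector_derivative vector_derivative \<tau> (at 0)) (at 0)"
  proof -
   have "\<tau> differentiable (at 0)" using smooth_on_has_derivative[OF st, of 0] d(1) differentiableI by auto
   then show ?thesis by (simp add: vector_derivative_works)
  qed
  then have "((\<lambda>t. \<kappa> (\<tau> t)) has_vector_derivative fderiv \<kappa> x (vector_derivative \<tau> (at 0))) (at 0)"
   using vector_derivative_diff_chain_within[of \<tau> _ 0 UNIV \<kappa> "fderiv \<kappa> x"]
    has_derivative_at_withinI[OF D] by (simp add: o_def t0)
  then have "(\<gamma> has_vector_derivative fderiv \<kappa> x (vector_derivative \<tau> (at 0))) (at 0)"
   by (rule has_vector_derivative_transform_within_open[of _ _ _ ?I]) (use d(1) in \<open>simp_all add: eq(1)\<close>)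
  then have "v = fderiv \<kappa> x (vector_derivative \<tau> (at 0))"
   using g(5) vector_derivative_unique_at by blast
  then show "v \<in> range (fderiv \<kappa> x)" by blast
 qed
qed

lemma has_derivative_linear_apply:
 fixes a :: "'p::euclidean_space => 'a::euclidean_space => 'b::real_normed_vector" and k :: "'x::real_normed_vector => 'p"
 assumes V: "open V" and a: "\<And>x. x \<in> V ==> linear (a x)" "\<And>v. smooth_on V (\<lambda>x. a x v)"
  and k: "(k has_derivative k') (at x)" "k x \<in> V" and c: "(c has_derivative c') (at x)"
 shows "((\<lambda>y. a (k y) (c y)) has_derivative
  (\<lambda>e. fderiv (\<lambda>z. a z (c x)) (k x) (k' e) + a (k x) (c' e))) (at x)"
proof -
 let ?D = "\<lambda>v. fderiv (\<lambda>z. a z v) (k x)"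
 have exp: "a z v = (\<Sum>b\<in>Basis. (v \<bullet> b) *\<^sub>R a z b)" if "z \<in> V" for z v
 proof -
  have "(\<Sum>b\<in>Basis. (v \<bullet> b) *\<^sub>R a z b) = a z (\<Sum>b\<in>Basis. (v \<bullet> b) *\<^sub>R b)"
   using a(1)[OF that] by (simp add: linear_sum linear_scale)
  then show ?thesis unfolding euclidean_representation by (rule sym)
 qed
 have Db: "((\<lambda>z. a z v) has_derivative ?D v) (at (k x))" for v by (rule smooth_on_has_derivative[OF a(2) k(2)])
 have Dexp: "?D v = (\<lambda>u. \<Sum>b\<in>Basis. (v \<bullet> b) *\<^sub>R ?D b u)" for v
 proof (rule frechet_derivative_eqI, rule has_derivative_transform_within_open[OF _ V k(2)])
  show "((\<lambda>z. \<Sum>b\<in>Basis. (v \<bullet> b) *\<^sub>R a z b) has_derivative (\<lambda>u. \<Sum>b\<in>Basis. (v \<bullet> b) *\<^sub>R ?D b u)) (at (k x))"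
   by (intro has_derivative_sum has_derivative_scaleR_right Db)
 qed (rule exp[symmetric])
 have "((\<lambda>y. \<Sum>b\<in>Basis. (c y \<bullet> b) *\<^sub>R a (k y) b) has_derivative
   (\<lambda>e. \<Sum>b\<in>Basis. (c x \<bullet> b) *\<^sub>R ?D b (k' e) + (c' e \<bullet> b) *\<^sub>R a (k x) b)) (at x)"
  by (intro has_derivative_sum has_derivative_scaleR has_derivative_inner_left c has_derivative_compose[OF k(1) Db])
 moreover have "(\<Sum>b\<in>Basis. (c x \<bullet> b) *\<^sub>R ?D b (k' e) + (c' e \<bullet> b) *\<^sub>R a (k x) b)
   = ?D (c x) (k' e) + a (k x) (c' e)" for e
  unfolding fun_cong[OF Dexp[of "c x"], of "k' e"] sum.distrib by (subst exp[OF k(2), of "c' e"]) (rule refl)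
 ultimately have *: "((\<lambda>y. \<Sum>b\<in>Basis. (c y \<bullet> b) *\<^sub>R a (k y) b) has_derivative (\<lambda>e. ?D (c x) (k' e) + a (k x) (c' e))) (at x)" by simp
 have "\<forall>\<^sub>F y in at x. k y \<in> V"
  using topological_tendstoD[OF has_derivative_continuous[OF k(1), unfolded continuous_within] V k(2)] .
 then have "\<forall>\<^sub>F y in at x. (\<Sum>b\<in>Basis. (c y \<bullet> b) *\<^sub>R a (k y) b) = a (k y) (c y)"
  by eventually_elim (rule exp[symmetric])
 then show ?thesis
  by (rule has_derivative_transform_eventually[OF *]) (simp_all add: exp[symmetric, OF k(2)])
qed

text \<open>In \<open>d (a (\<kappa> y) (D\<kappa> y e))\<close> the terms with second derivatives of \<open>\<kappa>\<close> are symmetric and cancel.  In particular the extension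
chosen in the definition does not matter.\<close>

lemma exterior_derivative_parametrization:
 assumes p: "parametrization S \<Omega> \<kappa>" and x: "x \<in> \<Omega>" and a: "smooth_form S \<alpha>"
 shows "exterior_derivative S \<alpha> (\<kappa> x) (fderiv \<kappa> x d) (fderiv \<kappa> x e)
  = fderiv (\<lambda>y. \<alpha> (\<kappa> y) (fderiv \<kappa> y e)) x d
  - fderiv (\<lambda>y. \<alpha> (\<kappa> y) (fderiv \<kappa> y d)) x e"
proof -
 obtain T and g :: "_ => real^_" where T: "open \<Omega>" "smooth_on \<Omega> \<kappa>" "open T" "\<kappa> ` \<Omega> = S \<inter> T" by (rule parametrizationE[OF p]) (rule that)
 define a where "a = (SOME a. extends_form S \<alpha> (\<kappa> x) a)"
 have "\<kappa> x \<in> S" using T(4) x by blast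
 then have "\<exists>a. extends_form S \<alpha> (\<kappa> x) a" using assms(3) unfolding smooth_form_def by blast
 then have "extends_form S \<alpha> (\<kappa> x) a" unfolding a_def by (rule someI_ex)
 then obtain V where V: "open V" "\<kappa> x \<in> V" "\<And>x. x \<in> V ==> linear (a x)" "\<And>v. smooth_on V (\<lambda>x. a x v)"
  "\<And>y v. y \<in> S \<inter> V ==> v \<in> tangent_space S y ==> \<alpha> y v = a y v"
  unfolding extends_form_def by blast
 let ?D = "\<lambda>v y. fderiv \<kappa> y v"
 have D: "fderiv (\<lambda>y. \<alpha> (\<kappa> y) (?D e y)) x d
   = fderiv (\<lambda>z. a z (?D e x)) (\<kappa> x) (?D d x) + a (\<kappa> x) (fderiv (?D e) x d)" for d e
 proof -
  have "((\<lambda>y. a (\<kappa> y) (?D e y)) has_derivative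
   (\<lambda>d. fderiv (\<lambda>z. a z (?D e x)) (\<kappa> x) (?D d x) + a (\<kappa> x) (fderiv (?D e) x d))) (at x)"
   by (rule has_derivative_linear_apply[OF V(1,3,4) smooth_on_has_derivative[OF T(2) x] V(2) smooth_on_has_derivative[OF smooth_on_derivative[OF T(2)] x]])
  then have "((\<lambda>y. \<alpha> (\<kappa> y) (?D e y)) has_derivative
   (\<lambda>d. fderiv (\<lambda>z. a z (?D e x)) (\<kappa> x) (?D d x) + a (\<kappa> x) (fderiv (?D e) x d))) (at x)"
  proof (rule has_derivative_transform_within_open)
   show "open (\<Omega> \<inter> \<kappa> -` V)" by (rule parametrization_preimage(1)[OF p V(1)])
   show "x \<in> \<Omega> \<inter> \<kappa> -` V" using x V(2) by simp
   show "a (\<kappa> y) (?D e y) = \<alpha> (\<kappa> y) (?D e y)" if "y \<in> \<Omega> \<inter> \<kappa> -` V" for y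
   proof -
    have "\<kappa> y \<in> S \<inter> V" using that T(4) by blast
    then show ?thesis using V(5)[of "\<kappa> y" "?D e y"] that tangent_space_parametrization[OF p, of y] by auto
   qed
  qed
  then show ?thesis by (simp add: frechet_derivative_eqI)
 qed
 show ?thesis
  unfolding exterior_derivative_def Let_def a_def[symmetric] D
  using second_derivative_symmetric[OF T(1) x T(2), of d e] by simp
qed

lemma smooth_on_pulled_back_form:
 assumes p: "parametrization S \<Omega> \<kappa>" and a: "smooth_form S \<alpha>"
 shows "smooth_on \<Omega> (\<lambda>y. \<alpha> (\<kappa> y) (fderiv \<kappa> y e))"
proof -
 obtain T and g :: "_ => real^_" where T: "open \<Omega>" "smooth_on \<Omega> \<kappa>" "open T" "\<kappa> ` \<Omega> = S \<inter> T" by (rule parametrizationE[OF p]) (rule that)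
 let ?D = "\<lambda>y. fderiv \<kappa> y e"
 have "\<exists>A. open A \<and> x \<in> A \<and> smooth_on A (\<lambda>y. \<alpha> (\<kappa> y) (?D y))" if x: "x \<in> \<Omega>" for x
 proof -
  obtain a where "extends_form S \<alpha> (\<kappa> x) a" using a x T(4) unfolding smooth_form_def by blast
  then obtain V where V: "open V" "\<kappa> x \<in> V" "\<And>x. x \<in> V ==> linear (a x)" "\<And>v. smooth_on V (\<lambda>x. a x v)"
   "\<And>y v. y \<in> S \<inter> V ==> v \<in> tangent_space S y ==> \<alpha> y v = a y v"
   unfolding extends_form_def by blast
  let ?A = "\<Omega> \<inter> \<kappa> -` V"
  have A: "open ?A" "x \<in> ?A" using parametrization_preimage(1)[OF p V(1)] x V(2) by auto
  have k: "smooth_on ?A \<kappa>" by (rule smooth_on_subset[OF T(2)]) simp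
  have "smooth_on ?A (\<lambda>y. \<Sum>b\<in>Basis. (?D y \<bullet> b) *\<^sub>R a (\<kappa> y) b)"
   by (intro smooth_intros A smooth_on_derivative k smooth_on_compose[OF A(1) V(1) k V(4)]) auto
  moreover have "(\<Sum>b\<in>Basis. (?D y \<bullet> b) *\<^sub>R a (\<kappa> y) b) = \<alpha> (\<kappa> y) (?D y)" if y: "y \<in> ?A" for y
  proof -
   have "(\<Sum>b\<in>Basis. (?D y \<bullet> b) *\<^sub>R a (\<kappa> y) b) = a (\<kappa> y) (\<Sum>b\<in>Basis. (?D y \<bullet> b) *\<^sub>R b)"
    using V(3)[of "\<kappa> y"] y by (simp add: linear_sum linear_scale)
   also have "\<dots> = \<alpha> (\<kappa> y) (?D y)"
   proof -
    have "\<kappa> y \<in> S \<inter> V" using y T(4) by blast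
    then show ?thesis using V(5)[of "\<kappa> y" "?D y"] y tangent_space_parametrization[OF p, of y] by (simp add: euclidean_representation)
   qed
   finally show ?thesis .
  qed
  ultimately have "smooth_on ?A (\<lambda>y. \<alpha> (\<kappa> y) (?D y))" by (rule smooth_on_cong[OF A(1)])
  then show ?thesis using A by blast
 qed
 then show ?thesis using smooth_on_local by blast
qed

section \<open>Test densities and test sections\<close>

lemma test_densities_Int:
 assumes U: "open U" and m: "\<mu> \<in> test_densities (S \<inter> U)"
 shows "\<mu> \<in> test_densities S"
proof -
 from m obtain K where K: "compact K" "K \<subseteq> S \<inter> U" "\<And>q A. q \<notin> K ==> \<mu> q A = 0"
  unfolding test_densities_def by blast
 have m1: "\<mu> q A = 0" if "q \<in> S \<inter> U" "A \<notin> frames (S \<inter> U) q" for q A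
  using m that unfolding test_densities_def by blast
 have m2: "\<mu> q (A \<circ> B) = of_real \<bar>det (matrix B)\<bar> * \<mu> q A" if "q \<in> S \<inter> U" "A \<in> frames (S \<inter> U) q" "linear B" for q A B
  using m that unfolding test_densities_def by blast
 have m3: "smooth_on \<Omega> (\<lambda>x. \<mu> (\<kappa> x) (fderiv \<kappa> x))" if "parametrization (S \<inter> U) \<Omega> \<kappa>" for \<Omega> \<kappa>
  using m that unfolding test_densities_def by blast
 have off: "\<mu> q A = 0" if "q \<notin> U" for q A using K that by blast
 show ?thesis
  unfolding test_densities_def mem_Collect_eq
 proof (intro conjI allI impI ballI)
  show "\<mu> q A = 0" if "q \<in> S" "A \<notin> frames S q" for q A
   using m1[of q A] off[of q A] that frames_Int[OF U, of q S] by (cases "q \<in> U") auto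
  show "\<mu> q (A \<circ> B) = of_real \<bar>det (matrix B)\<bar> * \<mu> q A" if "q \<in> S" "A \<in> frames S q" "linear B" for q A B
   using m2[of q A B] off[of q] that frames_Int[OF U, of q S] by (cases "q \<in> U") auto
  show "smooth_on \<Omega> (\<lambda>x. \<mu> (\<kappa> x) (fderiv \<kappa> x))" if p: "parametrization S \<Omega> \<kappa>" for \<Omega> \<kappa>
  proof (rule smooth_on_local)
   fix x assume x: "x \<in> \<Omega>"
   show "\<exists>A. open A \<and> x \<in> A \<and> smooth_on A (\<lambda>x. \<mu> (\<kappa> x) (fderiv \<kappa> x))"
   proof (cases "\<kappa> x \<in> U")
    case True
    then show ?thesis
     using parametrization_preimage[OF p U] m3 x by (intro exI[of _ "\<Omega> \<inter> \<kappa> -` U"]) auto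
   next
    case False
    have oK: "open (- K)" using compact_imp_closed[OF K(1)] by (simp add: open_Compl)
    have "smooth_on (\<Omega> \<inter> \<kappa> -` (- K)) (\<lambda>x. \<mu> (\<kappa> x) (fderiv \<kappa> x))"
     by (rule smooth_on_cong[OF parametrization_preimage(1)[OF p oK] smooth_on_const[of _ 0]]) (use K(3) in auto)
    then show ?thesis
     using parametrization_preimage(1)[OF p oK] x False K(2) by (intro exI[of _ "\<Omega> \<inter> \<kappa> -` (- K)"]) auto
   qed
  qed
  show "\<exists>K. compact K \<and> K \<subseteq> S \<and> (\<forall>q. q \<notin> K \<longrightarrow> (\<forall>A. \<mu> q A = 0))" using K by blast
 qed
qed

lemma test_densities_zero: "(\<lambda>q A. 0) \<in> test_densities S"
 unfolding test_densities_def by (auto intro: smooth_on_const exI[of _ "{}"])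

lemma holomorphic_cotangent_linear:
 assumes h: "\<xi> \<in> holomorphic_cotangent S q" "\<eta> \<in> holomorphic_cotangent S q"
 shows "(\<lambda>v. a * \<xi> v + b * \<eta> v) \<in> holomorphic_cotangent S q"
proof -
 have x: "\<And>v. v \<notin> tangent_space S q ==> \<xi> v = 0" "\<And>v. v \<notin> tangent_space S q ==> \<eta> v = 0"
  using h unfolding holomorphic_cotangent_def complex_cotangent_def by blast+
 have l: "\<xi> (c *\<^sub>R u + d *\<^sub>R v) = of_real c * \<xi> u + of_real d * \<xi> v" "\<eta> (c *\<^sub>R u + d *\<^sub>R v) = of_real c * \<eta> u + of_real d * \<eta> v"
  if "u \<in> tangent_space S q" "v \<in> tangent_space S q" for u v c d
  using h that unfolding holomorphic_cotangent_def complex_cotangent_def by blast+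
 have c: "\<xi> (fst L) + \<i> * \<xi> (snd L) = 0" "\<eta> (fst L) + \<i> * \<eta> (snd L) = 0" if "L \<in> CR_bundle S q" for L
  using h that unfolding holomorphic_cotangent_def covector_apply_def by blast+
 have c': "a * \<xi> (fst L) + b * \<eta> (fst L) + \<i> * (a * \<xi> (snd L) + b * \<eta> (snd L)) = 0" if "L \<in> CR_bundle S q" for L
 proof -
  have "a * \<xi> (fst L) + b * \<eta> (fst L) + \<i> * (a * \<xi> (snd L) + b * \<eta> (snd L))
   = a * (\<xi> (fst L) + \<i> * \<xi> (snd L)) + b * (\<eta> (fst L) + \<i> * \<eta> (snd L))" by (simp add: algebra_simps)
  then show ?thesis using c[OF that] by simp
 qed
 show ?thesis
  unfolding holomorphic_cotangent_def complex_cotangent_def covector_apply_def mem_Collect_eq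
 proof (intro conjI allI impI ballI)
  show "a * \<xi> v + b * \<eta> v = 0" if "v \<notin> tangent_space S q" for v using x[OF that] by simp
  show "a * \<xi> (ra *\<^sub>R u + rb *\<^sub>R v) + b * \<eta> (ra *\<^sub>R u + rb *\<^sub>R v)
    = complex_of_real ra * (a * \<xi> u + b * \<eta> u) + complex_of_real rb * (a * \<xi> v + b * \<eta> v)"
   if "u \<in> tangent_space S q" "v \<in> tangent_space S q" for u v ra rb
   unfolding l[OF that] by (simp add: algebra_simps)
 qed (rule c')
qed

lemma form_times_density_test:
 assumes w: "\<omega> \<in> holomorphic_forms S" and m: "\<mu> \<in> test_densities S"
 shows "form_times_density \<omega> \<mu> \<in> test_sections S"
proof -
 from m obtain K where K: "compact K" "K \<subseteq> S" "\<And>q A. q \<notin> K ==> \<mu> q A = 0"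
  unfolding test_densities_def by blast
 have m1: "\<mu> q A = 0" if "q \<in> S" "A \<notin> frames S q" for q A
  using m that unfolding test_densities_def by blast
 have m2: "\<mu> q (A \<circ> B) = of_real \<bar>det (matrix B)\<bar> * \<mu> q A" if "q \<in> S" "A \<in> frames S q" "linear B" for q A B
  using m that unfolding test_densities_def by blast
 have m3: "smooth_on \<Omega> (\<lambda>x. \<mu> (\<kappa> x) (fderiv \<kappa> x))" if "parametrization S \<Omega> \<kappa>" for \<Omega> \<kappa>
  using m that unfolding test_densities_def by blast
 have hc: "(\<lambda>v. c * \<omega> q v) \<in> holomorphic_cotangent S q" if "q \<in> S" for c q
 proof -
  have "\<omega> q \<in> holomorphic_cotangent S q" using w that by (simp add: holomorphic_forms_def)
  from holomorphic_cotangent_linear[OF this this, of c 0] show ?thesis by simp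
 qed
 show ?thesis
  unfolding test_sections_def mem_Collect_eq form_times_density_def
 proof (intro conjI allI impI ballI)
  show "\<mu> q A * \<omega> q v = 0" if "q \<in> S" "A \<notin> frames S q" for q A v using m1[OF that] by simp
  show "(\<lambda>v. \<mu> q A * \<omega> q v) \<in> holomorphic_cotangent S q" if "q \<in> S" for q A by (rule hc[OF that])
  show "\<mu> q (A \<circ> B) * \<omega> q v = of_real \<bar>det (matrix B)\<bar> * (\<mu> q A * \<omega> q v)"
   if "q \<in> S" "A \<in> frames S q" "linear B" for q A B v using m2[OF that] by simp
  show "smooth_on \<Omega> (\<lambda>x. \<mu> (\<kappa> x) (fderiv \<kappa> x) * \<omega> (\<kappa> x) (fderiv \<kappa> x h))"
   if p: "parametrization S \<Omega> \<kappa>" for \<Omega> \<kappa> h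
  proof -
   have "open \<Omega>" using p by (simp add: parametrization_def)
   moreover have "smooth_form S \<omega>" using w by (simp add: holomorphic_forms_def)
   ultimately show ?thesis by (intro smooth_on_mult m3[OF p] smooth_on_pulled_back_form[OF p])
  qed
  show "\<exists>K. compact K \<and> K \<subseteq> S \<and> (\<forall>q. q \<notin> K \<longrightarrow> (\<forall>A v. \<mu> q A * \<omega> q v = 0))" using K by auto
 qed
qed

lemma test_sections_linear:
 assumes s: "\<sigma> \<in> test_sections S" and t: "\<tau> \<in> test_sections S"
 shows "(\<lambda>q A v. a * \<sigma> q A v + b * \<tau> q A v) \<in> test_sections S"
proof -
 from s obtain K where K: "compact K" "K \<subseteq> S" "\<And>q A v. q \<notin> K ==> \<sigma> q A v = 0"
  unfolding test_sections_def by blast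
 from t obtain L where L: "compact L" "L \<subseteq> S" "\<And>q A v. q \<notin> L ==> \<tau> q A v = 0"
  unfolding test_sections_def by blast
 have 1: "\<rho> q A v = 0" if "\<rho> \<in> test_sections S" "q \<in> S" "A \<notin> frames S q" for \<rho> q A v
  using that unfolding test_sections_def by blast
 have 2: "\<rho> q (A \<circ> B) v = of_real \<bar>det (matrix B)\<bar> * \<rho> q A v" if "\<rho> \<in> test_sections S" "q \<in> S" "A \<in> frames S q" "linear B" for \<rho> q A B v
  using that unfolding test_sections_def by blast
 have 3: "\<rho> q A \<in> holomorphic_cotangent S q" if "\<rho> \<in> test_sections S" "q \<in> S" "A \<in> frames S q" for \<rho> q A
  using that unfolding test_sections_def by blast
 have 4: "smooth_on \<Omega> (\<lambda>x. \<rho> (\<kappa> x) (fderiv \<kappa> x) (fderiv \<kappa> x h))"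
  if "\<rho> \<in> test_sections S" "parametrization S \<Omega> \<kappa>" for \<rho> \<Omega> \<kappa> h
  using that unfolding test_sections_def by blast
 show ?thesis
  unfolding test_sections_def mem_Collect_eq
 proof (intro conjI allI impI ballI)
  show "a * \<sigma> q A v + b * \<tau> q A v = 0" if "q \<in> S" "A \<notin> frames S q" for q A v
   using 1[OF s that] 1[OF t that] by simp
  show "(\<lambda>v. a * \<sigma> q A v + b * \<tau> q A v) \<in> holomorphic_cotangent S q" if "q \<in> S" "A \<in> frames S q" for q A
   by (rule holomorphic_cotangent_linear[OF 3[OF s that] 3[OF t that]])
  show "a * \<sigma> q (A \<circ> B) v + b * \<tau> q (A \<circ> B) v = of_real \<bar>det (matrix B)\<bar> * (a * \<sigma> q A v + b * \<tau> q A v)"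
   if "q \<in> S" "A \<in> frames S q" "linear B" for q A B v
   unfolding 2[OF s that] 2[OF t that] by (simp add: algebra_simps)
  show "smooth_on \<Omega> (\<lambda>x. a * \<sigma> (\<kappa> x) (fderiv \<kappa> x) (fderiv \<kappa> x h)
    + b * \<tau> (\<kappa> x) (fderiv \<kappa> x) (fderiv \<kappa> x h))"
   if p: "parametrization S \<Omega> \<kappa>" for \<Omega> \<kappa> h
  proof -
   have "open \<Omega>" using p by (simp add: parametrization_def)
   then show ?thesis by (intro smooth_on_add smooth_on_mult smooth_on_const 4[OF s p] 4[OF t p])
  qed
  show "\<exists>K. compact K \<and> K \<subseteq> S \<and> (\<forall>q. q \<notin> K \<longrightarrow> (\<forall>A v. a * \<sigma> q A v + b * \<tau> q A v = 0))"
   by (rule exI[of _ "K \<union> L"]) (use K L in \<open>simp add: compact_Un\<close>)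
 qed
qed

lemma distributional_section_linear:
 assumes X: "distributional_section S X" and "\<sigma> \<in> test_sections S" "\<tau> \<in> test_sections S"
 shows "X (\<lambda>q A v. a * \<sigma> q A v + b * \<tau> q A v) = a * X \<sigma> + b * X \<tau>"
 using assms unfolding distributional_section_def by blast

lemma distributional_section_sum:
 assumes X: "distributional_section S X" and I: "finite I" and s: "\<And>i. i \<in> I ==> \<sigma> i \<in> test_sections S"
  and "I \<noteq> {}"
 shows "(\<lambda>q A v. \<Sum>i\<in>I. \<sigma> i q A v) \<in> test_sections S \<and> X (\<lambda>q A v. \<Sum>i\<in>I. \<sigma> i q A v) = (\<Sum>i\<in>I. X (\<sigma> i))"
 using I assms(4) s
proof (induction I rule: finite_ne_induct)
 case (singleton i)
 then show ?case by simp
next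
 case (insert i I)
 have m: "\<sigma> i \<in> test_sections S" "(\<lambda>q A v. \<Sum>i\<in>I. \<sigma> i q A v) \<in> test_sections S" using insert by auto
 show ?case
  using test_sections_linear[OF m, of 1 1] distributional_section_linear[OF X m, of 1 1] insert by simp
qed

lemma parametrization_image: "parametrization S \<Omega> \<kappa> ==> \<kappa> ` \<Omega> \<subseteq> S"
 unfolding parametrization_def using openin_imp_subset by metis

lemma smooth_on_abs:
 fixes f :: "'a::euclidean_space => real"
 assumes S: "open S" and f: "smooth_on S f" and nz: "\<And>x. x \<in> S ==> f x \<noteq> 0"
 shows "smooth_on S (\<lambda>x. \<bar>f x\<bar>)"
proof (rule smooth_on_local)
 fix x assume x: "x \<in> S"
 have c: "continuous_on S f" by (rule smooth_on_continuous[OF f])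
 have o: "open (S \<inter> f -` {0<..})" "open (S \<inter> f -` {..<0})"
  by (rule continuous_open_preimage[OF c S]; simp)+
 have "smooth_on (S \<inter> f -` {0<..}) (\<lambda>x. \<bar>f x\<bar>)"
  by (rule smooth_on_cong[OF o(1) smooth_on_subset[OF f]]) auto
 moreover have "smooth_on (S \<inter> f -` {..<0}) (\<lambda>x. \<bar>f x\<bar>)"
  by (rule smooth_on_cong[OF o(2) smooth_on_subset[OF smooth_on_minus[OF S f]]]) auto
 moreover have "x \<in> S \<inter> f -` {0<..} \<or> x \<in> S \<inter> f -` {..<0}" using nz[OF x] x by auto
 ultimately show "\<exists>U. open U \<and> x \<in> U \<and> smooth_on U (\<lambda>x. \<bar>f x\<bar>)" using o by blast
qed

text \<open>The left inverse \<open>\<pi>\<close> on the ambient space makes transition maps to other parametrizations smooth at once, as restrictions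
of \<open>\<pi>\<close>, and it replaces the inverse of \<open>D\<kappa>\<close>, which is a choice function off the tangent space.\<close>

locale chart_with_inverse =
 fixes S :: "(complex^'N) set" and \<Omega> :: "(real^'d) set" and \<kappa> :: "real^'d => complex^'N"
  and W :: "(complex^'N) set" and \<pi> :: "complex^'N => real^'d"
 assumes par: "parametrization S \<Omega> \<kappa>" and W: "open W" and \<pi>: "smooth_on W \<pi>" and \<kappa>W: "\<kappa> ` \<Omega> \<subseteq> W"
  and \<pi>\<kappa>: "\<And>x. x \<in> \<Omega> ==> \<pi> (\<kappa> x) = x"
begin

lemma open_\<Omega>: "open \<Omega>" and smooth_\<kappa>: "smooth_on \<Omega> \<kappa>"
 using par by (simp_all add: parametrization_def)

lemma derivative_\<pi>_\<kappa>:
 assumes x: "x \<in> \<Omega>"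
 shows "fderiv \<pi> (\<kappa> x) (fderiv \<kappa> x v) = v"
proof -
 have "((\<lambda>y. \<pi> (\<kappa> y)) has_derivative (\<lambda>v. fderiv \<pi> (\<kappa> x) (fderiv \<kappa> x v))) (at x)"
  by (rule has_derivative_compose[OF smooth_on_has_derivative[OF smooth_\<kappa> x] smooth_on_has_derivative[OF \<pi>]]) (use \<kappa>W x in blast)
 then have "((\<lambda>y. y) has_derivative (\<lambda>v. fderiv \<pi> (\<kappa> x) (fderiv \<kappa> x v))) (at x)"
  by (rule has_derivative_transform_within_open[OF _ open_\<Omega> x]) (rule \<pi>\<kappa>)
 then show ?thesis using has_derivative_unique[OF has_derivative_ident] by metis
qed

lemma inv_derivative: "x \<in> \<Omega> ==> inv (fderiv \<kappa> x) (fderiv \<kappa> x v) = v"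
 by (rule inv_f_f[OF parametrization_linear(2)[OF par]])

lemma inv_into_\<kappa>: "x \<in> \<Omega> ==> inv_into \<Omega> \<kappa> (\<kappa> x) = x"
 by (rule inv_into_f_f) (use \<pi>\<kappa> in \<open>metis inj_on_inverseI\<close>)

lemma frames_image: "q \<in> \<kappa> ` \<Omega> ==> frames (\<kappa> ` \<Omega>) q = frames S q"
 by (rule parametrizationE[OF par]) (metis Int_iff frames_Int)

lemma frame_derivative:
 assumes p: "parametrization S \<Omega>' \<kappa>'" and x: "x \<in> \<Omega>'"
 shows "fderiv \<kappa>' x \<in> frames S (\<kappa>' x)"
 using parametrization_linear[OF p x] tangent_space_parametrization[OF p x] by (simp add: frames_def)

lemma chart_density_eq:
 assumes x: "x \<in> \<Omega>" and A: "A \<in> frames S (\<kappa> x)"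
 shows "chart_density \<Omega> \<kappa> \<phi> (\<kappa> x) A = \<phi> x * of_real \<bar>det (matrix (fderiv \<pi> (\<kappa> x) \<circ> A))\<bar>"
  and "det (matrix (fderiv \<pi> (\<kappa> x) \<circ> A)) \<noteq> 0"
  and "linear (fderiv \<pi> (\<kappa> x) \<circ> A)"
proof -
 let ?P = "fderiv \<pi> (\<kappa> x)" and ?D = "fderiv \<kappa> x"
 have lP: "linear ?P" using \<kappa>W x by (intro has_derivative_linear[OF smooth_on_has_derivative[OF \<pi>]]) blast
 have A': "linear A" "inj A" "range A = range ?D"
  using A tangent_space_parametrization[OF par x] by (auto simp: frames_def)
 have e: "inv ?D (A v) = ?P (A v)" for v
 proof -
  have "A v \<in> range ?D" using A'(3) by blast
  then obtain u where "A v = ?D u" by blast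
  then show ?thesis using inv_derivative[OF x] derivative_\<pi>_\<kappa>[OF x] by simp
 qed
 then have "inv ?D \<circ> A = ?P \<circ> A" by (simp add: fun_eq_iff)
 then show "chart_density \<Omega> \<kappa> \<phi> (\<kappa> x) A = \<phi> x * of_real \<bar>det (matrix (?P \<circ> A))\<bar>"
  using x A by (simp add: chart_density_def inv_into_\<kappa> frames_image)
 show l: "linear (?P \<circ> A)" by (rule linear_compose[OF A'(1) lP])
 have "inj (?P \<circ> A)"
 proof (rule injI)
  fix u v assume *: "(?P \<circ> A) u = (?P \<circ> A) v"
  have "A u \<in> range ?D" "A v \<in> range ?D" using A'(3) by blast+
  then obtain a b where ab: "A u = ?D a" "A v = ?D b" by blast
  then have "a = b" using * derivative_\<pi>_\<kappa>[OF x] by simp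
  then have "A u = A v" using ab by simp
  then show "u = v" by (rule injD[OF A'(2)])
 qed
 then show "det (matrix (?P \<circ> A)) \<noteq> 0" by (simp add: det_nz_iff_inj[OF l])
qed

lemma chart_density_off: "q \<notin> \<kappa> ` \<Omega> ==> chart_density \<Omega> \<kappa> \<phi> q A = 0" "A \<notin> frames S q ==> chart_density \<Omega> \<kappa> \<phi> q A = 0"
 using frames_image by (auto simp: chart_density_def)

lemma chart_density_at_parametrization:
 assumes p: "parametrization S \<Omega>' \<kappa>'" and x: "x \<in> \<Omega>'" and im: "\<kappa>' x \<in> \<kappa> ` \<Omega>"
 shows "chart_density \<Omega> \<kappa> \<phi> (\<kappa>' x) (fderiv \<kappa>' x)
   = \<phi> (\<pi> (\<kappa>' x)) * of_real \<bar>det (matrix (fderiv (\<lambda>x. \<pi> (\<kappa>' x)) x))\<bar>"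
  and "det (matrix (fderiv (\<lambda>x. \<pi> (\<kappa>' x)) x)) \<noteq> 0"
proof -
 obtain y where y: "y \<in> \<Omega>" "\<kappa>' x = \<kappa> y" using im by blast
 have s: "smooth_on \<Omega>' \<kappa>'" using p by (simp add: parametrization_def)
 have "((\<lambda>x. \<pi> (\<kappa>' x)) has_derivative (fderiv \<pi> (\<kappa>' x) \<circ> fderiv \<kappa>' x)) (at x)"
  unfolding o_def
  by (rule has_derivative_compose[OF smooth_on_has_derivative[OF s x] smooth_on_has_derivative[OF \<pi>]]) (use \<kappa>W im in blast)
 then have D: "fderiv (\<lambda>x. \<pi> (\<kappa>' x)) x = fderiv \<pi> (\<kappa>' x) \<circ> fderiv \<kappa>' x"
  by (rule frechet_derivative_eqI)
 show "chart_density \<Omega> \<kappa> \<phi> (\<kappa>' x) (fderiv \<kappa>' x)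
   = \<phi> (\<pi> (\<kappa>' x)) * of_real \<bar>det (matrix (fderiv (\<lambda>x. \<pi> (\<kappa>' x)) x))\<bar>"
  "det (matrix (fderiv (\<lambda>x. \<pi> (\<kappa>' x)) x)) \<noteq> 0"
  using chart_density_eq(1,2)[OF y(1), of "fderiv \<kappa>' x"] frame_derivative[OF p x] unfolding D y(2) \<pi>\<kappa>[OF y(1)]
  by simp_all
qed

text \<open>In another parametrization the density is \<open>\<phi>\<close> times the absolute Jacobian of the transition map, which is smooth since the
Jacobian has no zeros.\<close>

lemma chart_density_test:
 assumes ph: "\<phi> \<in> test_functions \<Omega>"
 shows "chart_density \<Omega> \<kappa> \<phi> \<in> test_densities S"
proof -
 obtain K where K: "smooth_on UNIV \<phi>" "compact K" "K \<subseteq> \<Omega>" "\<And>x. x \<notin> K ==> \<phi> x = 0"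
  using test_functionsE[OF ph] by blast
 have cK: "compact (\<kappa> ` K)"
  by (rule compact_continuous_image[OF continuous_on_subset[OF smooth_on_continuous[OF smooth_\<kappa>] K(3)] K(2)])
 have off: "chart_density \<Omega> \<kappa> \<phi> q A = 0" if q: "q \<notin> \<kappa> ` K" for q A
 proof (cases "q \<in> \<kappa> ` \<Omega> \<and> A \<in> frames S q")
  case True
  then obtain x where x: "x \<in> \<Omega>" "q = \<kappa> x" by blast
  then have "x \<notin> K" using q by blast
  then show ?thesis using chart_density_eq(1)[OF x(1)] True x K(4) by simp
 next
  case False
  then show ?thesis using chart_density_off by blast
 qed
 obtain T and g :: "complex^'N => real^'d" where T: "open T" "\<kappa> ` \<Omega> = S \<inter> T" by (rule parametrizationE[OF par]) (rule that)
 have S: "\<kappa> ` K \<subseteq> S" using T K(3) by blast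
 show ?thesis
  unfolding test_densities_def mem_Collect_eq
 proof (intro conjI allI impI ballI)
  show "chart_density \<Omega> \<kappa> \<phi> q A = 0" if "A \<notin> frames S q" for q A by (rule chart_density_off(2)[OF that])
  show "chart_density \<Omega> \<kappa> \<phi> q (A \<circ> B) = of_real \<bar>det (matrix B)\<bar> * chart_density \<Omega> \<kappa> \<phi> q A"
   if q: "q \<in> S" and A: "A \<in> frames S q" and B: "linear B" for q A B
  proof (cases "q \<in> \<kappa> ` \<Omega>")
   case True
   then obtain x where x: "x \<in> \<Omega>" "q = \<kappa> x" by blast
   let ?P = "fderiv \<pi> q"
   have m: "matrix (?P \<circ> A \<circ> B) = matrix (?P \<circ> A) ** matrix B"
    using matrix_compose[OF B chart_density_eq(3)[OF x(1)]] A x(2) by simp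
   show ?thesis
   proof (cases "A \<circ> B \<in> frames S q")
    case True
    then show ?thesis
     using chart_density_eq(1)[OF x(1), of "A \<circ> B" \<phi>] chart_density_eq(1)[OF x(1), of A \<phi>] A x(2) m
     by (simp add: o_assoc det_mul abs_mult mult_ac)
   next
    case False
    have "det (matrix B) = 0"
    proof (rule ccontr)
     assume "det (matrix B) \<noteq> 0"
     then have "inj B" by (simp add: det_nz_iff_inj[OF B])
     then have "surj B" using linear_injective_imp_surjective[OF B] by blast
     then have "A \<circ> B \<in> frames S q"
     proof -
      have "range (A \<circ> B) = range A" unfolding image_comp[symmetric] \<open>surj B\<close> ..
      then show ?thesis
       using A \<open>inj B\<close> linear_compose[OF B, of A] inj_compose[of A B] by (simp add: frames_def)
     qed
     then show False using False by blast
    qed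
    then show ?thesis using chart_density_off(2)[OF False] by simp
   qed
  next
   case False
   then show ?thesis using chart_density_off(1) by simp
  qed
  show "smooth_on \<Omega>' (\<lambda>x. chart_density \<Omega> \<kappa> \<phi> (\<kappa>' x) (fderiv \<kappa>' x))" (is "smooth_on _ ?h")
   if p: "parametrization S \<Omega>' \<kappa>'" for \<Omega>' \<kappa>'
  proof (rule smooth_on_local)
   fix x assume x: "x \<in> \<Omega>'"
   have s': "smooth_on \<Omega>' \<kappa>'" "open \<Omega>'" using p by (simp_all add: parametrization_def)
   note s' = s' parametrization_image[OF p]
   show "\<exists>A. open A \<and> x \<in> A \<and> smooth_on A ?h"
   proof (cases "\<kappa>' x \<in> T")
    case True
    let ?A = "\<Omega>' \<inter> \<kappa>' -` (T \<inter> W)"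
    have oA: "open ?A" by (rule parametrization_preimage(1)[OF p open_Int[OF T(1) W]])
    have im: "\<kappa>' y \<in> \<kappa> ` \<Omega>" if "y \<in> ?A" for y using that T(2) s'(3) by blast
    have sp: "smooth_on ?A (\<lambda>y. \<pi> (\<kappa>' y))"
     by (rule smooth_on_compose[OF oA W smooth_on_subset[OF s'(1)] \<pi>]) auto
    have sd: "smooth_on ?A (\<lambda>y. det (matrix (fderiv (\<lambda>x. \<pi> (\<kappa>' x)) y)))"
     by (rule smooth_on_det[OF oA], unfold matrix_def vec_lambda_beta) (intro smooth_on_nth smooth_on_derivative oA sp)
    have A': "y \<in> \<Omega>'" if "y \<in> ?A" for y using that by blast
    have nz: "det (matrix (fderiv (\<lambda>x. \<pi> (\<kappa>' x)) y)) \<noteq> 0" if "y \<in> ?A" for y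
     by (rule chart_density_at_parametrization(2)[OF p A'[OF that] im[OF that]])
    have "smooth_on ?A (\<lambda>y. \<phi> (\<pi> (\<kappa>' y)) * of_real \<bar>det (matrix (fderiv (\<lambda>x. \<pi> (\<kappa>' x)) y))\<bar>)"
     by (intro smooth_intros smooth_on_abs oA sd nz smooth_on_compose[OF oA open_UNIV sp K(1)] subset_UNIV)
    then have "smooth_on ?A ?h"
     by (rule smooth_on_cong[OF oA]) (rule chart_density_at_parametrization(1)[OF p A' im, symmetric])
    moreover have "x \<in> ?A" using x True \<kappa>W T(2) s'(3) by blast
    ultimately show ?thesis using oA by blast
   next
    case False
    have oK: "open (- (\<kappa> ` K))" using compact_imp_closed[OF cK] by (simp add: open_Compl)
    have "smooth_on (\<Omega>' \<inter> \<kappa>' -` (- (\<kappa> ` K))) ?h"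
     by (rule smooth_on_cong[OF parametrization_preimage(1)[OF p oK] smooth_on_const[of _ 0]]) (use off in auto)
    moreover have "\<kappa>' x \<notin> \<kappa> ` K" using False T(2) K(3) by blast
    ultimately show ?thesis
     using parametrization_preimage(1)[OF p oK] x by (intro exI[of _ "\<Omega>' \<inter> \<kappa>' -` (- (\<kappa> ` K))"]) auto
   qed
  qed
  show "\<exists>K. compact K \<and> K \<subseteq> S \<and> (\<forall>q. q \<notin> K \<longrightarrow> (\<forall>A. chart_density \<Omega> \<kappa> \<phi> q A = 0))"
   using cK S off by blast
 qed
qed

lemma chart_density_Int:
 assumes "open U" "\<kappa> ` \<Omega> \<subseteq> U"
 shows "chart_with_inverse (S \<inter> U) \<Omega> \<kappa> W \<pi>"
 using par W \<pi> \<kappa>W \<pi>\<kappa> assms by (simp add: chart_with_inverse_def parametrization_Int_iff)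

lemma chart_with_inverse_subset:
 assumes "open \<Omega>'" "\<Omega>' \<subseteq> \<Omega>"
 shows "chart_with_inverse S \<Omega>' \<kappa> W \<pi>"
 using parametrization_subset[OF par assms] W \<pi> \<kappa>W \<pi>\<kappa> assms(2) by (auto simp: chart_with_inverse_def)

end

lemma chart_density_cnj: "chart_density \<Omega> \<kappa> (\<lambda>x. cnj (\<phi> x)) q A = cnj (chart_density \<Omega> \<kappa> \<phi> q A)"
 by (simp add: chart_density_def Let_def)

section \<open>The hypersurface as a graph\<close>

lemma linear_axis_expansion:
 fixes A :: "real^'d => complex"
 assumes "linear A"
 shows "A v = (\<Sum>i\<in>UNIV. of_real (v $ i) * A (axis i 1))"
proof -
 have "v = (\<Sum>i\<in>UNIV. v $ i *\<^sub>R axis i 1)"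
  using basis_expansion[of v] by (simp add: scalar_mult_eq_scaleR)
 then have "A v = A (\<Sum>i\<in>UNIV. v $ i *\<^sub>R axis i 1)" by simp
 also have "\<dots> = (\<Sum>i\<in>UNIV. of_real (v $ i) * A (axis i 1))"
  unfolding linear_sum[OF assms] linear_scale[OF assms] by (simp add: scaleR_conv_of_real)
 finally show ?thesis .
qed

lemma complexified_linear:
 fixes A :: "real^'d => complex" and Y :: "complex^'d"
 assumes "linear A"
 shows "A (\<chi> i. Re (Y $ i)) + \<i> * A (\<chi> i. Im (Y $ i)) = (\<Sum>i\<in>UNIV. Y $ i * A (axis i 1))"
proof -
 have "Y $ i * A (axis i 1) = of_real (Re (Y $ i)) * A (axis i 1) + \<i> * (of_real (Im (Y $ i)) * A (axis i 1))" for i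
  by (subst complex_eq[of "Y $ i"]) (simp add: algebra_simps)
 then show ?thesis
  unfolding linear_axis_expansion[OF assms, of "\<chi> i. Re (Y $ i)"] linear_axis_expansion[OF assms, of "\<chi> i. Im (Y $ i)"]
  by (simp add: sum.distrib sum_distrib_left)
qed

text \<open>The graph \<open>g\<close> over the open set \<open>S\<close>, inside the domain \<open>W\<close> of the holomorphic coordinates, shrunk so that
\<open>(z, Re w)\<close> maps \<open>W\<close> into \<open>S\<close>.\<close>

locale graph_hypersurface = chart_index e + real_valued_graph m \<Phi> S
 for e :: "('n::finite \<times> bool) option => 'd::finite" and m \<Phi> S +
 fixes M W :: "(complex^'N::finite) set" and z :: "complex^'N => complex^'n" and w :: "complex^'N => complex"
  and g :: "(complex^'n) \<times> real => complex^'N"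
 assumes W: "open W"
  and hz: "\<And>l. holomorphic_function W (\<lambda>q. z q $ l)" and hw: "holomorphic_function W w"
  and inj: "\<And>q. q \<in> W ==> inj (fderiv (\<lambda>q. (z q, w q)) q)"
  and gM: "M \<inter> W = g ` S" and g: "smooth_on S g"
  and gz: "\<And>x. x \<in> S ==> z (g x) = fst x"
  and gw: "\<And>x. x \<in> S ==> w (g x) = of_real (snd x) + \<i> * (of_real (snd x) ^ m * \<Phi> x)"
  and inS: "\<And>q. q \<in> W ==> (z q, Re (w q)) \<in> S"
begin

definition graph :: "(complex^'n) \<times> real => complex" where "graph x = of_real (snd x) ^ m * \<Phi> x"

definition Z :: "'n option => complex^'N => complex" where "Z i q = (case i of None => w q | Some l => z q $ l)"

text \<open>The coordinates restricted to the graph, as functions on the model space.\<close>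

definition Zg :: "'n option => (complex^'n) \<times> real => complex"
 where "Zg i x = (case i of None => of_real (snd x) + \<i> * graph x | Some l => fst x $ l)"

definition \<kappa> :: "real^'d => complex^'N" where "\<kappa> y = g (to_model y)"

definition \<pi> :: "complex^'N => real^'d" where "\<pi> q = of_model (z q, Re (w q))"

abbreviation "D \<equiv> to_model -` S"
abbreviation "D\<kappa> y \<equiv> fderiv \<kappa> y"
abbreviation "DZ i q \<equiv> fderiv (Z i) q"
abbreviation "Dh x \<equiv> fderiv graph x"

lemma open_D: "open D" by (rule open_to_model[OF S])

lemma graph_eq: "graph = (\<lambda>x. of_real (snd x) ^ m * \<Phi> x)" by (simp add: graph_def[abs_def])

lemma smooth_graph: "smooth_on S graph" unfolding graph_eq by (rule smooth_on_graph)

lemma graph_real: "x \<in> S ==> graph x \<in> \<real>" unfolding graph_def by (auto intro!: real Reals_mult Reals_power)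

lemma Dh_real: "x \<in> S ==> Dh x v \<in> \<real>"
 by (rule real_derivative[OF smooth_graph]) (auto intro: graph_real)

lemma linear_Dh: "x \<in> S ==> linear (Dh x)"
 by (rule has_derivative_linear[OF smooth_on_has_derivative[OF smooth_graph]])

lemma holomorphic_Z: "holomorphic_function W (Z i)"
 by (cases i) (simp_all add: Z_def[abs_def] hz hw)

lemma smooth_Z: "smooth_on W (Z i)"
 by (rule holomorphic_function_smooth[OF W holomorphic_Z])

lemma smooth_z: "smooth_on W z"
proof -
 have "smooth_on W (\<lambda>q. \<chi> l. z q $ l)"
  by (intro smooth_on_vec_lambda W holomorphic_function_smooth[OF W hz])
 then show ?thesis by simp
qed

lemma smooth_w: "smooth_on W w" by (rule holomorphic_function_smooth[OF W hw])

lemma smooth_model: "smooth_on W (\<lambda>q. (z q, Re (w q)))"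
 by (intro smooth_intros W smooth_z smooth_w)

lemma smooth_\<pi>: "smooth_on W \<pi>"
 unfolding \<pi>_def[abs_def] by (rule smooth_on_linear_compose[OF bounded_linear_of_model W smooth_model])

lemma smooth_\<kappa>: "smooth_on D \<kappa>"
 unfolding \<kappa>_def[abs_def]
 by (rule smooth_on_compose[OF open_D S smooth_on_linear[OF bounded_linear_to_model open_D] g]) auto

lemma linear_D\<kappa>: "y \<in> D ==> linear (D\<kappa> y)"
 by (rule has_derivative_linear[OF smooth_on_has_derivative[OF smooth_\<kappa>]])

lemma linear_DZ: "q \<in> W ==> linear (DZ i q)"
 by (rule has_derivative_linear[OF smooth_on_has_derivative[OF smooth_Z]])

lemma DZ_J: "q \<in> W ==> DZ i q (\<i> *s v) = \<i> * DZ i q v"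
 using holomorphic_Z[of i] unfolding holomorphic_function_def by (metis frechet_derivative_eqI)

lemma DZ_inj:
 assumes q: "q \<in> W" and 0: "\<And>i. DZ i q v = 0"
 shows "v = 0"
proof -
 let ?F = "fderiv (\<lambda>q. (z q, w q)) q"
 have F: "((\<lambda>q. (z q, w q)) has_derivative ?F) (at q)"
  by (rule smooth_on_has_derivative[OF _ q]) (intro smooth_intros W smooth_z smooth_w)
 have l: "(Z (Some l) has_derivative (\<lambda>v. fst (?F v) $ l)) (at q)" for l
  using bounded_linear.has_derivative[OF bounded_linear_compose[OF bounded_linear_vec_nth bounded_linear_fst] F] by (simp add: Z_def[abs_def])
 have "fst (?F v) $ l = 0" for l using 0[of "Some l"] unfolding frechet_derivative_eqI[OF l] .
 moreover have n: "(Z None has_derivative (\<lambda>v. snd (?F v))) (at q)"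
  using bounded_linear.has_derivative[OF bounded_linear_snd F] by (simp add: Z_def[abs_def])
 have "snd (?F v) = 0" using 0[of None] unfolding frechet_derivative_eqI[OF n] .
 ultimately have "?F v = 0" by (simp add: prod_eq_iff vec_eq_iff)
 then show "v = 0" using injD[OF inj[OF q], of v 0] linear_0[OF has_derivative_linear[OF F]] by simp
qed

lemma \<kappa>_in: "y \<in> D ==> \<kappa> y \<in> M" "y \<in> D ==> \<kappa> y \<in> W"
 using gM by (auto simp: \<kappa>_def)

lemma image_\<kappa>: "\<kappa> ` D = M \<inter> W"
proof -
 have "\<kappa> ` D = g ` S" unfolding \<kappa>_def by (force simp: image_iff intro: bexI[of _ "of_model _"])
 then show ?thesis using gM by simp
qed

lemma model_\<kappa>: "y \<in> D ==> (z (\<kappa> y), Re (w (\<kappa> y))) = to_model y"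
 using graph_real[of "to_model y"] by (auto simp: \<kappa>_def gz gw graph_def complex_is_Real_iff prod_eq_iff)

lemma \<pi>_\<kappa>: "y \<in> D ==> \<pi> (\<kappa> y) = y"
 by (simp add: \<pi>_def model_\<kappa>)

lemma \<pi>_in: "q \<in> W ==> \<pi> q \<in> D"
 by (simp add: \<pi>_def inS)

lemma Z_\<kappa>: "y \<in> D ==> Z i (\<kappa> y) = Zg i (to_model y)"
 by (cases i) (simp_all add: Z_def Zg_def \<kappa>_def gz gw graph_def)

lemma parametrization_\<kappa>: "parametrization M D \<kappa>"
proof -
 have o: "openin (top_of_set M) (\<kappa> ` D)" unfolding image_\<kappa> by (rule openin_open_Int[OF W])
 have h: "homeomorphism D (\<kappa> ` D) \<kappa> \<pi>"
 proof (rule homeomorphismI)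
  show "continuous_on D \<kappa>" by (rule smooth_on_continuous[OF smooth_\<kappa>])
  show "continuous_on (\<kappa> ` D) \<pi>" by (rule continuous_on_subset[OF smooth_on_continuous[OF smooth_\<pi>]]) (use \<kappa>_in in auto)
 qed (use \<pi>_\<kappa> in auto)
 have "inj (D\<kappa> y)" if y: "y \<in> D" for y
 proof -
  have "((\<lambda>y. \<pi> (\<kappa> y)) has_derivative (\<lambda>v. fderiv \<pi> (\<kappa> y) (D\<kappa> y v))) (at y)"
   by (rule has_derivative_compose[OF smooth_on_has_derivative[OF smooth_\<kappa> y] smooth_on_has_derivative[OF smooth_\<pi> \<kappa>_in(2)[OF y]]])
  then have "((\<lambda>y. y) has_derivative (\<lambda>v. fderiv \<pi> (\<kappa> y) (D\<kappa> y v))) (at y)"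
   by (rule has_derivative_transform_within_open[OF _ open_D y]) (rule \<pi>_\<kappa>)
  then have "fderiv \<pi> (\<kappa> y) (D\<kappa> y v) = v" for v using has_derivative_unique[OF has_derivative_ident] by metis
  then show ?thesis by (metis injI)
 qed
 then show ?thesis using open_D smooth_\<kappa> o h unfolding parametrization_def by blast
qed

lemma chart: "chart_with_inverse M D \<kappa> W \<pi>"
 by (intro chart_with_inverse.intro parametrization_\<kappa> W smooth_\<pi> \<pi>_\<kappa>) (use \<kappa>_in in auto)

lemma tangent_\<kappa>: "y \<in> D ==> tangent_space M (\<kappa> y) = range (D\<kappa> y)"
 by (rule tangent_space_parametrization[OF parametrization_\<kappa>])

lemma smooth_Zg: "smooth_on S (Zg i)"
proof (cases i)
 case None
 have s: "smooth_on S (\<lambda>x :: (complex^'n) \<times> real. of_real (snd x) :: complex)" using smooth_on_real_coordinate[OF S, of 1] by simp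
 show ?thesis unfolding None Zg_def[abs_def] option.case
  by (rule smooth_on_add[OF S s smooth_on_mult[OF S smooth_on_const smooth_graph]])
next
 case (Some l)
 show ?thesis unfolding Some Zg_def[abs_def] option.case by (intro smooth_on_nth S smooth_on_linear bounded_linear_fst)
qed

lemma D_Zg:
 assumes x: "x \<in> S"
 shows "fderiv (Zg (Some l)) x v = fst v $ l"
  "fderiv (Zg None) x v = of_real (snd v) + \<i> * Dh x v"
proof -
 have "(Zg (Some l) has_derivative (\<lambda>v. fst v $ l)) (at x)"
  unfolding Zg_def[abs_def] by simp (rule bounded_linear_imp_has_derivative[OF bounded_linear_compose[OF bounded_linear_vec_nth bounded_linear_fst]])
 then show "fderiv (Zg (Some l)) x v = fst v $ l" by (simp add: frechet_derivative_eqI)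
 have "(Zg None has_derivative (\<lambda>v. of_real (snd v) + \<i> * Dh x v)) (at x)"
  unfolding Zg_def[abs_def] option.case
  by (intro has_derivative_add has_derivative_of_real has_derivative_snd has_derivative_ident has_derivative_mult_right smooth_on_has_derivative[OF smooth_graph x])
 then show "fderiv (Zg None) x v = of_real (snd v) + \<i> * Dh x v" by (simp add: frechet_derivative_eqI)
qed

lemma DZ_\<kappa>:
 assumes y: "y \<in> D"
 shows "DZ i (\<kappa> y) (D\<kappa> y v) = fderiv (Zg i) (to_model y) (to_model v)"
  and "DZ i (\<kappa> y) (D\<kappa> y v) = fderiv (\<lambda>y. Zg i (to_model y)) y v"
proof -
 have "((\<lambda>y. Z i (\<kappa> y)) has_derivative (\<lambda>v. DZ i (\<kappa> y) (D\<kappa> y v))) (at y)"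
  by (rule has_derivative_compose[OF smooth_on_has_derivative[OF smooth_\<kappa> y] smooth_on_has_derivative[OF smooth_Z \<kappa>_in(2)[OF y]]])
 then have "((\<lambda>y. Zg i (to_model y)) has_derivative (\<lambda>v. DZ i (\<kappa> y) (D\<kappa> y v))) (at y)"
  by (rule has_derivative_transform_within_open[OF _ open_D y]) (rule Z_\<kappa>)
 then show 1: "DZ i (\<kappa> y) (D\<kappa> y v) = fderiv (\<lambda>y. Zg i (to_model y)) y v" by (simp add: frechet_derivative_eqI)
 show "DZ i (\<kappa> y) (D\<kappa> y v) = fderiv (Zg i) (to_model y) (to_model v)"
  unfolding 1 by (rule derivative_to_model[OF smooth_Zg]) (use y in simp)
qed

abbreviation "CRY j \<equiv> CR_field j (\<lambda>x. of_real (snd x) ^ m * CR_coefficient m \<Phi> j x)"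

lemma CRY_Zg:
 assumes x: "x \<in> S"
 shows "dzbar j (Zg i) x + of_real (snd x) ^ m * CR_coefficient m \<Phi> j x * ds (Zg i) x = 0"
proof (cases i)
 case (Some l)
 then show ?thesis by (simp add: dzbar_def ds_def D_Zg[OF x] axis_def)
next
 case None
 have d: "dzbar j graph x = of_real (snd x) ^ m * dzbar j \<Phi> x"
  unfolding graph_eq using Wirtinger_mult(2)[OF smooth_on_real_coordinate[OF S] \<Phi> x] by (simp add: Wirtinger_real_coordinate)
 have s: "graph_ds m \<Phi> = ds graph" unfolding graph_ds_def graph_eq ..
 have "dzbar j (Zg None) x = \<i> * dzbar j graph x" "ds (Zg None) x = 1 + \<i> * ds graph x"
  by (simp_all add: dzbar_def ds_def D_Zg[OF x] algebra_simps)
 then show ?thesis using graph_ds_nonzero(1)[OF x] None by (simp add: d CR_coefficient_def s)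
qed

definition CR_re :: "'n => real^'d => real^'d" where "CR_re j y = (\<chi> i. Re (CRY j y $ i))"
definition CR_im :: "'n => real^'d => real^'d" where "CR_im j y = (\<chi> i. Im (CRY j y $ i))"

text \<open>A complexified tangent vector \<open>u + \<i> v\<close> that annihilates all holomorphic coordinates is antiholomorphic: \<open>v = J u\<close>.\<close>

lemma CR_im_J:
 assumes y: "y \<in> D"
 shows "D\<kappa> y (CR_im j y) = \<i> *s D\<kappa> y (CR_re j y)"
proof -
 note q = \<kappa>_in(2)[OF y] and lk = linear_D\<kappa>[OF y]
 have "DZ i (\<kappa> y) (D\<kappa> y (CR_im j y) - \<i> *s D\<kappa> y (CR_re j y)) = 0" for i
 proof -
  let ?A = "\<lambda>v. DZ i (\<kappa> y) (D\<kappa> y v)"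
  have l: "linear ?A" using linear_compose[OF lk linear_DZ[OF q]] by (simp add: o_def)
  have "?A (CR_re j y) + \<i> * ?A (CR_im j y) = (\<Sum>k\<in>UNIV. CRY j y $ k * ?A (axis k 1))"
   unfolding CR_re_def CR_im_def by (rule complexified_linear[OF l])
  also have "\<dots> = vector_field_derivative (CRY j) (\<lambda>y. Zg i (to_model y)) y"
   unfolding vector_field_derivative_def partial_deriv_def DZ_\<kappa>(2)[OF y] ..
  also have "\<dots> = 0" using vector_field_derivative_CR_field[OF smooth_Zg, of y] CRY_Zg y by simp
  finally have "?A (CR_re j y) = - (\<i> * ?A (CR_im j y))" by (simp add: eq_neg_iff_add_eq_0)
  then show ?thesis by (simp add: linear_diff[OF linear_DZ[OF q]] DZ_J[OF q])
 qed
 then have "D\<kappa> y (CR_im j y) - \<i> *s D\<kappa> y (CR_re j y) = 0" by (rule DZ_inj[OF q])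
 then show ?thesis by simp
qed

text \<open>The coefficients of a holomorphic covector in the basis \<open>dZ\<close>, read off from its values on \<open>\<partial>/\<partial>s\<close> and \<open>\<partial>/\<partial>x\<^sub>l\<close>; this
formula shows that they are smooth.\<close>

definition coefficient :: "'N cform => 'n option => real^'d => complex"
 where "coefficient \<omega> i y =
  (let c = \<omega> (\<kappa> y) (D\<kappa> y (axis (e None) 1)) / (1 + \<i> * graph_ds m \<Phi> (to_model y))
   in case i of None => c
   | Some l => \<omega> (\<kappa> y) (D\<kappa> y (axis (e (Some (l, False))) 1)) - \<i> * c * Dh (to_model y) (axis l 1, 0))"

lemma Dh_s: "Dh x (0, 1) = graph_ds m \<Phi> x"
 unfolding graph_ds_def graph_eq ds_def ..

lemma sum_option: "(\<Sum>i\<in>UNIV. f i) = f None + (\<Sum>l\<in>UNIV. f (Some l))" for f :: "'n option => complex"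
 by (simp add: UNIV_option_conv sum.reindex)

lemma sum_Zg:
 assumes y: "y \<in> D"
 shows "(\<Sum>i\<in>UNIV. c i * DZ i (\<kappa> y) (D\<kappa> y v))
  = c None * (of_real (snd (to_model v)) + \<i> * Dh (to_model y) (to_model v)) + (\<Sum>l\<in>UNIV. c (Some l) * fst (to_model v) $ l)"
 unfolding sum_option DZ_\<kappa>(1)[OF y] using y by (simp add: D_Zg)

text \<open>The difference vanishes on \<open>\<partial>/\<partial>s\<close> and \<open>\<partial>/\<partial>x\<^sub>l\<close> by the choice of the coefficients, and on \<open>\<partial>/\<partial>y\<^sub>l\<close> because it annihilates the
CR vector fields.\<close>

lemma holomorphic_covector_expansion:
 assumes y: "y \<in> D" and w: "\<omega> (\<kappa> y) \<in> holomorphic_cotangent M (\<kappa> y)" and v: "v \<in> tangent_space M (\<kappa> y)"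
 shows "\<omega> (\<kappa> y) v = (\<Sum>i\<in>UNIV. coefficient \<omega> i y * DZ i (\<kappa> y) v)"
proof -
 let ?t = "tangent_space M (\<kappa> y)" and ?c = "\<lambda>i. coefficient \<omega> i y"
 have lin: "\<omega> (\<kappa> y) (a *\<^sub>R u + b *\<^sub>R u') = of_real a * \<omega> (\<kappa> y) u + of_real b * \<omega> (\<kappa> y) u'" if "u \<in> ?t" "u' \<in> ?t" for u u' a b
  using w that unfolding holomorphic_cotangent_def complex_cotangent_def by blast
 have CR: "\<omega> (\<kappa> y) u + \<i> * \<omega> (\<kappa> y) (\<i> *s u) = 0" if "u \<in> ?t" "\<i> *s u \<in> ?t" for u
 proof -
  have "(u, \<i> *s u) \<in> CR_bundle M (\<kappa> y)" using that by (simp add: CR_bundle_def antiholomorphic_vectors_def)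
  then have "covector_apply (\<omega> (\<kappa> y)) (u, \<i> *s u) = 0" using w unfolding holomorphic_cotangent_def by blast
  then show ?thesis by (simp add: covector_apply_def)
 qed
 define A where "A v = \<omega> (\<kappa> y) (D\<kappa> y v) - (\<Sum>i\<in>UNIV. ?c i * DZ i (\<kappa> y) (D\<kappa> y v))" for v
 have tk: "D\<kappa> y v \<in> ?t" for v using tangent_\<kappa>[OF y] by blast
 have l1: "linear (\<lambda>v. \<omega> (\<kappa> y) (D\<kappa> y v))"
 proof (rule linearI)
  show "\<omega> (\<kappa> y) (D\<kappa> y (a + b)) = \<omega> (\<kappa> y) (D\<kappa> y a) + \<omega> (\<kappa> y) (D\<kappa> y b)" for a b
   using lin[OF tk tk, of 1 a 1 b] by (simp add: linear_add[OF linear_D\<kappa>[OF y]])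
  show "\<omega> (\<kappa> y) (D\<kappa> y (r *\<^sub>R a)) = r *\<^sub>R \<omega> (\<kappa> y) (D\<kappa> y a)" for r a
   using lin[OF tk tk, of r a 0 a] unfolding linear_scale[OF linear_D\<kappa>[OF y]] by (simp add: scaleR_conv_of_real[where 'a = complex])
 qed
 have l2: "linear (\<lambda>v. ?c i * DZ i (\<kappa> y) (D\<kappa> y v))" for i
  using linear_compose[OF linear_compose[OF linear_D\<kappa>[OF y] linear_DZ[OF \<kappa>_in(2)[OF y], of i]], of "\<lambda>x. ?c i * x"]
  by (simp add: o_def linear_times)
 have lA: "linear A"
  unfolding A_def[abs_def] by (intro linear_compose_sub l1 linear_compose_sum l2 ballI)
 have yS: "to_model y \<in> S" using y by simp
 have As: "A (axis (e None) 1) = 0"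
  unfolding A_def sum_Zg[OF y] to_model_axis by (simp add: Dh_s coefficient_def Let_def graph_ds_nonzero(1)[OF yS])
 have Ax: "A (axis (e (Some (l, False))) 1) = 0" for l
 proof -
  have "(\<Sum>k\<in>UNIV. ?c (Some k) * axis l 1 $ k) = ?c (Some l)"
   by (simp add: axis_def if_distrib[of "\<lambda>x. _ * x"] cong: if_cong)
  then show ?thesis unfolding A_def sum_Zg[OF y] to_model_axis by (simp add: coefficient_def Let_def)
 qed
 have Ay: "A (axis (e (Some (j, True))) 1) = 0" for j
 proof -
  let ?u = "D\<kappa> y (CR_re j y)"
  have J: "\<i> *s ?u = D\<kappa> y (CR_im j y)" by (rule CR_im_J[OF y, symmetric])
  have q: "\<kappa> y \<in> W" by (rule \<kappa>_in(2)[OF y])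
  have E1: "\<omega> (\<kappa> y) ?u + \<i> * \<omega> (\<kappa> y) (D\<kappa> y (CR_im j y)) = 0" using CR[of ?u] tk unfolding J by blast
  have "DZ i (\<kappa> y) ?u + \<i> * DZ i (\<kappa> y) (D\<kappa> y (CR_im j y)) = 0" for i
   unfolding J[symmetric] DZ_J[OF q] by simp
  then have E2: "(\<Sum>i\<in>UNIV. ?c i * DZ i (\<kappa> y) ?u) + \<i> * (\<Sum>i\<in>UNIV. ?c i * DZ i (\<kappa> y) (D\<kappa> y (CR_im j y))) = 0"
  proof -
   assume *: "\<And>i. DZ i (\<kappa> y) ?u + \<i> * DZ i (\<kappa> y) (D\<kappa> y (CR_im j y)) = 0"
   have "(\<Sum>i\<in>UNIV. ?c i * DZ i (\<kappa> y) ?u) + \<i> * (\<Sum>i\<in>UNIV. ?c i * DZ i (\<kappa> y) (D\<kappa> y (CR_im j y)))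
     = (\<Sum>i\<in>UNIV. ?c i * (DZ i (\<kappa> y) ?u + \<i> * DZ i (\<kappa> y) (D\<kappa> y (CR_im j y))))"
    by (simp add: sum_distrib_left sum.distrib distrib_left mult.left_commute)
   then show ?thesis unfolding * by simp
  qed
  have "A (CR_re j y) + \<i> * A (CR_im j y)
   = (\<omega> (\<kappa> y) ?u + \<i> * \<omega> (\<kappa> y) (D\<kappa> y (CR_im j y)))
   - ((\<Sum>i\<in>UNIV. ?c i * DZ i (\<kappa> y) ?u) + \<i> * (\<Sum>i\<in>UNIV. ?c i * DZ i (\<kappa> y) (D\<kappa> y (CR_im j y))))"
   unfolding A_def by (simp only: right_diff_distrib) simp
  then have "A (CR_re j y) + \<i> * A (CR_im j y) = 0" unfolding E1 E2 by simp
  moreover have "A (CR_re j y) + \<i> * A (CR_im j y) = (\<Sum>k\<in>UNIV. CRY j y $ k * A (axis k 1))"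
   unfolding CR_re_def CR_im_def by (rule complexified_linear[OF lA])
  ultimately show ?thesis unfolding sum_CR_field by (simp add: As Ax)
 qed
 have "A (axis k 1) = 0" for k
 proof -
  obtain t where t: "k = e t" using inv_e(2) by metis
  consider "t = None" | l where "t = Some (l, False)" | l where "t = Some (l, True)"
   by (metis (full_types) not_None_eq surj_pair)
  then show ?thesis unfolding t by cases (simp_all add: As Ax Ay)
 qed
 then have "A u = 0" for u by (subst linear_axis_expansion[OF lA]) simp
 moreover obtain u where "v = D\<kappa> y u" using v tangent_\<kappa>[OF y] by blast
 ultimately show ?thesis by (simp add: A_def)
qed

lemma independent_DZ:
 assumes y: "y \<in> D" and 0: "\<And>v. (\<Sum>i\<in>UNIV. c i * DZ i (\<kappa> y) (D\<kappa> y v)) = 0"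
 shows "c i = 0"
proof -
 have yS: "to_model y \<in> S" using y by simp
 have n: "c None = 0"
  using 0[of "axis (e None) 1"] graph_ds_nonzero(1)[OF yS] unfolding sum_Zg[OF y] to_model_axis by (simp add: Dh_s)
 have "c (Some l) = 0" for l
 proof -
  have "(\<Sum>k\<in>UNIV. c (Some k) * axis l 1 $ k) = c (Some l)"
   by (simp add: axis_def if_distrib[of "\<lambda>x. _ * x"] cong: if_cong)
  then show ?thesis using 0[of "axis (e (Some (l, False))) 1"] n unfolding sum_Zg[OF y] to_model_axis by simp
 qed
 then show ?thesis using n by (cases i) auto
qed

lemma smooth_coefficient:
 assumes U: "open U" and w: "\<omega> \<in> holomorphic_forms (M \<inter> U)"
 shows "smooth_on (D \<inter> \<kappa> -` U) (coefficient \<omega> i)"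
proof -
 note p = parametrization_preimage[OF parametrization_\<kappa> U]
 have f: "smooth_form (M \<inter> U) \<omega>" using w by (simp add: holomorphic_forms_def)
 note s = smooth_on_pulled_back_form[OF p(2) f]
 have sub: "smooth_on (D \<inter> \<kappa> -` U) (\<lambda>y. F (to_model y))" if "smooth_on S F" for F :: "_ => complex"
  by (rule smooth_on_subset[OF smooth_on_to_model[OF S that]]) auto
 have c: "smooth_on (D \<inter> \<kappa> -` U) (\<lambda>y. \<omega> (\<kappa> y) (D\<kappa> y (axis (e None) 1)) / (1 + \<i> * graph_ds m \<Phi> (to_model y)))"
  using graph_ds_nonzero(1) by (intro smooth_on_divide smooth_intros p(1) s sub smooth_on_graph_ds) auto
 show ?thesis
  unfolding coefficient_def[abs_def] Let_def
  by (cases i; simp only: option.case; intro smooth_on_diff smooth_on_mult smooth_on_const p(1) c s sub smooth_on_derivative[OF smooth_graph])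
qed

end

section \<open>Global forms and vector fields by cutoff\<close>

text \<open>The hypotheses speak of forms and vector fields on all of \<open>M\<close>.  The cutoff function \<open>\<eta>\<close> is supported in the closed set
\<open>C\<close>, and all statements are localized to the open set \<open>B\<close> where it is \<open>1\<close>.\<close>

locale cutoff_graph = graph_hypersurface e m \<Phi> S M W z w g
 for e :: "('n::finite \<times> bool) option => 'd::finite" and m \<Phi> S and M W :: "(complex^'N::finite) set" and z w g +
 fixes \<eta> :: "complex^'N => real" and C B :: "(complex^'N) set"
 assumes \<eta>: "smooth_on UNIV \<eta>" and C: "closed C" "C \<subseteq> W" "\<And>q. q \<notin> C ==> \<eta> q = 0"
  and B: "open B" "\<And>q. q \<in> B ==> \<eta> q = 1"
begin

lemma B_W: "B \<subseteq> W"
 using B(2) C(2,3) by fastforce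

lemma open_off_C: "open (- C)" using C(1) by (simp add: open_Compl)

lemma smooth_\<eta>: "smooth_on A (\<lambda>q. of_real (\<eta> q) :: complex)" if "open A" for A
 using that by (intro smooth_intros smooth_on_subset[OF \<eta>]) auto

definition cut_form :: "('n option => complex^'N => complex) => 'N cform"
 where "cut_form c q v = (if q \<in> M \<and> v \<in> tangent_space M q then of_real (\<eta> q) * (\<Sum>i\<in>UNIV. c i q * DZ i q v) else 0)"

lemma in_M_W: "q \<in> M ==> q \<in> W ==> \<exists>y\<in>D. q = \<kappa> y"
 using image_\<kappa> by blast

lemma tangent_linear: "q \<in> M ==> q \<in> W ==> u \<in> tangent_space M q ==> v \<in> tangent_space M q ==> a *\<^sub>R u + b *\<^sub>R v \<in> tangent_space M q"
proof -
 assume q: "q \<in> M" "q \<in> W" and uv: "u \<in> tangent_space M q" "v \<in> tangent_space M q"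
 obtain y where y: "y \<in> D" "q = \<kappa> y" using in_M_W[OF q] by blast
 obtain u' v' where "u = D\<kappa> y u'" "v = D\<kappa> y v'" using uv tangent_\<kappa>[OF y(1)] y(2) by blast
 then have "a *\<^sub>R u + b *\<^sub>R v = D\<kappa> y (a *\<^sub>R u' + b *\<^sub>R v')"
  using linear_D\<kappa>[OF y(1)] by (simp add: linear_add linear_scale)
 then show "a *\<^sub>R u + b *\<^sub>R v \<in> tangent_space M q" using tangent_\<kappa>[OF y(1)] y(2) by blast
qed

lemma cut_form_linear:
 assumes "q \<in> M" "u \<in> tangent_space M q" "v \<in> tangent_space M q"
 shows "cut_form c q (a *\<^sub>R u + b *\<^sub>R v) = of_real a * cut_form c q u + of_real b * cut_form c q v"
proof (cases "q \<in> W")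
 case True
 have "DZ i q (a *\<^sub>R u + b *\<^sub>R v) = of_real a * DZ i q u + of_real b * DZ i q v" for i
  unfolding linear_add[OF linear_DZ[OF True]] linear_scale[OF linear_DZ[OF True]] by (simp add: scaleR_conv_of_real)
 then have "(\<Sum>i\<in>UNIV. c i q * DZ i q (a *\<^sub>R u + b *\<^sub>R v)) = of_real a * (\<Sum>i\<in>UNIV. c i q * DZ i q u) + of_real b * (\<Sum>i\<in>UNIV. c i q * DZ i q v)"
  by (simp add: sum_distrib_left sum.distrib algebra_simps)
 then show ?thesis
  using tangent_linear[OF assms(1) True assms(2,3)] assms by (simp add: cut_form_def algebra_simps)
next
 case False
 then have "\<eta> q = 0" using C by blast
 then show ?thesis by (simp add: cut_form_def)
qed

lemma cut_form_J:
 assumes "u \<in> tangent_space M q" "\<i> *s u \<in> tangent_space M q"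
 shows "cut_form c q (\<i> *s u) = \<i> * cut_form c q u"
proof (cases "q \<in> W")
 case True
 then show ?thesis using assms by (simp add: cut_form_def DZ_J sum_distrib_left mult_ac)
next
 case False
 then have "\<eta> q = 0" using C by blast
 then show ?thesis by (simp add: cut_form_def)
qed

lemma cut_form_smooth:
 assumes c: "\<And>i. smooth_on W (c i)"
 shows "smooth_form M (cut_form c)"
 unfolding smooth_form_def
proof
 fix q assume q: "q \<in> M"
 show "\<exists>a. extends_form M (cut_form c) q a"
 proof (cases "q \<in> W")
  case True
  let ?a = "\<lambda>q v. of_real (\<eta> q) * (\<Sum>i\<in>UNIV. c i q * DZ i q v)"
  have "linear (?a x)" if x: "x \<in> W" for x
  proof (rule linearI)
   show "?a x (u + v) = ?a x u + ?a x v" for u v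
    using linear_add[OF linear_DZ[OF x]] by (simp add: sum.distrib distrib_left)
   show "?a x (r *\<^sub>R u) = r *\<^sub>R ?a x u" for r u
    unfolding linear_scale[OF linear_DZ[OF x]] by (simp add: scaleR_conv_of_real sum_distrib_left mult_ac)
  qed
  moreover have "smooth_on W (\<lambda>x. ?a x v)" for v
   by (intro smooth_on_mult smooth_on_sum smooth_\<eta> W c smooth_on_derivative[OF smooth_Z])
  ultimately have "extends_form M (cut_form c) q ?a"
   unfolding extends_form_def using True W by (intro exI[of _ W]) (auto simp: cut_form_def)
  then show ?thesis by blast
 next
  case False
  then have "q \<in> - C" using C by blast
  moreover have "linear (\<lambda>v :: complex^'N. 0 :: complex)" by (rule linearI) simp_all
  ultimately have "extends_form M (cut_form c) q (\<lambda>q v. 0)"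
   unfolding extends_form_def using open_off_C C(3)
   by (intro exI[of _ "- C"]) (auto simp: cut_form_def smooth_on_const)
  then show ?thesis by blast
 qed
qed

lemma cut_form_cotangent:
 assumes q: "q \<in> M"
 shows "cut_form c q \<in> holomorphic_cotangent M q"
 unfolding holomorphic_cotangent_def complex_cotangent_def mem_Collect_eq
proof (intro conjI allI impI ballI)
 show "cut_form c q v = 0" if "v \<notin> tangent_space M q" for v using that by (simp add: cut_form_def)
 show "cut_form c q (a *\<^sub>R u + b *\<^sub>R v) = of_real a * cut_form c q u + of_real b * cut_form c q v"
  if "u \<in> tangent_space M q" "v \<in> tangent_space M q" for u v a b by (rule cut_form_linear[OF q that])
 show "covector_apply (cut_form c q) L = 0" if "L \<in> CR_bundle M q" for L
 proof -
  obtain u where u: "L = (u, \<i> *s u)" "u \<in> tangent_space M q" "\<i> *s u \<in> tangent_space M q"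
   using \<open>L \<in> _\<close> by (auto simp: CR_bundle_def antiholomorphic_vectors_def)
  then show ?thesis by (simp add: covector_apply_def cut_form_J)
 qed
qed

lemma cut_form_holomorphic: "(\<And>i. smooth_on W (c i)) ==> cut_form c \<in> holomorphic_forms M"
 using cut_form_smooth cut_form_cotangent by (simp add: holomorphic_forms_def)

definition dZ :: "'n option => 'N cform" where "dZ i = cut_form (\<lambda>j q. if j = i then 1 else 0)"

lemma dZ_holomorphic: "dZ i \<in> holomorphic_forms M"
 unfolding dZ_def by (rule cut_form_holomorphic) (rule smooth_on_const)

lemma dZ_eq: "v \<in> tangent_space M q ==> q \<in> M ==> dZ i q v = of_real (\<eta> q) * DZ i q v"
 by (simp add: dZ_def cut_form_def if_distrib[of "\<lambda>x. x * _"] cong: if_cong)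

abbreviation "D' \<equiv> D \<inter> \<kappa> -` B"

lemma D': "open D'" "parametrization (M \<inter> B) D' \<kappa>" "parametrization M D' \<kappa>"
 using parametrization_preimage[OF parametrization_\<kappa> B(1)] parametrization_Int_iff[OF B(1)] by auto

lemma tangent_D: "D\<kappa> y v \<in> tangent_space M (\<kappa> y)" if "y \<in> D" for y v
 using tangent_\<kappa>[OF that] by blast

text \<open>In the chart the form is the differential of a function.\<close>

lemma exterior_derivative_dZ:
 assumes y: "y \<in> D'"
 shows "exterior_derivative M (dZ i) (\<kappa> y) (D\<kappa> y u) (D\<kappa> y v) = 0"
proof -
 have f: "smooth_form M (dZ i)" using dZ_holomorphic by (simp add: holomorphic_forms_def)
 let ?F = "\<lambda>y. Zg i (to_model y)"
 have "dZ i (\<kappa> x) (D\<kappa> x v) = fderiv ?F x v" if "x \<in> D'" for x v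
  using that dZ_eq[OF tangent_D \<kappa>_in(1), of x i] B(2) by (simp add: DZ_\<kappa>(2))
 then have "fderiv (\<lambda>x. dZ i (\<kappa> x) (D\<kappa> x v)) y = fderiv (\<lambda>x. fderiv ?F x v) y" for v
  by (rule frechet_derivative_cong_open[OF D'(1) y])
 moreover have "smooth_on D' ?F" by (rule smooth_on_subset[OF smooth_on_to_model[OF S smooth_Zg]]) auto
 ultimately show ?thesis
  unfolding exterior_derivative_parametrization[OF D'(3) y f]
  using second_derivative_symmetric[OF D'(1) y, where u = u and v = v and f = ?F] by simp
qed

lemma Lie_derivative_dZ:
 assumes L: "L \<in> CR_vector_fields M" and q: "q \<in> B"
 shows "Lie_derivative M L (dZ i) q v = 0"
proof (cases "q \<in> M \<and> v \<in> tangent_space M q")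
 case True
 then obtain y where y: "y \<in> D" "q = \<kappa> y" using in_M_W B_W q by blast
 then have y': "y \<in> D'" using q by simp
 have "L q \<in> CR_bundle M q" using L True by (simp add: CR_vector_fields_def)
 then have "fst (L q) \<in> tangent_space M q" "snd (L q) \<in> tangent_space M q" by (auto simp: CR_bundle_def)
 then obtain a b c where "fst (L q) = D\<kappa> y a" "snd (L q) = D\<kappa> y b" "v = D\<kappa> y c"
  using True tangent_\<kappa>[OF y(1)] y(2) by blast
 then show ?thesis using exterior_derivative_dZ[OF y'] y(2) by (simp add: Lie_derivative_def)
qed (auto simp: Lie_derivative_def)

definition cut_CR :: "'n => complex^'N => (complex^'N) \<times> (complex^'N)"
 where "cut_CR j q = (if q \<in> W then (\<eta> q *\<^sub>R D\<kappa> (\<pi> q) (CR_re j (\<pi> q)), \<eta> q *\<^sub>R D\<kappa> (\<pi> q) (CR_im j (\<pi> q))) else (0, 0))"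

lemma smooth_CRY: "smooth_on D (\<lambda>y. CRY j y $ i)"
 by (intro smooth_on_CR_field smooth_intros S smooth_on_CR_coefficient)

lemma smooth_CR_parts: "smooth_on D (CR_re j)" "smooth_on D (CR_im j)"
 unfolding CR_re_def[abs_def] CR_im_def[abs_def]
 by (intro smooth_on_vec_lambda open_D smooth_on_Re smooth_on_Im smooth_CRY)+

lemma cut_CR_field: "cut_CR j \<in> CR_vector_fields M"
 unfolding CR_vector_fields_def mem_Collect_eq
proof (intro conjI ballI)
 show "smooth_on_submanifold M (cut_CR j)"
  unfolding smooth_on_submanifold_def
 proof
  fix q assume "q \<in> M"
  show "\<exists>U h. open U \<and> q \<in> U \<and> smooth_on U h \<and> (\<forall>x\<in>M \<inter> U. cut_CR j x = h x)"
  proof (cases "q \<in> W")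
   case True
   have im: "\<pi> ` W \<subseteq> D" using \<pi>_in by blast
   have sx: "smooth_on W \<eta>" by (rule smooth_on_subset[OF \<eta>]) simp
   have "smooth_on W (\<lambda>q. (\<eta> q *\<^sub>R D\<kappa> (\<pi> q) (CR_re j (\<pi> q)), \<eta> q *\<^sub>R D\<kappa> (\<pi> q) (CR_im j (\<pi> q))))"
    by (intro smooth_on_Pair smooth_on_scaleR W sx smooth_on_derivative_apply[OF W open_D smooth_\<kappa> smooth_\<pi> im]
      smooth_on_compose[OF W open_D smooth_\<pi> _ im] smooth_CR_parts)
   then show ?thesis using True W by (intro exI[of _ W]) (auto simp: cut_CR_def)
  next
   case False
   then have "q \<in> - C" using C by blast
   then show ?thesis
    using open_off_C C(3) by (intro exI[of _ "- C"] exI[of _ "\<lambda>q. (0, 0)"]) (auto simp: cut_CR_def smooth_on_const)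
  qed
 qed
 fix q assume q: "q \<in> M"
 have z: "0 \<in> tangent_space M q"
  unfolding tangent_space_def using q
  by (auto intro!: exI[of _ "1::real"] exI[of _ "\<lambda>t. q"] smooth_on_const)
 show "cut_CR j q \<in> CR_bundle M q"
 proof (cases "q \<in> W")
  case True
  then obtain y where y: "y \<in> D" "q = \<kappa> y" using in_M_W q by blast
  have s: "\<eta> q *\<^sub>R D\<kappa> y v = D\<kappa> y (\<eta> q *\<^sub>R v)" for v using linear_scale[OF linear_D\<kappa>[OF y(1)]] by simp
  have J: "\<eta> q *\<^sub>R D\<kappa> y (CR_im j y) = \<i> *s (\<eta> q *\<^sub>R D\<kappa> y (CR_re j y))"
   unfolding CR_im_J[OF y(1)] by (simp add: vec_eq_iff)
  have "cut_CR j q = (\<eta> q *\<^sub>R D\<kappa> y (CR_re j y), \<eta> q *\<^sub>R D\<kappa> y (CR_im j y))"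
   using True y by (simp add: cut_CR_def \<pi>_\<kappa>)
  moreover have t: "\<eta> q *\<^sub>R D\<kappa> y v \<in> tangent_space M q" for v unfolding s using tangent_D[OF y(1)] y(2) by blast
  moreover have "(a, b) \<in> CR_bundle M q" if "a \<in> tangent_space M q" "b \<in> tangent_space M q" "b = \<i> *s a" for a b
   using that by (simp add: CR_bundle_def antiholomorphic_vectors_def)
  ultimately show ?thesis using J by metis
 next
  case False
  then show ?thesis using z by (simp add: cut_CR_def CR_bundle_def antiholomorphic_vectors_def vec_eq_iff)
 qed
qed

lemma chart_vector_field_cut_CR:
 assumes y: "y \<in> D'"
 shows "chart_vector_field \<kappa> (cut_CR j) y = CRY j y"
proof -
 have i: "inv (D\<kappa> y) (D\<kappa> y v) = v" for v
  by (rule inv_f_f[OF parametrization_linear(2)[OF parametrization_\<kappa>]]) (use y in simp)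
 have "\<kappa> y \<in> W" "\<eta> (\<kappa> y) = 1" "\<pi> (\<kappa> y) = y" using y \<kappa>_in(2)[of y] B(2) \<pi>_\<kappa>[of y] by auto
 then have "chart_vector_field \<kappa> (cut_CR j) y = vec_lambda (\<lambda>k. Complex (CR_re j y $ k) (CR_im j y $ k))"
  by (simp add: chart_vector_field_def cut_CR_def Let_def i)
 then show ?thesis by (simp add: CR_re_def CR_im_def vec_eq_iff)
qed

definition \<theta> :: "'N cform"
 where "\<theta> = cut_form (\<lambda>i q. case i of None => 1 - \<i> * graph_ds m \<Phi> (z q, Re (w q))
  | Some l => - 2 * \<i> * dz l graph (z q, Re (w q)))"

lemma \<theta>_holomorphic: "\<theta> \<in> holomorphic_forms M"
 unfolding \<theta>_def
proof (rule cut_form_holomorphic)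
 fix i
 have s: "smooth_on W (\<lambda>q. F (z q, Re (w q)))" if "smooth_on S F" for F :: "_ => complex"
  by (rule smooth_on_compose[OF W S smooth_model that]) (use inS in auto)
 show "smooth_on W (\<lambda>q. case i of None => 1 - \<i> * graph_ds m \<Phi> (z q, Re (w q)) | Some l => - 2 * \<i> * dz l graph (z q, Re (w q)))"
  by (cases i; simp only: option.case; intro smooth_on_diff smooth_on_mult smooth_on_const W s smooth_on_graph_ds smooth_on_Wirtinger(1)[OF S smooth_graph])
qed

text \<open>The differential of a real function is twice the real part of its \<open>(1,0)\<close>-part in \<open>z\<close>.\<close>

lemma Dh_expansion:
 assumes x: "x \<in> S"
 shows "Dh x v = graph_ds m \<Phi> x * of_real (snd v) + 2 * of_real (Re (\<Sum>l\<in>UNIV. dz l graph x * fst v $ l))"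
proof -
 have lin: "linear (Dh x)" by (rule linear_Dh[OF x])
 have "linear (\<lambda>u. Dh x (to_model u))" using linear_compose[OF linear_to_model lin] by (simp add: o_def)
 from linear_axis_expansion[OF this, of "of_model v"]
 have "Dh x v = (\<Sum>i\<in>UNIV. of_real (of_model v $ i) * Dh x (to_model (axis i 1)))" by simp
 also have "\<dots> = (\<Sum>t\<in>UNIV. of_real (of_model v $ e t) * Dh x (to_model (axis (e t) 1)))"
  by (rule sum.reindex_bij_betw[OF bij, symmetric])
 also have "\<dots> = of_real (snd v) * Dh x (0, 1)
   + (\<Sum>l\<in>UNIV. of_real (Re (fst v $ l)) * Dh x (axis l 1, 0) + of_real (Im (fst v $ l)) * Dh x (axis l \<i>, 0))"
 proof -
  have U: "(UNIV :: ('n \<times> bool) option set) = insert None (Some ` (UNIV \<times> UNIV))"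
   by (auto simp: UNIV_option_conv)
  have c: "(\<Sum>x\<in>UNIV. F x) = (\<Sum>l\<in>UNIV. F (l, False) + F (l, True))" for F :: "'n \<times> bool => complex"
   using sum.cartesian_product[of "\<lambda>l b. F (l, b)" UNIV UNIV, unfolded UNIV_Times_UNIV] by (simp add: UNIV_bool add.commute)
  show ?thesis
   unfolding U by (subst sum.insert) (auto simp: sum.reindex c to_model_axis of_model_def)
 qed
 also have "(\<Sum>l\<in>UNIV. of_real (Re (fst v $ l)) * Dh x (axis l 1, 0) + of_real (Im (fst v $ l)) * Dh x (axis l \<i>, 0))
   = (\<Sum>l\<in>UNIV. 2 * of_real (Re (dz l graph x * fst v $ l)))"
 proof (rule sum.cong[OF refl])
  fix l
  obtain a b where ab: "Dh x (axis l 1, 0) = of_real a" "Dh x (axis l \<i>, 0) = of_real b"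
   using Dh_real[OF x] by (metis Reals_cases)
  show "of_real (Re (fst v $ l)) * Dh x (axis l 1, 0) + of_real (Im (fst v $ l)) * Dh x (axis l \<i>, 0)
    = (2 * of_real (Re (dz l graph x * fst v $ l)) :: complex)"
   unfolding dz_def ab by (simp add: complex_eq_iff)
 qed
 finally show ?thesis by (simp add: Dh_s sum_distrib_left Re_sum)
qed

text \<open>On a tangent vector with \<open>s\<close>-component \<open>v\<close> and \<open>T = \<Sum> h\<^sub>z dz\<close>, the value is \<open>(1 - \<i> h\<^sub>s) (v + \<i> (h\<^sub>s v + 2 Re T)) - 2 \<i> T\<close>,
whose imaginary part cancels.\<close>

lemma \<theta>_real:
 assumes q: "q \<in> M"
 shows "\<theta> q v \<in> \<real>"
proof (cases "q \<in> W \<and> v \<in> tangent_space M q")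
 case True
 then obtain y where y: "y \<in> D" "q = \<kappa> y" using in_M_W q by blast
 then obtain u where u: "v = D\<kappa> y u" using tangent_\<kappa>[OF y(1)] True by blast
 let ?x = "to_model y" and ?v = "to_model u"
 let ?h = "graph_ds m \<Phi> ?x" and ?T = "\<Sum>l\<in>UNIV. dz l graph ?x * fst ?v $ l"
 have x: "?x \<in> S" using y by simp
 define T where "T = ?T"
 obtain h where h: "?h = of_real h" using graph_ds_real[OF x] by (rule Reals_cases)
 have "(\<Sum>l\<in>UNIV. - 2 * \<i> * dz l graph ?x * fst ?v $ l) = - 2 * \<i> * ?T"
  unfolding sum_distrib_left by (simp add: mult_ac)
 then have "\<theta> q v = of_real (\<eta> q) * ((1 - \<i> * ?h) * (of_real (snd ?v) + \<i> * Dh ?x ?v) - 2 * \<i> * T)"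
  using q True unfolding \<theta>_def cut_form_def y(2) u sum_Zg[OF y(1)] model_\<kappa>[OF y(1)] T_def by simp
 also have "(1 - \<i> * ?h) * (of_real (snd ?v) + \<i> * Dh ?x ?v) - 2 * \<i> * T
   = of_real (snd ?v * (1 + h * h) + 2 * h * Re T + 2 * Im T)"
  unfolding Dh_expansion[OF x] h T_def[symmetric] by (rule complex_eqI) (simp_all add: algebra_simps)
 finally show ?thesis by (metis Reals_mult Reals_of_real)
next
 case False
 then have "\<theta> q v = 0" using C by (auto simp: \<theta>_def cut_form_def)
 then show ?thesis by simp
qed

text \<open>A real form that is complex linear on the complex tangent space vanishes there.\<close>

lemma \<theta>_characteristic: "\<theta> \<in> characteristic_forms M"
 unfolding characteristic_forms_def mem_Collect_eq
proof (intro conjI ballI)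
 show "smooth_form M \<theta>" using \<theta>_holomorphic by (simp add: holomorphic_forms_def)
 fix q assume q: "q \<in> M"
 have hc: "\<theta> q \<in> holomorphic_cotangent M q" using \<theta>_holomorphic q by (simp add: holomorphic_forms_def)
 show "\<theta> q \<in> characteristic_cotangent M q"
  unfolding characteristic_cotangent_def real_cotangent_def mem_Collect_eq
 proof (intro conjI ballI allI)
  show "\<theta> q \<in> complex_cotangent M q" using hc by (simp add: holomorphic_cotangent_def)
  show "\<theta> q v \<in> \<real>" for v by (rule \<theta>_real[OF q])
  fix L assume "L \<in> CR_bundle M q \<union> CR_bundle_conj M q"
  then obtain u where u: "L = (u, \<i> *s u) \<or> L = (u, - (\<i> *s u))" "u \<in> tangent_space M q" "\<i> *s u \<in> tangent_space M q"
   by (auto simp: CR_bundle_conj_def CR_bundle_def antiholomorphic_vectors_def)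
  have J: "\<theta> q (\<i> *s u) = \<i> * \<theta> q u" unfolding \<theta>_def by (rule cut_form_J[OF u(2,3)])
  have "\<i> * \<theta> q u \<in> \<real>" "\<theta> q u \<in> \<real>" using \<theta>_real[OF q, of "\<i> *s u"] \<theta>_real[OF q, of u] unfolding J by auto
  then have 0: "\<theta> q u = 0" by (auto simp: complex_is_Real_iff complex_eq_iff)
  have "\<theta> q (- (\<i> *s u)) = - \<theta> q (\<i> *s u)"
   using cut_form_linear[OF q u(3) u(3), of _ "-1" 0] unfolding \<theta>_def by simp
  then show "covector_apply (\<theta> q) L = 0" using u(1) J 0 by (auto simp: covector_apply_def)
 qed
qed

lemma \<theta>_chart:
 assumes y: "y \<in> D'" and v: "v \<in> tangent_space M (\<kappa> y)"
 shows "\<theta> (\<kappa> y) v = (1 - \<i> * graph_ds m \<Phi> (to_model y)) * dZ None (\<kappa> y) v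
  + (\<Sum>l\<in>UNIV. - 2 * \<i> * of_real (snd (to_model y)) ^ m * dz l \<Phi> (to_model y) * dZ (Some l) (\<kappa> y) v)"
proof -
 have yD: "y \<in> D" and c: "\<eta> (\<kappa> y) = 1" using y B(2) by auto
 have "dz l graph (to_model y) = of_real (snd (to_model y)) ^ m * dz l \<Phi> (to_model y)" for l
  unfolding graph_eq using Wirtinger_mult(1)[OF smooth_on_real_coordinate[OF S] \<Phi>, of "to_model y"] yD by (simp add: Wirtinger_real_coordinate)
 then show ?thesis
  using v \<kappa>_in(1)[OF yD] unfolding \<theta>_def cut_form_def sum_option dZ_eq[OF v \<kappa>_in(1)[OF yD]] model_\<kappa>[OF yD] c
  by (simp add: mult.assoc)
qed

lemma local_basis_dZ:
 assumes \<sigma>: "bij \<sigma>" and U: "open U" "U \<subseteq> B"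
 shows "local_basis (M \<inter> U) (\<lambda>j. dZ (\<sigma> j))"
 unfolding local_basis_def
proof (intro conjI allI ballI impI)
 show "dZ (\<sigma> j) \<in> holomorphic_forms (M \<inter> U)" for j by (rule holomorphic_forms_Int[OF U(1) dZ_holomorphic])
 fix q assume q: "q \<in> M \<inter> U"
 then obtain y where y: "y \<in> D" "q = \<kappa> y" using in_M_W B_W U by blast
 have c: "\<eta> q = 1" using q U B by blast
 have re: "(\<Sum>j\<in>UNIV. F (\<sigma> j)) = (\<Sum>i\<in>UNIV. F i)" for F :: "'n option => complex"
  by (rule sum.reindex_bij_betw[OF \<sigma>])
 have d: "dZ i q v = DZ i q v" if "v \<in> tangent_space M q" for i v using dZ_eq[OF that] q c by simp
 show "a j = 0" if a: "\<forall>v. (\<Sum>j\<in>UNIV. a j * dZ (\<sigma> j) q v) = 0" for a j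
 proof -
  let ?a = "\<lambda>i. a (inv \<sigma> i)"
  have "(\<Sum>i\<in>UNIV. ?a i * DZ i (\<kappa> y) (D\<kappa> y v)) = 0" for v
  proof -
   have t: "D\<kappa> y v \<in> tangent_space M q" using tangent_D[OF y(1)] y(2) by simp
   have "(\<Sum>i\<in>UNIV. ?a i * DZ i (\<kappa> y) (D\<kappa> y v)) = (\<Sum>j\<in>UNIV. ?a (\<sigma> j) * DZ (\<sigma> j) q (D\<kappa> y v))"
    unfolding y(2) by (rule re[symmetric])
   also have "\<dots> = 0" using a[rule_format, of "D\<kappa> y v", unfolded d[OF t]] \<sigma> by (simp add: bij_is_inj inv_f_f)
   finally show ?thesis .
  qed
  from independent_DZ[OF y(1) this, of "\<sigma> j"] show ?thesis using \<sigma> by (simp add: bij_is_inj inv_f_f)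
 qed
 fix \<xi> assume "\<xi> \<in> holomorphic_cotangent (M \<inter> U) q"
 then have x: "\<xi> \<in> holomorphic_cotangent M q" using holomorphic_cotangent_Int[OF U(1)] q by auto
 let ?c = "\<lambda>i. coefficient (\<lambda>_. \<xi>) i y"
 have "\<xi> v = (\<Sum>j\<in>UNIV. ?c (\<sigma> j) * dZ (\<sigma> j) q v)" for v
 proof (cases "v \<in> tangent_space M q")
  case True
  then have "\<xi> v = (\<Sum>i\<in>UNIV. ?c i * DZ i q v)"
   using holomorphic_covector_expansion[OF y(1), of "\<lambda>_. \<xi>" v] x y(2) by simp
  then show ?thesis using d[OF True] re[of "\<lambda>i. ?c i * DZ i q v"] by simp
 next
  case False
  have "\<xi> v = 0" using x False by (simp add: holomorphic_cotangent_def complex_cotangent_def)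
  then show ?thesis using False by (simp add: dZ_def cut_form_def)
 qed
 then show "\<exists>a. \<forall>v. \<xi> v = (\<Sum>j\<in>UNIV. a j * dZ (\<sigma> j) q v)" by (intro exI[of _ "\<lambda>j. ?c (\<sigma> j)"]) simp
qed

end

section \<open>Pairings as distributions\<close>

lemma form_times_density_linear:
 "form_times_density \<omega> (\<lambda>q A. a * \<mu> q A + b * \<nu> q A)
  = (\<lambda>q A v. a * form_times_density \<omega> \<mu> q A v + b * form_times_density \<omega> \<nu> q A v)"
 by (simp add: form_times_density_def fun_eq_iff algebra_simps)

lemma distributional_section_zero:
 fixes X :: "('N::finite, 'd::finite) form_density => complex" and \<sigma> :: "('N, 'd) form_density"
 assumes "distributional_section S X" "\<sigma> \<in> test_sections S"
 shows "X (\<lambda>q A v. 0) = 0"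
 using distributional_section_linear[OF assms(1) assms(2) assms(2), of 0 0] by simp

lemma pairing_scalar_distribution:
 assumes X: "distributional_section M X" and w: "\<omega> \<in> holomorphic_forms M" and U: "open U"
 shows "scalar_distribution (M \<inter> U) (pairing \<omega> X)"
 unfolding scalar_distribution_def
proof (intro conjI ballI allI impI)
 fix \<mu> \<nu> :: "('a, 'b) density" and a b
 assume "\<mu> \<in> test_densities (M \<inter> U)" "\<nu> \<in> test_densities (M \<inter> U)"
 then have "\<mu> \<in> test_densities M" "\<nu> \<in> test_densities M" using test_densities_Int[OF U] by blast+
 then show "pairing \<omega> X (\<lambda>q A. a * \<mu> q A + b * \<nu> q A) = a * pairing \<omega> X \<mu> + b * pairing \<omega> X \<nu>"
  unfolding pairing_def form_times_density_linear
  by (intro distributional_section_linear[OF X] form_times_density_test[OF w])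
next
 fix \<Omega> and \<kappa> :: "real^'b => complex^'a" assume "parametrization (M \<inter> U) \<Omega> \<kappa>"
 then have p: "parametrization M \<Omega> \<kappa>" by (simp add: parametrization_Int_iff[OF U])
 obtain T and g :: "complex^'a => real^'b" where T: "open T" "\<kappa> ` \<Omega> = M \<inter> T"
  by (rule parametrizationE[OF p]) (rule that)
 have "\<omega> \<in> holomorphic_forms (\<kappa> ` \<Omega>)" unfolding T(2) by (rule holomorphic_forms_Int[OF T(1) w])
 then show "distribution \<Omega> (local_distribution \<Omega> \<kappa> (pairing \<omega> X))"
  using X p unfolding distributional_section_def by blast
qed

text \<open>The Fourier transform of a real distribution at \<open>-\<eta>\<close> is the complex conjugate of that at \<open>\<eta>\<close>.\<close>

lemma wavefront_symmetric:
 assumes T: "\<And>\<psi>. \<psi> \<in> test_functions \<Omega> ==> T \<psi> = cnj (T (\<lambda>y. cnj (\<psi> y)))"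
  and wf: "(x, \<xi>) \<in> wavefront_set_on \<Omega> T"
 shows "(x, - \<xi>) \<in> wavefront_set_on \<Omega> T"
proof (rule ccontr)
 assume "(x, - \<xi>) \<notin> wavefront_set_on \<Omega> T"
 moreover have x: "x \<in> \<Omega>" "\<xi> \<noteq> 0" using wf by (auto simp: wavefront_set_on_def)
 ultimately obtain \<phi> V where p: "\<phi> \<in> test_functions \<Omega>" "\<phi> x \<noteq> 0" and V: "open V" "- \<xi> \<in> V" "\<forall>\<eta>\<in>V. \<forall>t>0. t *\<^sub>R \<eta> \<in> V"
  and dec: "\<forall>r::nat. \<exists>C. \<forall>\<eta>\<in>V. norm (T (\<lambda>y. \<phi> y * cis (- (y \<bullet> \<eta>)))) \<le> C / (1 + norm \<eta>) ^ r"
  by (auto simp: wavefront_set_on_def)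
 have n1: "open (uminus ` V)" using V(1) open_negations by blast
 have n2: "\<xi> \<in> uminus ` V" using V(2) by force
 have n3: "\<forall>\<eta>\<in>uminus ` V. \<forall>t>0. t *\<^sub>R \<eta> \<in> uminus ` V" using V(3) by (auto intro!: image_eqI)
 have n4: "\<forall>r::nat. \<exists>C. \<forall>\<eta>\<in>uminus ` V. norm (T (\<lambda>y. cnj (\<phi> y) * cis (- (y \<bullet> \<eta>)))) \<le> C / (1 + norm \<eta>) ^ r"
 proof
  fix r :: nat
  obtain C where C: "\<And>\<eta>. \<eta> \<in> V ==> norm (T (\<lambda>y. \<phi> y * cis (- (y \<bullet> \<eta>)))) \<le> C / (1 + norm \<eta>) ^ r" using dec by blast
  have "norm (T (\<lambda>y. cnj (\<phi> y) * cis (y \<bullet> \<eta>))) \<le> C / (1 + norm \<eta>) ^ r" if "\<eta> \<in> V" for \<eta>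
  proof -
   have "T (\<lambda>y. \<phi> y * cis (- (y \<bullet> \<eta>))) = cnj (T (\<lambda>y. cnj (\<phi> y * cis (- (y \<bullet> \<eta>)))))"
    by (rule T) (rule test_functions_mult_cis[OF p(1)])
   also have "(\<lambda>y. cnj (\<phi> y * cis (- (y \<bullet> \<eta>)))) = (\<lambda>y. cnj (\<phi> y) * cis (y \<bullet> \<eta>))" by (simp add: cis_cnj fun_eq_iff)
   finally show ?thesis using C[OF that] by simp
  qed
  then show "\<exists>C. \<forall>\<eta>\<in>uminus ` V. norm (T (\<lambda>y. cnj (\<phi> y) * cis (- (y \<bullet> \<eta>)))) \<le> C / (1 + norm \<eta>) ^ r" by auto
 qed
 have n5: "(\<lambda>y. cnj (\<phi> y)) \<in> test_functions \<Omega>" "cnj (\<phi> x) \<noteq> 0" using p by (simp_all add: test_functions_cnj)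
 have "(x, \<xi>) \<notin> wavefront_set_on \<Omega> T"
  unfolding wavefront_set_on_def mem_Collect_eq case_prod_conv de_Morgan_conj not_not
  by (rule disjI2, rule disjI2, rule bexI[OF _ n5(1)], intro conjI n5(2) exI[of _ "uminus ` V"] n1 n2 n3 n4)
 then show False using wf by blast
qed

text \<open>The midpoint of opposite covectors is \<open>0\<close>, which the convex cone \<open>\<Gamma>\<close> omits.\<close>

lemma microlocal_extension_no_opposite:
 assumes ext: "extends_microlocally S X" and w: "\<omega> \<in> holomorphic_forms S"
  and p: "parametrization S \<Omega> \<kappa>" and x: "x \<in> \<Omega>"
  and wf: "(x, \<xi>) \<in> wavefront_set_on \<Omega> (local_distribution \<Omega> \<kappa> (pairing \<omega> X))"
   "(x, - \<xi>) \<in> wavefront_set_on \<Omega> (local_distribution \<Omega> \<kappa> (pairing \<omega> X))"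
 shows False
proof -
 let ?D = "fderiv \<kappa> x" and ?q = "\<kappa> x"
 obtain \<Gamma> :: "complex^'a => (complex^'a => complex) set" where G:
  "\<forall>q\<in>S. closedin (top_of_set (characteristic_cotangent S q - {\<lambda>_. 0})) (\<Gamma> q) \<and>
     (\<forall>\<xi>\<in>\<Gamma> q. \<forall>t::real. t > 0 \<longrightarrow> (\<lambda>v. of_real t * \<xi> v) \<in> \<Gamma> q) \<and>
     (\<forall>\<xi>\<in>\<Gamma> q. \<forall>\<eta>\<in>\<Gamma> q. \<forall>s t :: real. s \<ge> 0 \<and> t \<ge> 0 \<and> s + t = 1 \<longrightarrow>
       (\<lambda>v. of_real s * \<xi> v + of_real t * \<eta> v) \<in> \<Gamma> q)"
  "\<forall>\<omega>\<in>holomorphic_forms S. wavefront_set S (pairing \<omega> X) \<subseteq> Sigma S \<Gamma>"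
  using ext unfolding extends_microlocally_def by (elim exE conjE) (rule that)
 note sub = bspec[OF G(2) w]
 have q: "?q \<in> S" using parametrization_image[OF p] x by blast
 note lD = parametrization_linear[OF p x] and tD = tangent_space_parametrization[OF p x]
 have iD: "inv ?D (?D v) = v" for v by (rule inv_f_f[OF lD(2)])
 define c where "c \<xi> v = (if v \<in> tangent_space S ?q then complex_of_real (\<xi> \<bullet> inv ?D v) else 0)" for \<xi> v
 have cD: "c \<xi> (?D v) = of_real (\<xi> \<bullet> v)" for \<xi> v using tD by (simp add: c_def iD)
 have rc: "c \<xi> \<in> real_cotangent S ?q" for \<xi>
  unfolding real_cotangent_def complex_cotangent_def mem_Collect_eq
 proof (intro conjI allI impI ballI)
  show "c \<xi> v = 0" if "v \<notin> tangent_space S ?q" for v using that by (simp add: c_def)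
  show "c \<xi> v \<in> \<real>" for v by (simp add: c_def)
  fix u v a b assume "u \<in> tangent_space S ?q" "v \<in> tangent_space S ?q"
  then obtain u' v' where uv: "u = ?D u'" "v = ?D v'" using tD by blast
  have "a *\<^sub>R u + b *\<^sub>R v = ?D (a *\<^sub>R u' + b *\<^sub>R v')" unfolding uv linear_add[OF lD(1)] linear_scale[OF lD(1)] ..
  then show "c \<xi> (a *\<^sub>R u + b *\<^sub>R v) = of_real a * c \<xi> u + of_real b * c \<xi> v"
   by (simp add: cD uv inner_add_right)
 qed
 note Gq = bspec[OF G(1) q]
 note cl = conjunct1[OF Gq] and cv = conjunct2[OF conjunct2[OF Gq], rule_format]
 have mem: "c \<xi> \<in> \<Gamma> ?q" if "(x, \<xi>) \<in> wavefront_set_on \<Omega> (local_distribution \<Omega> \<kappa> (pairing \<omega> X))" for \<xi>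
 proof -
  have "(\<chi> j. Re (c \<xi> (?D (axis j 1)))) = \<xi>" by (simp add: cD vec_eq_iff inner_axis)
  then have "(?q, c \<xi>) \<in> wavefront_set S (pairing \<omega> X)"
   unfolding wavefront_set_def using rc p x that by (auto intro!: exI[of _ \<Omega>] exI[of _ \<kappa>] exI[of _ x])
  then show ?thesis using sub by blast
 qed
 have "(\<lambda>v. of_real (1/2) * c \<xi> v + of_real (1/2) * c (- \<xi>) v) \<in> \<Gamma> ?q"
  by (rule cv[OF mem[OF wf(1)] mem[OF wf(2)]]) auto
 moreover have "(\<lambda>v. of_real (1/2) * c \<xi> v + of_real (1/2) * c (- \<xi>) v) = (\<lambda>_. 0)" by (simp add: c_def fun_eq_iff)
 ultimately have "(\<lambda>_. 0) \<in> \<Gamma> ?q" by simp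
 moreover have "\<Gamma> ?q \<subseteq> characteristic_cotangent S ?q - {\<lambda>_. 0}" using closedin_imp_subset[OF cl] .
 ultimately show False by blast
qed

section \<open>Smoothness of the infinitesimal CR diffeomorphism\<close>

locale infinitesimal_CR = cutoff_graph e m \<Phi> S M W z w g \<eta> C B
 for e :: "('n::finite \<times> bool) option => 'd::finite" and m \<Phi> S and M W :: "(complex^'N::finite) set" and z w g \<eta> C B +
 fixes X :: "('N, 'd) form_density => complex" and \<sigma> :: "'N => 'n option" and U\<^sub>0 :: "(complex^'N) set" and p :: "complex^'N" and k :: nat
 assumes CR: "infinitesimal_CR_diffeomorphism M X" and loc: "locally_integrable_section M X"
  and ext: "extends_microlocally (M \<inter> U\<^sub>0) X" and U\<^sub>0: "open U\<^sub>0" "B \<subseteq> U\<^sub>0"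
  and \<sigma>: "bij \<sigma>" and p: "p \<in> M" "p \<in> B" "z p = 0" "w p = 0"
  and vanishing: "vanish (Suc k) \<Phi>" and vanishing_dz: "\<And>l. dz l \<Phi> (0, 0) = 0"
  and span: "vec.span {(\<chi> j. dz j (foldr dzbar \<alpha> \<Phi>) (0, 0)) | \<alpha>. length \<alpha> \<le> k} = UNIV"
begin

lemma section_X: "distributional_section M X"
 using CR by (simp add: infinitesimal_CR_diffeomorphism_def)

lemma chart_D':
 assumes "open \<Omega>" "\<Omega> \<subseteq> D'"
 shows "chart_with_inverse M \<Omega> \<kappa> W \<pi>"
 by (rule chart_with_inverse.chart_with_inverse_subset[OF chart assms(1)]) (use assms(2) in blast)

text \<open>The distributions \<open>dZ(X)\<close> are the coefficients of \<open>X\<close> in the basis dual to the \<open>dZ\<close>, so local integrability of \<open>X\<close>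
applies to them.\<close>

lemma pairing_dZ_function: "\<exists>F. given_by_function (M \<inter> B) (pairing (dZ i) X) F"
proof -
 have "local_representation (M \<inter> B) (\<lambda>j. dZ (\<sigma> j)) X (\<lambda>j. pairing (dZ (\<sigma> j)) X)"
  unfolding local_representation_def
 proof (intro conjI allI impI)
  show "local_basis (M \<inter> B) (\<lambda>j. dZ (\<sigma> j))" by (rule local_basis_dZ[OF \<sigma> B(1) order_refl])
  show "scalar_distribution (M \<inter> B) (pairing (dZ (\<sigma> j)) X)" for j
   by (rule pairing_scalar_distribution[OF section_X dZ_holomorphic B(1)])
  fix \<mu> :: "'N => ('N, 'd) density" assume \<mu>: "\<forall>j. \<mu> j \<in> test_densities (M \<inter> B)"
  show "X (\<lambda>q A v. \<Sum>j\<in>UNIV. form_times_density (dZ (\<sigma> j)) (\<mu> j) q A v) = (\<Sum>j\<in>UNIV. pairing (dZ (\<sigma> j)) X (\<mu> j))"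
   unfolding pairing_def
   by (rule conjunct2[OF distributional_section_sum[OF section_X]])
    (use \<mu> in \<open>auto intro: form_times_density_test[OF dZ_holomorphic] test_densities_Int[OF B(1)]\<close>)
 qed
 then have "\<forall>j. \<exists>F. given_by_function (M \<inter> B) (pairing (dZ (\<sigma> j)) X) F"
  using loc B(1) unfolding locally_integrable_section_def by blast
 moreover obtain j where "i = \<sigma> j" using \<sigma> by (metis bij_pointE)
 ultimately show ?thesis by blast
qed

definition F :: "'n option => complex^'N => complex"
 where "F i = (SOME F. given_by_function (M \<inter> B) (pairing (dZ i) X) F)"

definition f :: "'n option => real^'d => complex" where "f i y = F i (\<kappa> y)"

lemma F: "given_by_function (M \<inter> B) (pairing (dZ i) X) (F i)"
 unfolding F_def by (rule someI_ex[OF pairing_dZ_function])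

lemma parametrization_D':
 assumes "open \<Omega>" "\<Omega> \<subseteq> D'"
 shows "parametrization (M \<inter> B) \<Omega> \<kappa>" "parametrization M \<Omega> \<kappa>"
 using parametrization_subset[OF D'(2) assms] parametrization_subset[OF D'(3) assms] .

lemma locally_integrable_f: "locally_integrable_on D' (f i)"
 using F[of i] D'(2) unfolding given_by_function_def locally_integrable_on_def f_def by blast

lemma pairing_dZ_chart:
 assumes O: "open \<Omega>" "\<Omega> \<subseteq> D'" and ph: "\<phi> \<in> test_functions \<Omega>"
 shows "local_distribution \<Omega> \<kappa> (pairing (dZ i) X) \<phi> = (LINT y|lebesgue. f i y * \<phi> y)"
proof -
 have "local_distribution \<Omega> \<kappa> (pairing (dZ i) X) \<phi> = (LINT y:\<Omega>|lebesgue. f i y * \<phi> y)"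
  using F[of i] parametrization_D'(1)[OF O] ph unfolding given_by_function_def f_def by blast
 then show ?thesis
  using locally_integrable_test(2)[OF locally_integrable_on_subset[OF locally_integrable_f O(2)] ph] by simp
qed

text \<open>\<open>X\<close> is linear over smooth functions.\<close>

lemma pairing_expansion:
 assumes O: "open \<Omega>" "\<Omega> \<subseteq> D'" and ph: "\<phi> \<in> test_functions \<Omega>"
  and c: "\<And>i. smooth_on \<Omega> (c i)"
  and w: "\<And>y v. y \<in> \<Omega> ==> v \<in> tangent_space M (\<kappa> y) ==> \<omega> (\<kappa> y) v = (\<Sum>i\<in>UNIV. c i y * dZ i (\<kappa> y) v)"
  and w0: "\<And>y v. y \<in> \<Omega> ==> v \<notin> tangent_space M (\<kappa> y) ==> \<omega> (\<kappa> y) v = 0"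
 shows "local_distribution \<Omega> \<kappa> (pairing \<omega> X) \<phi> = (LINT y|lebesgue. (\<Sum>i\<in>UNIV. f i y * c i y) * \<phi> y)"
proof -
 interpret ch: chart_with_inverse M \<Omega> \<kappa> W \<pi> by (rule chart_D'[OF O])
 have t: "(\<lambda>y. c i y * \<phi> y) \<in> test_functions \<Omega>" for i by (rule test_functions_mult[OF O(1) c ph])
 have "form_times_density \<omega> (chart_density \<Omega> \<kappa> \<phi>) q A v
   = (\<Sum>i\<in>UNIV. form_times_density (dZ i) (chart_density \<Omega> \<kappa> (\<lambda>y. c i y * \<phi> y)) q A v)" for q A v
 proof (cases "q \<in> \<kappa> ` \<Omega>")
  case True
  then obtain y where y: "y \<in> \<Omega>" "q = \<kappa> y" by blast
  have cd: "chart_density \<Omega> \<kappa> (\<lambda>y. c i y * \<phi> y) q A = c i y * chart_density \<Omega> \<kappa> \<phi> q A" for i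
   unfolding y(2) by (simp add: chart_density_def Let_def ch.inv_into_\<kappa>[OF y(1)])
  have wq: "\<omega> q v = (\<Sum>i\<in>UNIV. c i y * dZ i q v)"
  proof (cases "v \<in> tangent_space M q")
   case True
   then show ?thesis using w[OF y(1)] y(2) by simp
  next
   case False
   then show ?thesis using w0[OF y(1)] y(2) by (simp add: dZ_def cut_form_def)
  qed
  show ?thesis unfolding form_times_density_def cd wq sum_distrib_left by (simp only: mult_ac)
 next
  case False
  then show ?thesis by (simp add: form_times_density_def ch.chart_density_off(1))
 qed
 then have "local_distribution \<Omega> \<kappa> (pairing \<omega> X) \<phi>
   = X (\<lambda>q A v. \<Sum>i\<in>UNIV. form_times_density (dZ i) (chart_density \<Omega> \<kappa> (\<lambda>y. c i y * \<phi> y)) q A v)"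
  unfolding local_distribution_def pairing_def by presburger
 also have "\<dots> = (\<Sum>i\<in>UNIV. X (form_times_density (dZ i) (chart_density \<Omega> \<kappa> (\<lambda>y. c i y * \<phi> y))))"
  by (rule conjunct2[OF distributional_section_sum[OF section_X]])
   (auto intro: form_times_density_test[OF dZ_holomorphic] ch.chart_density_test[OF t])
 also have "\<dots> = (\<Sum>i\<in>UNIV. LINT y|lebesgue. f i y * (c i y * \<phi> y))"
  using pairing_dZ_chart[OF O t] by (simp add: local_distribution_def pairing_def)
 also have "\<dots> = (LINT y|lebesgue. (\<Sum>i\<in>UNIV. f i y * c i y) * \<phi> y)"
  unfolding sum_distrib_right mult.assoc
  by (rule Bochner_Integration.integral_sum[symmetric])
    (rule locally_integrable_test(1)[OF locally_integrable_on_subset[OF locally_integrable_f O(2)] t])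
 finally show ?thesis .
qed

text \<open>Where the cutoff is \<open>1\<close> the form \<open>dZ\<close> is closed, so its Lie derivative along the CR vector field vanishes.\<close>

lemma weak_CR:
 assumes ph: "\<phi> \<in> test_functions D'"
 shows "(LINT y|lebesgue. f i y * divergence_form (CRY j) \<phi> y) = 0"
proof -
 interpret ch: chart_with_inverse M D' \<kappa> W \<pi> by (rule chart_D'[OF D'(1) order_refl])
 let ?T = "local_distribution D' \<kappa> (pairing (dZ i) X)"
 have d: "divergence_form (CRY j) \<phi> \<in> test_functions D'"
  by (rule divergence_form_test(1)[OF D'(1) _ ph]) (rule smooth_on_subset[OF smooth_CRY], simp)
 have "form_times_density (Lie_derivative M (cut_CR j) (dZ i)) (chart_density D' \<kappa> \<phi>) q A v = 0" for q A v
 proof (cases "q \<in> \<kappa> ` D'")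
  case True
  then have "q \<in> B" by blast
  then show ?thesis by (simp add: form_times_density_def Lie_derivative_dZ[OF cut_CR_field])
 next
  case False
  then show ?thesis by (simp add: form_times_density_def ch.chart_density_off(1))
 qed
 then have "local_distribution D' \<kappa> (pairing (Lie_derivative M (cut_CR j) (dZ i)) X) \<phi> = X (\<lambda>q A v. 0)"
  unfolding local_distribution_def pairing_def by presburger
 also have "\<dots> = 0"
  by (rule distributional_section_zero[OF section_X form_times_density_test[OF dZ_holomorphic test_densities_zero]])
 finally have "vector_field_apply (chart_vector_field \<kappa> (cut_CR j)) ?T \<phi> = 0"
  using CR cut_CR_field dZ_holomorphic D'(3) ph unfolding infinitesimal_CR_diffeomorphism_def by metis
 moreover have "(\<lambda>y. chart_vector_field \<kappa> (cut_CR j) y $ l * \<phi> y) = (\<lambda>y. CRY j y $ l * \<phi> y)" for l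
  using chart_vector_field_cut_CR test_functions_zero[OF ph] by (fastforce simp: fun_eq_iff)
 then have "vector_field_apply (chart_vector_field \<kappa> (cut_CR j)) ?T \<phi> = - ?T (divergence_form (CRY j) \<phi>)"
  unfolding vector_field_apply_def divergence_form_def[abs_def] by presburger
 ultimately show ?thesis using pairing_dZ_chart[OF D'(1) order_refl d] by simp
qed

definition relation :: "real^'d => complex"
 where "relation y = f None y * (1 - \<i> * graph_ds m \<Phi> (to_model y))
  + (\<Sum>l\<in>UNIV. f (Some l) y * (- 2 * \<i> * of_real (snd (to_model y)) ^ m * dz l \<Phi> (to_model y)))"

definition relation_weight :: "'n option => real^'d => complex"
 where "relation_weight i y = (case i of None => 1 - \<i> * graph_ds m \<Phi> (to_model y)
  | Some l => - 2 * \<i> * of_real (snd (to_model y)) ^ m * dz l \<Phi> (to_model y))"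

lemma relation_eq: "relation y = (\<Sum>i\<in>UNIV. f i y * relation_weight i y)"
 unfolding relation_def sum_option relation_weight_def by simp

lemma smooth_relation_weight: "smooth_on D' (relation_weight i)"
proof -
 have s: "smooth_on D' (\<lambda>y. G (to_model y))" if "smooth_on S G" for G :: "_ => complex"
  by (rule smooth_on_subset[OF smooth_on_to_model[OF S that]]) simp
 show ?thesis
  unfolding relation_weight_def[abs_def]
  by (cases i; simp only: option.case;
    intro smooth_on_diff smooth_on_mult smooth_on_const D'(1) s smooth_on_graph_ds smooth_on_real_coordinate smooth_on_Wirtinger(1)[OF S \<Phi>] S)
qed

lemma pairing_\<theta>:
 assumes "\<phi> \<in> test_functions D'"
 shows "local_distribution D' \<kappa> (pairing \<theta> X) \<phi> = (LINT y|lebesgue. relation y * \<phi> y)"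
 unfolding relation_eq
proof (rule pairing_expansion[OF D'(1) order_refl assms smooth_relation_weight])
 show "\<theta> (\<kappa> y) v = (\<Sum>i\<in>UNIV. relation_weight i y * dZ i (\<kappa> y) v)" if "y \<in> D'" "v \<in> tangent_space M (\<kappa> y)" for y v
  unfolding \<theta>_chart[OF that] sum_option relation_weight_def by simp
 show "\<theta> (\<kappa> y) v = 0" if "v \<notin> tangent_space M (\<kappa> y)" for y v using that by (simp add: \<theta>_def cut_form_def)
qed

lemma wavefront_\<theta>_empty: "(x, \<xi>) \<notin> wavefront_set_on D' (local_distribution D' \<kappa> (pairing \<theta> X))"
proof
 interpret ch: chart_with_inverse M D' \<kappa> W \<pi> by (rule chart_D'[OF D'(1) order_refl])
 let ?T = "local_distribution D' \<kappa> (pairing \<theta> X)"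
 assume wf: "(x, \<xi>) \<in> wavefront_set_on D' ?T"
 have "?T \<psi> = cnj (?T (\<lambda>y. cnj (\<psi> y)))" if "\<psi> \<in> test_functions D'" for \<psi>
 proof -
  have "?T \<psi> = conj_distribution (pairing \<theta> X) (chart_density D' \<kappa> \<psi>)"
   using CR \<theta>_characteristic ch.chart_density_test[OF that]
   unfolding infinitesimal_CR_diffeomorphism_def local_distribution_def by blast
  also have "\<dots> = cnj (?T (\<lambda>y. cnj (\<psi> y)))"
   unfolding conj_distribution_def local_distribution_def chart_density_cnj[abs_def] ..
  finally show ?thesis .
 qed
 then have "(x, - \<xi>) \<in> wavefront_set_on D' ?T" by (rule wavefront_symmetric[OF _ wf])
 moreover have "\<theta> \<in> holomorphic_forms (M \<inter> U\<^sub>0)" by (rule holomorphic_forms_Int[OF U\<^sub>0(1) \<theta>_holomorphic])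
 moreover have "parametrization (M \<inter> U\<^sub>0) D' \<kappa>" using D'(3) U\<^sub>0 parametrization_Int_iff[OF U\<^sub>0(1)] by blast
 moreover have "x \<in> D'" using wf by (simp add: wavefront_set_on_def)
 ultimately show False using microlocal_extension_no_opposite[OF ext _ _ _ wf] by blast
qed

lemma p_chart: "\<kappa> 0 = p" "0 \<in> D'"
proof -
 obtain y where y: "y \<in> D" "p = \<kappa> y" using in_M_W p B_W by blast
 have "to_model y = (0, 0)" using model_\<kappa>[OF y(1)] y(2) p by simp
 then have "of_model (to_model y) = of_model (to_model 0)" by simp
 then have "y = 0" by (simp only: of_model_to_model)
 then show "\<kappa> 0 = p" "0 \<in> D'" using y p by auto
qed

lemma smooth_representatives:
 "\<exists>\<Omega> h. open \<Omega> \<and> 0 \<in> \<Omega> \<and> \<Omega> \<subseteq> D' \<and> (\<forall>i. smooth_on \<Omega> (h i) \<and> (AE y in lebesgue. y \<in> \<Omega> \<longrightarrow> f i y = h i y))"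
proof -
 have LI: "locally_integrable_on D' relation"
  unfolding relation_eq[abs_def]
  by (intro locally_integrable_on_sum locally_integrable_on_mult locally_integrable_f smooth_on_continuous[OF smooth_relation_weight])
 obtain \<Omega>1 u where O1: "open \<Omega>1" "0 \<in> \<Omega>1" "\<Omega>1 \<subseteq> D'" and u: "smooth_on \<Omega>1 u" "AE y in lebesgue. y \<in> \<Omega>1 \<longrightarrow> relation y = u y"
  using smooth_of_empty_wavefront[OF D'(1) LI p_chart(2) pairing_\<theta> wavefront_\<theta>_empty] by blast
 let ?S1 = "of_model -` \<Omega>1"
 have S1: "to_model -` ?S1 = \<Omega>1" by (intro set_eqI) (simp only: vimage_eq of_model_to_model)
 have sub: "?S1 \<subseteq> S"
 proof
  fix x assume "x \<in> ?S1"
  then have "of_model x \<in> D" using O1(3) by blast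
  then show "x \<in> S" by simp
 qed
 have oS1: "open ?S1" by (rule open_of_model[OF O1(1)])
 have z0: "of_model (0, 0) = 0" using of_model_to_model[of 0] by (simp only: to_model_0)
 interpret loc: weak_CR_functions e m \<Phi> ?S1 f u k
 proof (unfold_locales, unfold S1)
  show "\<And>i j \<phi>. \<phi> \<in> test_functions \<Omega>1 ==> (LINT y|lebesgue. f i y * divergence_form (CRY j) \<phi> y) = 0"
   using weak_CR test_functions_mono[OF _ O1(3)] by blast
  show "AE y in lebesgue. y \<in> \<Omega>1 \<longrightarrow> f None y * (1 - \<i> * graph_ds m \<Phi> (to_model y))
    + (\<Sum>l\<in>UNIV. f (Some l) y * (- 2 * \<i> * of_real (snd (to_model y)) ^ m * dz l \<Phi> (to_model y))) = u y"
   using u(2) unfolding relation_def .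
  show "locally_integrable_on \<Omega>1 (f i)" for i by (rule locally_integrable_on_subset[OF locally_integrable_f O1(3)])
 qed (use m oS1 sub smooth_on_subset[OF \<Phi> sub] real z0 O1(2) u(1) vanishing vanishing_dz span in auto)
 obtain \<Omega> where O: "open \<Omega>" "0 \<in> \<Omega>" "\<Omega> \<subseteq> \<Omega>1" and "\<forall>i. \<exists>h. smooth_on \<Omega> h \<and> (AE y in lebesgue. y \<in> \<Omega> \<longrightarrow> f i y = h y)"
  using loc.smooth_representatives unfolding S1 by blast
 then obtain h where h: "\<forall>i. smooth_on \<Omega> (h i) \<and> (AE y in lebesgue. y \<in> \<Omega> \<longrightarrow> f i y = h i y)"
  by (auto dest!: choice)
 have "\<Omega> \<subseteq> D'" using O(3) O1(3) by (rule order_trans)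
 then show ?thesis using O(1,2) h by (intro exI[of _ \<Omega>] exI[of _ h]) (intro conjI)
qed

end

lemma negligible_smooth_image:
 fixes \<rho> :: "real^'d => real^'d"
 assumes "open S" "smooth_on S \<rho>" "N \<subseteq> S" "negligible N"
 shows "negligible (\<rho> ` N)"
proof (rule negligible_differentiable_image_negligible[OF _ assms(4)])
 show "\<rho> differentiable_on N"
  unfolding differentiable_on_def
 proof
  fix x assume "x \<in> N"
  then have "x \<in> S" using assms(3) by blast
  then have "(\<rho> has_derivative fderiv \<rho> x) (at x within N)"
   by (rule has_derivative_at_withinI[OF smooth_on_has_derivative[OF assms(2)]])
  then show "\<rho> differentiable at x within N" unfolding differentiable_def by blast
 qed
qed simp

context infinitesimal_CR
begin

text \<open>A coefficient \<open>c\<close> of \<open>X\<close> in an arbitrary local basis \<open>\<omega>\<close> equals \<open>\<omega>(X)\<close>, which is \<open>\<Sum> a\<^sub>i f\<^sub>i\<close> with the smooth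
coefficients \<open>a\<^sub>i\<close> of \<open>\<omega>\<close> in the \<open>dZ\<close>.  It is given by some function \<open>f0\<close> in every parametrization, so it is enough to
identify \<open>f0\<close> almost everywhere with a smooth function in the graph chart and to transport the null set.\<close>

lemma smooth_near_X: "smooth_near M p X"
proof -
 obtain \<Omega> h where O: "open \<Omega>" "0 \<in> \<Omega>" "\<Omega> \<subseteq> D'" and h: "\<And>i. smooth_on \<Omega> (h i)"
  "\<And>i. AE y in lebesgue. y \<in> \<Omega> \<longrightarrow> f i y = h i y"
  using smooth_representatives by blast
 obtain T and \<gamma> :: "complex^'N => real^'d" where T: "open T" "\<kappa> ` \<Omega> = M \<inter> T"
  by (rule parametrizationE[OF parametrization_D'(2)[OF O(1,3)]]) (rule that)
 define U where "U = T \<inter> B"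
 have U: "open U" "p \<in> U"
 proof -
  show "open U" unfolding U_def using T(1) B(1) by (rule open_Int)
  have "p \<in> \<kappa> ` \<Omega>" using p_chart(1) O(2) by blast
  then show "p \<in> U" using T(2) p(2) by (simp add: U_def)
 qed
 have "smooth_section (M \<inter> U) X"
  unfolding smooth_section_def
 proof (intro allI impI, elim conjE)
  fix U' \<omega> c j assume U': "open U'" and rep: "local_representation (M \<inter> U \<inter> U') \<omega> X c"
  let ?V = "U \<inter> U'"
  have V: "open ?V" and MV: "M \<inter> U \<inter> U' = M \<inter> ?V" using U(1) U' by auto
  define \<Omega>3 where "\<Omega>3 = \<Omega> \<inter> \<kappa> -` ?V"
  have p3: "parametrization (M \<inter> ?V) \<Omega>3 \<kappa>" and o3: "open \<Omega>3"
   unfolding \<Omega>3_def using parametrization_preimage[OF parametrization_D'(2)[OF O(1,3)] V] by auto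
  have sub3: "\<Omega>3 \<subseteq> D'" "\<Omega>3 \<subseteq> \<Omega>" "\<Omega>3 \<subseteq> D \<inter> \<kappa> -` ?V" "\<Omega>3 \<subseteq> D" using O(3) by (auto simp: \<Omega>3_def)
  have im3: "\<exists>y\<in>\<Omega>3. q = \<kappa> y" if "q \<in> M \<inter> ?V" for q
  proof -
   have "q \<in> \<kappa> ` \<Omega>" using that T(2) by (simp add: U_def)
   then show ?thesis using that by (auto simp: \<Omega>3_def)
  qed
  have mem3: "\<kappa> y \<in> M \<inter> ?V" if "y \<in> \<Omega>3" for y using that parametrization_image[OF p3] by blast
  interpret ch: chart_with_inverse "M \<inter> ?V" \<Omega>3 \<kappa> W \<pi>
   by (rule chart_with_inverse.chart_density_Int[OF chart_D'[OF o3 sub3(1)] V]) (use mem3 in blast)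
  obtain f0 where f0: "given_by_function (M \<inter> ?V) (c j) f0"
   using loc V rep unfolding locally_integrable_section_def MV by blast
  have wj: "\<omega> j \<in> holomorphic_forms (M \<inter> ?V)"
   using rep unfolding local_representation_def local_basis_def MV by blast
  let ?a = "coefficient (\<omega> j)"
  have a: "smooth_on \<Omega>3 (?a i)" for i by (rule smooth_on_subset[OF smooth_coefficient[OF V wj] sub3(3)])
  define G where "G y = (\<Sum>i\<in>UNIV. h i y * ?a i y)" for y
  have G: "smooth_on \<Omega>3 G"
   unfolding G_def[abs_def] by (intro smooth_on_sum smooth_on_mult o3 a smooth_on_subset[OF h(1) sub3(2)])
  have cot: "\<omega> j q \<in> holomorphic_cotangent M q" if "q \<in> M \<inter> ?V" for q
   using wj that holomorphic_cotangent_Int[OF V, of q M] by (auto simp: holomorphic_forms_def)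
  have expand: "\<omega> j (\<kappa> y) v = (\<Sum>i\<in>UNIV. ?a i y * dZ i (\<kappa> y) v)" if "y \<in> \<Omega>3" "v \<in> tangent_space M (\<kappa> y)" for y v
  proof -
   have y: "y \<in> D" "\<eta> (\<kappa> y) = 1" using that(1) sub3(1) B(2) by auto
   show ?thesis
    using holomorphic_covector_expansion[where \<omega> = "\<omega> j", OF y(1) cot[OF mem3[OF that(1)]] that(2)]
    by (simp add: dZ_eq[OF that(2) \<kappa>_in(1)[OF y(1)]] y(2))
  qed
  have LIf: "locally_integrable_on \<Omega>3 (\<lambda>y. \<Sum>i\<in>UNIV. f i y * ?a i y)"
   by (intro locally_integrable_on_sum locally_integrable_on_mult locally_integrable_on_subset[OF locally_integrable_f sub3(1)] smooth_on_continuous[OF a])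
  have LI0: "locally_integrable_on \<Omega>3 (\<lambda>y. f0 (\<kappa> y))"
   using f0 p3 unfolding given_by_function_def locally_integrable_on_def by blast
  have "AE y in lebesgue. y \<in> \<Omega>3 \<longrightarrow> f0 (\<kappa> y) - (\<Sum>i\<in>UNIV. f i y * ?a i y) = 0"
  proof (rule locally_integrable_eq_0[OF o3 locally_integrable_on_diff[OF LI0 LIf]])
   fix \<phi> :: "real^'d => complex" assume ph: "\<phi> \<in> test_functions \<Omega>3"
   let ?d = "chart_density \<Omega>3 \<kappa> \<phi> :: ('N, 'd) density"
   have lhs: "c j ?d = (LINT y|lebesgue. f0 (\<kappa> y) * \<phi> y)"
   proof -
    have "local_distribution \<Omega>3 \<kappa> (c j) \<phi> = (LINT y:\<Omega>3|lebesgue. f0 (\<kappa> y) * \<phi> y)"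
     using f0 p3 ph unfolding given_by_function_def by blast
    then show ?thesis using locally_integrable_test(2)[OF LI0 ph] by (simp add: local_distribution_def)
   qed
   have c0: "c i (\<lambda>q A. 0) = 0" for i
   proof -
    have sd: "scalar_distribution (M \<inter> ?V) (c i)" using rep unfolding local_representation_def MV by blast
    have "\<forall>\<mu>\<in>test_densities (M \<inter> ?V). \<forall>\<nu>\<in>test_densities (M \<inter> ?V). \<forall>a b. c i (\<lambda>q A. a * \<mu> q A + b * \<nu> q A) = a * c i \<mu> + b * c i \<nu>"
     using sd unfolding scalar_distribution_def by (rule conjunct1)
    from this[rule_format, OF test_densities_zero test_densities_zero, of 0 0]
    have "c i (\<lambda>q A. 0 * 0 + 0 * 0) = 0 * c i (\<lambda>q A. 0) + 0 * c i (\<lambda>q A. 0)" .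
    then show ?thesis by simp
   qed
   define \<mu> :: "'N => ('N, 'd) density" where "\<mu> i = (if i = j then ?d else (\<lambda>q A. 0))" for i
   have "\<forall>i. \<mu> i \<in> test_densities (M \<inter> ?V)"
    unfolding \<mu>_def using ch.chart_density_test[OF ph] test_densities_zero by auto
   then have E1: "X (\<lambda>q A v. \<Sum>i\<in>UNIV. form_times_density (\<omega> i) (\<mu> i) q A v) = (\<Sum>i\<in>UNIV. c i (\<mu> i))"
    using rep unfolding local_representation_def MV by blast
   have E2: "(\<lambda>q A v. \<Sum>i\<in>UNIV. form_times_density (\<omega> i) (\<mu> i) q A v) = form_times_density (\<omega> j) ?d"
   proof (intro HOL.ext)
    fix q A v
    have "(\<Sum>i\<in>UNIV. form_times_density (\<omega> i) (\<mu> i) q A v) = (\<Sum>i\<in>UNIV. if i = j then form_times_density (\<omega> j) ?d q A v else 0)"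
     by (intro sum.cong) (auto simp: \<mu>_def form_times_density_def)
    then show "(\<Sum>i\<in>UNIV. form_times_density (\<omega> i) (\<mu> i) q A v) = form_times_density (\<omega> j) ?d q A v" by simp
   qed
   have E3: "(\<Sum>i\<in>UNIV. c i (\<mu> i)) = c j ?d"
   proof -
    have "(\<Sum>i\<in>UNIV. c i (\<mu> i)) = (\<Sum>i\<in>UNIV. if i = j then c j ?d else 0)"
     by (intro sum.cong) (auto simp: \<mu>_def c0)
    then show ?thesis by simp
   qed
   have "c j ?d = local_distribution \<Omega>3 \<kappa> (pairing (\<omega> j) X) \<phi>"
    unfolding local_distribution_def pairing_def using E1 unfolding E2 E3 by (rule sym)
   also have "\<dots> = (LINT y|lebesgue. (\<Sum>i\<in>UNIV. f i y * ?a i y) * \<phi> y)"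
   proof (rule pairing_expansion[OF o3 sub3(1) ph a expand])
    fix y v assume "y \<in> \<Omega>3" "v \<notin> tangent_space M (\<kappa> y)"
    then show "\<omega> j (\<kappa> y) v = 0"
     using cot[OF mem3] unfolding holomorphic_cotangent_def complex_cotangent_def by blast
   qed
   finally have "(LINT y|lebesgue. f0 (\<kappa> y) * \<phi> y) = (LINT y|lebesgue. (\<Sum>i\<in>UNIV. f i y * ?a i y) * \<phi> y)"
    using lhs by simp
   then show "(LINT y|lebesgue. (f0 (\<kappa> y) - (\<Sum>i\<in>UNIV. f i y * ?a i y)) * \<phi> y) = 0"
    unfolding left_diff_distrib
    using Bochner_Integration.integral_diff[OF locally_integrable_test(1)[OF LI0 ph] locally_integrable_test(1)[OF LIf ph]] by simp
  qed
  moreover have "AE y in lebesgue. \<forall>i\<in>UNIV. y \<in> \<Omega> \<longrightarrow> f i y = h i y"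
   by (rule AE_finite_allI[OF finite]) (rule h(2))
  ultimately have f0G: "AE y in lebesgue. y \<in> \<Omega>3 \<longrightarrow> f0 (\<kappa> y) = G y"
  proof eventually_elim
   case (elim y)
   then show ?case using subsetD[OF sub3(2), of y] by (auto simp: G_def)
  qed
  define N where "N = {y \<in> \<Omega>3. f0 (\<kappa> y) \<noteq> G y}"
  have N: "negligible N"
  proof -
   obtain N' where N': "{y \<in> space lebesgue. \<not> (y \<in> \<Omega>3 \<longrightarrow> f0 (\<kappa> y) = G y)} \<subseteq> N'"
    "emeasure lebesgue N' = 0" "N' \<in> sets lebesgue"
    using AE_E[OF f0G] .
   have "negligible N'" using N'(2,3) by (simp add: negligible_iff_null_sets null_setsI)
   moreover have "N \<subseteq> N'" using N'(1) by (auto simp: N_def)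
   ultimately show ?thesis by (rule negligible_subset)
  qed
  define ff where "ff q = G (\<pi> q)" for q
  have ff\<kappa>: "ff (\<kappa> y) = G y" if "y \<in> \<Omega>3" for y using \<pi>_\<kappa>[of y] that sub3(4) by (auto simp: ff_def)
  have \<pi>3: "\<pi> q \<in> \<Omega>3" "\<kappa> (\<pi> q) = q" "q \<in> W" if "q \<in> M \<inter> ?V" for q
  proof -
   obtain y where y: "y \<in> \<Omega>3" "q = \<kappa> y" using im3[OF \<open>q \<in> _\<close>] by blast
   then have yD: "y \<in> D" using sub3(4) by blast
   show "\<pi> q \<in> \<Omega>3" "\<kappa> (\<pi> q) = q" "q \<in> W" using y \<pi>_\<kappa>[OF yD] \<kappa>_in(2)[OF yD] by simp_all
  qed
  have oW: "open (W \<inter> \<pi> -` \<Omega>3)" by (rule continuous_open_preimage[OF smooth_on_continuous[OF smooth_\<pi>] W o3])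
  have sff: "smooth_on (W \<inter> \<pi> -` \<Omega>3) ff"
   unfolding ff_def[abs_def] by (rule smooth_on_compose[OF oW o3 smooth_on_subset[OF smooth_\<pi>] G]) auto
  have "smooth_on_submanifold (M \<inter> ?V) ff"
   unfolding smooth_on_submanifold_def using oW sff \<pi>3 by blast
  moreover have "given_by_function (M \<inter> ?V) (c j) ff"
   unfolding given_by_function_def
  proof (intro allI impI)
   fix \<Omega>' and \<kappa>' :: "real^'d => complex^'N" assume p': "parametrization (M \<inter> ?V) \<Omega>' \<kappa>'"
   obtain T' \<gamma>' where T': "open \<Omega>'" "smooth_on \<Omega>' \<kappa>'" "open T'" "\<kappa>' ` \<Omega>' = (M \<inter> ?V) \<inter> T'"
    "homeomorphism \<Omega>' (\<kappa>' ` \<Omega>') \<kappa>' \<gamma>'" "\<And>x. x \<in> \<Omega>' ==> inj (fderiv \<kappa>' x)"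
    by (rule parametrizationE[OF p']) (rule that)
   have m': "\<kappa>' x \<in> M \<inter> ?V" if "x \<in> \<Omega>'" for x using that T'(4) by blast
   define \<Omega>4 where "\<Omega>4 = \<Omega>3 \<inter> \<kappa> -` T'"
   have o4: "open \<Omega>4" unfolding \<Omega>4_def by (rule parametrization_preimage(1)[OF p3 T'(3)])
   have s4: "smooth_on \<Omega>4 \<kappa>" by (rule smooth_on_subset[OF smooth_\<kappa>]) (use sub3(4) in \<open>auto simp: \<Omega>4_def\<close>)
   have im4: "\<kappa> ` \<Omega>4 \<subseteq> \<kappa>' ` \<Omega>'" using mem3 T'(4) by (auto simp: \<Omega>4_def)
   \<comment> \<open>The transition map from the graph chart to the given parametrization.\<close>
   define \<rho> where "\<rho> y = \<gamma>' (\<kappa> y)" for y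
   have \<rho>: "\<rho> y \<in> \<Omega>'" "\<kappa>' (\<rho> y) = \<kappa> y" if "y \<in> \<Omega>4" for y
   proof -
    have "\<kappa> y \<in> \<kappa>' ` \<Omega>'" using that im4 by blast
    then show "\<rho> y \<in> \<Omega>'" "\<kappa>' (\<rho> y) = \<kappa> y"
     unfolding \<rho>_def using homeomorphism_image2[OF T'(5)] homeomorphism_apply2[OF T'(5)] by blast+
   qed
   have s\<rho>: "smooth_on \<Omega>4 \<rho>"
   proof (rule smooth_on_implicit[OF o4 T'(1,2) s4])
    show "continuous_on \<Omega>4 \<rho>"
     unfolding \<rho>_def by (rule continuous_on_compose2[OF homeomorphism_cont2[OF T'(5)] smooth_on_continuous[OF s4] im4])
    show "\<rho> ` \<Omega>4 \<subseteq> \<Omega>'" using \<rho>(1) by blast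
    show "inj (fderiv \<kappa>' (\<rho> y))" if "y \<in> \<Omega>4" for y by (rule T'(6)[OF \<rho>(1)[OF that]])
   qed (rule \<rho>(2))
   have neg: "negligible (\<rho> ` (N \<inter> \<Omega>4))"
    by (rule negligible_smooth_image[OF o4 s\<rho>]) (auto intro: negligible_subset[OF N])
   have bad: "x \<in> \<rho> ` (N \<inter> \<Omega>4)" if x: "x \<in> \<Omega>'" "f0 (\<kappa>' x) \<noteq> ff (\<kappa>' x)" for x
   proof -
    let ?y = "\<pi> (\<kappa>' x)"
    have y: "?y \<in> \<Omega>3" "\<kappa> ?y = \<kappa>' x" using \<pi>3[OF m'[OF x(1)]] by auto
    have "?y \<in> \<Omega>4" using y x(1) T'(4) by (auto simp: \<Omega>4_def)
    moreover have "?y \<in> N" using x(2) y by (simp add: N_def ff_def)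
    moreover have "\<rho> ?y = x" unfolding \<rho>_def y(2) by (rule homeomorphism_apply1[OF T'(5) x(1)])
    ultimately show ?thesis by (metis IntI image_eqI)
   qed
   have AE': "AE x in lebesgue. x \<in> \<Omega>' \<longrightarrow> f0 (\<kappa>' x) = ff (\<kappa>' x)"
    by (rule AE_I'[of "\<rho> ` (N \<inter> \<Omega>4)"]) (use neg bad in \<open>auto simp: negligible_iff_null_sets\<close>)
   have LI0': "locally_integrable_on \<Omega>' (\<lambda>x. f0 (\<kappa>' x))"
    using f0 p' unfolding given_by_function_def locally_integrable_on_def by blast
   have LI1: "locally_integrable_on \<Omega>' (\<lambda>x. ff (\<kappa>' x))"
    by (intro locally_integrable_on_continuous continuous_on_compose2[OF smooth_on_continuous[OF sff] smooth_on_continuous[OF T'(2)]])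
     (use m' \<pi>3 in blast)
   show "(\<forall>K. compact K \<and> K \<subseteq> \<Omega>' \<longrightarrow> set_integrable lebesgue K (\<lambda>x. ff (\<kappa>' x))) \<and>
     (\<forall>\<phi>\<in>test_functions \<Omega>'. local_distribution \<Omega>' \<kappa>' (c j) \<phi> = (LINT x:\<Omega>'|lebesgue. ff (\<kappa>' x) * \<phi> x))"
   proof (intro conjI ballI)
    show "\<forall>K. compact K \<and> K \<subseteq> \<Omega>' \<longrightarrow> set_integrable lebesgue K (\<lambda>x. ff (\<kappa>' x))"
     using LI1 unfolding locally_integrable_on_def .
    fix \<phi> :: "real^'d => complex" assume ph: "\<phi> \<in> test_functions \<Omega>'"
    have "local_distribution \<Omega>' \<kappa>' (c j) \<phi> = (LINT x:\<Omega>'|lebesgue. f0 (\<kappa>' x) * \<phi> x)"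
     using f0 p' ph unfolding given_by_function_def by blast
    also have "\<dots> = (LINT x|lebesgue. f0 (\<kappa>' x) * \<phi> x)" by (rule locally_integrable_test(2)[OF LI0' ph])
    also have "\<dots> = (LINT x|lebesgue. ff (\<kappa>' x) * \<phi> x)"
    proof (rule integral_cong_AE)
     show "AE x in lebesgue. f0 (\<kappa>' x) * \<phi> x = ff (\<kappa>' x) * \<phi> x"
      using AE'
     proof eventually_elim
      case (elim x)
      then show ?case using test_functions_zero[OF ph, of x] by (cases "x \<in> \<Omega>'") auto
     qed
    qed (rule borel_measurable_integrable, rule locally_integrable_test(1)[OF _ ph], rule LI0' LI1)+
    also have "\<dots> = (LINT x:\<Omega>'|lebesgue. ff (\<kappa>' x) * \<phi> x)" by (rule locally_integrable_test(2)[OF LI1 ph, symmetric])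
    finally show "local_distribution \<Omega>' \<kappa>' (c j) \<phi> = (LINT x:\<Omega>'|lebesgue. ff (\<kappa>' x) * \<phi> x)" .
   qed
  qed
  ultimately show "\<exists>f. smooth_on_submanifold (M \<inter> U \<inter> U') f \<and> given_by_function (M \<inter> U \<inter> U') (c j) f"
   unfolding MV by blast
 qed
 then show ?thesis unfolding smooth_near_def using U by blast
qed

end

theorem corollary2:
  fixes M :: "(complex^'N) set" and p :: "complex^'N" and k :: nat
    and X :: "('N::finite, 'd::finite) form_density \<Rightarrow> complex"
  assumes "CARD('N) = CARD('n::finite) + 1"
    and "CARD('d) + 1 = 2 * CARD('N)"
    and "real_hypersurface M"
    and "p \<in> M"
    and "weakly_k_nondegenerate TYPE('n) M p k"
    and "infinitesimal_CR_diffeomorphism M X"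
    and "locally_integrable_section M X"
    and "extends_microlocally_near M p X"
  shows "smooth_near M p X"
proof -
 obtain m where m: "m > 0" and k: "k > 0" and wn: "weak_nondegeneracy_condition TYPE('n) M p m k"
  using assms(5) unfolding weakly_k_nondegenerate_def by blast
 obtain W\<^sub>0 and z :: "complex^'N => complex^'n" and w D and \<phi> :: "(complex^'n) \<times> real => real" where
  hc: "holomorphic_coordinates W\<^sub>0 z w" and p0: "p \<in> W\<^sub>0" "z p = 0" "w p = 0"
  and D: "open D" "smooth_on D \<phi>" "\<forall>x\<in>W\<^sub>0. (z x, Re (w x)) \<in> D"
  and MW: "M \<inter> W\<^sub>0 = {x\<in>W\<^sub>0. Im (w x) = Re (w x) ^ m * \<phi> (z x, Re (w x))}"
  and van: "\<forall>\<alpha>. length \<alpha> \<le> k \<longrightarrow>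
     foldr dz \<alpha> (\<lambda>x. of_real (\<phi> x)) (0, 0) = 0 \<and>
     foldr dzbar \<alpha> (\<lambda>x. of_real (\<phi> x)) (0, 0) = 0"
  and sp: "vec.span {(\<chi> j. dz j (foldr dzbar \<alpha> (\<lambda>x. of_real (\<phi> x))) (0, 0)) | \<alpha>. length \<alpha> \<le> k} = UNIV"
  using wn unfolding weak_nondegeneracy_condition_def by (elim exE conjE) (rule that)
 have W0: "open W\<^sub>0" "\<And>j. holomorphic_function W\<^sub>0 (\<lambda>x. z x $ j)" "holomorphic_function W\<^sub>0 w"
  "inj_on (\<lambda>x. (z x, w x)) W\<^sub>0" "\<And>x. x \<in> W\<^sub>0 ==> bij (fderiv (\<lambda>x. (z x, w x)) x)"
  using hc by (simp_all add: holomorphic_coordinates_def)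
 let ?F = "\<lambda>x. (z x, w x)"
 have sz: "smooth_on W\<^sub>0 z"
 proof -
  have "smooth_on W\<^sub>0 (\<lambda>x. \<chi> j. z x $ j)"
   by (intro smooth_on_vec_lambda W0(1) holomorphic_function_smooth[OF W0(1,2)])
  then show ?thesis by simp
 qed
 have sw: "smooth_on W\<^sub>0 w" by (rule holomorphic_function_smooth[OF W0(1,3)])
 have sF: "smooth_on W\<^sub>0 ?F" by (intro smooth_on_Pair W0(1) sz sw)
 have cF: "continuous_on W\<^sub>0 ?F" by (rule smooth_on_continuous[OF sF])
 \<comment> \<open>Invariance of domain provides a continuous inverse \<open>G\<close> of the coordinates, and \<open>smooth_on_implicit\<close>
  makes its composition with the graph smooth.\<close>
 have dim: "DIM((complex^'n) \<times> complex) \<le> DIM(complex^'N)" using assms(1) by simp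
 obtain G where G: "homeomorphism W\<^sub>0 (?F ` W\<^sub>0) ?F G"
  by (rule invariance_of_domain_homeomorphism[OF W0(1) cF dim W0(4)])
 have oF: "open (?F ` W\<^sub>0)" by (rule invariance_of_domain_gen[OF W0(1) cF W0(4) dim])
 define \<Phi> :: "(complex^'n) \<times> real => complex" where "\<Phi> x = of_real (\<phi> x)" for x
 have s\<Phi>: "smooth_on D \<Phi>" unfolding \<Phi>_def[abs_def] by (rule smooth_on_of_real[OF D(1,2)])
 define Gr :: "(complex^'n) \<times> real => (complex^'n) \<times> complex"
  where "Gr x = (fst x, of_real (snd x) + \<i> * (of_real (snd x) ^ m * \<Phi> x))" for x
 have s1: "smooth_on D (\<lambda>x :: (complex^'n) \<times> real. complex_of_real (snd x))"
  using smooth_on_real_coordinate[OF D(1), of 1] by simp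
 have sGr: "smooth_on D Gr"
  unfolding Gr_def[abs_def]
  by (intro smooth_on_Pair D(1) smooth_on_linear[OF bounded_linear_fst] smooth_on_add s1 smooth_on_mult smooth_on_const smooth_on_power s\<Phi>)
 define S where "S = D \<inter> Gr -` (?F ` W\<^sub>0)"
 have oS: "open S" unfolding S_def by (rule continuous_open_preimage[OF smooth_on_continuous[OF sGr] D(1) oF])
 have SD: "S \<subseteq> D" by (simp add: S_def)
 define g where "g x = G (Gr x)" for x
 have g: "g x \<in> W\<^sub>0" "?F (g x) = Gr x" if "x \<in> S" for x
 proof -
  have x: "Gr x \<in> ?F ` W\<^sub>0" using that by (simp add: S_def)
  show "g x \<in> W\<^sub>0" unfolding g_def using homeomorphism_image2[OF G] x by blast
  show "?F (g x) = Gr x" unfolding g_def by (rule homeomorphism_apply2[OF G x])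
 qed
 have gz: "z (g x) = fst x" and gw: "w (g x) = of_real (snd x) + \<i> * (of_real (snd x) ^ m * \<Phi> x)" if "x \<in> S" for x
  using g(2)[OF that] by (simp_all add: Gr_def)
 have sg: "smooth_on S g"
 proof (rule smooth_on_implicit[OF oS W0(1) sF smooth_on_subset[OF sGr SD]])
  show "continuous_on S g"
   unfolding g_def
   by (rule continuous_on_compose2[OF homeomorphism_cont2[OF G] smooth_on_continuous[OF smooth_on_subset[OF sGr SD]]])
     (auto simp: S_def)
  show "g ` S \<subseteq> W\<^sub>0" using g(1) by blast
  show "inj (fderiv ?F (g x))" if "x \<in> S" for x by (rule bij_is_inj[OF W0(5)[OF g(1)[OF that]]])
 qed (rule g(2))
 define W where "W = W\<^sub>0 \<inter> (\<lambda>q. (z q, Re (w q))) -` S"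
 have oW: "open W"
  unfolding W_def
  by (rule continuous_open_preimage[OF smooth_on_continuous[OF smooth_on_Pair[OF W0(1) sz smooth_on_Re[OF W0(1) sw]]] W0(1) oS])
 have WW: "W \<subseteq> W\<^sub>0" by (simp add: W_def)
 have snd_g: "Re (w (g x)) = snd x" "Im (w (g x)) = snd x ^ m * \<phi> x" if "x \<in> S" for x
  using gw[OF that] by (simp_all add: \<Phi>_def flip: of_real_power of_real_mult)
 have on_graph: "Gr (z q, Re (w q)) = ?F q" "(z q, Re (w q)) \<in> S" if "q \<in> M" "q \<in> W\<^sub>0" for q
 proof -
  have "Im (w q) = Re (w q) ^ m * \<phi> (z q, Re (w q))" using that MW by blast
  then have "w q = of_real (Re (w q)) + \<i> * (of_real (Re (w q)) ^ m * \<Phi> (z q, Re (w q)))"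
   by (simp add: complex_eq_iff \<Phi>_def flip: of_real_power of_real_mult)
  then show 1: "Gr (z q, Re (w q)) = ?F q" by (simp add: Gr_def)
  show "(z q, Re (w q)) \<in> S" using that D(3) by (simp add: S_def 1)
 qed
 have gM: "M \<inter> W = g ` S"
 proof (intro set_eqI iffI)
  fix q assume "q \<in> M \<inter> W"
  then have q: "q \<in> M" "q \<in> W\<^sub>0" using WW by auto
  have "g (z q, Re (w q)) = q" unfolding g_def on_graph(1)[OF q] by (rule homeomorphism_apply1[OF G q(2)])
  then show "q \<in> g ` S" using on_graph(2)[OF q] by (metis imageI)
 next
  fix q assume "q \<in> g ` S"
  then obtain x where x: "x \<in> S" "q = g x" by blast
  have e: "(z q, Re (w q)) = x" using gz[OF x(1)] snd_g(1)[OF x(1)] x(2) by (simp add: prod_eq_iff)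
  have "q \<in> W" using g(1)[OF x(1)] x(1) e x(2) by (simp add: W_def)
  moreover have "q \<in> M \<inter> W\<^sub>0"
  proof -
   have "Im (w q) = Re (w q) ^ m * \<phi> (z q, Re (w q))"
    unfolding e using snd_g[OF x(1)] x(2) by simp
   then show ?thesis unfolding MW using g(1)[OF x(1)] x(2) by simp
  qed
  ultimately show "q \<in> M \<inter> W" by blast
 qed
 have pW: "p \<in> W" using on_graph(2)[OF assms(4) p0(1)] p0(1) by (simp add: W_def)
 obtain U\<^sub>0 where U0: "open U\<^sub>0" "p \<in> U\<^sub>0" "extends_microlocally (M \<inter> U\<^sub>0) X"
  using assms(8) unfolding extends_microlocally_near_def by blast
 obtain R where R: "R > 0" "ball p R \<subseteq> W \<inter> U\<^sub>0"
  using openE[OF open_Int[OF oW U0(1)]] pW U0(2) by blast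
 obtain \<eta> :: "complex^'N => real" where \<eta>: "smooth_on UNIV \<eta>" "\<forall>x\<in>ball p (R/3). \<eta> x = 1" "\<forall>x. x \<notin> ball p (R/2) \<longrightarrow> \<eta> x = 0"
  using exists_cutoff[of "R/3" "R/2" p] R(1) by auto
 have cb: "cball p (R/2) \<subseteq> ball p R" "ball p (R/3) \<subseteq> ball p R" using R(1) by auto
 have "card (UNIV :: ('n \<times> bool) option set) = CARD('d)" using assms(1,2) by (simp add: card_prod)
 then obtain e :: "('n \<times> bool) option => 'd" where e: "bij e"
  using finite_same_card_bij[of "UNIV :: ('n \<times> bool) option set" "UNIV :: 'd set"] by auto
 have "CARD('N) = card (UNIV :: 'n option set)" using assms(1) by simp
 then obtain \<sigma> :: "'N => 'n option" where \<sigma>: "bij \<sigma>"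
  using finite_same_card_bij[of "UNIV :: 'N set" "UNIV :: 'n option set"] by auto
 interpret infinitesimal_CR e m \<Phi> S M W z w g \<eta> "cball p (R/2)" "ball p (R/3)" X \<sigma> U\<^sub>0 p k
 proof unfold_locales
  show "holomorphic_function W (\<lambda>q. z q $ l)" for l using W0(2) WW unfolding holomorphic_function_def by blast
  show "holomorphic_function W w" using W0(3) WW unfolding holomorphic_function_def by blast
  show "inj (fderiv (\<lambda>q. (z q, w q)) q)" if "q \<in> W" for q
   using bij_is_inj[OF W0(5)] that WW by blast
  show "(z q, Re (w q)) \<in> S" if "q \<in> W" for q using that by (simp add: W_def)
  show "cball p (R/2) \<subseteq> W" using cb(1) R(2) by blast
  show "\<eta> q = 0" if "q \<notin> cball p (R/2)" for q using \<eta>(3) that by auto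
  show "\<eta> q = 1" if "q \<in> ball p (R/3)" for q using \<eta>(2) that by blast
  show "ball p (R/3) \<subseteq> U\<^sub>0" using cb(2) R(2) by blast
  show "p \<in> ball p (R/3)" using R(1) by simp
  show "vanish (Suc k) \<Phi>" by (rule vanish_iterated) (use van in \<open>simp add: \<Phi>_def[abs_def]\<close>)
  show "dz l \<Phi> (0, 0) = 0" for l using van[rule_format, of "[l]"] k by (simp add: \<Phi>_def[abs_def])
  show "vec.span {(\<chi> j. dz j (foldr dzbar \<alpha> \<Phi>) (0, 0)) | \<alpha>. length \<alpha> \<le> k} = UNIV"
   using sp unfolding \<Phi>_def[abs_def] .
  show "\<Phi> x \<in> \<real>" for x by (simp add: \<Phi>_def)
 qed (use e m oS smooth_on_subset[OF s\<Phi> SD] oW gM sg gz gw \<eta>(1) assms(4,6,7) U0 \<sigma> p0 in auto)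
 show ?thesis by (rule smooth_near_X)
qed

end
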